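(* Let $\{X(t):\, t\in\mathbb{R}^d\}$ be a stationary centered Gaussian random field with unit variance and covariance function $\rho(t)=\mathbb{E}[X(s+t)X(s)]$ satisfying $\int_{\mathbb{R}^d}|\rho(t)|\,dt<\infty$. Assume moreover that there is a constant $c>0$ such that $$\int_{\mathbb{R}^d\setminus[-a,a]^d}|\rho(t)|\,dt\le c\,(\log a)^{-1}\quad\text{for all sufficiently large } a.$$ Fix $u\in\mathbb{R}$ and define the sojourn time $S_T=\int_{[0,T]^d}\mathbb{I}(X(t)\ge u)\,dt$. Let $$\sigma^2=\sum_{n=1}^{\infty}\frac{\varphi^2(u)H_{n-1}^2(u)}{n!}\int_{\mathbb{R}^d}\rho^n(t)\,dt .$$ Then there exist constants $C>0$ and $T_0>1$, depending on the field and on $u$, such that for all $T\ge T_0$, $$d\left(\frac{S_T-\mathbb{E}(S_T)}{\sqrt{T^d}},\ \mathcal{N}(0,\sigma^2)\right)\le C(\log T)^{-1/4}.$$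
   Context: $\varphi$ denotes the standard Gaussian density. $H_n$ is the $n$-th Hermite polynomial $H_n(x)=(-1)^n e^{x^2/2}\frac{d^n}{dx^n}e^{-x^2/2}$ (so $H_0=1$). For two integrable random variables (or their laws) $X,Y$, $d(X,Y)=\sup_{h\in\mathrm{Lip}(1)}|\mathbb{E}h(X)-\mathbb{E}h(Y)|$ is the Wasserstein distance, where $\mathrm{Lip}(1)$ is the set of Lipschitz functions $\mathbb{R}\to\mathbb{R}$ with Lipschitz constant at most $1$. $\mathcal{N}(0,\sigma^2)$ is the centered normal law with variance $\sigma^2$. *)

theory Defs
  imports "HOL-Probability.Probability"
begin

definition hermite :: "nat \<Rightarrow> real \<Rightarrow> real" where
  "hermite n x = (-1) ^ n * exp (x\<^sup>2 / 2) * ((deriv ^^ n) (\<lambda>y. exp (- y\<^sup>2 / 2))) x"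

definition normal_law :: "real \<Rightarrow> real measure" where
  "normal_law v = (if v = 0 then return borel 0 else density lborel (normal_density 0 (sqrt v)))"

definition wasserstein :: "real measure \<Rightarrow> real measure \<Rightarrow> ereal" where
  "wasserstein P Q = (SUP h \<in> {h :: real \<Rightarrow> real. lipschitz_on 1 UNIV h}.
      ereal \<bar>(\<integral>x. h x \<partial>P) - (\<integral>x. h x \<partial>Q)\<bar>)"

definition gaussian_rv :: "'a measure \<Rightarrow> ('a \<Rightarrow> real) \<Rightarrow> bool" where
  "gaussian_rv M Y \<longleftrightarrow> Y \<in> borel_measurable M \<and>
     (\<exists>m v. v \<ge> 0 \<and> distr M borel Y =
        (if v = 0 then return borel m else density lborel (normal_density m (sqrt v))))"

definition gaussian_field :: "'a measure \<Rightarrow> ('t \<Rightarrow> 'a \<Rightarrow> real) \<Rightarrow> bool" where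
  "gaussian_field M X \<longleftrightarrow>
     (\<forall>(ts :: 't list) (cs :: real list). length cs = length ts \<longrightarrow>
        gaussian_rv M (\<lambda>\<omega>. \<Sum>i<length ts. cs ! i * X (ts ! i) \<omega>))"

end

theory Submission
  imports Defs "HOL-Computational_Algebra.Polynomial"
begin

text \<open>Let \<open>F\<close> be the normalised sojourn time. The indicator of \<open>[u, \<infinity>)\<close> is replaced by a smooth
  function \<open>g\<close> with transition scale \<open>\<epsilon>\<close>; the \<open>L\<^sup>2\<close> error is controlled by Gebelein's inequality
  \<open>\<bar>cov (g (X s)) (g (X t))\<bar> \<le> \<bar>\<rho> (t - s)\<bar> var g\<close>. Writing the centred \<open>g\<close> as \<open>x q - q'\<close> with a
  one-dimensional Stein solution \<open>q\<close>, Gaussian integration by parts yields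
  \<open>E (\<Phi> f(\<Phi>)) = E (f'(\<Phi>) V)\<close> for the functional \<open>\<Phi>\<close> of \<open>g\<close>, where \<open>V\<close> is a double integral of
  \<open>\<rho> (t - s) q (X s) g' (X t)\<close>. Hence the Wasserstein distance to the normal law is at most a
  multiple of the \<open>L\<^sup>2\<close> distance of \<open>V\<close> from \<open>\<sigma>\<^sup>2\<close>. The fluctuations of \<open>V\<close> are of order
  \<open>\<epsilon>\<^sup>-\<^sup>2 T\<^sup>-\<^sup>1\<^sup>/\<^sup>2\<close> by a covariance bound for four jointly Gaussian variables, and the tail condition gives
  \<open>E F\<^sup>2 = \<sigma>\<^sup>2 + O (1 / log T)\<close>. With \<open>\<epsilon> = T\<^sup>-\<^sup>1\<^sup>/\<^sup>8\<close> every error is \<open>O (1 / log T)\<close> if \<open>\<sigma> > 0\<close>; if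
  \<open>\<sigma> = 0\<close>, the distance is at most the square root of \<open>E F\<^sup>2\<close>.\<close>

text \<open>The paths of the field are only measurable, so a window integral is not a limit of
  Riemann sums, and coordinates of the field may be linearly dependent, so joint densities may not
  exist. Gaussian calculus is therefore done for finitely many coordinates, described by
  characteristic functions alone, and is carried over to window integrals by sampling points. The
  recurring device is to subtract from a Gaussian vector its regression on one coordinate: the
  residuals are independent of that coordinate, and everything reduces to one-dimensional Gaussian
  integrals. Smoothing is forced because \<open>V\<close> contains g', and because the covariance
  bound behind the fluctuations of \<open>V\<close> needs g' Lipschitz, with constant
  1/\<epsilon>^2. The smoothing error \<epsilon>^(1/4) competes with \<epsilon>^(-2) T^(-d/2), so
  every \<epsilon> = T^(-p) with 0 < p < 1/4 makes both decay polynomially; the logarithm comes from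
  the tail condition alone, taken at a = sqrt T. The formula for \<sigma>^2 rests on Mehler's
  series, which is proved for correlations of modulus below one; hence the set where
  \<bar>\<rho>\<bar> = 1 must be shown to be null.\<close>

lemma integrable_mult_square:
  fixes f g :: "'a \<Rightarrow> real"
  assumes [measurable]: "f \<in> borel_measurable M" "g \<in> borel_measurable M"
    and i: "integrable M (\<lambda>x. (f x)\<^sup>2)" "integrable M (\<lambda>x. (g x)\<^sup>2)"
  shows "integrable M (\<lambda>x. f x * g x)"
proof (rule Bochner_Integration.integrable_bound[OF Bochner_Integration.integrable_add[OF i]])
  have "\<bar>a * b\<bar> \<le> a\<^sup>2 + b\<^sup>2" for a b :: real
    using sum_squares_bound[of "\<bar>a\<bar>" "\<bar>b\<bar>"] zero_le_power2[of a] zero_le_power2[of b] abs_ge_zero[of "a * b"]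
    unfolding power2_abs abs_mult by linarith
  then show "AE x in M. norm (f x * g x) \<le> norm ((f x)\<^sup>2 + (g x)\<^sup>2)"
    by simp
qed measurable

lemma integral_Cauchy_Schwarz:
  fixes f g :: "'a \<Rightarrow> real"
  assumes m: "f \<in> borel_measurable M" "g \<in> borel_measurable M"
    and i: "integrable M (\<lambda>x. (f x)\<^sup>2)" "integrable M (\<lambda>x. (g x)\<^sup>2)"
  shows "\<bar>\<integral>x. f x * g x \<partial>M\<bar> \<le> sqrt (\<integral>x. (f x)\<^sup>2 \<partial>M) * sqrt (\<integral>x. (g x)\<^sup>2 \<partial>M)"
proof -
  define a b c where "a = (\<integral>x. (f x)\<^sup>2 \<partial>M)" and "b = (\<integral>x. (g x)\<^sup>2 \<partial>M)" and "c = (\<integral>x. f x * g x \<partial>M)"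
  note ifg = integrable_mult_square[OF m i]
  \<comment> \<open>The square of f - t g is expanded. For b = 0 the value t = (a + 1) / (2 c) would
    give -1, so c = 0; for b > 0 the minimiser t = c / b gives the inequality.\<close>
  have q: "0 \<le> a - 2 * t * c + t\<^sup>2 * b" for t
  proof -
    have "0 \<le> (\<integral>x. (f x - t * g x)\<^sup>2 \<partial>M)" by simp
    also have "\<dots> = (\<integral>x. (f x)\<^sup>2 - (2 * t) * (f x * g x) + t\<^sup>2 * (g x)\<^sup>2 \<partial>M)"
      by (intro Bochner_Integration.integral_cong) (auto simp: power2_eq_square algebra_simps)
    also have "\<dots> = a - 2 * t * c + t\<^sup>2 * b"
      using i ifg by (simp add: a_def b_def c_def)
    finally show ?thesis .
  qed
  have b: "b \<ge> 0" by (simp add: b_def)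
  have "c\<^sup>2 \<le> a * b"
  proof (cases "b = 0")
    case True
    have "c = 0"
    proof (rule ccontr)
      assume "c \<noteq> 0"
      then show False using q[of "(a + 1) / (2 * c)"] True by simp
    qed
    then show ?thesis using True by simp
  next
    case False
    then show ?thesis using q[of "c / b"] b by (simp add: field_simps power2_eq_square)
  qed
  then have "sqrt (c\<^sup>2) \<le> sqrt (a * b)" by (rule real_sqrt_le_mono)
  then show ?thesis by (simp add: a_def b_def c_def real_sqrt_mult)
qed

lemma (in prob_space) expectation_abs_le_sqrt:
  fixes f :: "'a \<Rightarrow> real"
  assumes "f \<in> borel_measurable M" "integrable M (\<lambda>x. (f x)\<^sup>2)"
  shows "integrable M f" "expectation (\<lambda>x. \<bar>f x\<bar>) \<le> sqrt (expectation (\<lambda>x. (f x)\<^sup>2))"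
  using integrable_mult_square[of f M "\<lambda>_. 1"] integral_Cauchy_Schwarz[of "\<lambda>x. \<bar>f x\<bar>" M "\<lambda>_. 1"] assms
  by (auto simp: prob_space)

subsection \<open>Standard Gaussian integrals and Hermite polynomials\<close>

abbreviation "gam \<equiv> std_normal_distribution"

interpretation gam: prob_space gam
  using prob_space_normal_density by auto

lemma gam_integrable_iff:
  fixes f :: "real \<Rightarrow> 'b::{banach,second_countable_topology}"
  assumes "f \<in> borel_measurable borel"
  shows "integrable gam f \<longleftrightarrow> integrable lborel (\<lambda>x. std_normal_density x *\<^sub>R f x)"
  using assms by (subst integrable_density) auto

lemma gam_integral:
  fixes f :: "real \<Rightarrow> 'b::{banach,second_countable_topology}"
  assumes "f \<in> borel_measurable borel"
  shows "(\<integral>x. f x \<partial>gam) = (\<integral>x. std_normal_density x *\<^sub>R f x \<partial>lborel)"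
  using assms by (subst integral_density) auto

lemma gam_integrable_poly: "integrable gam (poly p)"
proof -
  have "integrable gam (\<lambda>x. coeff p i * x ^ i)" for i
    by (intro integrable_mult_right integrable_std_normal_distribution_moment)
  then show ?thesis unfolding poly_altdef by (intro Bochner_Integration.integrable_sum)
qed

lemma std_normal_density_deriv:
  "(std_normal_density has_real_derivative - x * std_normal_density x) (at x)"
  unfolding std_normal_density_def [abs_def]
  by (auto intro!: derivative_eq_intros simp: field_simps)

lemma isCont_std_normal_density [continuous_intros]: "isCont std_normal_density x"
  using std_normal_density_deriv DERIV_isCont by blast

lemma poly_fun_simps:
  fixes p q :: "real poly"
  shows "poly (p * q) = (\<lambda>x. poly p x * poly q x)" "poly (p - q) = (\<lambda>x. poly p x - poly q x)"
    "poly (pCons 0 p) = (\<lambda>x. x * poly p x)"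
  by auto

lemma poly_borel_measurable [measurable]: "poly (p :: real poly) \<in> borel_measurable borel"
  by (intro borel_measurable_continuous_onI continuous_on_poly continuous_on_id)

lemma gam_integrable_poly_mult: "integrable gam (\<lambda>x. poly p x * poly q x)"
  using gam_integrable_poly[of "p * q"] by (simp only: poly_fun_simps)

lemma power_std_normal_density_tendsto:
  "((\<lambda>x::real. x ^ k * std_normal_density x) \<longlongrightarrow> 0) at_top"
  "((\<lambda>x::real. x ^ k * std_normal_density x) \<longlongrightarrow> 0) at_bot"
proof -
  \<comment> \<open>From 2 on, x^2 / 2 is at least x, which reduces the limit to that of x^k / exp
    x. The left tail follows since the density is even.\<close>
  have bd: "std_normal_density x \<le> exp (- x)" if "x \<ge> 2" for x :: real
  proof -
    have "1 \<le> sqrt (2 * pi)" using pi_gt3 by (intro real_le_rsqrt) simp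
    then have "1 / sqrt (2 * pi) \<le> 1" by simp
    moreover have "2 * x \<le> x * x" using that by (intro mult_right_mono) auto
    then have "exp (- x\<^sup>2 / 2) \<le> exp (- x)" by (simp add: power2_eq_square)
    ultimately show ?thesis
      unfolding std_normal_density_def using mult_mono[of "1 / sqrt (2 * pi)" 1 "exp (- x\<^sup>2 / 2)" "exp (- x)"] by simp
  qed
  show 1: "((\<lambda>x::real. x ^ k * std_normal_density x) \<longlongrightarrow> 0) at_top"
  proof (rule tendsto_0_le[OF tendsto_power_div_exp_0[of k], of _ 1])
    show "\<forall>\<^sub>F x in at_top. norm (x ^ k * std_normal_density x) \<le> norm (x ^ k / exp x) * 1"
      using eventually_ge_at_top[of 2]
      by eventually_elim (use bd in \<open>auto simp: abs_mult divide_inverse exp_minus[symmetric] intro!: mult_left_mono\<close>)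
  qed
  have "((\<lambda>x::real. (-1)^k * (x ^ k * std_normal_density x)) \<longlongrightarrow> 0) at_top"
    using tendsto_mult[OF tendsto_const 1, of "(-1)^k"] by simp
  moreover have "(- x) ^ k * std_normal_density (- x) = (-1)^k * (x ^ k * std_normal_density x)" for x :: real
    by (simp add: std_normal_density_def power_minus[of x])
  ultimately show "((\<lambda>x::real. x ^ k * std_normal_density x) \<longlongrightarrow> 0) at_bot"
    unfolding filterlim_at_bot_mirror by (simp only:)
qed

lemma poly_std_normal_density_tendsto:
  fixes p :: "real poly"
  shows "((\<lambda>x. poly p x * std_normal_density x) \<longlongrightarrow> 0) at_top"
    and "((\<lambda>x. poly p x * std_normal_density x) \<longlongrightarrow> 0) at_bot"
proof -
  have *: "((\<lambda>x. poly p x * std_normal_density x) \<longlongrightarrow> 0) F"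
    if "\<And>k. ((\<lambda>x::real. x ^ k * std_normal_density x) \<longlongrightarrow> 0) F" for F
  proof -
    have "((\<lambda>x. \<Sum>i\<le>degree p. coeff p i * (x ^ i * std_normal_density x)) \<longlongrightarrow> (\<Sum>i\<le>degree p. coeff p i * 0)) F"
      by (intro tendsto_sum tendsto_mult tendsto_const that)
    then show ?thesis by (simp add: poly_altdef sum_distrib_right mult.assoc)
  qed
  show "((\<lambda>x. poly p x * std_normal_density x) \<longlongrightarrow> 0) at_top"
    "((\<lambda>x. poly p x * std_normal_density x) \<longlongrightarrow> 0) at_bot"
    by (intro * power_std_normal_density_tendsto)+
qed

text \<open>The integrand times the density is the derivative of density times \<open>G\<close>, and
  the polynomial bound makes the boundary terms vanish. Integrability is asked of the combination
  \<open>G' x - x *\<^sub>R G x\<close> only, because in the later use just this combination is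
  bounded. Vector values are allowed for the sake of complex exponentials.\<close>

lemma gauss_ibp:
  fixes G :: "real \<Rightarrow> 'b::euclidean_space"
  assumes D: "\<And>x. (G has_vector_derivative G' x) (at x)"
    and C: "\<And>x. isCont G' x"
    and I: "integrable gam (\<lambda>x. G' x - x *\<^sub>R G x)"
    and B: "\<And>x. norm (G x) \<le> \<bar>poly p x\<bar>"
  shows "(\<integral>x. (G' x - x *\<^sub>R G x) \<partial>gam) = 0"
proof -
  let ?f = "\<lambda>x. std_normal_density x *\<^sub>R (G' x - x *\<^sub>R G x)"
  let ?F = "\<lambda>x. std_normal_density x *\<^sub>R G x"
  have contG: "isCont G x" for x
    using D has_vector_derivative_continuous by blast
  have meas: "(\<lambda>x. G' x - x *\<^sub>R G x) \<in> borel_measurable borel"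
    using I by auto
  have lim: "(?F \<longlongrightarrow> 0) F" if "((\<lambda>x. poly p x * std_normal_density x) \<longlongrightarrow> 0) F" for F
  proof (rule tendsto_0_le[OF that, of _ 1])
    show "\<forall>\<^sub>F x in F. norm (?F x) \<le> norm (poly p x * std_normal_density x) * 1"
      using mult_right_mono[OF B normal_density_nonneg] by (intro always_eventually allI) (simp add: abs_mult mult.commute)
  qed
  have "(LBINT x=-\<infinity>..\<infinity>. ?f x) = 0 - 0"
  proof (rule interval_integral_FTC_integrable)
    show "(?F has_vector_derivative ?f x) (at x)" for x
      by (rule has_vector_derivative_eq_rhs[OF has_vector_derivative_scaleR[OF std_normal_density_deriv D]])
         (simp add: algebra_simps)
    show "isCont ?f x" for x
      by (intro continuous_intros C contG)
    show "set_integrable lborel (einterval (- \<infinity>) \<infinity>) ?f"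
      using I gam_integrable_iff[OF meas] by (simp add: set_integrable_def einterval_def)
    show "((?F \<circ> real_of_ereal) \<longlongrightarrow> 0) (at_right (-\<infinity>))"
      by (simp add: ereal_tendsto_simps lim poly_std_normal_density_tendsto)
    show "((?F \<circ> real_of_ereal) \<longlongrightarrow> 0) (at_left \<infinity>)"
      by (simp add: ereal_tendsto_simps lim poly_std_normal_density_tendsto)
  qed simp
  then have "(\<integral>x. ?f x \<partial>lborel) = 0"
    by (simp add: interval_lebesgue_integral_def einterval_def set_lebesgue_integral_def)
  then show ?thesis
    using gam_integral[OF meas] by simp
qed

text \<open>Hermite polynomials generated by x - d/dx, the adjoint of d/dx in L^2 of the Gaussian
  measure. As elements of the polynomial type they can be differentiated and multiplied inside
  inductions; \<open>hermite_eq_hp\<close> links them to the iterated derivatives.\<close>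

fun hp :: "nat \<Rightarrow> real poly" where
  "hp 0 = 1"
| "hp (Suc n) = [:0, 1:] * hp n - pderiv (hp n)"

text \<open>The commutator of d/dx with x - d/dx is the identity, so each induction step contributes
  one further copy of the lower polynomial.\<close>

lemma pderiv_hp: "pderiv (hp (Suc n)) = smult (real (Suc n)) (hp n)"
proof (induction n)
  case 0 show ?case by (simp add: pderiv_pCons pderiv_1)
next
  case (Suc n)
  have "pderiv (hp (Suc (Suc n))) = hp (Suc n) + [:0, 1:] * pderiv (hp (Suc n)) - pderiv (pderiv (hp (Suc n)))"
    by (subst hp.simps) (simp add: pderiv_diff pderiv_mult pderiv_pCons del: hp.simps)
  also have "\<dots> = hp (Suc n) + smult (real (Suc n)) ([:0, 1:] * hp n - pderiv (hp n))"
    by (simp only: Suc pderiv_smult smult_diff_right mult_smult_right add_diff_eq)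
  also have "\<dots> = smult (real (Suc (Suc n))) (hp (Suc n))"
    by (simp only: hp.simps(2)[symmetric] of_nat_Suc[of "Suc n"] smult_add_left smult_1_left)
  finally show ?case .
qed

lemma deriv_iterate_gauss:
  "(deriv ^^ n) (\<lambda>y::real. exp (- y\<^sup>2 / 2)) = (\<lambda>x. (-1)^n * poly (hp n) x * exp (- x\<^sup>2 / 2))"
proof (induction n)
  case (Suc n)
  have "((\<lambda>x. (-1)^n * poly (hp n) x * exp (- x\<^sup>2 / 2)) has_real_derivative
     ((-1)^Suc n * poly (hp (Suc n)) x * exp (- x\<^sup>2 / 2))) (at x)" for x :: real
    by (auto intro!: derivative_eq_intros simp: algebra_simps)
  then show ?case
    using Suc DERIV_imp_deriv by (simp only: funpow.simps o_apply) blast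
qed simp

lemma hermite_eq_hp: "hermite n x = poly (hp n) x"
proof -
  have "hermite n x = ((-1) ^ n * (-1) ^ n) * (exp (x\<^sup>2 / 2) * exp (- x\<^sup>2 / 2)) * poly (hp n) x"
    unfolding hermite_def deriv_iterate_gauss by (simp only: mult_ac)
  also have "\<dots> = poly (hp n) x"
    by (simp add: mult_exp_exp power_mult_distrib[symmetric])
  finally show ?thesis .
qed

text \<open>Adjointness of x - d/dx and d/dx: Gaussian integration by parts for the product
  \<open>hp n * p\<close>.\<close>

lemma hp_integral_Suc:
  "(\<integral>x. poly (hp (Suc n)) x * poly p x \<partial>gam) = (\<integral>x. poly (hp n) x * poly (pderiv p) x \<partial>gam)"
proof -
  let ?P = "hp n * p"
  have "(\<integral>x. (poly (pderiv ?P) x - x *\<^sub>R poly ?P x) \<partial>gam) = 0"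
  proof (rule gauss_ibp[where p="?P"])
    show "(poly ?P has_vector_derivative poly (pderiv ?P) x) (at x)" for x
      using poly_DERIV has_real_derivative_iff_has_vector_derivative by blast
    have "integrable gam (poly (pderiv ?P - [:0,1:] * ?P))"
      by (rule gam_integrable_poly)
    then show "integrable gam (\<lambda>x. poly (pderiv ?P) x - x *\<^sub>R poly ?P x)"
      by (simp add: poly_fun_simps)
  qed (auto simp: isCont_polynom)
  also have "(\<lambda>x. poly (pderiv ?P) x - x *\<^sub>R poly ?P x)
     = (\<lambda>x. poly (hp n * pderiv p) x - poly (hp (Suc n) * p) x)"
    by (auto simp: pderiv_mult algebra_simps)
  also have "(\<integral>x. poly (hp n * pderiv p) x - poly (hp (Suc n) * p) x \<partial>gam)
     = (\<integral>x. poly (hp n * pderiv p) x \<partial>gam) - (\<integral>x. poly (hp (Suc n) * p) x \<partial>gam)"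
    by (intro Bochner_Integration.integral_diff gam_integrable_poly)
  finally show ?thesis by simp
qed

text \<open>Adjointness trades a degree in one factor for a derivative of the other, and
  \<open>pderiv_hp\<close> turns that derivative into a lower Hermite polynomial; the factors n, n -
  1, ... collect to the factorial.\<close>

lemma hp_orthogonal:
  "(\<integral>x. poly (hp m) x * poly (hp n) x \<partial>gam) = (if m = n then fact n else 0)"
proof (induction m arbitrary: n)
  case 0
  show ?case
  proof (cases n)
    case (Suc k)
    then show ?thesis
      using hp_integral_Suc[of k 1] by (simp add: pderiv_1)
  qed (simp add: gam.prob_space[simplified])
next
  case (Suc m)
  show ?case
  proof (cases n)
    case 0
    then show ?thesis using hp_integral_Suc[of m 1] by (simp add: pderiv_1)
  next
    case (Suc k)
    have "(\<integral>x. poly (hp (Suc m)) x * poly (hp (Suc k)) x \<partial>gam)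
       = (\<integral>x. real (Suc k) * (poly (hp m) x * poly (hp k) x) \<partial>gam)"
      by (subst hp_integral_Suc) (simp only: pderiv_hp poly_smult mult.left_commute)
    also have "\<dots> = real (Suc k) * (if m = k then fact k else 0)"
      by (simp only: integral_mult_right_zero Suc.IH)
    finally show ?thesis using Suc by (simp del: hp.simps)
  qed
qed

text \<open>With \<open>P\<close> the truncated Hermite expansion of h, orthogonality gives the
  integral of (h - P)^2 as that of h^2 minus the partial sum. The terms are divided by
  \<open>fact n\<close> because \<open>hp n\<close> has squared norm n!.\<close>

lemma hp_bessel:
  assumes h: "h \<in> borel_measurable borel" and K: "\<And>x. \<bar>h x\<bar> \<le> K"
  shows "summable (\<lambda>n. (\<integral>x. h x * poly (hp n) x \<partial>gam)\<^sup>2 / fact n)"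
    and "(\<Sum>n. (\<integral>x. h x * poly (hp n) x \<partial>gam)\<^sup>2 / fact n) \<le> (\<integral>x. (h x)\<^sup>2 \<partial>gam)"
proof -
  define a where "a n = (\<integral>x. h x * poly (hp n) x \<partial>gam)" for n
  have [measurable]: "h \<in> borel_measurable borel" by fact
  have ip: "integrable gam (\<lambda>x. h x * poly p x)" for p
  proof (rule Bochner_Integration.integrable_bound[of _ "\<lambda>x. K * \<bar>poly p x\<bar>"])
    show "integrable gam (\<lambda>x. K * \<bar>poly p x\<bar>)"
      using gam_integrable_poly by auto
    show "AE x in gam. norm (h x * poly p x) \<le> norm (K * \<bar>poly p x\<bar>)"
      using K order_trans[OF abs_ge_zero K]  by (auto simp: abs_mult intro!: mult_right_mono)
    show "(\<lambda>x. h x * poly p x) \<in> borel_measurable gam"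
      using gam_integrable_poly[of p] by auto
  qed
  have ih: "integrable gam (\<lambda>x. (h x)\<^sup>2)"
    by (rule gam.integrable_const_bound[where B="K\<^sup>2"])
       (auto intro!: power_mono[OF K, of _ 2, simplified])
  have fin: "(\<Sum>n<N. a n ^ 2 / fact n) \<le> (\<integral>x. (h x)\<^sup>2 \<partial>gam)" for N
  proof -
    define P where "P = (\<Sum>n<N. smult (a n / fact n) (hp n))"
    have 1: "(\<integral>x. h x * poly P x \<partial>gam) = (\<Sum>n<N. a n ^ 2 / fact n)"
    proof -
      have "(\<integral>x. h x * poly P x \<partial>gam) = (\<integral>x. (\<Sum>n<N. (a n / fact n) * (h x * poly (hp n) x)) \<partial>gam)"
        by (simp add: P_def poly_sum sum_distrib_left mult_ac)
      also have "\<dots> = (\<Sum>n<N. (a n / fact n) * a n)"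
        unfolding a_def by (subst Bochner_Integration.integral_sum) (auto intro!: integrable_mult_right ip)
      finally show ?thesis by (simp add: power2_eq_square)
    qed
    have 2: "(\<integral>x. poly P x * poly P x \<partial>gam) = (\<Sum>n<N. a n ^ 2 / fact n)"
    proof -
      have int: "integrable gam (\<lambda>x. poly (hp n) x * poly (hp m) x)" for m n
        by (rule gam_integrable_poly_mult)
      have "(\<integral>x. poly P x * poly P x \<partial>gam) =
        (\<integral>x. (\<Sum>n<N. \<Sum>m<N. (a n / fact n) * (a m / fact m) * (poly (hp n) x * poly (hp m) x)) \<partial>gam)"
        by (simp add: P_def poly_sum sum_product mult_ac)
      also have "\<dots> = (\<Sum>n<N. \<Sum>m<N. (a n / fact n) * (a m / fact m) * (if n = m then fact m else 0))"
        by (subst Bochner_Integration.integral_sum, (intro Bochner_Integration.integrable_sum integrable_mult_right int),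
            subst Bochner_Integration.integral_sum, (intro integrable_mult_right int), simp only: integral_mult_right_zero hp_orthogonal)
      also have "\<dots> = (\<Sum>n<N. a n ^ 2 / fact n)"
        by (intro sum.cong refl) (simp add: if_distrib sum.delta power2_eq_square cong: if_cong)
      finally show ?thesis .
    qed
    have iP: "integrable gam (\<lambda>x. poly P x * poly P x)"
      by (rule gam_integrable_poly_mult)
    have "0 \<le> (\<integral>x. (h x - poly P x)\<^sup>2 \<partial>gam)"
      by simp
    also have "\<dots> = (\<integral>x. (h x)\<^sup>2 - 2 * (h x * poly P x) + poly P x * poly P x \<partial>gam)"
      by (intro Bochner_Integration.integral_cong) (auto simp: power2_eq_square algebra_simps)
    also have "\<dots> = (\<integral>x. (h x)\<^sup>2 \<partial>gam) - 2 * (\<Sum>n<N. a n ^ 2 / fact n) + (\<Sum>n<N. a n ^ 2 / fact n)"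
      using ih ip iP by (simp add: 1 2)
    finally show ?thesis by simp
  qed
  show s: "summable (\<lambda>n. (\<integral>x. h x * poly (hp n) x \<partial>gam)\<^sup>2 / fact n)"
    using fin by (intro bounded_imp_summable[of _ "\<integral>x. (h x)\<^sup>2 \<partial>gam"])
      (auto simp: a_def lessThan_Suc_atMost[symmetric] simp del: sum.lessThan_Suc)
  show "(\<Sum>n. (\<integral>x. h x * poly (hp n) x \<partial>gam)\<^sup>2 / fact n) \<le> (\<integral>x. (h x)\<^sup>2 \<partial>gam)"
    using fin by (intro suminf_le_const s) (auto simp: a_def)
qed

lemma hp_integral_abs: "(\<integral>x. \<bar>poly (hp n) x\<bar> \<partial>gam) \<le> sqrt (fact n)"
proof -
  have i: "integrable gam (\<lambda>x. (poly (hp n) x)\<^sup>2)"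
    using gam_integrable_poly_mult[of "hp n" "hp n"] by (simp add: power2_eq_square)
  show ?thesis
    using gam.expectation_abs_le_sqrt(2)[OF _ i] unfolding power2_eq_square hp_orthogonal by simp
qed

text \<open>Integration by parts moves x - d/dx from the polynomial onto the exponential, where each
  derivative yields a factor \<i>\<theta>; the base case is the characteristic function. A Hermite
  series thereby becomes a power series in \<theta> after Fourier transformation, which is the
  engine of Mehler's formula.\<close>

lemma hp_fourier:
  "(\<integral>x. of_real (poly (hp n) x) * exp (\<i> * of_real (\<theta> * x)) \<partial>gam)
     = (\<i> * of_real \<theta>)^n * of_real (exp (- \<theta>\<^sup>2 / 2))"
proof (induction n)
  case 0
  show ?case
    using fun_cong[OF char_std_normal_distribution, of \<theta>] by (simp add: char_def)
next
  case (Suc n)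
  let ?e = "\<lambda>x::real. exp (\<i> * complex_of_real (\<theta> * x))"
  let ?G = "\<lambda>x. of_real (poly (hp n) x) * ?e x"
  let ?G' = "\<lambda>x. of_real (poly (pderiv (hp n)) x) * ?e x + (\<i> * of_real \<theta>) * ?G x"
  have ii: "integrable gam (\<lambda>x. of_real (poly p x) * ?e x)" for p
    by (rule Bochner_Integration.integrable_bound[OF gam_integrable_poly[of p]])
       (auto simp: norm_mult)
  have *: "?G' x - x *\<^sub>R ?G x = (\<i> * of_real \<theta>) * ?G x - of_real (poly (hp (Suc n)) x) * ?e x" for x
    by (simp add: algebra_simps scaleR_conv_of_real)
  have "(\<integral>x. ?G' x - x *\<^sub>R ?G x \<partial>gam) = 0"
  proof (rule gauss_ibp[where p="hp n"])
    show "(?G has_vector_derivative ?G' x) (at x)" for x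
    proof -
      have 1: "((\<lambda>x. complex_of_real (poly (hp n) x)) has_vector_derivative of_real (poly (pderiv (hp n)) x)) (at x)"
        using has_vector_derivative_of_real[of "poly (hp n)" "poly (pderiv (hp n)) x" "at x"]  poly_DERIV[of "hp n" x]
          has_real_derivative_iff_has_vector_derivative by blast
      have 2: "(?e has_vector_derivative (\<i> * of_real \<theta>) * ?e x) (at x)"
        by (auto intro!: derivative_eq_intros has_vector_derivative_real_field has_vector_derivative_of_real simp: field_simps)
      show ?thesis
        by (rule has_vector_derivative_eq_rhs[OF has_vector_derivative_mult[OF 1 2]]) (simp add: algebra_simps)
    qed
    show "isCont ?G' x" for x by (intro continuous_intros isCont_of_real isCont_polynom)
    show "integrable gam (\<lambda>x. ?G' x - x *\<^sub>R ?G x)"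
      unfolding * by (intro Bochner_Integration.integrable_diff integrable_mult_right ii)
  qed (auto simp: norm_mult)
  then have "(\<i> * of_real \<theta>) * (\<integral>x. ?G x \<partial>gam) - (\<integral>x. of_real (poly (hp (Suc n)) x) * ?e x \<partial>gam) = 0"
    unfolding * by (subst (asm) Bochner_Integration.integral_diff)
        (intro integrable_mult_right ii, rule ii, simp only: integral_mult_right_zero)
  then show ?case unfolding Suc by (simp only: power_Suc) (simp add: mult.assoc del: hp.simps)
qed

text \<open>The integrand is minus the derivative of \<open>hp n\<close> times the density, so only
  the boundary value at u remains. These are the Hermite coefficients of the indicator and the
  origin of the factor \<phi>(u) H_(n-1)(u) in \<sigma>^2.\<close>

lemma hp_tail_integral:
  "(\<integral>x. indicator {u..} x * poly (hp (Suc n)) x \<partial>gam) = std_normal_density u * poly (hp n) u"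
proof -
  let ?F = "\<lambda>x. - (poly (hp n) x * std_normal_density x)"
  let ?f = "\<lambda>x. std_normal_density x * poly (hp (Suc n)) x"
  have i: "integrable lborel ?f"
    using gam_integrable_poly[of "hp (Suc n)"] by (subst (asm) gam_integrable_iff) (simp_all del: hp.simps)
  have "(LBINT x=ereal u..\<infinity>. ?f x) = 0 - ?F u"
  proof (rule interval_integral_FTC_integrable)
    show "(?F has_vector_derivative ?f x) (at x)" for x
      unfolding has_real_derivative_iff_has_vector_derivative[symmetric]
      by (auto intro!: derivative_eq_intros std_normal_density_deriv simp: algebra_simps)
    show "isCont ?f x" for x
      by (intro continuous_intros isCont_polynom)
    show "set_integrable lborel (einterval (ereal u) \<infinity>) ?f"
      unfolding set_integrable_def using i by (intro integrable_mult_indicator) auto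
    have "isCont ?F u" by (intro continuous_intros isCont_polynom)
    then show "((?F \<circ> real_of_ereal) \<longlongrightarrow> ?F u) (at_right (ereal u))"
      unfolding ereal_tendsto_simps isCont_def by (rule tendsto_mono[OF at_le[OF subset_UNIV]])
    show "((?F \<circ> real_of_ereal) \<longlongrightarrow> 0) (at_left \<infinity>)"
      unfolding ereal_tendsto_simps
      using tendsto_minus[OF poly_std_normal_density_tendsto(1)[of "hp n"]] by simp
  qed simp
  moreover have "(LBINT x=ereal u..\<infinity>. ?f x) = (\<integral>x. indicator {u<..} x * ?f x \<partial>lborel)"
    by (simp add: interval_lebesgue_integral_def einterval_def set_lebesgue_integral_def greaterThan_def)
  moreover have "\<dots> = (\<integral>x. indicator {u..} x * ?f x \<partial>lborel)"
  proof (rule integral_cong_AE)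
    show "AE x in lborel. indicator {u<..} x * ?f x = indicator {u..} x * ?f x"
      using AE_lborel_singleton[of u] by eventually_elim (auto simp: indicator_def simp del: hp.simps)
  qed measurable
  moreover have "\<dots> = (\<integral>x. indicator {u..} x * poly (hp (Suc n)) x \<partial>gam)"
    by (subst gam_integral) (auto simp: mult_ac simp del: hp.simps)
  ultimately show ?thesis by (simp add: mult.commute[of "std_normal_density u"] del: hp.simps)
qed

subsection \<open>Stein's equation\<close>

lemma has_real_derivative_lower_integral:
  fixes F :: "real \<Rightarrow> real"
  assumes C: "continuous_on UNIV F" and I: "integrable lborel F"
  shows "((\<lambda>x. \<integral>y. indicator {..x} y * F y \<partial>lborel) has_real_derivative F x0) (at x0)"
proof -
  \<comment> \<open>Any base point below x0 would do: to its right, the half-line integral is a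
    constant plus an integral over a compact interval, to which the fundamental theorem
    applies.\<close>
  let ?c = "x0 - 1"
  have ii: "integrable lborel (\<lambda>y. indicator A y * F y)" if "A \<in> sets borel" for A
    using integrable_mult_indicator[of A lborel F] that I by simp
  have eq: "(\<integral>y. indicator {..x} y * F y \<partial>lborel)
     = (\<integral>y. indicator {..?c} y * F y \<partial>lborel) + (LBINT y=?c..x. F y)" if "?c \<le> x" for x
  proof -
    have "(\<integral>y. indicator {..x} y * F y \<partial>lborel)
       = (\<integral>y. indicator {..?c} y * F y + indicator {?c<..x} y * F y \<partial>lborel)"
      using that by (intro Bochner_Integration.integral_cong) (auto simp: indicator_def)
    also have "\<dots> = (\<integral>y. indicator {..?c} y * F y \<partial>lborel) + (\<integral>y. indicator {?c<..x} y * F y \<partial>lborel)"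
      by (intro Bochner_Integration.integral_add ii) auto
    also have "(\<integral>y. indicator {?c<..x} y * F y \<partial>lborel) = (LBINT y=?c..x. F y)"
      unfolding interval_integral_Ioc[OF that] set_lebesgue_integral_def real_scaleR_def by (rule refl)
    finally show ?thesis .
  qed
  have "((\<lambda>u. LBINT y=?c..u. F y) has_vector_derivative F x0) (at x0 within {?c..x0 + 1})"
    by (rule interval_integral_FTC2) (auto intro: continuous_on_subset[OF C])
  moreover have "at x0 within {?c..x0 + 1} = at x0"
    by (rule at_within_Icc_at) auto
  ultimately have "((\<lambda>u. (\<integral>y. indicator {..?c} y * F y \<partial>lborel) + (LBINT y=?c..u. F y)) has_real_derivative 0 + F x0) (at x0)"
    by (intro DERIV_add DERIV_const) (simp only: has_real_derivative_iff_has_vector_derivative)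
  then show ?thesis
    unfolding add_0
  proof (rule has_field_derivative_transform_within_open[of _ _ _ "{?c<..}"])
    fix x assume "x \<in> {?c<..}"
    then have "?c \<le> x" by simp
    from eq[OF this, symmetric]
    show "(\<integral>y. indicator {..?c} y * F y \<partial>lborel) + (LBINT y=?c..x. F y) = (\<integral>y. indicator {..x} y * F y \<partial>lborel)" .
  qed auto
qed

lemma gam_reflect:
  fixes f :: "real \<Rightarrow> real"
  assumes [measurable]: "f \<in> borel_measurable borel"
  shows "(\<integral>x. f (- x) \<partial>gam) = (\<integral>x. f x \<partial>gam)"
proof -
  have "(\<integral>x. f x \<partial>gam) = (\<integral>x. std_normal_density x * f x \<partial>lborel)"
    by (subst gam_integral) auto
  also have "\<dots> = (\<integral>x. std_normal_density (- x) * f (- x) \<partial>lborel)"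
    by (subst lborel_integral_real_affine[where c="-1" and t=0]) auto
  also have "\<dots> = (\<integral>x. f (- x) \<partial>gam)"
    by (subst gam_integral) (auto simp: std_normal_density_def)
  finally show ?thesis by simp
qed

lemma gam_integrable_linear:
  "integrable gam (\<lambda>x. x)" "integrable gam (\<lambda>x. \<bar>x\<bar>)"
  using gam_integrable_poly[of "[:0,1:]"] by (auto intro!: integrable_abs simp: poly_fun_simps)

lemma gam_tail_first_moment:
  "(\<integral>y. indicator {x..} y * y \<partial>gam) = std_normal_density x"
proof -
  have "poly (hp (Suc 0)) = (\<lambda>y. y)" "poly (hp 0) = (\<lambda>y. 1)" by auto
  with hp_tail_integral[of x 0] show ?thesis by (simp only: mult_1_right)
qed

text \<open>Mills ratio estimates. On the tail beyond x every c <= x is at most y, so c times the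
  tail mass is at most the first moment of the tail, which is the density itself.\<close>

lemma gam_tail_bounds:
  assumes "x \<ge> 0"
  shows "(\<integral>y. indicator {x..} y \<partial>gam) \<le> 6 * std_normal_density x"
    and "x * (\<integral>y. indicator {x..} y \<partial>gam) \<le> std_normal_density x"
proof -
  have i: "integrable gam (\<lambda>y. indicator {x..} y * y)"
    using integrable_mult_indicator[of "{x..}" gam "\<lambda>y. y"] gam_integrable_linear by simp
  have i0: "integrable gam (indicator {x..} :: real \<Rightarrow> real)"
    by (rule gam.integrable_const_bound[of _ 1]) (auto simp: indicator_def)
  have 0: "c * (\<integral>y. indicator {x..} y \<partial>gam) \<le> std_normal_density x" if "c \<le> x" for c
  proof -
    have "c * (\<integral>y. indicator {x..} y \<partial>gam) = (\<integral>y. c * indicator {x..} y \<partial>gam)"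
      by simp
    also have "\<dots> \<le> (\<integral>y. indicator {x..} y * y \<partial>gam)"
    proof (rule integral_mono)
      show "c * indicator {x..} y \<le> indicator {x..} y * y" for y :: real
        using that by (auto simp: indicator_def)
    qed (intro integrable_mult_right i i0)+
    finally show ?thesis by (simp only: gam_tail_first_moment)
  qed
  show "x * (\<integral>y. indicator {x..} y \<partial>gam) \<le> std_normal_density x"
    by (rule 0) simp
  show "(\<integral>y. indicator {x..} y \<partial>gam) \<le> 6 * std_normal_density x"
  proof (cases "x \<ge> 1")
    case True
    then show ?thesis using 0[of 1] normal_density_nonneg[of 0 1 x] by linarith
  next
    case False
    \<comment> \<open>Origin of the constant 6: for x in [0, 1) the density is at least exp (-1/2) /
      sqrt (2 pi) >= 1 / (2 * 3), while the tail mass is at most 1.\<close>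
    have "sqrt (2 * pi) \<le> 3"
      using pi_less_4 by (intro real_le_lsqrt) auto
    moreover have "exp (1/2 :: real) \<le> 2"
      using exp_le by (intro power2_le_imp_le[of "exp (1/2)" "2 :: real"]) (auto simp: exp_double[symmetric])
    ultimately have "sqrt (2 * pi) * exp (1/2) \<le> 3 * 2"
      by (intro mult_mono) auto
    then have "1 \<le> 6 * (1 / sqrt (2 * pi) * exp (- 1 / 2))"
      by (simp add: field_simps exp_minus)
    also have "\<dots> \<le> 6 * std_normal_density x"
      unfolding std_normal_density_def using False assms
      by (intro mult_left_mono) (auto simp: abs_square_le_1)
    finally have "1 \<le> 6 * std_normal_density x" .
    moreover have "(\<integral>y. indicator {x..} y \<partial>gam :: real) \<le> (\<integral>y. 1 \<partial>gam)"
    proof (rule integral_mono)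
      show "indicator {x..} y \<le> (1::real)" for y :: real
        by (auto simp: indicator_def)
    qed (use i0 in auto)
    moreover have "(\<integral>y. 1 \<partial>gam) = (1::real)"
      using gam.prob_space by simp
    ultimately show ?thesis by linarith
  qed
qed

text \<open>The solution is bounded by a constant multiple of \<open>a\<close> only because \<open>k\<close> has Gaussian mean
  zero: this allows to integrate from whichever side the tail is light.\<close>

lemma stein_equation_solution:
  fixes k :: "real \<Rightarrow> real"
  assumes k: "continuous_on UNIV k" and bd: "\<And>x. \<bar>k x\<bar> \<le> a + b * \<bar>x\<bar>"
    and mean: "(\<integral>x. k x \<partial>gam) = 0" and ab: "a \<ge> 0" "b \<ge> 0"
  obtains q where "\<And>x. (q has_real_derivative x * q x - k x) (at x)"
    "\<And>x. \<bar>q x\<bar> \<le> 6 * a + b" "b = 0 \<Longrightarrow> (\<And>x. \<bar>x * q x\<bar> \<le> a)"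
proof -
  have [measurable]: "k \<in> borel_measurable borel"
    using k by (rule borel_measurable_continuous_onI)
  have ik: "integrable gam k"
  proof (rule Bochner_Integration.integrable_bound)
    show "integrable gam (\<lambda>x. a + b * \<bar>x\<bar>)"
      using gam_integrable_linear by auto
    show "AE x in gam. norm (k x) \<le> norm (a + b * \<bar>x\<bar>)"
      using bd ab by auto
  qed simp
  have ii: "integrable gam (\<lambda>y. indicator A y * f y)" if "A \<in> sets borel" "integrable gam f" for A and f :: "real \<Rightarrow> real"
    using integrable_mult_indicator[of A gam f] that by simp
  define I where "I x = (\<integral>y. indicator {..x} y * k y \<partial>gam)" for x
  \<comment> \<open>The density is the integrating factor: q' = x q - k says that q times the
    density has derivative -k times the density.\<close>
  define q where "q x = - I x / std_normal_density x" for x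
  have pos: "std_normal_density x > 0" for x
    by (simp add: normal_density_pos)
  have "I = (\<lambda>x. \<integral>y. indicator {..x} y * (std_normal_density y * k y) \<partial>lborel)"
    unfolding I_def by (subst gam_integral) (auto simp: mult_ac)
  moreover have "integrable lborel (\<lambda>y. std_normal_density y * k y)"
    using ik by (subst (asm) gam_integrable_iff) auto
  moreover have "continuous_on UNIV std_normal_density"
    by (simp add: continuous_at_imp_continuous_on isCont_std_normal_density)
  ultimately have dI: "(I has_real_derivative std_normal_density x * k x) (at x)" for x
    using has_real_derivative_lower_integral k by (auto intro: continuous_on_mult)
  have dq: "(q has_real_derivative x * q x - k x) (at x)" for x
    unfolding q_def using pos[of x]
    by (auto intro!: derivative_eq_intros dI std_normal_density_deriv simp: field_simps power2_eq_square)
  define T where "T x = (\<integral>y. indicator {x..} y \<partial>gam :: real)" for x :: real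
  have T_eq: "(\<integral>y. indicator {x..} y * (a + b * \<bar>y\<bar>) \<partial>gam) = a * T x + b * std_normal_density x" if "x \<ge> 0" for x
  proof -
    have "(\<integral>y. indicator {x..} y * (a + b * \<bar>y\<bar>) \<partial>gam) = (\<integral>y. a * indicator {x..} y + b * (indicator {x..} y * y) \<partial>gam)"
      using that by (intro Bochner_Integration.integral_cong) (auto simp: indicator_def)
    also have "\<dots> = a * T x + b * (\<integral>y. indicator {x..} y * y \<partial>gam)"
      unfolding T_def using ii[of "{x..}" "\<lambda>y. y"] ii[of "{x..}" "\<lambda>y. 1"] gam_integrable_linear
      by (subst Bochner_Integration.integral_add) (auto intro!: integrable_mult_right)
    finally show ?thesis by (simp only: gam_tail_first_moment)
  qed
  have ibd: "integrable gam (\<lambda>y. a + b * \<bar>y\<bar>)"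
    using gam_integrable_linear by auto
  have Ile: "\<bar>I x\<bar> \<le> a * T \<bar>x\<bar> + b * std_normal_density x" for x
  proof (cases "x \<ge> 0")
    case True
    have "I x + (\<integral>y. indicator {x<..} y * k y \<partial>gam) = (\<integral>y. indicator {..x} y * k y + indicator {x<..} y * k y \<partial>gam)"
      unfolding I_def using ik by (intro Bochner_Integration.integral_add[symmetric] ii) auto
    also have "\<dots> = (\<integral>y. k y \<partial>gam)"
      by (intro Bochner_Integration.integral_cong) (auto simp: indicator_def)
    finally have "\<bar>I x\<bar> = \<bar>\<integral>y. indicator {x<..} y * k y \<partial>gam\<bar>"
      using mean by linarith
    also have "\<dots> \<le> (\<integral>y. \<bar>indicator {x<..} y * k y\<bar> \<partial>gam)"
      by (rule integral_abs_bound)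
    also have "\<dots> \<le> (\<integral>y. indicator {x..} y * (a + b * \<bar>y\<bar>) \<partial>gam)"
      using bd order_trans[OF abs_ge_zero bd] ik ibd by (intro integral_mono integrable_abs ii) (auto simp: indicator_def)
    finally show ?thesis using True T_eq by simp
  next
    case False
    have "\<bar>I x\<bar> \<le> (\<integral>y. \<bar>indicator {..x} y * k y\<bar> \<partial>gam)"
      unfolding I_def by (rule integral_abs_bound)
    also have "\<dots> \<le> (\<integral>y. indicator {..x} y * (a + b * \<bar>y\<bar>) \<partial>gam)"
      using bd order_trans[OF abs_ge_zero bd] ik ibd by (intro integral_mono integrable_abs ii) (auto simp: indicator_def)
    also have "\<dots> = (\<integral>y. indicator {..x} (- y) * (a + b * \<bar>- y\<bar>) \<partial>gam)"
      by (rule gam_reflect[symmetric]) auto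
    also have "\<dots> = (\<integral>y. indicator {\<bar>x\<bar>..} y * (a + b * \<bar>y\<bar>) \<partial>gam)"
      using False by (intro Bochner_Integration.integral_cong) (auto simp: indicator_def)
    also have "\<dots> = a * T \<bar>x\<bar> + b * std_normal_density \<bar>x\<bar>"
      by (rule T_eq) simp
    finally show ?thesis by (simp add: std_normal_density_def)
  qed
  have absd: "std_normal_density \<bar>x\<bar> = std_normal_density x" for x
    by (simp add: std_normal_density_def)
  \<comment> \<open>Dividing \<open>Ile\<close> by the density, the first tail bound yields this
    estimate, and the second one, tail mass times x, the bound on x q.\<close>
  have "\<bar>q x\<bar> \<le> 6 * a + b" for x
  proof -
    have "\<bar>I x\<bar> \<le> a * (6 * std_normal_density x) + b * std_normal_density x"
      using Ile[of x] mult_left_mono[OF gam_tail_bounds(1)[of "\<bar>x\<bar>"] ab(1)] by (simp add: T_def absd)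
    then show ?thesis using pos[of x] by (simp add: q_def abs_div divide_le_eq algebra_simps)
  qed
  moreover have "\<bar>x * q x\<bar> \<le> a" if "b = 0" for x
  proof -
    have "\<bar>x\<bar> * \<bar>I x\<bar> \<le> \<bar>x\<bar> * (a * T \<bar>x\<bar>)"
      using Ile[of x] that by (intro mult_left_mono) auto
    also have "\<dots> \<le> a * std_normal_density x"
      using mult_left_mono[OF gam_tail_bounds(2)[of "\<bar>x\<bar>"] ab(1)] by (simp add: T_def absd mult_ac)
    finally show ?thesis using pos[of x] by (simp add: q_def abs_div abs_mult divide_le_eq)
  qed
  ultimately show thesis using that dq by blast
qed

subsection \<open>Uniqueness of Fourier transforms\<close>

text \<open>A weak form of E[D | Y] = 0: it suffices to test against exponentials of Y. Levy's
  uniqueness theorem is applied to the laws of Y weighted by the positive and by the negative part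
  of D. This replaces approximation by trigonometric polynomials throughout.\<close>

lemma fourier_unique_real:
  fixes D Y k :: "_ \<Rightarrow> real"
  assumes D: "integrable M D" and Y [measurable]: "Y \<in> borel_measurable M"
    and ft: "\<And>\<theta>. (\<integral>\<omega>. of_real (D \<omega>) * iexp (\<theta> * Y \<omega>) \<partial>M) = 0"
    and k [measurable]: "k \<in> borel_measurable borel" and K: "\<And>x. \<bar>k x\<bar> \<le> K"
  shows "(\<integral>\<omega>. D \<omega> * k (Y \<omega>) \<partial>M) = 0"
proof -
  define P where "P \<omega> = max 0 (D \<omega>)" for \<omega>
  define N where "N \<omega> = max 0 (- D \<omega>)" for \<omega>
  have [measurable]: "D \<in> borel_measurable M" using D by auto
  have PN [measurable]: "P \<in> borel_measurable M" "N \<in> borel_measurable M"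
    unfolding P_def [abs_def] N_def [abs_def] by measurable
  have nn: "P \<omega> \<ge> 0" "N \<omega> \<ge> 0" for \<omega> by (auto simp: P_def N_def)
  have DPN: "D \<omega> = P \<omega> - N \<omega>" for \<omega> by (auto simp: P_def N_def)
  have iP: "integrable M P" and iN: "integrable M N"
    using D by (auto simp: P_def [abs_def] N_def [abs_def] intro!: integrable_max)
  define m where "m = (\<integral>\<omega>. P \<omega> \<partial>M)"
  have ft0: "(\<integral>\<omega>. P \<omega> *\<^sub>R iexp (\<theta> * Y \<omega>) \<partial>M) = (\<integral>\<omega>. N \<omega> *\<^sub>R iexp (\<theta> * Y \<omega>) \<partial>M)" for \<theta>
  proof -
    have i: "integrable M (\<lambda>\<omega>. Q \<omega> *\<^sub>R iexp (\<theta> * Y \<omega>))" if "integrable M Q" for Q :: "_ \<Rightarrow> real"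
      using that by (rule Bochner_Integration.integrable_bound) (use that in auto)
    have "(\<integral>\<omega>. P \<omega> *\<^sub>R iexp (\<theta> * Y \<omega>) \<partial>M) - (\<integral>\<omega>. N \<omega> *\<^sub>R iexp (\<theta> * Y \<omega>) \<partial>M)
       = (\<integral>\<omega>. of_real (D \<omega>) * iexp (\<theta> * Y \<omega>) \<partial>M)"
      unfolding Bochner_Integration.integral_diff[OF i[OF iP] i[OF iN], symmetric]
      by (intro Bochner_Integration.integral_cong refl) (simp add: DPN algebra_simps scaleR_conv_of_real)
    then show ?thesis using ft by simp
  qed
  \<comment> \<open>The frequency zero shows that both parts have the same mass, so that one
    constant normalises both to probability measures.\<close>
  have m2: "m = (\<integral>\<omega>. N \<omega> \<partial>M)"
  proof -
    have "complex_of_real m = complex_of_real (\<integral>\<omega>. N \<omega> \<partial>M)"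
      using ft0[of 0] iP iN by (simp add: m_def scaleR_conv_of_real)
    then show ?thesis by simp
  qed
  have m0: "m \<ge> 0" unfolding m_def using nn by (intro integral_nonneg_AE) auto
  show ?thesis
  proof (cases "m = 0")
    case True
    have "AE \<omega> in M. P \<omega> = 0" "AE \<omega> in M. N \<omega> = 0"
      using integral_nonneg_eq_0_iff_AE[OF iP] integral_nonneg_eq_0_iff_AE[OF iN] nn True m2
      by (auto simp: m_def)
    then have "AE \<omega> in M. D \<omega> * k (Y \<omega>) = 0"
      by eventually_elim (simp add: DPN)
    then show ?thesis by (subst integral_cong_AE[of _ _ "\<lambda>_. 0"]) auto
  next
    case False
    then have mp: "m > 0" using m0 by simp
    define \<mu> where "\<mu> Q = distr (density M (\<lambda>\<omega>. ennreal (Q \<omega> / m))) borel Y" for Q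
    have mu: "(\<integral>x. f x \<partial>\<mu> Q) = (\<integral>\<omega>. (Q \<omega> / m) *\<^sub>R f (Y \<omega>) \<partial>M)"
      if [measurable]: "f \<in> borel_measurable borel" "Q \<in> borel_measurable M" and "\<And>\<omega>. Q \<omega> \<ge> 0"
      for Q and f :: "real \<Rightarrow> 'c::{banach,second_countable_topology}"
      unfolding \<mu>_def using that mp by (subst integral_distr, simp, simp, subst integral_density) auto
    have rd: "real_distribution (\<mu> Q)"
      if [measurable]: "Q \<in> borel_measurable M" and "\<And>\<omega>. Q \<omega> \<ge> 0" "integrable M Q" "(\<integral>\<omega>. Q \<omega> \<partial>M) = m" for Q
    proof -
      have "prob_space (density M (\<lambda>\<omega>. ennreal (Q \<omega> / m)))"
      proof
        have "(\<integral>\<^sup>+ \<omega>. ennreal (Q \<omega> / m) \<partial>M) = ennreal (\<integral>\<omega>. Q \<omega> / m \<partial>M)"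
          using that mp by (intro nn_integral_eq_integral) auto
        also have "\<dots> = 1" using that mp by simp
        finally show "emeasure (density M (\<lambda>\<omega>. ennreal (Q \<omega> / m))) (space (density M (\<lambda>\<omega>. ennreal (Q \<omega> / m)))) = 1"
          by (simp add: emeasure_density cong: nn_integral_cong)
      qed
      then show ?thesis
        unfolding \<mu>_def by (intro prob_space.real_distribution_distr) auto
    qed
    have "char (\<mu> P) = char (\<mu> N)"
    proof
      fix \<theta>
      have c: "char (\<mu> Q) \<theta> = (1 / m) *\<^sub>R (\<integral>\<omega>. Q \<omega> *\<^sub>R iexp (\<theta> * Y \<omega>) \<partial>M)"
        if "Q \<in> borel_measurable M" and "\<And>\<omega>. Q \<omega> \<ge> 0" for Q
        unfolding char_def by (subst mu[OF _ that]) (simp_all add: divide_inverse mult.commute[of _ "inverse m"] flip: scaleR_scaleR)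
      show "char (\<mu> P) \<theta> = char (\<mu> N) \<theta>"
        by (simp only: c[OF PN(1) nn(1)] c[OF PN(2) nn(2)] ft0)
    qed
    then have "\<mu> P = \<mu> N"
      using rd[OF PN(1) nn(1) iP] rd[OF PN(2) nn(2) iN] m2 by (intro Levy_uniqueness) (auto simp: m_def)
    then have "(\<integral>x. k x \<partial>\<mu> P) = (\<integral>x. k x \<partial>\<mu> N)" by simp
    then have *: "(\<integral>\<omega>. P \<omega> * k (Y \<omega>) \<partial>M) = (\<integral>\<omega>. N \<omega> * k (Y \<omega>) \<partial>M)"
      using mp by (simp add: mu nn)
    have i: "integrable M (\<lambda>\<omega>. Q \<omega> * k (Y \<omega>))" if Q: "integrable M Q" for Q
    proof (rule Bochner_Integration.integrable_bound[OF integrable_mult_right[OF Q, of K]])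
      show "AE \<omega> in M. norm (Q \<omega> * k (Y \<omega>)) \<le> norm (K * Q \<omega>)"
        using K order_trans[OF abs_ge_zero K] by (auto simp: abs_mult mult.commute[of K] intro!: mult_left_mono)
    qed (use Q in auto)
    show ?thesis
      unfolding DPN left_diff_distrib using * by (subst Bochner_Integration.integral_diff) (auto intro: i iP iN)
  qed
qed

text \<open>Reduction to real and imaginary part. The transform of the conjugate of D at \<theta> is
  the conjugate of the transform of D at -\<theta>, so it vanishes too, and Re D and Im D are
  combinations of D and its conjugate.\<close>

lemma fourier_unique:
  fixes D :: "'a \<Rightarrow> complex" and Y k :: "_ \<Rightarrow> real"
  assumes D: "integrable M D" and Y [measurable]: "Y \<in> borel_measurable M"
    and ft: "\<And>\<theta>. (\<integral>\<omega>. D \<omega> * iexp (\<theta> * Y \<omega>) \<partial>M) = 0"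
    and k [measurable]: "k \<in> borel_measurable borel" and K: "\<And>x. \<bar>k x\<bar> \<le> K"
  shows "(\<integral>\<omega>. D \<omega> * of_real (k (Y \<omega>)) \<partial>M) = 0"
proof -
  have [measurable]: "D \<in> borel_measurable M" using D by auto
  have [measurable]: "cnj \<in> borel_measurable borel"
    by (intro borel_measurable_continuous_onI continuous_on_cnj continuous_on_id)
  have i: "integrable M (\<lambda>\<omega>. D \<omega> * iexp (\<theta> * Y \<omega>))" for \<theta>
    by (rule Bochner_Integration.integrable_bound[OF D]) (auto simp: norm_mult)
  have ic: "integrable M (\<lambda>\<omega>. cnj (D \<omega>) * iexp (\<theta> * Y \<omega>))" for \<theta>
    by (rule Bochner_Integration.integrable_bound[OF D]) (auto simp: norm_mult)
  have ftc: "(\<integral>\<omega>. cnj (D \<omega>) * iexp (\<theta> * Y \<omega>) \<partial>M) = 0" for \<theta>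
  proof -
    have "(\<integral>\<omega>. cnj (D \<omega> * iexp (- \<theta> * Y \<omega>)) \<partial>M) = 0"
      using ft[of "- \<theta>"] by (subst Bochner_Integration.integral_cnj) (simp only: complex_cnj_zero)
    then show ?thesis by (simp add: exp_cnj)
  qed
  have re: "(\<integral>\<omega>. Re (D \<omega>) * k (Y \<omega>) \<partial>M) = 0"
  proof (rule fourier_unique_real[OF _ Y _ k K])
    show "integrable M (\<lambda>\<omega>. Re (D \<omega>))" using D by simp
    have "(\<integral>\<omega>. of_real (Re (D \<omega>)) * iexp (\<theta> * Y \<omega>) \<partial>M)
      = (\<integral>\<omega>. (D \<omega> * iexp (\<theta> * Y \<omega>) + cnj (D \<omega>) * iexp (\<theta> * Y \<omega>)) / 2 \<partial>M)" for \<theta>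
      by (intro Bochner_Integration.integral_cong refl) (simp add: complex_add_cnj flip: distrib_right)
    then show "(\<integral>\<omega>. of_real (Re (D \<omega>)) * iexp (\<theta> * Y \<omega>) \<partial>M) = 0" for \<theta>
      unfolding integral_divide_zero Bochner_Integration.integral_add[OF i ic] ft ftc by simp
  qed
  have im: "(\<integral>\<omega>. Im (D \<omega>) * k (Y \<omega>) \<partial>M) = 0"
  proof (rule fourier_unique_real[OF _ Y _ k K])
    show "integrable M (\<lambda>\<omega>. Im (D \<omega>))" using D by simp
    have "(\<integral>\<omega>. of_real (Im (D \<omega>)) * iexp (\<theta> * Y \<omega>) \<partial>M)
      = (\<integral>\<omega>. (D \<omega> * iexp (\<theta> * Y \<omega>) - cnj (D \<omega>) * iexp (\<theta> * Y \<omega>)) / (2 * \<i>) \<partial>M)" for \<theta>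
      by (intro Bochner_Integration.integral_cong refl) (simp add: complex_diff_cnj algebra_simps flip: left_diff_distrib[of "D _"])
    then show "(\<integral>\<omega>. of_real (Im (D \<omega>)) * iexp (\<theta> * Y \<omega>) \<partial>M) = 0" for \<theta>
      unfolding integral_divide_zero Bochner_Integration.integral_diff[OF i ic] ft ftc by simp
  qed
  have iD: "integrable M (\<lambda>\<omega>. D \<omega> * of_real (k (Y \<omega>)))"
  proof (rule Bochner_Integration.integrable_bound[OF integrable_mult_right[OF D, of "of_real K"]])
    show "AE \<omega> in M. norm (D \<omega> * of_real (k (Y \<omega>))) \<le> norm (of_real K * D \<omega>)"
      using K order_trans[OF abs_ge_zero K] by (auto simp: norm_mult mult.commute[of K] intro!: mult_left_mono)
  qed auto
  show ?thesis
  proof (rule complex_eqI)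
    show "Re (\<integral>\<omega>. D \<omega> * of_real (k (Y \<omega>)) \<partial>M) = Re 0"
      using re integral_Re[OF iD] by simp
    show "Im (\<integral>\<omega>. D \<omega> * of_real (k (Y \<omega>)) \<partial>M) = Im 0"
      using im integral_Im[OF iD] by simp
  qed
qed

subsection \<open>Gaussian families\<close>

text \<open>A finite centred Gaussian vector. The covariance matrix enters only through second
  moments of linear combinations, so singular covariances are included and closure under linear maps
  is immediate; the absence of a linear term in the exponent encodes mean zero.\<close>

definition gaussian_family :: "'a measure \<Rightarrow> 'i set \<Rightarrow> ('i \<Rightarrow> 'a \<Rightarrow> real) \<Rightarrow> bool" where
  "gaussian_family M I W \<longleftrightarrow> finite I \<and>
     (\<forall>i\<in>I. W i \<in> borel_measurable M \<and> integrable M (\<lambda>\<omega>. (W i \<omega>)\<^sup>2)) \<and>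
     (\<forall>c. (\<integral>\<omega>. iexp (\<Sum>i\<in>I. c i * W i \<omega>) \<partial>M)
        = of_real (exp (- (\<integral>\<omega>. (\<Sum>i\<in>I. c i * W i \<omega>)\<^sup>2 \<partial>M) / 2)))"

lemma gaussian_family_finite: "gaussian_family M I W \<Longrightarrow> finite I"
  by (simp add: gaussian_family_def)

lemma gaussian_family_measurable: "gaussian_family M I W \<Longrightarrow> i \<in> I \<Longrightarrow> W i \<in> borel_measurable M"
  by (simp add: gaussian_family_def)

lemma gaussian_family_square: "gaussian_family M I W \<Longrightarrow> i \<in> I \<Longrightarrow> integrable M (\<lambda>\<omega>. (W i \<omega>)\<^sup>2)"
  by (simp add: gaussian_family_def)

lemma gaussian_family_mult:
  "gaussian_family M I W \<Longrightarrow> i \<in> I \<Longrightarrow> j \<in> I \<Longrightarrow> integrable M (\<lambda>\<omega>. W i \<omega> * W j \<omega>)"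
  by (auto simp: gaussian_family_def intro!: integrable_mult_square)

lemma gaussian_family_char:
  "gaussian_family M I W \<Longrightarrow> (\<integral>\<omega>. iexp (\<Sum>i\<in>I. c i * W i \<omega>) \<partial>M)
     = of_real (exp (- (\<integral>\<omega>. (\<Sum>i\<in>I. c i * W i \<omega>)\<^sup>2 \<partial>M) / 2))"
  by (simp add: gaussian_family_def)

lemma gaussian_family_integral_mult_sum:
  assumes W: "gaussian_family M I W" and j: "j \<in> I" and K: "K \<subseteq> I"
  shows "integrable M (\<lambda>\<omega>. W j \<omega> * (\<Sum>i\<in>K. c i * W i \<omega>))"
    and "(\<integral>\<omega>. W j \<omega> * (\<Sum>i\<in>K. c i * W i \<omega>) \<partial>M) = (\<Sum>i\<in>K. c i * (\<integral>\<omega>. W j \<omega> * W i \<omega> \<partial>M))"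
proof -
  have i: "integrable M (\<lambda>\<omega>. c i * (W j \<omega> * W i \<omega>))" if "i \<in> K" for i
    using gaussian_family_mult[OF W j, of i] that K by auto
  have eq: "(\<lambda>\<omega>. W j \<omega> * (\<Sum>i\<in>K. c i * W i \<omega>)) = (\<lambda>\<omega>. \<Sum>i\<in>K. c i * (W j \<omega> * W i \<omega>))"
    by (simp add: sum_distrib_left mult_ac)
  show "integrable M (\<lambda>\<omega>. W j \<omega> * (\<Sum>i\<in>K. c i * W i \<omega>))"
    unfolding eq by (intro Bochner_Integration.integrable_sum i)
  show "(\<integral>\<omega>. W j \<omega> * (\<Sum>i\<in>K. c i * W i \<omega>) \<partial>M) = (\<Sum>i\<in>K. c i * (\<integral>\<omega>. W j \<omega> * W i \<omega> \<partial>M))"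
    unfolding eq by (subst Bochner_Integration.integral_sum) (erule i, simp)
qed

lemma gaussian_family_linear:
  assumes W: "gaussian_family M I W" and J: "finite J"
  shows "gaussian_family M J (\<lambda>j \<omega>. \<Sum>i\<in>I. a j i * W i \<omega>)"
  unfolding gaussian_family_def
proof (intro conjI ballI allI)
  have [measurable]: "W i \<in> borel_measurable M" if "i \<in> I" for i
    using W that by (rule gaussian_family_measurable)
  show "(\<lambda>\<omega>. \<Sum>i\<in>I. a j i * W i \<omega>) \<in> borel_measurable M" for j
    by measurable
  show "integrable M (\<lambda>\<omega>. (\<Sum>i\<in>I. a j i * W i \<omega>)\<^sup>2)" for j
  proof -
    have "(\<lambda>\<omega>. (\<Sum>i\<in>I. a j i * W i \<omega>)\<^sup>2) = (\<lambda>\<omega>. \<Sum>k\<in>I. a j k * (W k \<omega> * (\<Sum>i\<in>I. a j i * W i \<omega>)))"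
      by (simp add: power2_eq_square sum_distrib_right mult.assoc)
    then show ?thesis
      by (simp only:) (intro Bochner_Integration.integrable_sum integrable_mult_right gaussian_family_integral_mult_sum(1)[OF W], auto)
  qed
  have eq: "(\<Sum>j\<in>J. c j * (\<Sum>i\<in>I. a j i * W i \<omega>)) = (\<Sum>i\<in>I. (\<Sum>j\<in>J. c j * a j i) * W i \<omega>)" for c \<omega>
    by (subst sum.swap[of _ J I, symmetric, unfolded sum_distrib_left[symmetric] ] | simp add: sum_distrib_left sum_distrib_right mult.assoc sum.swap[of _ J I])+
  show "(\<integral>\<omega>. iexp (\<Sum>j\<in>J. c j * (\<Sum>i\<in>I. a j i * W i \<omega>)) \<partial>M)
        = of_real (exp (- (\<integral>\<omega>. (\<Sum>j\<in>J. c j * (\<Sum>i\<in>I. a j i * W i \<omega>))\<^sup>2 \<partial>M) / 2))" for c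
    unfolding eq by (rule gaussian_family_char[OF W])
qed (rule J)

text \<open>Selecting coordinates is a linear map with coefficients 0 and 1; repetitions are
  therefore harmless, as when sampled points coincide.\<close>

lemma gaussian_family_reindex:
  assumes W: "gaussian_family M I W" and J: "finite J" and f: "\<And>j. j \<in> J \<Longrightarrow> f j \<in> I"
  shows "gaussian_family M J (\<lambda>j. W (f j))"
proof -
  have I: "finite I" using W by (rule gaussian_family_finite)
  have 1: "(\<Sum>i\<in>I. (if i = f j then 1 else 0) * W i \<omega>) = W (f j) \<omega>" if "j \<in> J" for j \<omega>
    using I f[OF that] by (simp add: if_distrib[of "\<lambda>x. x * _"] sum.delta cong: if_cong)
  have "gaussian_family M J (\<lambda>j \<omega>. \<Sum>i\<in>I. (if i = f j then 1 else 0) * W i \<omega>)"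
    by (rule gaussian_family_linear[OF W J])
  then show ?thesis
    unfolding gaussian_family_def by (simp add: 1 cong: ball_cong sum.cong)
qed

text \<open>For uncorrelated summands the second moments add, hence the Gaussian exponentials
  multiply. The cases (l, 1), (l, 0) and (0, 1) of the two-parameter formula \<open>c\<close> are
  compared.\<close>

lemma gaussian_family_char_split:
  assumes W: "gaussian_family M (insert p J) W" and p: "p \<notin> J"
    and uncorr: "\<And>j. j \<in> J \<Longrightarrow> (\<integral>\<omega>. W p \<omega> * W j \<omega> \<partial>M) = 0"
  shows "(\<integral>\<omega>. iexp (l * W p \<omega>) * iexp (\<Sum>j\<in>J. c j * W j \<omega>) \<partial>M)
     = (\<integral>\<omega>. iexp (l * W p \<omega>) \<partial>M) * (\<integral>\<omega>. iexp (\<Sum>j\<in>J. c j * W j \<omega>) \<partial>M)"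
proof -
  have J: "finite J" using gaussian_family_finite[OF W] by simp
  let ?S = "\<lambda>\<omega>. \<Sum>j\<in>J. c j * W j \<omega>"
  have c: "(\<integral>\<omega>. iexp (a * W p \<omega> + b * ?S \<omega>) \<partial>M)
      = of_real (exp (- (\<integral>\<omega>. (a * W p \<omega> + b * ?S \<omega>)\<^sup>2 \<partial>M) / 2))" for a b
  proof -
    have "(\<Sum>i\<in>insert p J. (if i = p then a else b * c i) * W i \<omega>) = a * W p \<omega> + b * ?S \<omega>" for \<omega>
    proof -
      have "(\<Sum>i\<in>J. (if i = p then a else b * c i) * W i \<omega>) = (\<Sum>i\<in>J. b * (c i * W i \<omega>))"
        using p by (intro sum.cong) auto
      then show ?thesis using J p by (simp add: sum_distrib_left)
    qed
    then show ?thesis using gaussian_family_char[OF W, of "\<lambda>i. if i = p then a else b * c i"] by simp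
  qed
  have ip: "integrable M (\<lambda>\<omega>. (W p \<omega>)\<^sup>2)" using gaussian_family_square[OF W] by simp
  have ipS: "integrable M (\<lambda>\<omega>. W p \<omega> * ?S \<omega>)"
    using gaussian_family_integral_mult_sum(1)[OF W, of p J c] by auto
  have eS: "(\<integral>\<omega>. W p \<omega> * ?S \<omega> \<partial>M) = 0"
    using gaussian_family_integral_mult_sum(2)[OF W, of p J c] uncorr by auto
  have iS: "integrable M (\<lambda>\<omega>. (?S \<omega>)\<^sup>2)"
  proof -
    have "gaussian_family M J W"
      using gaussian_family_reindex[OF W J, of "\<lambda>j. j"] by auto
    from gaussian_family_linear[OF this, of "{()}" "\<lambda>_. c"] show ?thesis
      by (simp add: gaussian_family_def)
  qed
  have "(\<lambda>\<omega>. (l * W p \<omega> + 1 * ?S \<omega>)\<^sup>2) = (\<lambda>\<omega>. l\<^sup>2 * (W p \<omega>)\<^sup>2 + 2 * l * (W p \<omega> * ?S \<omega>) + (?S \<omega>)\<^sup>2)"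
    by (simp add: power2_eq_square algebra_simps)
  then have "(\<integral>\<omega>. (l * W p \<omega> + 1 * ?S \<omega>)\<^sup>2 \<partial>M) = l\<^sup>2 * (\<integral>\<omega>. (W p \<omega>)\<^sup>2 \<partial>M) + (\<integral>\<omega>. (?S \<omega>)\<^sup>2 \<partial>M)"
    using ip ipS iS eS by simp
  then have "(\<integral>\<omega>. iexp (l * W p \<omega> + 1 * ?S \<omega>) \<partial>M)
     = of_real (exp (- (\<integral>\<omega>. (l * W p \<omega> + 0 * ?S \<omega>)\<^sup>2 \<partial>M) / 2)) * of_real (exp (- (\<integral>\<omega>. (0 * W p \<omega> + 1 * ?S \<omega>)\<^sup>2 \<partial>M) / 2))"
    unfolding c of_real_mult[symmetric] exp_add[symmetric]
    using ip by (simp add: power_mult_distrib add_divide_distrib)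
  also have "\<dots> = (\<integral>\<omega>. iexp (l * W p \<omega> + 0 * ?S \<omega>) \<partial>M) * (\<integral>\<omega>. iexp (0 * W p \<omega> + 1 * ?S \<omega>) \<partial>M)"
    unfolding c ..
  finally show ?thesis
    by (simp add: exp_add[symmetric] distrib_left)
qed

context prob_space
begin

text \<open>Independence of W p from the other coordinates, tested on products. The factorisation
  known for exponentials is transferred to bounded functions one coordinate at a time by uniqueness
  of Fourier transforms.\<close>

lemma gaussian_family_indep_prod:
  fixes W :: "'i \<Rightarrow> 'a \<Rightarrow> real" and h :: "'i \<Rightarrow> real \<Rightarrow> real"
  assumes W: "gaussian_family M (insert p J) W" and p: "p \<notin> J"
    and uncorr: "\<And>j. j \<in> J \<Longrightarrow> expectation (\<lambda>\<omega>. W p \<omega> * W j \<omega>) = 0"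
    and h [measurable]: "\<And>j. h j \<in> borel_measurable borel" and h1: "\<And>j x. \<bar>h j x\<bar> \<le> 1"
    and g [measurable]: "g \<in> borel_measurable borel" and g1: "\<And>x::real. \<bar>g x\<bar> \<le> (1::real)"
  shows "expectation (\<lambda>\<omega>. g (W p \<omega>) * (\<Prod>j\<in>J. h j (W j \<omega>)))
     = expectation (\<lambda>\<omega>. g (W p \<omega>)) * expectation (\<lambda>\<omega>. \<Prod>j\<in>J. h j (W j \<omega>))"
proof -
  have J: "finite J" using gaussian_family_finite[OF W] by simp
  have [measurable]: "W p \<in> borel_measurable M" "\<And>j. j \<in> J \<Longrightarrow> W j \<in> borel_measurable M"
    using gaussian_family_measurable[OF W] by auto
  have prod1: "\<bar>\<Prod>j\<in>K. h j (W j \<omega>)\<bar> \<le> 1" for K \<omega>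
    unfolding abs_prod using h1 by (intro prod_le_1) auto
  define \<phi> where "\<phi> l = expectation (\<lambda>\<omega>. iexp (l * W p \<omega>))" for l
  have \<phi>1: "cmod (\<phi> l) \<le> 1" for l
  proof -
    have "cmod (\<phi> l) \<le> expectation (\<lambda>\<omega>. cmod (iexp (l * W p \<omega>)))"
      unfolding \<phi>_def by (rule integral_norm_bound)
    then show ?thesis by (simp add: prob_space)
  qed
  \<comment> \<open>Interpolation between exponentials and the functions h j: the coordinates in K
    are already replaced. Centring the first factor turns the factorisation into the vanishing of
    one expectation.\<close>
  define E where "E K l c \<omega> = (iexp (l * W p \<omega>) - \<phi> l) * of_real (\<Prod>j\<in>K. h j (W j \<omega>)) * iexp (\<Sum>j\<in>J - K. c j * W j \<omega>)"
    for K l c \<omega>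
  have "expectation (E K l c) = 0" if "K \<subseteq> J" for K l c
    using finite_subset[OF that J] that
  proof (induction K arbitrary: c rule: finite_induct)
    case empty
    let ?S = "\<lambda>\<omega>. \<Sum>j\<in>J. c j * W j \<omega>"
    have "expectation (E {} l c) = expectation (\<lambda>\<omega>. iexp (l * W p \<omega>) * iexp (?S \<omega>) - \<phi> l * iexp (?S \<omega>))"
      by (simp add: E_def [abs_def] left_diff_distrib)
    also have "\<dots> = expectation (\<lambda>\<omega>. iexp (l * W p \<omega>) * iexp (?S \<omega>)) - expectation (\<lambda>\<omega>. \<phi> l * iexp (?S \<omega>))"
      by (intro Bochner_Integration.integral_diff integrable_mult_right integrable_const_bound[where B=1])
         (auto simp: norm_mult)
    also have "\<dots> = 0"
    proof -
      have e: "expectation (\<lambda>\<omega>. iexp (l * W p \<omega>) * iexp (?S \<omega>)) = \<phi> l * expectation (\<lambda>\<omega>. iexp (?S \<omega>))"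
        unfolding \<phi>_def by (rule gaussian_family_char_split[OF W p uncorr])
      show ?thesis
        unfolding e integral_mult_right_zero by (rule diff_self)
    qed
    finally show ?case .
  next
    case (insert k K)
    then have kJ: "k \<in> J" and KJ: "K \<subseteq> J" and kK: "k \<notin> K" by auto
    note [measurable] = \<open>\<And>j. j \<in> J \<Longrightarrow> W j \<in> borel_measurable M\<close>[OF kJ]
    \<comment> \<open>All factors except the one in coordinate k. Its transform along W k is
      \<open>E K l c\<close> with the k-th frequency set to \<theta>, which vanishes by induction;
      this is why the induction generalises over c.\<close>
    define D where "D \<omega> = (iexp (l * W p \<omega>) - \<phi> l) * of_real (\<Prod>j\<in>K. h j (W j \<omega>)) * iexp (\<Sum>j\<in>J - insert k K. c j * W j \<omega>)" for \<omega>
    have [measurable]: "(\<lambda>\<omega>. \<Prod>j\<in>K. h j (W j \<omega>)) \<in> borel_measurable M"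
      using KJ by (intro borel_measurable_prod) auto
    have [measurable]: "(\<lambda>\<omega>. \<Sum>j\<in>J - insert k K. c j * W j \<omega>) \<in> borel_measurable M"
      by (intro borel_measurable_sum) auto
    have "expectation (\<lambda>\<omega>. D \<omega> * of_real (h k (W k \<omega>))) = 0"
    proof (rule fourier_unique[where K=1 and Y="W k" and k="h k"])
      show "integrable M D"
      proof (rule integrable_const_bound[where B="2 * 1 * 1"])
        have 2: "cmod (iexp (l * W p \<omega>) - \<phi> l) \<le> 2" for \<omega>
          using norm_triangle_ineq4[of "iexp (l * W p \<omega>)" "\<phi> l"] \<phi>1[of l] norm_exp_i_times[of "l * W p \<omega>"] by linarith
        have "norm (D \<omega>) \<le> 2 * 1 * 1" for \<omega>
        proof -
          have "norm (D \<omega>) = cmod (iexp (l * W p \<omega>) - \<phi> l) * \<bar>\<Prod>j\<in>K. h j (W j \<omega>)\<bar>"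
            unfolding D_def norm_mult norm_of_real norm_exp_i_times by (rule mult_1_right)
          also have "\<dots> \<le> 2 * 1"
            by (rule mult_mono[OF 2 prod1]) (rule zero_le_numeral, rule abs_ge_zero)
          finally show ?thesis by linarith
        qed
        then show "AE \<omega> in M. norm (D \<omega>) \<le> 2 * 1 * 1"
          by (rule AE_I2)
        show "D \<in> borel_measurable M"
          unfolding D_def [abs_def] by measurable
      qed
      show "expectation (\<lambda>\<omega>. D \<omega> * iexp (\<theta> * W k \<omega>)) = 0" for \<theta>
      proof -
        have "(\<Sum>j\<in>J - K. (c(k := \<theta>)) j * W j \<omega>) = \<theta> * W k \<omega> + (\<Sum>j\<in>J - insert k K. c j * W j \<omega>)" for \<omega>
        proof -
          have *: "J - K = insert k (J - insert k K)" using kJ kK by auto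
          have **: "(\<Sum>j\<in>J - insert k K. (c(k := \<theta>)) j * W j \<omega>) = (\<Sum>j\<in>J - insert k K. c j * W j \<omega>)"
            by (intro sum.cong) auto
          show ?thesis
            unfolding * by (subst sum.insert) (simp_all only: finite_Diff[OF J] ** fun_upd_same, simp)
        qed
        then have "E K l (c(k := \<theta>)) = (\<lambda>\<omega>. D \<omega> * iexp (\<theta> * W k \<omega>))"
          unfolding E_def D_def by (simp add: distrib_left exp_add mult_ac)
        with insert.IH[OF KJ, of "c(k := \<theta>)"] show ?thesis by (simp only:)
      qed
    qed (auto simp: h1)
    moreover have "E (insert k K) l c = (\<lambda>\<omega>. D \<omega> * of_real (h k (W k \<omega>)))"
      unfolding E_def D_def using kK insert.hyps(1) by (simp add: mult_ac)
    ultimately show ?case by simp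
  qed
  from this[of J] have E0: "expectation (E J l (\<lambda>_. 0)) = 0" for l by simp
  define P where "P \<omega> = (\<Prod>j\<in>J. h j (W j \<omega>))" for \<omega>
  have [measurable]: "P \<in> borel_measurable M" unfolding P_def [abs_def] by measurable
  have P1: "\<bar>P \<omega>\<bar> \<le> 1" for \<omega> unfolding P_def by (rule prod1)
  have EJ: "E J l (\<lambda>_. 0) = (\<lambda>\<omega>. (iexp (l * W p \<omega>) - \<phi> l) * of_real (P \<omega>))" for l
    unfolding E_def [abs_def] P_def by (simp del: of_real_prod)
  let ?P = P
  have iP: "integrable M ?P"
    by (rule integrable_const_bound[where B=1]) (use P1 in auto)
  \<comment> \<open>The same replacement for the remaining exponential, the one in W p, with the
    product as the weight.\<close>
  have "expectation (\<lambda>\<omega>. (?P \<omega> - expectation ?P) * g (W p \<omega>)) = 0"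
  proof (rule fourier_unique_real[where K=1 and Y="W p" and k=g])
    show "integrable M (\<lambda>\<omega>. ?P \<omega> - expectation ?P)" using iP by simp
    show "(\<integral>\<omega>. of_real (?P \<omega> - expectation ?P) * iexp (\<theta> * W p \<omega>) \<partial>M) = 0" for \<theta>
    proof -
      have i1: "integrable M (\<lambda>\<omega>. iexp (\<theta> * W p \<omega>) * of_real (?P \<omega>))"
        by (rule integrable_const_bound[where B=1]) (use P1 in \<open>auto simp: norm_mult\<close>)
      have i2: "integrable M (\<lambda>\<omega>. iexp (\<theta> * W p \<omega>))"
        by (rule integrable_const_bound[where B=1]) auto
      have "expectation (E J \<theta> (\<lambda>_. 0)) = expectation (\<lambda>\<omega>. iexp (\<theta> * W p \<omega>) * of_real (?P \<omega>) - \<phi> \<theta> * of_real (?P \<omega>))"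
        by (simp add: EJ left_diff_distrib)
      also have "\<dots> = expectation (\<lambda>\<omega>. iexp (\<theta> * W p \<omega>) * of_real (?P \<omega>)) - \<phi> \<theta> * of_real (expectation ?P)"
        using i1 iP by (subst Bochner_Integration.integral_diff) auto
      finally have e: "expectation (\<lambda>\<omega>. iexp (\<theta> * W p \<omega>) * of_real (?P \<omega>)) = \<phi> \<theta> * of_real (expectation ?P)"
        using E0[of \<theta>] by simp
      have "expectation (\<lambda>\<omega>. of_real (?P \<omega> - expectation ?P) * iexp (\<theta> * W p \<omega>))
         = expectation (\<lambda>\<omega>. iexp (\<theta> * W p \<omega>) * of_real (?P \<omega>) - of_real (expectation ?P) * iexp (\<theta> * W p \<omega>))"
        by (intro Bochner_Integration.integral_cong refl) (simp only: of_real_diff left_diff_distrib mult.commute)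
      also have "\<dots> = \<phi> \<theta> * of_real (expectation ?P) - of_real (expectation ?P) * \<phi> \<theta>"
        unfolding Bochner_Integration.integral_diff[OF i1 integrable_mult_right[OF i2]] e integral_mult_right_zero \<phi>_def ..
      finally show ?thesis by simp
    qed
  qed (auto simp: g1)
  moreover have "expectation (\<lambda>\<omega>. (?P \<omega> - expectation ?P) * g (W p \<omega>))
      = expectation (\<lambda>\<omega>. g (W p \<omega>) * ?P \<omega>) - expectation ?P * expectation (\<lambda>\<omega>. g (W p \<omega>))"
  proof -
    have 1: "integrable M (\<lambda>\<omega>. g (W p \<omega>) * ?P \<omega>)"
    proof (rule integrable_const_bound[where B="1 * 1"])
      show "AE \<omega> in M. norm (g (W p \<omega>) * ?P \<omega>) \<le> 1 * 1"
        by (simp add: abs_mult mult_le_one g1 P1)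
    qed measurable
    have 2: "integrable M (\<lambda>\<omega>. g (W p \<omega>))"
      by (rule integrable_const_bound[where B=1]) (use g1 in auto)
    have "expectation (\<lambda>\<omega>. (?P \<omega> - expectation ?P) * g (W p \<omega>))
        = expectation (\<lambda>\<omega>. g (W p \<omega>) * ?P \<omega> - expectation ?P * g (W p \<omega>))"
      by (intro Bochner_Integration.integral_cong refl) (simp add: algebra_simps)
    then show ?thesis
      using Bochner_Integration.integral_diff[OF 1 integrable_mult_right[OF 2, of "expectation ?P"]] by simp
  qed
  ultimately show ?thesis unfolding P_def [symmetric] by (simp add: mult.commute)
qed

text \<open>For a fixed set A of values of W p, both sides are finite measures in the second
  argument, \<open>Q1\<close> and \<open>Q2\<close>. They agree on boxes by
  \<open>gaussian_family_indep_prod\<close> applied to indicators, and boxes determine a finite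
  measure on a finite product.\<close>

lemma gaussian_family_indep:
  fixes W :: "'i \<Rightarrow> 'a \<Rightarrow> real"
  assumes W: "gaussian_family M (insert p J) W" and p: "p \<notin> J"
    and uncorr: "\<And>j. j \<in> J \<Longrightarrow> expectation (\<lambda>\<omega>. W p \<omega> * W j \<omega>) = 0"
  shows "distr M borel (W p) \<Otimes>\<^sub>M distr M (PiM J (\<lambda>_. borel)) (\<lambda>\<omega>. \<lambda>j\<in>J. W j \<omega>)
    = distr M (borel \<Otimes>\<^sub>M PiM J (\<lambda>_. borel)) (\<lambda>\<omega>. (W p \<omega>, \<lambda>j\<in>J. W j \<omega>))"
proof (rule pair_measure_eqI)
  have J: "finite J" using gaussian_family_finite[OF W] by simp
  have [measurable]: "W p \<in> borel_measurable M" "\<And>j. j \<in> J \<Longrightarrow> W j \<in> borel_measurable M"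
    using gaussian_family_measurable[OF W] by auto
  let ?V = "\<lambda>\<omega>. \<lambda>j\<in>J. W j \<omega>"
  let ?N = "PiM J (\<lambda>_. borel :: real measure)"
  have V [measurable]: "?V \<in> measurable M ?N" by measurable
  show "sigma_finite_measure (distr M borel (W p))" "sigma_finite_measure (distr M ?N ?V)"
    by (auto intro!: prob_space_imp_sigma_finite prob_space_distr)
  fix A B assume A: "A \<in> sets (distr M borel (W p))" and B: "B \<in> sets (distr M ?N ?V)"
  then have [measurable]: "A \<in> sets borel" "B \<in> sets ?N" by auto
  define Q1 where "Q1 = distr (density M (\<lambda>\<omega>. indicator A (W p \<omega>))) ?N ?V"
  define Q2 where "Q2 = distr (density M (\<lambda>\<omega>. ennreal (prob (W p -` A \<inter> space M)))) ?N ?V"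
  have Q1: "emeasure Q1 C = ennreal (expectation (\<lambda>\<omega>. indicator A (W p \<omega>) * indicator C (?V \<omega>)))"
    if [measurable]: "C \<in> sets ?N" for C
  proof -
    have "emeasure Q1 C = (\<integral>\<^sup>+\<omega>. indicator A (W p \<omega>) * indicator (?V -` C \<inter> space M) \<omega> \<partial>M)"
      unfolding Q1_def by (subst emeasure_distr) (auto simp: emeasure_density)
    also have "\<dots> = (\<integral>\<^sup>+\<omega>. ennreal (indicator A (W p \<omega>) * indicator C (?V \<omega>)) \<partial>M)"
      by (intro nn_integral_cong) (auto simp: indicator_def)
    also have "\<dots> = ennreal (expectation (\<lambda>\<omega>. indicator A (W p \<omega>) * indicator C (?V \<omega>)))"
      by (intro nn_integral_eq_integral integrable_const_bound[where B=1]) (auto simp: indicator_def)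
    finally show ?thesis .
  qed
  have Q2: "emeasure Q2 C = ennreal (expectation (\<lambda>\<omega>. indicator A (W p \<omega>)) * expectation (\<lambda>\<omega>. indicator C (?V \<omega>)))"
    if [measurable]: "C \<in> sets ?N" for C
  proof -
    have eA: "expectation (\<lambda>\<omega>. indicator A (W p \<omega>)) = prob (W p -` A \<inter> space M)"
      by (subst Bochner_Integration.integral_cong[OF refl, where g="indicator (W p -` A \<inter> space M)"]) (auto simp: indicator_def)
    have eC: "expectation (\<lambda>\<omega>. indicator C (?V \<omega>)) = prob (?V -` C \<inter> space M)"
      by (subst Bochner_Integration.integral_cong[OF refl, where g="indicator (?V -` C \<inter> space M)"]) (auto simp: indicator_def)
    have "emeasure Q2 C = ennreal (prob (W p -` A \<inter> space M)) * emeasure M (?V -` C \<inter> space M)"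
      unfolding Q2_def by (subst emeasure_distr) (auto simp: emeasure_density nn_integral_cmult_indicator)
    then show ?thesis unfolding eA eC by (simp add: emeasure_eq_measure ennreal_mult)
  qed
  have Q12: "Q1 = Q2"
  proof (rule measure_eqI_PiM_finite[OF J, where A="\<lambda>_. space ?N"])
    show "sets Q1 = sets ?N" "sets Q2 = sets ?N" by (auto simp: Q1_def Q2_def)
    fix C :: "'i \<Rightarrow> real set" assume C: "\<And>j. j \<in> J \<Longrightarrow> C j \<in> sets borel"
    define h where "h j x = (if j \<in> J then indicator (C j) x else 0 :: real)" for j x
    have hm: "h j \<in> borel_measurable borel" for j
      using C[of j] by (cases "j \<in> J") (simp_all add: h_def [abs_def])
    have ind: "indicator (Pi\<^sub>E J C) (?V \<omega>) = (\<Prod>j\<in>J. h j (W j \<omega>))" for \<omega>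
      using J by (auto simp: h_def indicator_def PiE_iff prod_zero_iff)
    have "PiE J C \<in> sets ?N" using C J by (intro sets_PiM_I_finite) auto
    moreover have "expectation (\<lambda>\<omega>. indicator A (W p \<omega>) * (\<Prod>j\<in>J. h j (W j \<omega>)))
      = expectation (\<lambda>\<omega>. indicator A (W p \<omega>)) * expectation (\<lambda>\<omega>. \<Prod>j\<in>J. h j (W j \<omega>))"
      by (rule gaussian_family_indep_prod[OF W p uncorr hm]) (auto simp: h_def)
    ultimately show "emeasure Q1 (PiE J C) = emeasure Q2 (PiE J C)"
      by (simp only: Q1 Q2 ind)
  next
    show "range (\<lambda>_. space ?N) \<subseteq> prod_algebra J (\<lambda>_. borel)"
      using J by (auto simp: space_PiM intro!: prod_algebraI_finite)
    show "emeasure Q1 (space ?N) \<noteq> \<infinity>" for i :: nat by (subst Q1) auto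
  qed auto
  have eq: "ennreal (expectation (\<lambda>\<omega>. indicator A (W p \<omega>) * indicator B (?V \<omega>)))
     = ennreal (prob (W p -` A \<inter> space M)) * emeasure M (?V -` B \<inter> space M)"
    unfolding Q1[OF \<open>B \<in> sets ?N\<close>, symmetric] Q12 Q2_def
    by (subst emeasure_distr) (auto simp: emeasure_density nn_integral_cmult_indicator)
  have "emeasure (distr M (borel \<Otimes>\<^sub>M ?N) (\<lambda>\<omega>. (W p \<omega>, ?V \<omega>))) (A \<times> B)
     = ennreal (expectation (\<lambda>\<omega>. indicator A (W p \<omega>) * indicator B (?V \<omega>)))"
  proof -
    have "emeasure (distr M (borel \<Otimes>\<^sub>M ?N) (\<lambda>\<omega>. (W p \<omega>, ?V \<omega>))) (A \<times> B)
      = emeasure M ((\<lambda>\<omega>. (W p \<omega>, ?V \<omega>)) -` (A \<times> B) \<inter> space M)"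
      by (subst emeasure_distr) auto
    also have "\<dots> = ennreal (expectation (indicator ((\<lambda>\<omega>. (W p \<omega>, ?V \<omega>)) -` (A \<times> B) \<inter> space M)))"
      by (simp add: emeasure_eq_measure)
    also have "expectation (indicator ((\<lambda>\<omega>. (W p \<omega>, ?V \<omega>)) -` (A \<times> B) \<inter> space M) :: 'a \<Rightarrow> real)
       = expectation (\<lambda>\<omega>. indicator A (W p \<omega>) * indicator B (?V \<omega>))"
      by (intro Bochner_Integration.integral_cong) (auto simp: indicator_def)
    finally show ?thesis .
  qed
  with eq show "emeasure (distr M borel (W p)) A * emeasure (distr M ?N ?V) B
     = emeasure (distr M (borel \<Otimes>\<^sub>M ?N) (\<lambda>\<omega>. (W p \<omega>, ?V \<omega>))) (A \<times> B)"
    by (simp add: emeasure_distr emeasure_eq_measure)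
qed (simp cong: sets_pair_measure_cong)

lemma gaussian_family_std_normal:
  assumes W: "gaussian_family M I W" and p: "p \<in> I" and v: "expectation (\<lambda>\<omega>. (W p \<omega>)\<^sup>2) = 1"
  shows "distr M borel (W p) = gam"
proof (rule Levy_uniqueness)
  have [measurable]: "W p \<in> borel_measurable M" using gaussian_family_measurable[OF W p] .
  show "real_distribution (distr M borel (W p))" "real_distribution gam"
    by (auto intro!: real_distribution_distr real_dist_normal_dist)
  show "char (distr M borel (W p)) = char gam"
  proof
    fix \<theta>
    have "gaussian_family M {p} (\<lambda>j. W j)"
      using gaussian_family_reindex[OF W, of "{p}" "\<lambda>j. j"] p by auto
    from gaussian_family_char[OF this, of "\<lambda>_. \<theta>"] v
    show "char (distr M borel (W p)) \<theta> = char gam \<theta>"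
      by (simp add: char_std_normal_distribution char_def integral_distr power_mult_distrib)
  qed
qed

text \<open>Independence combined with Fubini, in both orders: integrating over the pivot W p inside
  is the form used for integration by parts, freezing the pivot outside is the form used for the
  covariance bounds.\<close>

lemma gaussian_family_decouple:
  fixes W :: "'i \<Rightarrow> 'a \<Rightarrow> real" and \<Psi> :: "real \<times> ('i \<Rightarrow> real) \<Rightarrow> real"
  assumes W: "gaussian_family M (insert p J) W" and p: "p \<notin> J"
    and uncorr: "\<And>j. j \<in> J \<Longrightarrow> expectation (\<lambda>\<omega>. W p \<omega> * W j \<omega>) = 0"
    and [measurable]: "\<Psi> \<in> borel_measurable (borel \<Otimes>\<^sub>M PiM J (\<lambda>_. borel))" and K: "\<And>z. \<bar>\<Psi> z\<bar> \<le> K"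
  shows "expectation (\<lambda>\<omega>. \<Psi> (W p \<omega>, \<lambda>j\<in>J. W j \<omega>))
      = expectation (\<lambda>\<omega>. \<integral>x. \<Psi> (x, \<lambda>j\<in>J. W j \<omega>) \<partial>distr M borel (W p))"
    and "expectation (\<lambda>\<omega>. \<Psi> (W p \<omega>, \<lambda>j\<in>J. W j \<omega>))
      = (\<integral>x. expectation (\<lambda>\<omega>. \<Psi> (x, \<lambda>j\<in>J. W j \<omega>)) \<partial>distr M borel (W p))"
proof -
  have [measurable]: "W p \<in> borel_measurable M" "\<And>j. j \<in> J \<Longrightarrow> W j \<in> borel_measurable M"
    using gaussian_family_measurable[OF W] by auto
  let ?V = "\<lambda>\<omega>. \<lambda>j\<in>J. W j \<omega>"
  let ?N = "PiM J (\<lambda>_. borel :: real measure)"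
  let ?P = "distr M borel (W p)" and ?Q = "distr M ?N ?V"
  have V [measurable]: "?V \<in> measurable M ?N" by measurable
  interpret P: prob_space ?P by (rule prob_space_distr) simp
  interpret Q: prob_space ?Q by (rule prob_space_distr) simp
  interpret PQ: pair_prob_space ?P ?Q ..
  have m: "\<Psi> \<in> borel_measurable (?P \<Otimes>\<^sub>M ?Q)"
    by (simp cong: measurable_cong_sets sets_pair_measure_cong)
  have i: "integrable (?P \<Otimes>\<^sub>M ?Q) \<Psi>"
    by (rule PQ.integrable_const_bound[where B=K]) (use K m in auto)
  have "expectation (\<lambda>\<omega>. \<Psi> (W p \<omega>, ?V \<omega>)) = (\<integral>z. \<Psi> z \<partial>distr M (borel \<Otimes>\<^sub>M ?N) (\<lambda>\<omega>. (W p \<omega>, ?V \<omega>)))"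
    by (subst integral_distr) auto
  also have "\<dots> = (\<integral>z. \<Psi> z \<partial>(?P \<Otimes>\<^sub>M ?Q))"
    using gaussian_family_indep[OF W p uncorr] by simp
  finally have *: "expectation (\<lambda>\<omega>. \<Psi> (W p \<omega>, ?V \<omega>)) = (\<integral>z. \<Psi> z \<partial>(?P \<Otimes>\<^sub>M ?Q))" .
  have "(\<integral>z. \<Psi> z \<partial>(?P \<Otimes>\<^sub>M ?Q)) = (\<integral>y. (\<integral>x. \<Psi> (x, y) \<partial>?P) \<partial>?Q)"
    using PQ.integral_snd[of "\<lambda>x y. \<Psi> (x, y)"] i by simp
  also have "\<dots> = expectation (\<lambda>\<omega>. \<integral>x. \<Psi> (x, ?V \<omega>) \<partial>?P)"
  proof (subst integral_distr)
    have "(\<lambda>y. \<integral>x. \<Psi> (x, y) \<partial>?P) \<in> borel_measurable ?N"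
      by (rule P.borel_measurable_lebesgue_integral)
         (simp add: split_beta' cong: measurable_cong_sets sets_pair_measure_cong)
    then show "(\<lambda>y. \<integral>x. \<Psi> (x, y) \<partial>?P) \<in> borel_measurable ?N" .
  qed auto
  finally show "expectation (\<lambda>\<omega>. \<Psi> (W p \<omega>, \<lambda>j\<in>J. W j \<omega>))
      = expectation (\<lambda>\<omega>. \<integral>x. \<Psi> (x, \<lambda>j\<in>J. W j \<omega>) \<partial>distr M borel (W p))"
    using * by simp
  have "(\<integral>z. \<Psi> z \<partial>(?P \<Otimes>\<^sub>M ?Q)) = (\<integral>x. (\<integral>y. \<Psi> (x, y) \<partial>?Q) \<partial>?P)"
    using PQ.integral_fst'[OF i] by simp
  also have "\<dots> = (\<integral>x. expectation (\<lambda>\<omega>. \<Psi> (x, ?V \<omega>)) \<partial>?P)"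
    by (intro Bochner_Integration.integral_cong refl, subst integral_distr) auto
  finally show "expectation (\<lambda>\<omega>. \<Psi> (W p \<omega>, \<lambda>j\<in>J. W j \<omega>))
      = (\<integral>x. expectation (\<lambda>\<omega>. \<Psi> (x, \<lambda>j\<in>J. W j \<omega>)) \<partial>distr M borel (W p))"
    using * by simp
qed

end

subsection \<open>Mehler's formula\<close>

lemma AE_summable_norm:
  fixes f :: "nat \<Rightarrow> 'a \<Rightarrow> 'b::{banach, second_countable_topology}"
  assumes i: "\<And>n. integrable M (f n)" and s: "summable (\<lambda>n. \<integral>x. norm (f n x) \<partial>M)"
  shows "AE x in M. summable (\<lambda>n. norm (f n x))"
proof -
  have [measurable]: "f n \<in> borel_measurable M" for n using i by auto
  have "(\<integral>\<^sup>+x. (\<Sum>n. ennreal (norm (f n x))) \<partial>M) = (\<Sum>n. \<integral>\<^sup>+x. ennreal (norm (f n x)) \<partial>M)"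
    by (rule nn_integral_suminf) simp
  also have "\<dots> = (\<Sum>n. ennreal (\<integral>x. norm (f n x) \<partial>M))"
    using i by (intro suminf_cong nn_integral_eq_integral) auto
  also have "\<dots> = ennreal (\<Sum>n. \<integral>x. norm (f n x) \<partial>M)"
    by (rule suminf_ennreal2) (auto intro: s)
  finally have "(\<integral>\<^sup>+x. (\<Sum>n. ennreal (norm (f n x))) \<partial>M) \<noteq> \<infinity>" by simp
  then have "AE x in M. (\<Sum>n. ennreal (norm (f n x))) \<noteq> \<infinity>"
    by (intro nn_integral_PInf_AE) auto
  then show ?thesis
    by eventually_elim (auto intro!: summable_suminf_not_top)
qed

text \<open>The term is a product of 2^(n/2) x^n / sqrt n! and 2^(-n/2); the arithmetic-geometric
  mean inequality bounds it by terms of an exponential and of a geometric series.\<close>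

lemma summable_power_sqrt_fact:
  fixes x :: real
  assumes "x \<ge> 0"
  shows "summable (\<lambda>n. x ^ n / sqrt (fact n))"
proof (rule summable_comparison_test')
  have "summable (\<lambda>n. (2 * x\<^sup>2) ^ n / fact n)"
    using summable_exp[of "2 * x\<^sup>2"] by (simp add: divide_inverse mult.commute)
  then show "summable (\<lambda>n. ((2 * x\<^sup>2) ^ n / fact n + (1/2) ^ n) / 2)"
    by (intro summable_divide summable_add summable_geometric) auto
  fix n :: nat
  have 1: "x ^ n / sqrt (fact n) = (sqrt 2 ^ n * x ^ n / sqrt (fact n)) * (1 / sqrt 2 ^ n)"
    by simp
  have "2 * (sqrt 2 ^ n * x ^ n / sqrt (fact n)) * (1 / sqrt 2 ^ n)
    \<le> (sqrt 2 ^ n * x ^ n / sqrt (fact n))\<^sup>2 + (1 / sqrt 2 ^ n)\<^sup>2"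
    by (rule sum_squares_bound)
  also have "(sqrt 2 ^ n * x ^ n / sqrt (fact n))\<^sup>2 = (2 * x\<^sup>2) ^ n / fact n"
    by (simp add: power_divide power_mult_distrib power_mult[symmetric] mult.commute[of n]) (simp add: power_mult)
  also have "(1 / sqrt 2 ^ n)\<^sup>2 = (1 / 2 :: real) ^ n"
    by (simp add: power_divide power_mult[symmetric] mult.commute[of n]) (simp add: power_mult)
  finally show "norm (x ^ n / sqrt (fact n)) \<le> ((2 * x\<^sup>2) ^ n / fact n + (1/2) ^ n) / 2"
    using 1 assms by (simp add: mult.commute)
qed

text \<open>The L^1 norm of \<open>hp n\<close> is at most sqrt n!, so under \<open>sc\<close> the
  series converges absolutely in L^1 of the Gaussian measure and may be integrated term by term
  against a bounded function.\<close>

lemma hermite_series: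
  fixes c :: "nat \<Rightarrow> complex" and g :: "real \<Rightarrow> complex"
  assumes sc: "summable (\<lambda>n. cmod (c n) * sqrt (fact n))"
    and [measurable]: "g \<in> borel_measurable borel" and K: "\<And>x. cmod (g x) \<le> K"
  shows "integrable gam (\<lambda>x. (\<Sum>n. c n * of_real (poly (hp n) x)) * g x)"
    and "(\<lambda>n. c n * (\<integral>x. of_real (poly (hp n) x) * g x \<partial>gam)) sums
           (\<integral>x. (\<Sum>n. c n * of_real (poly (hp n) x)) * g x \<partial>gam)"
proof -
  define f where "f n x = c n * of_real (poly (hp n) x)" for n x
  have iP: "integrable gam (\<lambda>x. complex_of_real (poly (hp n) x))" for n
    using gam_integrable_poly[of "hp n"] by simp
  have if': "integrable gam (f n)" for n
    unfolding f_def [abs_def] by (intro integrable_mult_right iP)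
  have nf: "(\<integral>x. norm (f n x) \<partial>gam) \<le> cmod (c n) * sqrt (fact n)" for n
    unfolding f_def norm_mult norm_of_real integral_mult_right_zero
    by (intro mult_left_mono hp_integral_abs) simp
  have AEs: "AE x in gam. summable (\<lambda>n. norm (f n x))"
    using nf by (intro AE_summable_norm if' summable_comparison_test'[OF sc]) auto
  have K0: "K \<ge> 0" using K[of 0] norm_ge_zero order_trans by blast
  have ifg: "integrable gam (\<lambda>x. f n x * g x)" for n
  proof (rule Bochner_Integration.integrable_bound[OF integrable_mult_right[OF if', of "of_real K" n]])
    show "AE x in gam. norm (f n x * g x) \<le> norm (of_real K * f n x)"
      using K K0 by (auto simp: norm_mult mult.commute[of K] intro!: mult_left_mono)
  qed (simp add: f_def)
  have AEs': "AE x in gam. summable (\<lambda>n. norm (f n x * g x))"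
    using AEs by eventually_elim (simp add: norm_mult summable_mult2)
  have nfg: "(\<integral>x. norm (f n x * g x) \<partial>gam) \<le> (cmod (c n) * sqrt (fact n)) * K" for n
  proof -
    have "(\<integral>x. norm (f n x * g x) \<partial>gam) \<le> (\<integral>x. norm (f n x) * K \<partial>gam)"
      using K if' ifg by (intro integral_mono integrable_norm) (auto simp: norm_mult intro!: mult_left_mono)
    also have "\<dots> \<le> (cmod (c n) * sqrt (fact n)) * K"
      using nf K0 by (simp add: mult_right_mono)
    finally show ?thesis .
  qed
  have s': "summable (\<lambda>n. \<integral>x. norm (f n x * g x) \<partial>gam)"
    using nfg by (intro summable_comparison_test'[OF summable_mult2[OF sc, of K]]) auto
  have eq: "AE x in gam. (\<Sum>n. f n x * g x) = (\<Sum>n. f n x) * g x"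
    using AEs by eventually_elim (rule suminf_mult2[symmetric], rule summable_norm_cancel)
  have m1: "(\<lambda>x. \<Sum>n. f n x * g x) \<in> borel_measurable gam"
    unfolding f_def by simp
  have m2: "(\<lambda>x. (\<Sum>n. f n x) * g x) \<in> borel_measurable gam"
    unfolding f_def by simp
  have "integrable gam (\<lambda>x. \<Sum>n. f n x * g x)"
    by (rule integrable_suminf[OF ifg AEs' s'])
  then show "integrable gam (\<lambda>x. (\<Sum>n. c n * of_real (poly (hp n) x)) * g x)"
    using integrable_cong_AE[OF m1 m2 eq] by (simp add: f_def)
  have "(\<lambda>n. \<integral>x. f n x * g x \<partial>gam) sums (\<integral>x. (\<Sum>n. f n x * g x) \<partial>gam)"
    by (rule sums_integral[OF ifg AEs' s'])
  also have "(\<integral>x. (\<Sum>n. f n x * g x) \<partial>gam) = (\<integral>x. (\<Sum>n. f n x) * g x \<partial>gam)"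
    by (rule integral_cong_AE[OF m1 m2 eq])
  finally show "(\<lambda>n. c n * (\<integral>x. of_real (poly (hp n) x) * g x \<partial>gam)) sums
           (\<integral>x. (\<Sum>n. c n * of_real (poly (hp n) x)) * g x \<partial>gam)"
    by (simp add: f_def mult.assoc)
qed

text \<open>Not normalised: the coefficient of \<open>hp n\<close> in the expansion of h is this
  number divided by n!.\<close>

definition hermite_coeff :: "(real \<Rightarrow> real) \<Rightarrow> nat \<Rightarrow> real" where
  "hermite_coeff h n = (\<integral>x. h x * poly (hp n) x \<partial>gam)"

lemma hermite_coeff_bound:
  assumes [measurable]: "h \<in> borel_measurable borel" and K: "\<And>x. \<bar>h x\<bar> \<le> K"
  shows "\<bar>hermite_coeff h n\<bar> \<le> K * sqrt (fact n)"
proof -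
  have K0: "K \<ge> 0" using K[of 0] by linarith
  have i: "integrable gam (\<lambda>x. K * \<bar>poly (hp n) x\<bar>)"
    using gam_integrable_poly by auto
  have "\<bar>hermite_coeff h n\<bar> \<le> (\<integral>x. \<bar>h x * poly (hp n) x\<bar> \<partial>gam)"
    unfolding hermite_coeff_def by (rule integral_abs_bound)
  also have "\<dots> \<le> (\<integral>x. K * \<bar>poly (hp n) x\<bar> \<partial>gam)"
    by (rule integral_mono'[OF i]) (auto simp: abs_mult K K0 intro!: mult_right_mono)
  also have "\<dots> \<le> K * sqrt (fact n)"
    using hp_integral_abs K0 by (simp add: mult_left_mono)
  finally show ?thesis .
qed

context prob_space
begin

text \<open>Two rounds of the same argument: first E[exp (\<i>\<eta>Y) | X], then E[h(X) | Y] is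
  identified with a Hermite series by comparing Fourier transforms. The pair enters only through its
  joint characteristic function.\<close>

lemma mehler:
  fixes X Y :: "'a \<Rightarrow> real"
  assumes [measurable]: "X \<in> borel_measurable M" "Y \<in> borel_measurable M"
    and lX: "distr M borel X = gam" and lY: "distr M borel Y = gam"
    and ch: "\<And>a b. expectation (\<lambda>\<omega>. iexp (a * X \<omega> + b * Y \<omega>)) = of_real (exp (- (a\<^sup>2 + 2 * r * a * b + b\<^sup>2) / 2))"
    and r: "\<bar>r\<bar> < 1"
    and [measurable]: "h \<in> borel_measurable borel" "k \<in> borel_measurable borel"
    and hK: "\<And>x. \<bar>h x\<bar> \<le> K" and kK: "\<And>x. \<bar>k x\<bar> \<le> K"
  shows "(\<lambda>n. r ^ n / fact n * hermite_coeff h n * hermite_coeff k n) sums expectation (\<lambda>\<omega>. h (X \<omega>) * k (Y \<omega>))"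
proof -
  have law: "(\<integral>\<omega>. f (X \<omega>) \<partial>M) = (\<integral>x. f x \<partial>gam)" "(\<integral>\<omega>. f (Y \<omega>) \<partial>M) = (\<integral>x. f x \<partial>gam)"
    if [measurable]: "f \<in> borel_measurable borel" for f :: "real \<Rightarrow> complex"
    using integral_distr[OF \<open>X \<in> borel_measurable M\<close> that] integral_distr[OF \<open>Y \<in> borel_measurable M\<close> that]
    by (simp_all only: lX lY)
  have lawi: "integrable M (\<lambda>\<omega>. f (X \<omega>))" "integrable M (\<lambda>\<omega>. f (Y \<omega>))"
    if "integrable gam f" for f :: "real \<Rightarrow> complex"
    using that integrable_distr[of X M borel f] integrable_distr[of Y M borel f] by (simp_all add: lX lY)
  have chc: "of_real (hermite_coeff f n) = (\<integral>x. of_real (poly (hp n) x) * complex_of_real (f x) \<partial>gam)" for f n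
    unfolding hermite_coeff_def integral_complex_of_real[symmetric] by (simp add: mult.commute)
  have ib: "integrable M (\<lambda>\<omega>. a \<omega> * of_real (b \<omega>))"
    if [measurable]: "a \<in> borel_measurable M" "b \<in> borel_measurable M" and "\<And>\<omega>. cmod (a \<omega>) \<le> 1" "\<And>\<omega>. \<bar>b \<omega>\<bar> \<le> K"
    for a :: "'a \<Rightarrow> complex" and b :: "'a \<Rightarrow> real"
  proof (rule integrable_const_bound[where B="1 * K"])
    show "AE \<omega> in M. norm (a \<omega> * of_real (b \<omega>)) \<le> 1 * K"
      unfolding norm_mult norm_of_real by (intro AE_I2 mult_mono that) auto
  qed simp
  have A: "(\<lambda>n. of_real (r ^ n / fact n) * (\<i> * of_real \<eta>) ^ n * of_real (exp (- \<eta>\<^sup>2 / 2)) * of_real (hermite_coeff h n))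
      sums expectation (\<lambda>\<omega>. iexp (\<eta> * Y \<omega>) * of_real (h (X \<omega>)))" for \<eta>
  proof -
    \<comment> \<open>The coefficients are read off from the power series of exp (- r \<eta>
      \<theta>), the cross term of the joint characteristic function. Here summability comes from
      the n! alone.\<close>
    define c where "c n = of_real (r ^ n / fact n) * (\<i> * of_real \<eta>) ^ n * of_real (exp (- \<eta>\<^sup>2 / 2))" for n
    define S where "S x = (\<Sum>n. c n * of_real (poly (hp n) x))" for x
    have sc: "summable (\<lambda>n. cmod (c n) * sqrt (fact n))"
    proof (rule summable_cong[THEN iffD1])
      show "summable (\<lambda>n. (\<bar>r\<bar> * \<bar>\<eta>\<bar>) ^ n / sqrt (fact n) * exp (- \<eta>\<^sup>2 / 2))"
        by (intro summable_mult2 summable_power_sqrt_fact) auto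
      have sf: "sqrt (fact n) / fact n = 1 / sqrt (fact n)" for n
        using real_sqrt_mult_self[of "fact n"] by (simp add: field_simps)
      have "cmod (c n) * sqrt (fact n) = (\<bar>r\<bar> * \<bar>\<eta>\<bar>) ^ n * (sqrt (fact n) / fact n) * exp (- \<eta>\<^sup>2 / 2)" for n
        by (simp add: c_def norm_mult norm_divide norm_power power_abs power_mult_distrib)
      then show "\<forall>\<^sub>F n in sequentially. (\<bar>r\<bar> * \<bar>\<eta>\<bar>) ^ n / sqrt (fact n) * exp (- \<eta>\<^sup>2 / 2) = cmod (c n) * sqrt (fact n)"
        by (simp add: sf)
    qed
    have iS: "integrable gam S"
      using hermite_series(1)[OF sc, of "\<lambda>_. 1" 1] by (simp add: S_def [abs_def])
    have [measurable]: "S \<in> borel_measurable borel" using iS by auto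
    have "expectation (\<lambda>\<omega>. (iexp (\<eta> * Y \<omega>) - S (X \<omega>)) * of_real (h (X \<omega>))) = 0"
    proof (rule fourier_unique[where K=K and Y=X and k=h])
      show "integrable M (\<lambda>\<omega>. iexp (\<eta> * Y \<omega>) - S (X \<omega>))"
        by (intro Bochner_Integration.integrable_diff lawi iS integrable_iexp) auto
      show "expectation (\<lambda>\<omega>. (iexp (\<eta> * Y \<omega>) - S (X \<omega>)) * iexp (\<theta> * X \<omega>)) = 0" for \<theta>
      proof -
        have "(\<lambda>n. c n * ((\<i> * of_real \<theta>) ^ n * of_real (exp (- \<theta>\<^sup>2 / 2)))) sums (\<integral>x. S x * iexp (\<theta> * x) \<partial>gam)"
          using hermite_series(2)[OF sc, of "\<lambda>x. iexp (\<theta> * x)" 1] unfolding hp_fourier S_def by simp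
        moreover have "(\<lambda>n. c n * ((\<i> * of_real \<theta>) ^ n * of_real (exp (- \<theta>\<^sup>2 / 2))))
           = (\<lambda>n. of_real (exp (- \<eta>\<^sup>2 / 2) * exp (- \<theta>\<^sup>2 / 2) * ((- r * \<eta> * \<theta>) ^ n /\<^sub>R fact n)))"
        proof
          fix n
          have *: "(\<i> * of_real \<eta>) ^ n * (\<i> * of_real \<theta>) ^ n = (of_real (- \<eta> * \<theta>) :: complex) ^ n"
            by (simp add: power_mult_distrib[symmetric] mult_ac)
          have "c n * ((\<i> * of_real \<theta>) ^ n * of_real (exp (- \<theta>\<^sup>2 / 2)))
            = of_real (r ^ n / fact n) * ((\<i> * of_real \<eta>) ^ n * (\<i> * of_real \<theta>) ^ n) * of_real (exp (- \<eta>\<^sup>2 / 2)) * of_real (exp (- \<theta>\<^sup>2 / 2))"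
            unfolding c_def by (simp only: mult_ac)
          then have "c n * ((\<i> * of_real \<theta>) ^ n * of_real (exp (- \<theta>\<^sup>2 / 2)))
            = of_real (r ^ n / fact n) * of_real (- \<eta> * \<theta>) ^ n * of_real (exp (- \<eta>\<^sup>2 / 2)) * of_real (exp (- \<theta>\<^sup>2 / 2))"
            unfolding * .
          also have "\<dots> = of_real (r ^ n / fact n * (- \<eta> * \<theta>) ^ n * exp (- \<eta>\<^sup>2 / 2) * exp (- \<theta>\<^sup>2 / 2))"
            by (simp only: of_real_mult of_real_power)
          also have "r ^ n / fact n * (- \<eta> * \<theta>) ^ n * exp (- \<eta>\<^sup>2 / 2) * exp (- \<theta>\<^sup>2 / 2)
            = exp (- \<eta>\<^sup>2 / 2) * exp (- \<theta>\<^sup>2 / 2) * ((- r * \<eta> * \<theta>) ^ n /\<^sub>R fact n)"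
          proof -
            have *: "r ^ n * (- \<eta> * \<theta>) ^ n = (- r * \<eta> * \<theta>) ^ n"
              by (simp add: power_mult_distrib[symmetric] mult.assoc)
            have "r ^ n / fact n * (- \<eta> * \<theta>) ^ n * A * B = A * B * ((r ^ n * (- \<eta> * \<theta>) ^ n) /\<^sub>R fact n)" for A B
              by (simp only: real_scaleR_def divide_inverse mult_ac)
            then show ?thesis unfolding * .
          qed
          finally show "c n * ((\<i> * of_real \<theta>) ^ n * of_real (exp (- \<theta>\<^sup>2 / 2)))
            = of_real (exp (- \<eta>\<^sup>2 / 2) * exp (- \<theta>\<^sup>2 / 2) * ((- r * \<eta> * \<theta>) ^ n /\<^sub>R fact n))" .
        qed
        moreover have "(\<lambda>n. complex_of_real (exp (- \<eta>\<^sup>2 / 2) * exp (- \<theta>\<^sup>2 / 2) * ((- r * \<eta> * \<theta>) ^ n /\<^sub>R fact n)))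
            sums of_real (exp (- \<eta>\<^sup>2 / 2) * exp (- \<theta>\<^sup>2 / 2) * exp (- r * \<eta> * \<theta>))"
          by (rule sums_of_real[OF sums_mult[OF exp_converges]])
        ultimately have "(\<integral>x. S x * iexp (\<theta> * x) \<partial>gam) = of_real (exp (- \<eta>\<^sup>2 / 2) * exp (- \<theta>\<^sup>2 / 2) * exp (- r * \<eta> * \<theta>))"
          using sums_unique2 by (simp only:) blast
        also have "exp (- \<eta>\<^sup>2 / 2) * exp (- \<theta>\<^sup>2 / 2) * exp (- r * \<eta> * \<theta>) = exp (- (\<theta>\<^sup>2 + 2 * r * \<theta> * \<eta> + \<eta>\<^sup>2) / 2)"
          by (simp add: exp_add[symmetric] field_simps)
        finally have 1: "(\<integral>x. S x * iexp (\<theta> * x) \<partial>gam) = of_real (exp (- (\<theta>\<^sup>2 + 2 * r * \<theta> * \<eta> + \<eta>\<^sup>2) / 2))" .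
        have 2: "expectation (\<lambda>\<omega>. S (X \<omega>) * iexp (\<theta> * X \<omega>)) = (\<integral>x. S x * iexp (\<theta> * x) \<partial>gam)"
          by (rule law(1)[of "\<lambda>x. S x * iexp (\<theta> * x)"]) simp
        have i1: "integrable M (\<lambda>\<omega>. S (X \<omega>) * iexp (\<theta> * X \<omega>))"
          using hermite_series(1)[OF sc, of "\<lambda>x. iexp (\<theta> * x)" 1] by (intro lawi(1)) (simp add: S_def)
        have i2: "integrable M (\<lambda>\<omega>. iexp (\<eta> * Y \<omega>) * iexp (\<theta> * X \<omega>))"
          by (rule integrable_const_bound[where B=1]) (auto simp: norm_mult)
        have "expectation (\<lambda>\<omega>. iexp (\<eta> * Y \<omega>) * iexp (\<theta> * X \<omega>)) = of_real (exp (- (\<theta>\<^sup>2 + 2 * r * \<theta> * \<eta> + \<eta>\<^sup>2) / 2))"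
          unfolding ch[symmetric] by (intro Bochner_Integration.integral_cong refl) (simp add: exp_add[symmetric] algebra_simps)
        then show ?thesis
          unfolding left_diff_distrib Bochner_Integration.integral_diff[OF i2 i1] 1 2 by simp
      qed
    qed (auto simp: hK)
    moreover have "expectation (\<lambda>\<omega>. (iexp (\<eta> * Y \<omega>) - S (X \<omega>)) * of_real (h (X \<omega>)))
       = expectation (\<lambda>\<omega>. iexp (\<eta> * Y \<omega>) * of_real (h (X \<omega>))) - (\<integral>x. S x * of_real (h x) \<partial>gam)"
    proof -
      have i1: "integrable M (\<lambda>\<omega>. S (X \<omega>) * of_real (h (X \<omega>)))"
        using hermite_series(1)[OF sc, of "\<lambda>x. of_real (h x)" K] hK by (intro lawi(1)) (simp add: S_def)
      have i2: "integrable M (\<lambda>\<omega>. iexp (\<eta> * Y \<omega>) * of_real (h (X \<omega>)))"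
        by (rule ib) (auto simp: hK)
      show ?thesis
        unfolding left_diff_distrib Bochner_Integration.integral_diff[OF i2 i1]
        by (subst law(1)[of "\<lambda>x. S x * of_real (h x)"]) simp_all
    qed
    moreover have "(\<lambda>n. c n * of_real (hermite_coeff h n)) sums (\<integral>x. S x * of_real (h x) \<partial>gam)"
      using hermite_series(2)[OF sc, of "\<lambda>x. of_real (h x)" K] hK unfolding chc S_def by simp
    ultimately show ?thesis by (simp add: c_def)
  qed
  \<comment> \<open>Second round, with h(X) in place of the exponential; formula A supplies the
    transform of h(X) along Y.\<close>
  define c where "c n = complex_of_real (r ^ n / fact n * hermite_coeff h n)" for n
  define S where "S x = (\<Sum>n. c n * of_real (poly (hp n) x))" for x
  have sc: "summable (\<lambda>n. cmod (c n) * sqrt (fact n))"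
  proof (rule summable_comparison_test')
    \<comment> \<open>Here r of modulus below 1 is essential: the coefficients of h grow like sqrt
      n!, the norms of \<open>hp n\<close> contribute another sqrt n!, and only the geometric factor
      is left.\<close>
    show "summable (\<lambda>n. K * \<bar>r\<bar> ^ n)"
      using r by (intro summable_mult summable_geometric) auto
    fix n :: nat
    have "cmod (c n) * sqrt (fact n) = \<bar>r\<bar> ^ n / fact n * (\<bar>hermite_coeff h n\<bar> * sqrt (fact n))"
      by (simp add: c_def norm_mult norm_divide norm_power power_abs abs_mult)
    also have "\<dots> \<le> \<bar>r\<bar> ^ n / fact n * ((K * sqrt (fact n)) * sqrt (fact n))"
      by (intro mult_left_mono mult_right_mono hermite_coeff_bound hK) auto
    also have "\<dots> = K * \<bar>r\<bar> ^ n" by (simp add: mult.assoc)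
    finally show "norm (cmod (c n) * sqrt (fact n)) \<le> K * \<bar>r\<bar> ^ n" by simp
  qed
  have iS: "integrable gam S"
    using hermite_series(1)[OF sc, of "\<lambda>_. 1" 1] by (simp add: S_def [abs_def])
  have [measurable]: "S \<in> borel_measurable borel" using iS by auto
  have ih: "integrable M (\<lambda>\<omega>. complex_of_real (h (X \<omega>)))"
    using ib[of "\<lambda>_. 1" "\<lambda>\<omega>. h (X \<omega>)"] hK by simp
  have "expectation (\<lambda>\<omega>. (of_real (h (X \<omega>)) - S (Y \<omega>)) * of_real (k (Y \<omega>))) = 0"
  proof (rule fourier_unique[where K=K and Y=Y and k=k])
    show "integrable M (\<lambda>\<omega>. of_real (h (X \<omega>)) - S (Y \<omega>))"
      by (intro Bochner_Integration.integrable_diff lawi iS ih)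
    show "expectation (\<lambda>\<omega>. (of_real (h (X \<omega>)) - S (Y \<omega>)) * iexp (\<eta> * Y \<omega>)) = 0" for \<eta>
    proof -
      have "(\<lambda>n. c n * ((\<i> * of_real \<eta>) ^ n * of_real (exp (- \<eta>\<^sup>2 / 2)))) sums (\<integral>x. S x * iexp (\<eta> * x) \<partial>gam)"
        using hermite_series(2)[OF sc, of "\<lambda>x. iexp (\<eta> * x)" 1] unfolding hp_fourier S_def by simp
      also have "(\<lambda>n. c n * ((\<i> * of_real \<eta>) ^ n * of_real (exp (- \<eta>\<^sup>2 / 2))))
         = (\<lambda>n. of_real (r ^ n / fact n) * (\<i> * of_real \<eta>) ^ n * of_real (exp (- \<eta>\<^sup>2 / 2)) * of_real (hermite_coeff h n))"
        unfolding c_def of_real_mult by (simp only: mult_ac)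
      finally have 1: "(\<integral>x. S x * iexp (\<eta> * x) \<partial>gam) = expectation (\<lambda>\<omega>. iexp (\<eta> * Y \<omega>) * of_real (h (X \<omega>)))"
        using A[of \<eta>] sums_unique2 by blast
      have 2: "expectation (\<lambda>\<omega>. S (Y \<omega>) * iexp (\<eta> * Y \<omega>)) = (\<integral>x. S x * iexp (\<eta> * x) \<partial>gam)"
        by (rule law(2)[of "\<lambda>x. S x * iexp (\<eta> * x)"]) simp
      have i1: "integrable M (\<lambda>\<omega>. S (Y \<omega>) * iexp (\<eta> * Y \<omega>))"
        using hermite_series(1)[OF sc, of "\<lambda>x. iexp (\<eta> * x)" 1] by (intro lawi(2)) (simp add: S_def)
      have i2: "integrable M (\<lambda>\<omega>. of_real (h (X \<omega>)) * iexp (\<eta> * Y \<omega>))"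
        using ib[of "\<lambda>\<omega>. iexp (\<eta> * Y \<omega>)" "\<lambda>\<omega>. h (X \<omega>)"] hK by (simp add: mult.commute)
      show ?thesis
        unfolding left_diff_distrib Bochner_Integration.integral_diff[OF i2 i1] 2 1 by (simp add: mult.commute)
    qed
  qed (auto simp: kK)
  moreover have "expectation (\<lambda>\<omega>. (of_real (h (X \<omega>)) - S (Y \<omega>)) * of_real (k (Y \<omega>)))
     = of_real (expectation (\<lambda>\<omega>. h (X \<omega>) * k (Y \<omega>))) - (\<integral>x. S x * of_real (k x) \<partial>gam)"
  proof -
    have i1: "integrable M (\<lambda>\<omega>. S (Y \<omega>) * of_real (k (Y \<omega>)))"
      using hermite_series(1)[OF sc, of "\<lambda>x. of_real (k x)" K] kK by (intro lawi(2)) (simp add: S_def)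
    have i2: "integrable M (\<lambda>\<omega>. complex_of_real (h (X \<omega>)) * of_real (k (Y \<omega>)))"
    proof (rule integrable_const_bound[where B="K * K"])
      show "AE \<omega> in M. norm (complex_of_real (h (X \<omega>)) * of_real (k (Y \<omega>))) \<le> K * K"
        unfolding norm_mult norm_of_real using order_trans[OF abs_ge_zero hK[of 0]] by (intro AE_I2 mult_mono hK kK) auto
    qed simp
    show ?thesis
      unfolding left_diff_distrib Bochner_Integration.integral_diff[OF i2 i1] integral_complex_of_real[symmetric] of_real_mult
      by (subst law(2)[of "\<lambda>x. S x * of_real (k x)"]) simp_all
  qed
  moreover have "(\<lambda>n. c n * of_real (hermite_coeff k n)) sums (\<integral>x. S x * of_real (k x) \<partial>gam)"
    using hermite_series(2)[OF sc, of "\<lambda>x. of_real (k x)" K] kK unfolding chc S_def by simp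
  ultimately have "(\<lambda>n. of_real (r ^ n / fact n * hermite_coeff h n * hermite_coeff k n))
      sums complex_of_real (expectation (\<lambda>\<omega>. h (X \<omega>) * k (Y \<omega>)))"
    by (simp add: c_def)
  then show ?thesis unfolding sums_of_real_iff .
qed

text \<open>In Mehler's series the term n = 0 is the squared mean, every further term has modulus of
  r^n at most that of r, and Bessel's inequality sums the rest.\<close>

lemma gebelein:
  fixes X Y :: "'a \<Rightarrow> real"
  assumes [measurable]: "X \<in> borel_measurable M" "Y \<in> borel_measurable M"
    and lX: "distr M borel X = gam" and lY: "distr M borel Y = gam"
    and ch: "\<And>a b. expectation (\<lambda>\<omega>. iexp (a * X \<omega> + b * Y \<omega>)) = of_real (exp (- (a\<^sup>2 + 2 * r * a * b + b\<^sup>2) / 2))"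
    and r: "\<bar>r\<bar> \<le> 1"
    and h [measurable]: "h \<in> borel_measurable borel"  and hK: "\<And>x. \<bar>h x\<bar> \<le> K"
  shows "\<bar>expectation (\<lambda>\<omega>. h (X \<omega>) * h (Y \<omega>)) - (\<integral>x. h x \<partial>gam)\<^sup>2\<bar> \<le> \<bar>r\<bar> * (\<integral>x. (h x)\<^sup>2 \<partial>gam)"
proof (cases "\<bar>r\<bar> < 1")
  case True
  define a where "a n = hermite_coeff h n" for n
  define b where "b n = (a n)\<^sup>2 / fact n" for n
  have b: "summable b" "(\<Sum>n. b n) \<le> (\<integral>x. (h x)\<^sup>2 \<partial>gam)"
    using hp_bessel[OF h hK] unfolding b_def [abs_def] a_def hermite_coeff_def by auto
  have bn: "b n \<ge> 0" for n by (simp add: b_def)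
  have "(\<lambda>n. r ^ n / fact n * a n * a n) sums expectation (\<lambda>\<omega>. h (X \<omega>) * h (Y \<omega>))"
    unfolding a_def by (rule mehler[OF _ _ lX lY ch True _ _ hK hK]) auto
  then have s: "(\<lambda>n. r ^ n * b n) sums expectation (\<lambda>\<omega>. h (X \<omega>) * h (Y \<omega>))"
    by (simp add: b_def power2_eq_square mult.assoc)
  have "a 0 = (\<integral>x. h x \<partial>gam)" by (simp add: a_def hermite_coeff_def)
  then have e: "expectation (\<lambda>\<omega>. h (X \<omega>) * h (Y \<omega>)) - (\<integral>x. h x \<partial>gam)\<^sup>2 = (\<Sum>n. r ^ Suc n * b (Suc n))"
    using s suminf_split_head[of "\<lambda>n. r ^ n * b n"] by (simp add: sums_iff b_def)
  have le: "norm (r ^ Suc n * b (Suc n)) \<le> \<bar>r\<bar> * b (Suc n)" for n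
    using mult_right_mono[OF power_decreasing[of 1 "Suc n" "\<bar>r\<bar>"] bn[of "Suc n"]] r bn[of "Suc n"]
    by (simp add: abs_mult power_abs)
  have sb: "summable (\<lambda>n. \<bar>r\<bar> * b (Suc n))"
    using b(1) by (intro summable_mult) (simp add: summable_Suc_iff)
  have "\<bar>\<Sum>n. r ^ Suc n * b (Suc n)\<bar> \<le> (\<Sum>n. \<bar>r\<bar> * b (Suc n))"
    using norm_suminf_le[OF le sb] by simp
  also have "\<dots> = \<bar>r\<bar> * (\<Sum>n. b (Suc n))"
    using b(1) by (intro suminf_mult) (simp add: summable_Suc_iff)
  also have "\<dots> \<le> \<bar>r\<bar> * (\<integral>x. (h x)\<^sup>2 \<partial>gam)"
    using suminf_split_head[OF b(1)] bn[of 0] b(2) by (intro mult_left_mono) auto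
  finally show ?thesis unfolding e .
next
  case False
  \<comment> \<open>At the end points the series is not at hand; the bound is then Cauchy-Schwarz
    for the centred variables, whose common variance is at most the second moment.\<close>
  then have r1: "\<bar>r\<bar> = 1" using r by simp
  define m where "m = (\<integral>x. h x \<partial>gam)"
  have law: "(\<integral>\<omega>. f (X \<omega>) \<partial>M) = (\<integral>x. f x \<partial>gam)" "(\<integral>\<omega>. f (Y \<omega>) \<partial>M) = (\<integral>x. f x \<partial>gam)"
    if [measurable]: "f \<in> borel_measurable borel" for f :: "real \<Rightarrow> real"
    using integral_distr[OF \<open>X \<in> borel_measurable M\<close> that] integral_distr[OF \<open>Y \<in> borel_measurable M\<close> that]
    by (simp_all only: lX lY)
  have K0: "K \<ge> 0" using hK[of 0] by linarith
  have iX: "integrable M (\<lambda>\<omega>. h (X \<omega>))" and iY: "integrable M (\<lambda>\<omega>. h (Y \<omega>))"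
    by (auto intro!: integrable_const_bound[where B=K] hK)
  have iXY: "integrable M (\<lambda>\<omega>. h (X \<omega>) * h (Y \<omega>))"
    by (rule integrable_const_bound[where B="K * K"]) (auto simp: abs_mult hK K0 intro!: mult_mono)
  have ih: "integrable gam h" "integrable gam (\<lambda>x. (h x)\<^sup>2)"
  proof -
    show "integrable gam h"
      by (rule gam.integrable_const_bound[where B=K]) (auto simp: hK)
    have "(h x)\<^sup>2 \<le> K\<^sup>2" for x
      using power_mono[OF hK abs_ge_zero, of x 2] by simp
    then show "integrable gam (\<lambda>x. (h x)\<^sup>2)"
      by (intro gam.integrable_const_bound[where B="K\<^sup>2"]) auto
  qed
  have e: "expectation (\<lambda>\<omega>. h (X \<omega>) * h (Y \<omega>)) - m\<^sup>2 = expectation (\<lambda>\<omega>. (h (X \<omega>) - m) * (h (Y \<omega>) - m))"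
  proof -
    have "(\<lambda>\<omega>. (h (X \<omega>) - m) * (h (Y \<omega>) - m)) = (\<lambda>\<omega>. h (X \<omega>) * h (Y \<omega>) - m * h (X \<omega>) - m * h (Y \<omega>) + m\<^sup>2)"
      by (auto simp: algebra_simps power2_eq_square)
    then show ?thesis
      using iX iY iXY law[OF h] by (simp add: m_def[symmetric] prob_space power2_eq_square)
  qed
  have b2: "(h x - m)\<^sup>2 \<le> (K + \<bar>m\<bar>)\<^sup>2" for x
  proof -
    have "\<bar>h x - m\<bar> \<le> K + \<bar>m\<bar>" using hK[of x] by linarith
    from power_mono[OF this abs_ge_zero, of 2] show ?thesis by simp
  qed
  have isq: "integrable M (\<lambda>\<omega>. (h (X \<omega>) - m)\<^sup>2)" "integrable M (\<lambda>\<omega>. (h (Y \<omega>) - m)\<^sup>2)"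
    by (intro integrable_const_bound[where B="(K + \<bar>m\<bar>)\<^sup>2"] AE_I2; simp add: b2)+
  have "\<bar>expectation (\<lambda>\<omega>. (h (X \<omega>) - m) * (h (Y \<omega>) - m))\<bar>
     \<le> sqrt (expectation (\<lambda>\<omega>. (h (X \<omega>) - m)\<^sup>2)) * sqrt (expectation (\<lambda>\<omega>. (h (Y \<omega>) - m)\<^sup>2))"
    by (rule integral_Cauchy_Schwarz) (auto intro: isq)
  also have "\<dots> = (\<integral>x. (h x - m)\<^sup>2 \<partial>gam)"
    using law[of "\<lambda>x. (h x - m)\<^sup>2"] by simp
  also have "\<dots> = (\<integral>x. (h x)\<^sup>2 \<partial>gam) - m\<^sup>2"
    unfolding m_def using gam.variance_eq[OF ih] .
  also have "\<dots> \<le> \<bar>r\<bar> * (\<integral>x. (h x)\<^sup>2 \<partial>gam)" using r1 by simp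
  finally show ?thesis using e by (simp add: m_def)
qed

text \<open>The integral of a non-integrable function is 0 by convention, and c >= 0 as it bounds an
  absolute value. The lemma thus applies directly to expectations depending on a parameter.\<close>

lemma abs_expectation_le:
  fixes f :: "'a \<Rightarrow> real"
  assumes "\<And>x. \<bar>f x\<bar> \<le> c"
  shows "\<bar>expectation f\<bar> \<le> c"
proof (cases "integrable M f")
  case True
  have "\<bar>expectation f\<bar> \<le> expectation (\<lambda>x. \<bar>f x\<bar>)" by (rule integral_abs_bound)
  also have "\<dots> \<le> expectation (\<lambda>x. c)"
    using True assms by (intro integral_mono integrable_abs) auto
  finally show ?thesis by (simp add: prob_space)
next
  case False
  then show ?thesis using order_trans[OF abs_ge_zero assms] by (simp add: not_integrable_integral_eq)
qed

lemma integrable_bounded_mult: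
  fixes f g :: "'a \<Rightarrow> real"
  assumes [measurable]: "f \<in> borel_measurable M" "g \<in> borel_measurable M"
    and f: "\<And>x. \<bar>f x\<bar> \<le> a" and g: "\<And>x. \<bar>g x\<bar> \<le> b"
  shows "integrable M (\<lambda>x. f x * g x)"
proof (rule integrable_const_bound[where B="a * b"])
  show "AE x in M. norm (f x * g x) \<le> a * b"
    unfolding real_norm_def abs_mult using order_trans[OF abs_ge_zero f] by (intro AE_I2 mult_mono f g) auto
qed simp

subsection \<open>Covariance bounds and integration by parts for Gaussian families\<close>

text \<open>Replacing W 2 and W 3 by their residuals after regression on W 0 makes B independent of
  a(W 0). The price is a change \<open>D\<close> of B of size proportional to the modulus of W 0,
  and a may be replaced by \<open>F\<close>, of the same size; each error is then of order v, the
  variance of W 0, which cancels the 1 / v in the regression coefficients.\<close>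

lemma gaussian_cov_pivot:
  fixes W :: "nat \<Rightarrow> 'a \<Rightarrow> real" and a :: "real \<Rightarrow> real" and B :: "real \<Rightarrow> real \<Rightarrow> real"
  assumes W: "gaussian_family M {0,2,3} W"
    and am [measurable]: "a \<in> borel_measurable borel"
    and aL: "\<And>x y. \<bar>a x - a y\<bar> \<le> Ka * \<bar>x - y\<bar>" and ab: "\<And>x. \<bar>a x\<bar> \<le> Ca"
    and Bm: "(\<lambda>p. B (fst p) (snd p)) \<in> borel_measurable (borel \<Otimes>\<^sub>M borel)"
    and BL: "\<And>y z y' z'. \<bar>B y z - B y' z'\<bar> \<le> L * (\<bar>y - y'\<bar> + \<bar>z - z'\<bar>)"
    and Bb: "\<And>y z. \<bar>B y z\<bar> \<le> Cb"
  shows "\<bar>expectation (\<lambda>\<omega>. a (W 0 \<omega>) * (B (W 2 \<omega>) (W 3 \<omega>) - expectation (\<lambda>\<omega>. B (W 2 \<omega>) (W 3 \<omega>))))\<bar>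
    \<le> 2 * Ka * L * (\<bar>expectation (\<lambda>\<omega>. W 0 \<omega> * W 2 \<omega>)\<bar> + \<bar>expectation (\<lambda>\<omega>. W 0 \<omega> * W 3 \<omega>)\<bar>)"
proof -
  have Wm [measurable]: "W 0 \<in> borel_measurable M" "W 2 \<in> borel_measurable M" "W 3 \<in> borel_measurable M"
    using gaussian_family_measurable[OF W] by auto
  have Bm' [measurable]: "(\<lambda>x. B (f x) (g x)) \<in> borel_measurable N"
    if [measurable]: "f \<in> borel_measurable N" "g \<in> borel_measurable N" for f g and N :: "'n measure"
    using measurable_compose[OF measurable_Pair[OF that] Bm] by simp
  have Bm'' [measurable]: "(\<lambda>x. B (f x) (g x)) \<in> borel_measurable N"
    if [measurable]: "f \<in> borel_measurable N" "g \<in> borel_measurable N" for f g and N :: "(real \<times> (nat \<Rightarrow> real)) measure"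
    using measurable_compose[OF measurable_Pair[OF that] Bm] by simp
  have Bma [measurable]: "(\<lambda>x. B (f x) (g x)) \<in> borel_measurable N"
    if [measurable]: "f \<in> borel_measurable N" "g \<in> borel_measurable N" for f g and N :: "'a measure"
    using measurable_compose[OF measurable_Pair[OF that] Bm] by simp
  have Ka: "Ka \<ge> 0" using aL[of 1 0] abs_ge_zero[of "a 1 - a 0"] by simp
  have L0: "L \<ge> 0" using BL[of 1 0 0 0] abs_ge_zero[of "B 1 0 - B 0 0"] by simp
  define \<beta> where "\<beta> = expectation (\<lambda>\<omega>. B (W 2 \<omega>) (W 3 \<omega>))"
  define v where "v = expectation (\<lambda>\<omega>. (W 0 \<omega>)\<^sup>2)"
  have iB: "integrable M (\<lambda>\<omega>. B (W 2 \<omega>) (W 3 \<omega>))"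
    by (rule integrable_const_bound[where B=Cb]) (auto simp: Bb)
  have isq: "integrable M (\<lambda>\<omega>. (W 0 \<omega>)\<^sup>2)" using gaussian_family_square[OF W] by simp
  have v0: "v \<ge> 0" by (simp add: v_def)
  have \<beta>b: "\<bar>\<beta>\<bar> \<le> Cb" unfolding \<beta>_def by (rule abs_expectation_le) (rule Bb)
  show ?thesis
  \<comment> \<open>For v = 0 the regression coefficients are meaningless, but then W 0 vanishes
    almost surely and a(W 0) is constant.\<close>
  proof (cases "v = 0")
    case True
    then have "AE \<omega> in M. (W 0 \<omega>)\<^sup>2 = 0"
      using integral_nonneg_eq_0_iff_AE[OF isq] by (simp add: v_def)
    then have "AE \<omega> in M. a (W 0 \<omega>) * (B (W 2 \<omega>) (W 3 \<omega>) - \<beta>) = a 0 * (B (W 2 \<omega>) (W 3 \<omega>) - \<beta>)"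
      by eventually_elim simp
    then have "expectation (\<lambda>\<omega>. a (W 0 \<omega>) * (B (W 2 \<omega>) (W 3 \<omega>) - \<beta>)) = expectation (\<lambda>\<omega>. a 0 * (B (W 2 \<omega>) (W 3 \<omega>) - \<beta>))"
      by (intro integral_cong_AE) auto
    also have "\<dots> = 0" using iB by (simp add: \<beta>_def prob_space)
    finally show ?thesis using Ka L0 by (simp add: \<beta>_def)
  next
    case False
    then have vp: "v > 0" using v0 by simp
    define c where "c j = expectation (\<lambda>\<omega>. W 0 \<omega> * W j \<omega>) / v" for j
    define V where "V j = (\<lambda>\<omega>. \<Sum>i\<in>{0,2,3}. (if i = j then 1 else if i = 0 then - c j else 0) * W i \<omega>)" for j
    have V: "gaussian_family M (insert 0 {2,3}) V"
      unfolding V_def by (rule gaussian_family_linear[OF W]) simp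
    have V0: "V 0 = W 0" and V1: "V 2 = (\<lambda>\<omega>. W 2 \<omega> - c 2 * W 0 \<omega>)" and V2: "V 3 = (\<lambda>\<omega>. W 3 \<omega> - c 3 * W 0 \<omega>)"
      by (auto simp: V_def)
    have iW: "integrable M (\<lambda>\<omega>. W 0 \<omega> * W 2 \<omega>)" "integrable M (\<lambda>\<omega>. W 0 \<omega> * W 3 \<omega>)"
      using gaussian_family_mult[OF W] by auto
    have unc: "expectation (\<lambda>\<omega>. V 0 \<omega> * V j \<omega>) = 0" if "j \<in> {2,3}" for j
    proof -
      have "expectation (\<lambda>\<omega>. V 0 \<omega> * V j \<omega>) = expectation (\<lambda>\<omega>. W 0 \<omega> * W j \<omega> - c j * (W 0 \<omega>)\<^sup>2)"
        using that unfolding V0 by (intro Bochner_Integration.integral_cong) (auto simp: V1 V2 algebra_simps power2_eq_square)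
      also have "\<dots> = expectation (\<lambda>\<omega>. W 0 \<omega> * W j \<omega>) - c j * v"
        using that iW isq by (subst Bochner_Integration.integral_diff) (auto simp: v_def)
      finally show ?thesis using vp by (simp add: c_def)
    qed
    define F where "F \<omega> = a (W 0 \<omega>) - a 0" for \<omega>
    define Z where "Z \<omega> = B (V 2 \<omega>) (V 3 \<omega>)" for \<omega>
    define D where "D \<omega> = B (W 2 \<omega>) (W 3 \<omega>) - Z \<omega>" for \<omega>
    define C where "C = L * (\<bar>c 2\<bar> + \<bar>c 3\<bar>)"
    have C0: "C \<ge> 0" using L0 by (simp add: C_def)
    have [measurable]: "V 2 \<in> borel_measurable M" "V 3 \<in> borel_measurable M" by (simp_all add: V1 V2)
    have [measurable]: "F \<in> borel_measurable M" "Z \<in> borel_measurable M" "D \<in> borel_measurable M"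
      unfolding F_def [abs_def] Z_def [abs_def] D_def [abs_def] by measurable
    have Fle: "\<bar>F \<omega>\<bar> \<le> Ka * \<bar>W 0 \<omega>\<bar>" for \<omega>
      using aL[of "W 0 \<omega>" 0] by (simp add: F_def)
    have Dle: "\<bar>D \<omega>\<bar> \<le> C * \<bar>W 0 \<omega>\<bar>" for \<omega>
      using BL[of "W 2 \<omega>" "W 3 \<omega>" "V 2 \<omega>" "V 3 \<omega>"]
      by (simp add: D_def Z_def C_def V1 V2 abs_mult algebra_simps)
    have Fb: "\<bar>F \<omega>\<bar> \<le> 2 * Ca" for \<omega> using ab[of "W 0 \<omega>"] ab[of 0] by (simp add: F_def)
    have Zb: "\<bar>Z \<omega>\<bar> \<le> Cb" for \<omega> by (simp add: Z_def Bb)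
    have Db: "\<bar>D \<omega>\<bar> \<le> 2 * Cb" for \<omega> using Zb[of \<omega>] Bb[of "W 2 \<omega>" "W 3 \<omega>"] by (simp add: D_def)
    have iF: "integrable M F" by (rule integrable_const_bound[where B="2 * Ca"]) (auto simp: Fb)
    have iZ: "integrable M Z" by (rule integrable_const_bound[where B=Cb]) (auto simp: Zb)
    have iD: "integrable M D" by (rule integrable_const_bound[where B="2 * Cb"]) (auto simp: Db)
    have Ca0: "Ca \<ge> 0" using ab[of 0] by linarith
    have iFD: "integrable M (\<lambda>\<omega>. F \<omega> * D \<omega>)"
      by (rule integrable_bounded_mult[OF _ _ Fb Db]) simp_all
    have iFZ: "integrable M (\<lambda>\<omega>. F \<omega> * (Z \<omega> - \<beta>))"
    proof (rule integrable_const_bound[where B="(2 * Ca) * (Cb + Cb)"])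
      have "\<bar>Z \<omega> - \<beta>\<bar> \<le> Cb + Cb" for \<omega> using Zb[of \<omega>] \<beta>b by linarith
      then show "AE \<omega> in M. norm (F \<omega> * (Z \<omega> - \<beta>)) \<le> (2 * Ca) * (Cb + Cb)"
        unfolding real_norm_def abs_mult using Ca0 by (intro AE_I2 mult_mono Fb) auto
    qed simp
    have EW: "integrable M (\<lambda>\<omega>. \<bar>W 0 \<omega>\<bar>)" "expectation (\<lambda>\<omega>. \<bar>W 0 \<omega>\<bar>) \<le> sqrt v"
      using expectation_abs_le_sqrt[OF Wm(1) isq] by (auto simp: v_def)
    have "expectation (\<lambda>\<omega>. F \<omega> * (Z \<omega> - \<beta>)) = expectation F * (expectation Z - \<beta>)"
    proof -
      define \<Psi> where "\<Psi> = (\<lambda>(x, y). (a x - a 0) * (B (y 2) (y (3::nat)) - \<beta>))"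
      have "expectation (\<lambda>\<omega>. \<Psi> (V 0 \<omega>, \<lambda>j\<in>{2,3}. V j \<omega>)) = (\<integral>x. expectation (\<lambda>\<omega>. \<Psi> (x, \<lambda>j\<in>{2,3}. V j \<omega>)) \<partial>distr M borel (V 0))"
      proof (rule gaussian_family_decouple(2)[OF V _ unc])
        show "\<Psi> \<in> borel_measurable (borel \<Otimes>\<^sub>M Pi\<^sub>M {2,3} (\<lambda>_. borel))"
          unfolding \<Psi>_def split_beta' by measurable
        show "\<bar>\<Psi> z\<bar> \<le> (2 * Ca) * (Cb + Cb)" for z
        proof (cases z)
          case (Pair x y)
          have 1: "\<bar>a x - a 0\<bar> \<le> 2 * Ca" using ab[of x] ab[of 0] by linarith
          have 2: "\<bar>B (y 2) (y 3) - \<beta>\<bar> \<le> Cb + Cb" using Bb[of "y 2" "y 3"] \<beta>b by linarith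
          show ?thesis unfolding Pair \<Psi>_def split_conv abs_mult by (intro mult_mono 1 2) (auto simp: Ca0)
        qed
      qed auto
      also have "\<dots> = (\<integral>x. (a x - a 0) * (expectation Z - \<beta>) \<partial>distr M borel (W 0))"
        using iZ unfolding V0 \<Psi>_def by (intro Bochner_Integration.integral_cong) (auto simp: Z_def[abs_def] prob_space)
      also have "\<dots> = expectation (\<lambda>\<omega>. F \<omega> * (expectation Z - \<beta>))"
        by (subst integral_distr) (auto simp: F_def)
      finally show ?thesis using V0 by (simp add: \<Psi>_def F_def [abs_def] Z_def)
    qed
    \<comment> \<open>The term with the independent Z is thereby of the same type as the others, a
      product of two quantities of order sqrt v.\<close>
    moreover have "expectation Z - \<beta> = - expectation D"
      using iB iZ by (simp add: D_def [abs_def] \<beta>_def)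
    ultimately have 1: "expectation (\<lambda>\<omega>. F \<omega> * (Z \<omega> - \<beta>)) = - (expectation F * expectation D)" by simp
    have aF: "\<bar>expectation F\<bar> \<le> Ka * sqrt v"
    proof -
      have "\<bar>expectation F\<bar> \<le> expectation (\<lambda>\<omega>. \<bar>F \<omega>\<bar>)" by (rule integral_abs_bound)
      also have "\<dots> \<le> expectation (\<lambda>\<omega>. Ka * \<bar>W 0 \<omega>\<bar>)"
        using iF EW Fle by (intro integral_mono integrable_abs) auto
      also have "\<dots> \<le> Ka * sqrt v" using EW(2) Ka by (simp add: mult_left_mono)
      finally show ?thesis .
    qed
    have aD: "\<bar>expectation D\<bar> \<le> C * sqrt v"
    proof -
      have "\<bar>expectation D\<bar> \<le> expectation (\<lambda>\<omega>. \<bar>D \<omega>\<bar>)" by (rule integral_abs_bound)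
      also have "\<dots> \<le> expectation (\<lambda>\<omega>. C * \<bar>W 0 \<omega>\<bar>)"
        using iD EW Dle by (intro integral_mono integrable_abs) auto
      also have "\<dots> \<le> C * sqrt v" using EW(2) C0 by (simp add: mult_left_mono)
      finally show ?thesis .
    qed
    have aFD: "\<bar>expectation (\<lambda>\<omega>. F \<omega> * D \<omega>)\<bar> \<le> Ka * C * v"
    proof -
      have "\<bar>expectation (\<lambda>\<omega>. F \<omega> * D \<omega>)\<bar> \<le> expectation (\<lambda>\<omega>. \<bar>F \<omega> * D \<omega>\<bar>)" by (rule integral_abs_bound)
      also have "\<dots> \<le> expectation (\<lambda>\<omega>. (Ka * C) * (W 0 \<omega>)\<^sup>2)"
      proof (rule integral_mono)
        fix \<omega>
        have "\<bar>F \<omega> * D \<omega>\<bar> \<le> (Ka * \<bar>W 0 \<omega>\<bar>) * (C * \<bar>W 0 \<omega>\<bar>)"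
          unfolding abs_mult using Ka by (intro mult_mono Fle Dle) auto
        also have "\<dots> = (Ka * C) * (\<bar>W 0 \<omega>\<bar> * \<bar>W 0 \<omega>\<bar>)" by (simp only: mult_ac)
        also have "\<dots> = (Ka * C) * (W 0 \<omega>)\<^sup>2" by (simp add: power2_eq_square)
        finally show "\<bar>F \<omega> * D \<omega>\<bar> \<le> (Ka * C) * (W 0 \<omega>)\<^sup>2" .
      qed (use iFD isq in auto)
      finally show ?thesis by (simp add: v_def)
    qed
    have "\<bar>expectation F * expectation D\<bar> \<le> (Ka * sqrt v) * (C * sqrt v)"
      unfolding abs_mult using Ka v0 by (intro mult_mono aF aD) auto
    also have "\<dots> = Ka * C * (sqrt v * sqrt v)" by (simp only: mult_ac)
    also have "\<dots> = Ka * C * v" using v0 by simp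
    finally have 2: "\<bar>expectation F * expectation D\<bar> \<le> Ka * C * v" .
    \<comment> \<open>Split with a = F + a 0 and B = D + Z. The part with the constant a 0 has mean
      zero; the other two are each at most Ka C v, hence the factor 2.\<close>
    have "expectation (\<lambda>\<omega>. a (W 0 \<omega>) * (B (W 2 \<omega>) (W 3 \<omega>) - \<beta>))
       = expectation (\<lambda>\<omega>. F \<omega> * D \<omega> + F \<omega> * (Z \<omega> - \<beta>) + a 0 * (B (W 2 \<omega>) (W 3 \<omega>) - \<beta>))"
      by (intro Bochner_Integration.integral_cong) (auto simp: F_def D_def algebra_simps)
    also have "\<dots> = expectation (\<lambda>\<omega>. F \<omega> * D \<omega>) + expectation (\<lambda>\<omega>. F \<omega> * (Z \<omega> - \<beta>)) + a 0 * (expectation (\<lambda>\<omega>. B (W 2 \<omega>) (W 3 \<omega>)) - \<beta>)"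
      using iFD iFZ iB by (simp add: prob_space)
    finally have 3: "\<bar>expectation (\<lambda>\<omega>. a (W 0 \<omega>) * (B (W 2 \<omega>) (W 3 \<omega>) - \<beta>))\<bar> \<le> 2 * (Ka * C * v)"
      using 1 2 aFD by (simp add: \<beta>_def)
    have "C * v = L * (\<bar>expectation (\<lambda>\<omega>. W 0 \<omega> * W 2 \<omega>)\<bar> + \<bar>expectation (\<lambda>\<omega>. W 0 \<omega> * W 3 \<omega>)\<bar>)"
      using vp by (simp add: C_def c_def field_simps)
    then have "2 * (Ka * C * v) = 2 * Ka * L * (\<bar>expectation (\<lambda>\<omega>. W 0 \<omega> * W 2 \<omega>)\<bar> + \<bar>expectation (\<lambda>\<omega>. W 0 \<omega> * W 3 \<omega>)\<bar>)"
      by (simp only: mult.assoc)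
    with 3 show ?thesis by (simp only: \<beta>_def)
  qed
qed

text \<open>Projecting off first the standardised variable \<open>W 0\<close> and then the residual of \<open>W 1\<close> keeps
  the bound linear in the cross covariances even if \<open>W 0\<close> and \<open>W 1\<close> are almost collinear: the
  variance of the residual cancels.\<close>

lemma gaussian_cov_pairs:
  fixes W :: "nat \<Rightarrow> 'a \<Rightarrow> real" and A B :: "real \<Rightarrow> real \<Rightarrow> real"
  assumes W: "gaussian_family M {0,2,3,4} W"
    and var: "expectation (\<lambda>\<omega>. (W 0 \<omega>)\<^sup>2) = 1"
    and r1: "\<bar>expectation (\<lambda>\<omega>. W 0 \<omega> * W 2 \<omega>)\<bar> \<le> 1"
    and Am: "(\<lambda>p. A (fst p) (snd p)) \<in> borel_measurable (borel \<Otimes>\<^sub>M borel)"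
    and AL: "\<And>x y y'. \<bar>A x y - A x y'\<bar> \<le> La * \<bar>y - y'\<bar>" and Ab: "\<And>x y. \<bar>A x y\<bar> \<le> Ca"
    and Bm: "(\<lambda>p. B (fst p) (snd p)) \<in> borel_measurable (borel \<Otimes>\<^sub>M borel)"
    and BL: "\<And>y z y' z'. \<bar>B y z - B y' z'\<bar> \<le> L * (\<bar>y - y'\<bar> + \<bar>z - z'\<bar>)"
    and Bb: "\<And>y z. \<bar>B y z\<bar> \<le> Cb"
  shows "\<bar>expectation (\<lambda>\<omega>. A (W 0 \<omega>) (W 2 \<omega>) * B (W 3 \<omega>) (W 4 \<omega>))
        - expectation (\<lambda>\<omega>. A (W 0 \<omega>) (W 2 \<omega>)) * expectation (\<lambda>\<omega>. B (W 3 \<omega>) (W 4 \<omega>))\<bar>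
    \<le> 2 * (Ca + La) * L * (\<bar>expectation (\<lambda>\<omega>. W 0 \<omega> * W 3 \<omega>)\<bar> + \<bar>expectation (\<lambda>\<omega>. W 0 \<omega> * W 4 \<omega>)\<bar>
        + \<bar>expectation (\<lambda>\<omega>. W 2 \<omega> * W 3 \<omega>)\<bar> + \<bar>expectation (\<lambda>\<omega>. W 2 \<omega> * W 4 \<omega>)\<bar>)"
proof -
  have Wm [measurable]: "W 0 \<in> borel_measurable M" "W 2 \<in> borel_measurable M" "W 3 \<in> borel_measurable M" "W 4 \<in> borel_measurable M"
    using gaussian_family_measurable[OF W] by auto
  have Bm1 [measurable]: "(\<lambda>x. B (f x) (g x)) \<in> borel_measurable N"
    if [measurable]: "f \<in> borel_measurable N" "g \<in> borel_measurable N" for f g and N :: "(real \<times> (nat \<Rightarrow> real)) measure"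
    using measurable_compose[OF measurable_Pair[OF that] Bm] by simp
  have Bm2 [measurable]: "(\<lambda>x. B (f x) (g x)) \<in> borel_measurable N"
    if [measurable]: "f \<in> borel_measurable N" "g \<in> borel_measurable N" for f g and N :: "'a measure"
    using measurable_compose[OF measurable_Pair[OF that] Bm] by simp
  have Am1 [measurable]: "(\<lambda>x. A (f x) (g x)) \<in> borel_measurable N"
    if [measurable]: "f \<in> borel_measurable N" "g \<in> borel_measurable N" for f g and N :: "(real \<times> (nat \<Rightarrow> real)) measure"
    using measurable_compose[OF measurable_Pair[OF that] Am] by simp
  have Am2 [measurable]: "(\<lambda>x. A (f x) (g x)) \<in> borel_measurable N"
    if [measurable]: "f \<in> borel_measurable N" "g \<in> borel_measurable N" for f g and N :: "'a measure"
    using measurable_compose[OF measurable_Pair[OF that] Am] by simp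
  have Am3 [measurable]: "(\<lambda>x. A (f x) (g x)) \<in> borel_measurable N"
    if [measurable]: "f \<in> borel_measurable N" "g \<in> borel_measurable N" for f g and N :: "real measure"
    using measurable_compose[OF measurable_Pair[OF that] Am] by simp
  have La: "La \<ge> 0" using AL[of 0 1 0] abs_ge_zero[of "A 0 1 - A 0 0"] by simp
  have L0: "L \<ge> 0" using BL[of 1 0 0 0] abs_ge_zero[of "B 1 0 - B 0 0"] by simp
  have Ca0: "Ca \<ge> 0" using Ab[of 0 0] by linarith
  define \<rho> where "\<rho> i j = expectation (\<lambda>\<omega>. W i \<omega> * W j \<omega>)" for i j
  \<comment> \<open>Residuals after regression on W 0; since W 0 has variance 1 the regression
    coefficient is the covariance itself.\<close>
  define V where "V j = (\<lambda>\<omega>. \<Sum>i\<in>{0,2,3,4}. (if i = j then 1 else if i = 0 then - \<rho> 0 j else 0) * W i \<omega>)" for j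
  have V: "gaussian_family M (insert 0 {2,3,4}) V"
    unfolding V_def by (rule gaussian_family_linear[OF W]) simp
  have V0: "V 0 = W 0" by (auto simp: V_def)
  have Vj: "V j = (\<lambda>\<omega>. W j \<omega> - \<rho> 0 j * W 0 \<omega>)" if "j \<in> {2,3,4}" for j
    using that by (auto simp: V_def)
  have iW: "integrable M (\<lambda>\<omega>. W i \<omega> * W j \<omega>)" if "i \<in> {0,2,3,4}" "j \<in> {0,2,3,4}" for i j
    using gaussian_family_mult[OF W that] .
  have isq: "integrable M (\<lambda>\<omega>. (W 0 \<omega>)\<^sup>2)" using gaussian_family_square[OF W] by simp
  have var': "expectation (\<lambda>\<omega>. W 0 \<omega> * W 0 \<omega>) = 1" using var by (simp add: power2_eq_square)
  have unc: "expectation (\<lambda>\<omega>. V 0 \<omega> * V j \<omega>) = 0" if "j \<in> {2,3,4}" for j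
  proof -
    have "expectation (\<lambda>\<omega>. V 0 \<omega> * V j \<omega>) = expectation (\<lambda>\<omega>. W 0 \<omega> * W j \<omega> - \<rho> 0 j * (W 0 \<omega> * W 0 \<omega>))"
      unfolding V0 Vj[OF that] by (intro Bochner_Integration.integral_cong) (auto simp: algebra_simps)
    also have "\<dots> = \<rho> 0 j - \<rho> 0 j * 1"
      unfolding \<rho>_def var'[symmetric]
      using that iW[of 0 0] iW[of 0 j] by (subst Bochner_Integration.integral_diff) (auto simp: var')
    finally show ?thesis by simp
  qed
  have cV: "expectation (\<lambda>\<omega>. V 2 \<omega> * V j \<omega>) = \<rho> 2 j - \<rho> 0 2 * \<rho> 0 j" if "j \<in> {3,4}" for j
  proof -
    have j: "j \<in> {2,3,4}" using that by auto
    have "expectation (\<lambda>\<omega>. V 2 \<omega> * V j \<omega>) = expectation (\<lambda>\<omega>. W 2 \<omega> * V j \<omega> - \<rho> 0 2 * (V 0 \<omega> * V j \<omega>))"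
      unfolding V0 by (intro Bochner_Integration.integral_cong) (auto simp: Vj algebra_simps)
    also have "\<dots> = expectation (\<lambda>\<omega>. W 2 \<omega> * V j \<omega>) - \<rho> 0 2 * 0"
    proof (subst Bochner_Integration.integral_diff)
      have "(\<lambda>\<omega>. W 2 \<omega> * V j \<omega>) = (\<lambda>\<omega>. W 2 \<omega> * W j \<omega> - \<rho> 0 j * (W 2 \<omega> * W 0 \<omega>))"
        by (auto simp: Vj[OF j] algebra_simps)
      then show "integrable M (\<lambda>\<omega>. W 2 \<omega> * V j \<omega>)"
        using iW[of 2 j] iW[of 2 0] that by auto
      show "integrable M (\<lambda>\<omega>. \<rho> 0 2 * (V 0 \<omega> * V j \<omega>))"
        using gaussian_family_mult[OF V, of 0 j] j by auto
    qed (use unc[OF j] in simp)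
    also have "expectation (\<lambda>\<omega>. W 2 \<omega> * V j \<omega>) = expectation (\<lambda>\<omega>. W 2 \<omega> * W j \<omega> - \<rho> 0 j * (W 0 \<omega> * W 2 \<omega>))"
      unfolding Vj[OF j] by (intro Bochner_Integration.integral_cong) (auto simp: algebra_simps)
    also have "\<dots> = \<rho> 2 j - \<rho> 0 j * \<rho> 0 2"
      unfolding \<rho>_def using iW[of 2 j] iW[of 0 2] that by (subst Bochner_Integration.integral_diff) auto
    finally show ?thesis by simp
  qed
  define a where "a \<omega> = A (W 0 \<omega>) (W 2 \<omega>)" for \<omega>
  define b where "b \<omega> = B (W 3 \<omega>) (W 4 \<omega>)" for \<omega>
  define b' where "b' \<omega> = B (V 3 \<omega>) (V 4 \<omega>)" for \<omega>
  have [measurable]: "V 2 \<in> borel_measurable M" "V 3 \<in> borel_measurable M" "V 4 \<in> borel_measurable M" by (simp_all add: Vj)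
  have [measurable]: "a \<in> borel_measurable M" "b \<in> borel_measurable M" "b' \<in> borel_measurable M"
    unfolding a_def [abs_def] b_def [abs_def] b'_def [abs_def] by measurable
  have ab: "\<bar>a \<omega>\<bar> \<le> Ca" and bb: "\<bar>b \<omega>\<bar> \<le> Cb" and bb': "\<bar>b' \<omega>\<bar> \<le> Cb" for \<omega>
    by (simp_all add: a_def b_def b'_def Ab Bb)
  have ia: "integrable M a" by (rule integrable_const_bound[where B=Ca]) (auto simp: ab)
  have ib: "integrable M b" by (rule integrable_const_bound[where B=Cb]) (auto simp: bb)
  have ib': "integrable M b'" by (rule integrable_const_bound[where B=Cb]) (auto simp: bb')
  have iab: "integrable M (\<lambda>\<omega>. a \<omega> * b \<omega>)" "integrable M (\<lambda>\<omega>. a \<omega> * b' \<omega>)"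
    by (rule integrable_bounded_mult[OF _ _ ab bb] integrable_bounded_mult[OF _ _ ab bb'], simp, simp)+
  \<comment> \<open>L^1 cost of replacing W 3 and W 4 by their residuals inside B. It is paid twice,
    in the mixed expectation and in the product of expectations.\<close>
  define \<delta> where "\<delta> = L * (\<bar>\<rho> 0 3\<bar> + \<bar>\<rho> 0 4\<bar>)"
  have \<delta>0: "\<delta> \<ge> 0" using L0 by (simp add: \<delta>_def)
  have bd: "\<bar>b \<omega> - b' \<omega>\<bar> \<le> \<delta> * \<bar>W 0 \<omega>\<bar>" for \<omega>
    using BL[of "W 3 \<omega>" "W 4 \<omega>" "V 3 \<omega>" "V 4 \<omega>"]
    by (simp add: b_def b'_def \<delta>_def Vj abs_mult algebra_simps)
  have EW: "integrable M (\<lambda>\<omega>. \<bar>W 0 \<omega>\<bar>)" "expectation (\<lambda>\<omega>. \<bar>W 0 \<omega>\<bar>) \<le> 1"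
    using expectation_abs_le_sqrt[OF Wm(1) isq] var by auto
  have Ebd: "expectation (\<lambda>\<omega>. \<bar>b \<omega> - b' \<omega>\<bar>) \<le> \<delta>"
  proof -
    have "expectation (\<lambda>\<omega>. \<bar>b \<omega> - b' \<omega>\<bar>) \<le> expectation (\<lambda>\<omega>. \<delta> * \<bar>W 0 \<omega>\<bar>)"
      using ib ib' EW bd by (intro integral_mono integrable_abs) auto
    also have "\<dots> \<le> \<delta> * 1" using EW(2) \<delta>0 by (simp add: mult_left_le)
    finally show ?thesis by simp
  qed
  have s1: "\<bar>expectation (\<lambda>\<omega>. a \<omega> * b \<omega>) - expectation (\<lambda>\<omega>. a \<omega> * b' \<omega>)\<bar> \<le> Ca * \<delta>"
  proof -
    have "expectation (\<lambda>\<omega>. a \<omega> * b \<omega>) - expectation (\<lambda>\<omega>. a \<omega> * b' \<omega>) = expectation (\<lambda>\<omega>. a \<omega> * b \<omega> - a \<omega> * b' \<omega>)"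
      using iab by simp
    also have "\<bar>\<dots>\<bar> \<le> expectation (\<lambda>\<omega>. \<bar>a \<omega> * b \<omega> - a \<omega> * b' \<omega>\<bar>)"
      by (rule integral_abs_bound)
    also have "\<dots> \<le> expectation (\<lambda>\<omega>. Ca * \<bar>b \<omega> - b' \<omega>\<bar>)"
    proof (rule integral_mono)
      show "\<bar>a \<omega> * b \<omega> - a \<omega> * b' \<omega>\<bar> \<le> Ca * \<bar>b \<omega> - b' \<omega>\<bar>" for \<omega>
        unfolding right_diff_distrib[symmetric] abs_mult by (intro mult_right_mono ab) auto
    qed (use iab ib ib' in auto)
    also have "\<dots> \<le> Ca * \<delta>" using Ebd Ca0 by (simp add: mult_left_mono)
    finally show ?thesis .
  qed
  have s2: "\<bar>expectation b - expectation b'\<bar> \<le> \<delta>"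
  proof -
    have "\<bar>expectation b - expectation b'\<bar> = \<bar>expectation (\<lambda>\<omega>. b \<omega> - b' \<omega>)\<bar>"
      using ib ib' by simp
    also have "\<dots> \<le> expectation (\<lambda>\<omega>. \<bar>b \<omega> - b' \<omega>\<bar>)" by (rule integral_abs_bound)
    finally show ?thesis using Ebd by simp
  qed
  have s2': "\<bar>expectation a * (expectation b' - expectation b)\<bar> \<le> Ca * \<delta>"
    unfolding abs_mult using abs_expectation_le[of a Ca] ab s2 Ca0
    by (intro mult_mono) (auto simp: abs_minus_commute)
  define \<beta> where "\<beta> = expectation b'"
  define E where "E = 2 * La * L * (\<bar>\<rho> 0 3\<bar> + \<bar>\<rho> 0 4\<bar> + \<bar>\<rho> 2 3\<bar> + \<bar>\<rho> 2 4\<bar>)"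
  have s3: "\<bar>expectation (\<lambda>\<omega>. a \<omega> * (b' \<omega> - \<beta>))\<bar> \<le> E"
  proof -
    define \<Psi> where "\<Psi> = (\<lambda>(x, y). A x (y (2::nat) + \<rho> 0 2 * x) * (B (y 3) (y 4) - \<beta>))"
    have \<beta>b: "\<bar>\<beta>\<bar> \<le> Cb" unfolding \<beta>_def by (rule abs_expectation_le) (rule bb')
    have "expectation (\<lambda>\<omega>. \<Psi> (V 0 \<omega>, \<lambda>j\<in>{2,3,4}. V j \<omega>)) = (\<integral>x. expectation (\<lambda>\<omega>. \<Psi> (x, \<lambda>j\<in>{2,3,4}. V j \<omega>)) \<partial>distr M borel (V 0))"
    proof (rule gaussian_family_decouple(2)[OF V _ unc])
      show "\<Psi> \<in> borel_measurable (borel \<Otimes>\<^sub>M Pi\<^sub>M {2,3,4} (\<lambda>_. borel))"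
        unfolding \<Psi>_def split_beta' by measurable
      show "\<bar>\<Psi> z\<bar> \<le> Ca * (Cb + Cb)" for z
      proof (cases z)
        case (Pair x y)
        have 2: "\<bar>B (y 3) (y 4) - \<beta>\<bar> \<le> Cb + Cb" using Bb[of "y 3" "y 4"] \<beta>b by linarith
        show ?thesis unfolding Pair \<Psi>_def split_conv abs_mult by (intro mult_mono Ab 2) (auto simp: Ca0)
      qed
    qed auto
    moreover have "expectation (\<lambda>\<omega>. \<Psi> (V 0 \<omega>, \<lambda>j\<in>{2,3,4}. V j \<omega>)) = expectation (\<lambda>\<omega>. a \<omega> * (b' \<omega> - \<beta>))"
      by (simp add: \<Psi>_def a_def b'_def V0 Vj)
    moreover have "\<bar>\<integral>x. expectation (\<lambda>\<omega>. \<Psi> (x, \<lambda>j\<in>{2,3,4}. V j \<omega>)) \<partial>distr M borel (V 0)\<bar> \<le> E"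
    proof (rule prob_space.abs_expectation_le)
      show "prob_space (distr M borel (V 0))" by (rule prob_space_distr) (simp add: V0)
      fix x
      \<comment> \<open>With the value x of W 0 frozen, A depends only on the residual V 2 of its
        second argument; V 2 becomes the pivot of \<open>gaussian_cov_pivot\<close>, for the shifted
        function y -> A x (y + \<rho> 0 2 * x).\<close>
      define U where "U j = V (if j = 0 then 2 else if j = 2 then 3 else 4)" for j :: nat
      have U: "gaussian_family M {0,2,3} U"
        unfolding U_def by (rule gaussian_family_reindex[OF V]) auto
      have Us: "U 0 = V 2" "U 2 = V 3" "U 3 = V 4" by (auto simp: U_def)
      have "\<bar>expectation (\<lambda>\<omega>. A x (U 0 \<omega> + \<rho> 0 2 * x) * (B (U 2 \<omega>) (U 3 \<omega>) - expectation (\<lambda>\<omega>. B (U 2 \<omega>) (U 3 \<omega>))))\<bar>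
         \<le> 2 * La * L * (\<bar>expectation (\<lambda>\<omega>. U 0 \<omega> * U 2 \<omega>)\<bar> + \<bar>expectation (\<lambda>\<omega>. U 0 \<omega> * U 3 \<omega>)\<bar>)"
      proof (rule gaussian_cov_pivot[where a="\<lambda>y. A x (y + \<rho> 0 2 * x)", OF U _ _ _ Bm BL Bb])
        show "\<bar>A x (y + \<rho> 0 2 * x) - A x (y' + \<rho> 0 2 * x)\<bar> \<le> La * \<bar>y - y'\<bar>" for y y'
          using AL[of x "y + \<rho> 0 2 * x" "y' + \<rho> 0 2 * x"] by simp
        show "\<bar>A x (y + \<rho> 0 2 * x)\<bar> \<le> Ca" for y by (rule Ab)
      qed measurable
      also have "\<dots> = 2 * La * L * (\<bar>\<rho> 2 3 - \<rho> 0 2 * \<rho> 0 3\<bar> + \<bar>\<rho> 2 4 - \<rho> 0 2 * \<rho> 0 4\<bar>)"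
        unfolding Us by (simp add: cV)
      also have "\<dots> \<le> E"
      proof -
        \<comment> \<open>The covariances of the residuals contain products; as the correlation of
          the first pair is at most 1, the bound stays linear in the cross covariances.\<close>
        have 1: "\<bar>\<rho> 0 2 * \<rho> 0 j\<bar> \<le> \<bar>\<rho> 0 j\<bar>" for j
          using r1 by (simp add: abs_mult \<rho>_def mult_left_le_one_le)
        have "\<bar>\<rho> 2 3 - \<rho> 0 2 * \<rho> 0 3\<bar> + \<bar>\<rho> 2 4 - \<rho> 0 2 * \<rho> 0 4\<bar> \<le> \<bar>\<rho> 0 3\<bar> + \<bar>\<rho> 0 4\<bar> + \<bar>\<rho> 2 3\<bar> + \<bar>\<rho> 2 4\<bar>"
          using 1[of 3] 1[of 4] by linarith
        then show ?thesis unfolding E_def using La L0 by (intro mult_left_mono) auto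
      qed
      finally show "\<bar>expectation (\<lambda>\<omega>. \<Psi> (x, \<lambda>j\<in>{2,3,4}. V j \<omega>))\<bar> \<le> E"
        by (simp add: \<Psi>_def Us \<beta>_def b'_def [abs_def])
    qed
    ultimately show ?thesis by simp
  qed
  have "expectation (\<lambda>\<omega>. a \<omega> * (b' \<omega> - \<beta>)) = expectation (\<lambda>\<omega>. a \<omega> * b' \<omega> - \<beta> * a \<omega>)"
    by (intro Bochner_Integration.integral_cong) (auto simp: algebra_simps)
  then have s3': "expectation (\<lambda>\<omega>. a \<omega> * (b' \<omega> - \<beta>)) = expectation (\<lambda>\<omega>. a \<omega> * b' \<omega>) - \<beta> * expectation a"
    using iab ia by simp
  have "expectation (\<lambda>\<omega>. a \<omega> * b \<omega>) - expectation a * expectation b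
     = (expectation (\<lambda>\<omega>. a \<omega> * b \<omega>) - expectation (\<lambda>\<omega>. a \<omega> * b' \<omega>))
     + expectation (\<lambda>\<omega>. a \<omega> * (b' \<omega> - \<beta>)) + expectation a * (expectation b' - expectation b)"
    unfolding s3' by (simp add: \<beta>_def algebra_simps)
  then have "\<bar>expectation (\<lambda>\<omega>. a \<omega> * b \<omega>) - expectation a * expectation b\<bar> \<le> Ca * \<delta> + E + Ca * \<delta>"
    using s1 s2' s3 by linarith
  also have "\<dots> \<le> 2 * (Ca + La) * L * (\<bar>\<rho> 0 3\<bar> + \<bar>\<rho> 0 4\<bar> + \<bar>\<rho> 2 3\<bar> + \<bar>\<rho> 2 4\<bar>)"
  proof -
    have "Ca * \<delta> \<le> Ca * (L * (\<bar>\<rho> 0 3\<bar> + \<bar>\<rho> 0 4\<bar> + \<bar>\<rho> 2 3\<bar> + \<bar>\<rho> 2 4\<bar>))"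
      unfolding \<delta>_def using Ca0 L0 by (intro mult_left_mono) auto
    then show ?thesis by (simp add: E_def algebra_simps)
  qed
  finally show ?thesis by (simp add: a_def [abs_def] b_def [abs_def] \<rho>_def)
qed

text \<open>Given the residuals of the W j after regression on W p, the sum inside f is a function
  of the standard normal W p alone, so the one-dimensional formula applies to q times that function;
  differentiating the regression terms produces the covariances. Bounds on f and f' are required
  only at values the sum can take, since the derivative of the later Stein solution is bounded only
  locally.\<close>

lemma gauss_ibp_finite:
  fixes W :: "'i \<Rightarrow> 'a \<Rightarrow> real"
  assumes W: "gaussian_family M (insert p J) W" and p: "p \<notin> J"
    and var: "expectation (\<lambda>\<omega>. (W p \<omega>)\<^sup>2) = 1"
    and dq: "\<And>x. (q has_real_derivative q' x) (at x)" and cq: "\<And>x. isCont q' x"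
    and dg: "\<And>x. (g has_real_derivative g' x) (at x)" and cg: "\<And>x. isCont g' x"
    and df: "\<And>x. (f has_real_derivative f' x) (at x)" and cf: "\<And>x. isCont f' x"
    and Q: "\<And>x. \<bar>q x\<bar> \<le> Q" and R: "\<And>x. \<bar>x * q x - q' x\<bar> \<le> R" and G: "\<And>x. \<bar>g' x\<bar> \<le> G"
    and f0: "\<And>z :: 'i \<Rightarrow> real. \<bar>f (c * (\<Sum>j\<in>J. g (z j)))\<bar> \<le> F"
    and f1: "\<And>z :: 'i \<Rightarrow> real. \<bar>f' (c * (\<Sum>j\<in>J. g (z j)))\<bar> \<le> F"
  shows "expectation (\<lambda>\<omega>. (W p \<omega> * q (W p \<omega>) - q' (W p \<omega>)) * f (c * (\<Sum>j\<in>J. g (W j \<omega>))))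
    = expectation (\<lambda>\<omega>. q (W p \<omega>) * (f' (c * (\<Sum>j\<in>J. g (W j \<omega>)))
        * (c * (\<Sum>j\<in>J. expectation (\<lambda>\<omega>. W p \<omega> * W j \<omega>) * g' (W j \<omega>)))))"
proof -
  have J: "finite J" using gaussian_family_finite[OF W] by simp
  have Wm [measurable]: "W p \<in> borel_measurable M" "\<And>j. j \<in> J \<Longrightarrow> W j \<in> borel_measurable M"
    using gaussian_family_measurable[OF W] by auto
  have bm: "h \<in> borel_measurable borel" if "\<And>x. isCont h x" for h :: "real \<Rightarrow> real"
    using that by (intro borel_measurable_continuous_onI continuous_at_imp_continuous_on) auto
  have Cq: "isCont q x" and Cg: "isCont g x" and Cf: "isCont f x" for x
    using dq dg df DERIV_isCont by blast+
  have [measurable]: "q \<in> borel_measurable borel" "q' \<in> borel_measurable borel" "g \<in> borel_measurable borel"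
    "g' \<in> borel_measurable borel" "f \<in> borel_measurable borel" "f' \<in> borel_measurable borel"
    by (intro bm cq cg cf Cq Cg Cf)+
  define r where "r j = expectation (\<lambda>\<omega>. W p \<omega> * W j \<omega>)" for j
  define V where "V j = (\<lambda>\<omega>. \<Sum>i\<in>insert p J. (if i = j then 1 else if i = p then - r j else 0) * W i \<omega>)" for j
  have V: "gaussian_family M (insert p J) V"
    unfolding V_def using J by (intro gaussian_family_linear[OF W]) simp
  have Vp: "V p = W p"
  proof
    fix \<omega>
    have "(\<Sum>i\<in>J. (if i = p then 1 else if i = p then - r p else 0) * W i \<omega>) = 0"
      using p by (intro sum.neutral) auto
    then show "V p \<omega> = W p \<omega>" using J p by (simp add: V_def)
  qed
  have Vj: "V j \<omega> = W j \<omega> - r j * W p \<omega>" if "j \<in> J" for j \<omega>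
  proof -
    have "(\<Sum>i\<in>J. (if i = j then 1 else if i = p then - r j else 0) * W i \<omega>) = (\<Sum>i\<in>J. if i = j then W i \<omega> else 0)"
      using p by (intro sum.cong) auto
    also have "\<dots> = W j \<omega>" using J that by simp
    finally show ?thesis using J p that by (auto simp: V_def)
  qed
  have unc: "expectation (\<lambda>\<omega>. V p \<omega> * V j \<omega>) = 0" if "j \<in> J" for j
  proof -
    have "expectation (\<lambda>\<omega>. V p \<omega> * V j \<omega>) = expectation (\<lambda>\<omega>. W p \<omega> * W j \<omega> - r j * (W p \<omega>)\<^sup>2)"
      unfolding Vp by (intro Bochner_Integration.integral_cong) (auto simp: Vj[OF that] algebra_simps power2_eq_square)
    also have "\<dots> = r j - r j * 1"
      unfolding r_def using gaussian_family_mult[OF W, of p j] gaussian_family_square[OF W, of p] that var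
      by (subst Bochner_Integration.integral_diff) auto
    finally show ?thesis by simp
  qed
  \<comment> \<open>The pivot is x and y are the residuals; B below is the derivative of A in x, and
    \<Psi> the difference of the two integrands to be compared.\<close>
  define A where "A x y = f (c * (\<Sum>j\<in>J. g (r j * x + y j)))" for x and y :: "'i \<Rightarrow> real"
  define B where "B x y = f' (c * (\<Sum>j\<in>J. g (r j * x + y j))) * (c * (\<Sum>j\<in>J. r j * g' (r j * x + y j)))"
    for x and y :: "'i \<Rightarrow> real"
  define D where "D = F * (\<bar>c\<bar> * (\<Sum>j\<in>J. \<bar>r j\<bar> * G))"
  define \<Psi> where "\<Psi> = (\<lambda>(x, y). (x * q x - q' x) * A x y - q x * B x y)"
  have F0: "F \<ge> 0" using order_trans[OF abs_ge_zero f0] .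
  have Q0: "Q \<ge> 0" using order_trans[OF abs_ge_zero Q] .
  have Ab: "\<bar>A x y\<bar> \<le> F" for x y unfolding A_def by (rule f0)
  have Bb: "\<bar>B x y\<bar> \<le> D" for x y
    unfolding B_def D_def abs_mult using F0
    by (intro mult_mono f1 order_trans[OF sum_abs] sum_mono) (auto simp: abs_mult intro!: mult_mono G)
  have dA: "((\<lambda>x. A x y) has_real_derivative B x y) (at x)" for x y
    unfolding A_def B_def
    by (rule DERIV_chain2[OF df DERIV_cmult[OF DERIV_sum]])
       (rule DERIV_cong[OF DERIV_chain2[OF dg]], auto intro!: derivative_eq_intros)
  have cB: "isCont (\<lambda>x. B x y) x" for x y
    unfolding B_def by (intro continuous_intros isCont_o2[OF _ cf] isCont_o2[OF _ cg] isCont_o2[OF _ Cg])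
  have \<Psi>b: "\<bar>\<Psi> z\<bar> \<le> R * F + Q * D" for z
  proof (cases z)
    case (Pair x y)
    have "\<bar>\<Psi> z\<bar> \<le> \<bar>(x * q x - q' x) * A x y\<bar> + \<bar>q x * B x y\<bar>"
      unfolding Pair \<Psi>_def split_conv by (rule abs_triangle_ineq4)
    also have "\<dots> \<le> R * F + Q * D"
      unfolding abs_mult[of _ "A x y"] abs_mult[of _ "B x y"] using order_trans[OF abs_ge_zero R] Q0
      by (intro add_mono mult_mono Ab Bb R Q) auto
    finally show ?thesis .
  qed
  have \<Psi>0: "(\<integral>x. \<Psi> (x, y) \<partial>gam) = 0" for y
  proof -
    have "(\<integral>x. (q' x * A x y + q x * B x y - x *\<^sub>R (q x * A x y)) \<partial>gam) = 0"
    proof (rule gauss_ibp[where p="[:Q * F:]"])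
      show "((\<lambda>x. q x * A x y) has_vector_derivative q' x * A x y + q x * B x y) (at x)" for x
        unfolding has_real_derivative_iff_has_vector_derivative[symmetric]
        by (rule DERIV_cong[OF DERIV_mult[OF dq dA]]) simp
      show "isCont (\<lambda>x. q' x * A x y + q x * B x y) x" for x
        using dA DERIV_isCont by (intro continuous_intros cq Cq cB) blast
      show "norm (q x * A x y) \<le> \<bar>poly [:Q * F:] x\<bar>" for x
        using mult_mono[OF Q Ab Q0 abs_ge_zero, of x x y] F0 Q0 by (simp add: abs_mult)
      have "(\<lambda>x. \<Psi> (x, y)) \<in> borel_measurable borel"
        unfolding \<Psi>_def A_def B_def by simp
      then have "integrable gam (\<lambda>x. \<Psi> (x, y))"
        by (intro gam.integrable_const_bound[where B="R * F + Q * D"]) (auto simp: \<Psi>b)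
      \<comment> \<open>Only the combination is bounded: x q and q' enter through x q - q', on which
        the hypothesis \<open>R\<close> acts.\<close>
      then have "integrable gam (\<lambda>x. - \<Psi> (x, y))" by simp
      moreover have "(\<lambda>x. - \<Psi> (x, y)) = (\<lambda>x. q' x * A x y + q x * B x y - x *\<^sub>R (q x * A x y))"
        by (simp add: \<Psi>_def algebra_simps)
      ultimately show "integrable gam (\<lambda>x. q' x * A x y + q x * B x y - x *\<^sub>R (q x * A x y))" by simp
    qed
    moreover have "(\<lambda>x. (q' x * A x y + q x * B x y - x *\<^sub>R (q x * A x y))) = (\<lambda>x. - \<Psi> (x, y))"
      by (simp add: \<Psi>_def algebra_simps)
    ultimately show ?thesis by simp
  qed
  have "expectation (\<lambda>\<omega>. \<Psi> (V p \<omega>, \<lambda>j\<in>J. V j \<omega>)) = expectation (\<lambda>\<omega>. \<integral>x. \<Psi> (x, \<lambda>j\<in>J. V j \<omega>) \<partial>distr M borel (V p))"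
  proof (rule gaussian_family_decouple(1)[OF V p unc _ \<Psi>b])
    show "\<Psi> \<in> borel_measurable (borel \<Otimes>\<^sub>M Pi\<^sub>M J (\<lambda>_. borel))"
      unfolding \<Psi>_def A_def B_def split_beta' by measurable
  qed
  also have "distr M borel (V p) = gam"
    using gaussian_family_std_normal[OF W _ var] by (simp add: Vp)
  also have "expectation (\<lambda>\<omega>. \<integral>x. \<Psi> (x, \<lambda>j\<in>J. V j \<omega>) \<partial>gam) = 0"
    unfolding \<Psi>0 by simp
  finally have 0: "expectation (\<lambda>\<omega>. \<Psi> (V p \<omega>, \<lambda>j\<in>J. V j \<omega>)) = 0" .
  let ?a = "\<lambda>\<omega>. (W p \<omega> * q (W p \<omega>) - q' (W p \<omega>)) * f (c * (\<Sum>j\<in>J. g (W j \<omega>)))"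
  let ?b = "\<lambda>\<omega>. q (W p \<omega>) * (f' (c * (\<Sum>j\<in>J. g (W j \<omega>))) * (c * (\<Sum>j\<in>J. r j * g' (W j \<omega>))))"
  have eq: "\<Psi> (V p \<omega>, \<lambda>j\<in>J. V j \<omega>) = ?a \<omega> - ?b \<omega>" for \<omega>
    by (simp add: \<Psi>_def A_def B_def Vp Vj cong: sum.cong)
  have ia: "integrable M ?a"
    by (rule integrable_bounded_mult[where a=R and b=F]) (auto intro: R f0)
  have ib: "integrable M ?b"
  proof (rule integrable_bounded_mult[where a=Q and b=D])
    show "\<bar>f' (c * (\<Sum>j\<in>J. g (W j \<omega>))) * (c * (\<Sum>j\<in>J. r j * g' (W j \<omega>)))\<bar> \<le> D" for \<omega>
      unfolding D_def abs_mult using F0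
      by (intro mult_mono f1 order_trans[OF sum_abs] sum_mono) (auto simp: abs_mult intro!: mult_mono G)
  qed (auto intro: Q)
  show ?thesis
    using 0 unfolding eq Bochner_Integration.integral_diff[OF ia ib] by (simp add: r_def)
qed

end

text \<open>Replaces the sampling of independent uniform points: if \<open>n\<close> points are chosen, the next one
  can be chosen such that the cross term is nonpositive, because it averages to zero.\<close>

lemma greedy_sampling:
  fixes a b :: "'t \<Rightarrow> 'a \<Rightarrow> real" and n :: nat and K m :: real
  assumes M: "prob_space M" and N: "finite_measure N" and m: "measure N (space N) = m" "m > 0"
    and am: "(\<lambda>(t, \<omega>). a t \<omega>) \<in> borel_measurable (N \<Otimes>\<^sub>M M)"
    and bm: "(\<lambda>(t, \<omega>). b t \<omega>) \<in> borel_measurable (N \<Otimes>\<^sub>M M)"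
    and ab: "\<And>t \<omega>. \<bar>a t \<omega>\<bar> \<le> K" and bb: "\<And>t \<omega>. \<bar>b t \<omega>\<bar> \<le> K"
  shows "\<exists>ts. (\<forall>i<n. ts i \<in> space N) \<and>
     (\<integral>\<omega>. (\<Sum>i<n. a (ts i) \<omega> - (\<integral>t. a t \<omega> \<partial>N) / m)\<^sup>2 \<partial>M)
     + (\<integral>\<omega>. (\<Sum>i<n. b (ts i) \<omega> - (\<integral>t. b t \<omega> \<partial>N) / m)\<^sup>2 \<partial>M) \<le> n * (8 * K\<^sup>2)"
proof -
  interpret M: prob_space M by fact
  interpret N: finite_measure N by fact
  interpret NM: pair_sigma_finite N M ..
  \<comment> \<open>The error of a single sample against the mean over N. It averages to zero in t
    for every outcome, hence so do its products with a bounded S that does not depend on t.\<close>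
  define D where "D f t \<omega> = f t \<omega> - (\<integral>t. f t \<omega> \<partial>N) / m" for f :: "'t \<Rightarrow> 'a \<Rightarrow> real" and t \<omega>
  have K0: "K \<ge> 0" using order_trans[OF abs_ge_zero ab] .
  have fin: "finite_measure (N \<Otimes>\<^sub>M M)"
    by (intro finite_measure_pair_measure N.finite_measure_axioms M.finite_measure_axioms)
  have *: "(\<lambda>(t, \<omega>). D f t \<omega>) \<in> borel_measurable (N \<Otimes>\<^sub>M M) \<and> (\<forall>t \<omega>. \<bar>D f t \<omega>\<bar> \<le> 2 * K) \<and>
     (\<forall>t\<in>space N. D f t \<in> borel_measurable M) \<and>
     (\<forall>S C. S \<in> borel_measurable M \<longrightarrow> (\<forall>\<omega>. \<bar>S \<omega>\<bar> \<le> C) \<longrightarrow>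
        integrable N (\<lambda>t. M.expectation (\<lambda>\<omega>. S \<omega> * D f t \<omega>)) \<and> (\<integral>t. M.expectation (\<lambda>\<omega>. S \<omega> * D f t \<omega>) \<partial>N) = 0)"
    if fm: "(\<lambda>(t, \<omega>). f t \<omega>) \<in> borel_measurable (N \<Otimes>\<^sub>M M)" and fb: "\<And>t \<omega>. \<bar>f t \<omega>\<bar> \<le> K" for f
  proof -
    note [measurable] = fm
    have 1 [measurable]: "(\<lambda>\<omega>. \<integral>t. f t \<omega> \<partial>N) \<in> borel_measurable M"
    proof (rule N.borel_measurable_lebesgue_integral)
      show "(\<lambda>(\<omega>, t). f t \<omega>) \<in> borel_measurable (M \<Otimes>\<^sub>M N)"
        using measurable_compose[OF measurable_pair_swap' fm] by (simp add: split_beta')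
    qed
    have 2: "(\<lambda>(t, \<omega>). D f t \<omega>) \<in> borel_measurable (N \<Otimes>\<^sub>M M)"
      unfolding D_def split_beta' using fm by (simp add: split_beta')
    have ib: "\<bar>\<integral>t. f t \<omega> \<partial>N\<bar> \<le> m * K" for \<omega>
    proof (cases "integrable N (\<lambda>t. f t \<omega>)")
      case True
      have "\<bar>\<integral>t. f t \<omega> \<partial>N\<bar> \<le> (\<integral>t. \<bar>f t \<omega>\<bar> \<partial>N)" by (rule integral_abs_bound)
      also have "\<dots> \<le> (\<integral>t. K \<partial>N)" using True fb by (intro integral_mono) auto
      finally show ?thesis using m by simp
    next
      case False
      then show ?thesis using m K0 by (simp add: not_integrable_integral_eq)
    qed
    have 3: "\<bar>D f t \<omega>\<bar> \<le> 2 * K" for t \<omega>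
    proof -
      have "\<bar>(\<integral>t. f t \<omega> \<partial>N) / m\<bar> \<le> K" using ib[of \<omega>] m by (simp add: abs_div divide_le_eq mult.commute)
      then show ?thesis unfolding D_def using fb[of t \<omega>] by linarith
    qed
    have 4: "D f t \<in> borel_measurable M" if "t \<in> space N" for t
      using measurable_compose[OF measurable_Pair1'[OF that] 2] by simp
    have 5: "integrable N (\<lambda>t. M.expectation (\<lambda>\<omega>. S \<omega> * D f t \<omega>))"
      "(\<integral>t. M.expectation (\<lambda>\<omega>. S \<omega> * D f t \<omega>) \<partial>N) = 0"
      if S [measurable]: "S \<in> borel_measurable M" and SC: "\<And>\<omega>. \<bar>S \<omega>\<bar> \<le> C" for S C
    proof -
      have "(\<lambda>(t, \<omega>). S \<omega> * D f t \<omega>) \<in> borel_measurable (N \<Otimes>\<^sub>M M)"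
        using 2 unfolding split_beta' by simp
      then have i: "integrable (N \<Otimes>\<^sub>M M) (\<lambda>(t, \<omega>). S \<omega> * D f t \<omega>)"
      proof (rule finite_measure.integrable_const_bound[OF fin, rotated])
        show "AE x in N \<Otimes>\<^sub>M M. norm (case x of (t, \<omega>) \<Rightarrow> S \<omega> * D f t \<omega>) \<le> C * (2 * K)"
          using order_trans[OF abs_ge_zero SC] by (auto simp: abs_mult intro!: AE_I2 mult_mono SC 3)
      qed
      show "integrable N (\<lambda>t. M.expectation (\<lambda>\<omega>. S \<omega> * D f t \<omega>))"
        using NM.integrable_fst'[OF i] by simp
      have "(\<integral>t. M.expectation (\<lambda>\<omega>. S \<omega> * D f t \<omega>) \<partial>N) = M.expectation (\<lambda>\<omega>. \<integral>t. S \<omega> * D f t \<omega> \<partial>N)"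
        using NM.Fubini_integral[OF i] by simp
      also have "\<dots> = M.expectation (\<lambda>\<omega>. 0)"
      proof (rule Bochner_Integration.integral_cong[OF refl])
        fix \<omega> assume w: "\<omega> \<in> space M"
        have "(\<lambda>t. f t \<omega>) \<in> borel_measurable N"
          using measurable_compose[OF measurable_Pair2'[OF w] fm] by simp
        then have "integrable N (\<lambda>t. f t \<omega>)"
          by (intro N.integrable_const_bound[where B=K]) (auto simp: fb)
        then have "(\<integral>t. D f t \<omega> \<partial>N) = 0"
          using m by (simp add: D_def)
        then show "(\<integral>t. S \<omega> * D f t \<omega> \<partial>N) = 0" by simp
      qed
      finally show "(\<integral>t. M.expectation (\<lambda>\<omega>. S \<omega> * D f t \<omega>) \<partial>N) = 0" by simp
    qed
    from 2 3 4 5 show ?thesis by blast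
  qed
  note Da = *[OF am ab] and Db = *[OF bm bb]
  have D4: "integrable N (\<lambda>t. M.expectation (\<lambda>\<omega>. S \<omega> * D a t \<omega>))" "(\<integral>t. M.expectation (\<lambda>\<omega>. S \<omega> * D a t \<omega>) \<partial>N) = 0"
    if "S \<in> borel_measurable M" "\<And>\<omega>. \<bar>S \<omega>\<bar> \<le> C" for S C
    using Da that by blast+
  have D4': "integrable N (\<lambda>t. M.expectation (\<lambda>\<omega>. S \<omega> * D b t \<omega>))" "(\<integral>t. M.expectation (\<lambda>\<omega>. S \<omega> * D b t \<omega>) \<partial>N) = 0"
    if "S \<in> borel_measurable M" "\<And>\<omega>. \<bar>S \<omega>\<bar> \<le> C" for S C
    using Db that by blast+
  have Dm: "D a t \<in> borel_measurable M" "D b t \<in> borel_measurable M" if "t \<in> space N" for t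
    using Da Db that by blast+
  have Dbd: "\<bar>D a t \<omega>\<bar> \<le> 2 * K" "\<bar>D b t \<omega>\<bar> \<le> 2 * K" for t \<omega>
    using Da Db by blast+
  have "\<exists>ts. (\<forall>i<n. ts i \<in> space N) \<and>
     M.expectation (\<lambda>\<omega>. (\<Sum>i<n. D a (ts i) \<omega>)\<^sup>2) + M.expectation (\<lambda>\<omega>. (\<Sum>i<n. D b (ts i) \<omega>)\<^sup>2) \<le> n * (8 * K\<^sup>2)"
  proof (induction n)
    case (Suc n)
    then obtain ts where ts: "\<And>i. i < n \<Longrightarrow> ts i \<in> space N"
      and le: "M.expectation (\<lambda>\<omega>. (\<Sum>i<n. D a (ts i) \<omega>)\<^sup>2) + M.expectation (\<lambda>\<omega>. (\<Sum>i<n. D b (ts i) \<omega>)\<^sup>2) \<le> n * (8 * K\<^sup>2)"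
      by blast
    define Sa where "Sa \<omega> = (\<Sum>i<n. D a (ts i) \<omega>)" for \<omega>
    define Sb where "Sb \<omega> = (\<Sum>i<n. D b (ts i) \<omega>)" for \<omega>
    have Sm: "Sa \<in> borel_measurable M" "Sb \<in> borel_measurable M"
      unfolding Sa_def [abs_def] Sb_def [abs_def] using Dm ts by (auto intro!: borel_measurable_sum)
    have Sbd: "\<bar>Sa \<omega>\<bar> \<le> n * (2 * K)" "\<bar>Sb \<omega>\<bar> \<le> n * (2 * K)" for \<omega>
      unfolding Sa_def Sb_def using sum_bounded_above[of "{..<n}" _ "2 * K", OF Dbd(1)] sum_bounded_above[of "{..<n}" _ "2 * K", OF Dbd(2)]
      by (auto intro!: order_trans[OF sum_abs])
    \<comment> \<open>The two cross terms are added, so that a single point t serves both functions.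
      The sum has integral zero over N, and N has positive mass, so it cannot be positive
      everywhere.\<close>
    define \<phi> where "\<phi> t = M.expectation (\<lambda>\<omega>. Sa \<omega> * D a t \<omega>) + M.expectation (\<lambda>\<omega>. Sb \<omega> * D b t \<omega>)" for t
    have i\<phi>: "integrable N \<phi>" and \<phi>0: "(\<integral>t. \<phi> t \<partial>N) = 0"
      unfolding \<phi>_def [abs_def] using D4[OF Sm(1) Sbd(1)] D4'[OF Sm(2) Sbd(2)] by simp_all
    have "\<exists>t\<in>space N. \<phi> t \<le> 0"
    proof (rule ccontr)
      assume "\<not> (\<exists>t\<in>space N. \<phi> t \<le> 0)"
      then have pos: "AE t in N. \<phi> t > 0" by (auto intro!: AE_I2)
      then have "AE t in N. \<phi> t = 0"
        using integral_nonneg_eq_0_iff_AE[OF i\<phi> eventually_mono[OF pos less_imp_le]] \<phi>0 by blast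
      with pos have "AE t in N. False" by eventually_elim simp
      then show False using m by (simp add: AE_iff_measurable[OF _ refl] N.emeasure_eq_measure)
    qed
    then obtain t where t: "t \<in> space N" "\<phi> t \<le> 0" by blast
    \<comment> \<open>Apart from the cross term, a new point adds at most (2 K)^2 to each of the two
      second moments, which is the 8 K^2 of the claim.\<close>
    have step: "M.expectation (\<lambda>\<omega>. (S \<omega> + D f t \<omega>)\<^sup>2)
       \<le> M.expectation (\<lambda>\<omega>. (S \<omega>)\<^sup>2) + 2 * M.expectation (\<lambda>\<omega>. S \<omega> * D f t \<omega>) + 4 * K\<^sup>2"
      if [measurable]: "S \<in> borel_measurable M" "D f t \<in> borel_measurable M" and S: "\<And>\<omega>. \<bar>S \<omega>\<bar> \<le> C" and Df: "\<And>\<omega>. \<bar>D f t \<omega>\<bar> \<le> 2 * K" for S f C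
    proof -
      have i1: "integrable M (\<lambda>\<omega>. (S \<omega>)\<^sup>2)" "integrable M (\<lambda>\<omega>. S \<omega> * D f t \<omega>)" "integrable M (\<lambda>\<omega>. (D f t \<omega>)\<^sup>2)"
        unfolding power2_eq_square by (rule M.integrable_bounded_mult[OF _ _ S S] M.integrable_bounded_mult[OF _ _ S Df] M.integrable_bounded_mult[OF _ _ Df Df], simp, simp)+
      have "M.expectation (\<lambda>\<omega>. (S \<omega> + D f t \<omega>)\<^sup>2) = M.expectation (\<lambda>\<omega>. (S \<omega>)\<^sup>2 + 2 * (S \<omega> * D f t \<omega>) + (D f t \<omega>)\<^sup>2)"
        by (intro Bochner_Integration.integral_cong) (auto simp: power2_eq_square algebra_simps)
      also have "\<dots> = M.expectation (\<lambda>\<omega>. (S \<omega>)\<^sup>2) + 2 * M.expectation (\<lambda>\<omega>. S \<omega> * D f t \<omega>) + M.expectation (\<lambda>\<omega>. (D f t \<omega>)\<^sup>2)"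
        using i1 by simp
      also have "M.expectation (\<lambda>\<omega>. (D f t \<omega>)\<^sup>2) \<le> M.expectation (\<lambda>\<omega>. 4 * K\<^sup>2)"
        using i1(3) power_mono[OF Df abs_ge_zero, of _ 2] by (intro integral_mono) (auto simp: power_mult_distrib)
      finally show ?thesis by (simp add: M.prob_space)
    qed
    have "M.expectation (\<lambda>\<omega>. (Sa \<omega> + D a t \<omega>)\<^sup>2) + M.expectation (\<lambda>\<omega>. (Sb \<omega> + D b t \<omega>)\<^sup>2)
       \<le> (M.expectation (\<lambda>\<omega>. (Sa \<omega>)\<^sup>2) + M.expectation (\<lambda>\<omega>. (Sb \<omega>)\<^sup>2)) + 2 * \<phi> t + 8 * K\<^sup>2"
      using step[OF Sm(1) Dm(1)[OF t(1)] Sbd(1) Dbd(1)] step[OF Sm(2) Dm(2)[OF t(1)] Sbd(2) Dbd(2)] by (simp add: \<phi>_def)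
    also have "\<dots> \<le> Suc n * (8 * K\<^sup>2)"
      using le t(2) by (simp add: Sa_def Sb_def algebra_simps)
    finally have fin: "M.expectation (\<lambda>\<omega>. (Sa \<omega> + D a t \<omega>)\<^sup>2) + M.expectation (\<lambda>\<omega>. (Sb \<omega> + D b t \<omega>)\<^sup>2) \<le> Suc n * (8 * K\<^sup>2)" .
    have S': "(\<Sum>i<Suc n. D f ((ts(n := t)) i) \<omega>) = (\<Sum>i<n. D f (ts i) \<omega>) + D f t \<omega>" for f \<omega>
      by simp
    show ?case
      by (rule exI[of _ "ts(n := t)"], unfold S', use fin t ts in \<open>auto simp: Sa_def Sb_def less_Suc_eq\<close>)
  qed (use K0 in simp)
  then show ?thesis by (simp add: D_def)
qed

subsection \<open>Stationary Gaussian fields\<close>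

text \<open>Passage from the description by laws to characteristic functions and second moments.
  Mean zero forces m = 0 in either case; the nondegenerate one is reduced to the standard normal law
  by dividing by the standard deviation.\<close>

lemma (in prob_space) gaussian_rv_char:
  assumes g: "gaussian_rv M Y" and E: "expectation Y = 0"
  shows "integrable M (\<lambda>\<omega>. (Y \<omega>)\<^sup>2)"
    and "expectation (\<lambda>\<omega>. iexp (Y \<omega>)) = of_real (exp (- expectation (\<lambda>\<omega>. (Y \<omega>)\<^sup>2) / 2))"
proof -
  have [measurable]: "Y \<in> borel_measurable M" using g by (simp add: gaussian_rv_def)
  obtain m v where v: "v \<ge> 0" and d: "distr M borel Y =
        (if v = 0 then return borel m else density lborel (normal_density m (sqrt v)))"
    using g by (auto simp: gaussian_rv_def)
  have "integrable M (\<lambda>\<omega>. (Y \<omega>)\<^sup>2) \<and> expectation (\<lambda>\<omega>. iexp (Y \<omega>)) = of_real (exp (- expectation (\<lambda>\<omega>. (Y \<omega>)\<^sup>2) / 2))"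
  proof (cases "v = 0")
    case True
    then have d: "distr M borel Y = return borel m" using d by simp
    have "AE x in distr M borel Y. x = m"
      unfolding d by (subst AE_return) auto
    then have ae: "AE \<omega> in M. Y \<omega> = m"
      by (subst (asm) AE_distr_iff) auto
    have "expectation Y = expectation (\<lambda>_. m)"
      by (intro integral_cong_AE ae) auto
    then have "m = 0" using E by (simp add: prob_space)
    with ae have ae: "AE \<omega> in M. Y \<omega> = 0" by simp
    have 1: "AE \<omega> in M. (Y \<omega>)\<^sup>2 = 0" using ae by eventually_elim simp
    have 2: "AE \<omega> in M. iexp (Y \<omega>) = 1" using ae by eventually_elim simp
    have "integrable M (\<lambda>\<omega>. (Y \<omega>)\<^sup>2)"
      using integrable_cong_AE[of "\<lambda>\<omega>. (Y \<omega>)\<^sup>2" M "\<lambda>_. 0"] 1 by simp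
    moreover have "expectation (\<lambda>\<omega>. (Y \<omega>)\<^sup>2) = 0"
      using integral_cong_AE[of "\<lambda>\<omega>. (Y \<omega>)\<^sup>2" M "\<lambda>_. 0"] 1 by simp
    moreover have "expectation (\<lambda>\<omega>. iexp (Y \<omega>)) = expectation (\<lambda>\<omega>. 1)"
      by (rule integral_cong_AE[OF _ _ 2]) auto
    ultimately show ?thesis by (simp add: prob_space)
  next
    case False
    define \<sigma> where "\<sigma> = sqrt v"
    have \<sigma>: "\<sigma> > 0" using v False by (simp add: \<sigma>_def)
    have dist: "distributed M lborel Y (normal_density m \<sigma>)"
      using d False unfolding distributed_def \<sigma>_def by (auto simp: distr_cong[of M M borel lborel Y Y, OF refl _ refl, symmetric])
    have m0: "m = 0" using normal_distributed_expectation[OF \<sigma> dist] E by simp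
    define Z where "Z \<omega> = Y \<omega> / \<sigma>" for \<omega>
    have [measurable]: "Z \<in> borel_measurable M" unfolding Z_def [abs_def] by simp
    have "distributed M lborel Z std_normal_density"
      using dist normal_standard_normal_convert[OF \<sigma>, of Y m] m0 by (simp add: Z_def [abs_def])
    then have "distr M lborel Z = gam" by (simp add: distributed_def)
    then have dZ: "distr M borel Z = gam"
      using distr_cong[of M M borel lborel Z Z] by simp
    have YZ: "Y \<omega> = \<sigma> * Z \<omega>" for \<omega> using \<sigma> by (simp add: Z_def)
    have "integrable gam (\<lambda>x. x\<^sup>2)" by (rule integrable_std_normal_distribution_moment)
    then have iZ: "integrable M (\<lambda>\<omega>. (Z \<omega>)\<^sup>2)"
      unfolding dZ[symmetric] by (subst (asm) integrable_distr_eq) auto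
    have "(\<integral>x. x\<^sup>2 \<partial>gam) = 1" using std_normal_distribution_even_moments(1)[of 1] by simp
    then have eZ: "expectation (\<lambda>\<omega>. (Z \<omega>)\<^sup>2) = 1"
      unfolding dZ[symmetric] by (subst (asm) integral_distr) auto
    have "char gam \<sigma> = expectation (\<lambda>\<omega>. iexp (\<sigma> * Z \<omega>))"
      unfolding dZ[symmetric] char_def by (subst integral_distr) auto
    then show ?thesis
      unfolding YZ using iZ eZ by (simp add: char_std_normal_distribution power_mult_distrib)
  qed
  then show "integrable M (\<lambda>\<omega>. (Y \<omega>)\<^sup>2)"
    and "expectation (\<lambda>\<omega>. iexp (Y \<omega>)) = of_real (exp (- expectation (\<lambda>\<omega>. (Y \<omega>)\<^sup>2) / 2))"
    by auto
qed

text \<open>Fubini writes the variance of an integral as the double integral of covariances. The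
  index space is arbitrary, as the result is needed both for a window and for the square of a
  window. The bound is stated for nonnegative integrals, so that c need not be integrated
  beforehand; the last claim keeps the exact value for the asymptotic variance.\<close>

lemma (in prob_space) variance_integral_le:
  fixes w :: "'p \<Rightarrow> 'a \<Rightarrow> real"
  assumes N: "finite_measure N"
    and wm: "(\<lambda>(p, \<omega>). w p \<omega>) \<in> borel_measurable (N \<Otimes>\<^sub>M M)" and wb: "\<And>p \<omega>. \<bar>w p \<omega>\<bar> \<le> K"
    and cov: "\<And>p p'. p \<in> space N \<Longrightarrow> p' \<in> space N \<Longrightarrow>
      \<bar>expectation (\<lambda>\<omega>. w p \<omega> * w p' \<omega>) - expectation (w p) * expectation (w p')\<bar> \<le> c p p'"
    and cm: "(\<lambda>(p, p'). c p p') \<in> borel_measurable (N \<Otimes>\<^sub>M N)"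
  defines "V \<equiv> \<lambda>\<omega>. \<integral>p. w p \<omega> \<partial>N"
  shows "V \<in> borel_measurable M"
    and "\<And>\<omega>. \<bar>V \<omega>\<bar> \<le> K * measure N (space N)"
    and "expectation V = (\<integral>p. expectation (w p) \<partial>N)"
    and "ennreal (expectation (\<lambda>\<omega>. (V \<omega> - expectation V)\<^sup>2)) \<le> (\<integral>\<^sup>+p. \<integral>\<^sup>+p'. ennreal (c p p') \<partial>N \<partial>N)"
    and "expectation (\<lambda>\<omega>. (V \<omega> - expectation V)\<^sup>2)
      = (\<integral>p. (\<integral>p'. expectation (\<lambda>\<omega>. w p \<omega> * w p' \<omega>) - expectation (w p) * expectation (w p') \<partial>N) \<partial>N)"
proof -
  interpret N: finite_measure N by fact
  interpret NM: pair_sigma_finite N M ..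
  interpret NN: pair_sigma_finite N N ..
  have finN: "finite_measure (N \<Otimes>\<^sub>M N)"
    by (intro finite_measure_pair_measure N.finite_measure_axioms)
  interpret NNf: finite_measure "N \<Otimes>\<^sub>M N" by fact
  interpret NNM: pair_sigma_finite "N \<Otimes>\<^sub>M N" M ..
  have finM: "finite_measure (N \<Otimes>\<^sub>M M)" "finite_measure ((N \<Otimes>\<^sub>M N) \<Otimes>\<^sub>M M)"
    by (intro finite_measure_pair_measure N.finite_measure_axioms finite_measure_axioms finN)+
  have K0: "K \<ge> 0" using order_trans[OF abs_ge_zero wb] .
  note [measurable] = wm cm
  have swap: "(\<lambda>(\<omega>, p). w p \<omega>) \<in> borel_measurable (M \<Otimes>\<^sub>M N)"
    using measurable_compose[OF measurable_pair_swap' wm] by (simp add: split_beta')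
  show Vm [measurable]: "V \<in> borel_measurable M"
    unfolding V_def using N.borel_measurable_lebesgue_integral[OF swap] by simp
  show Vb: "\<bar>V \<omega>\<bar> \<le> K * measure N (space N)" for \<omega>
  proof (cases "integrable N (\<lambda>p. w p \<omega>)")
    case True
    have "\<bar>V \<omega>\<bar> \<le> (\<integral>p. \<bar>w p \<omega>\<bar> \<partial>N)" unfolding V_def by (rule integral_abs_bound)
    also have "\<dots> \<le> (\<integral>p. K \<partial>N)" using True wb by (intro integral_mono) auto
    finally show ?thesis by (simp add: mult.commute)
  next
    case False
    then show ?thesis using K0 by (simp add: V_def not_integrable_integral_eq)
  qed
  have iw: "integrable (N \<Otimes>\<^sub>M M) (\<lambda>(p, \<omega>). w p \<omega>)"
    by (rule finite_measure.integrable_const_bound[OF finM(1), where B=K]) (auto simp: wb)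
  show EV: "expectation V = (\<integral>p. expectation (w p) \<partial>N)"
    unfolding V_def using NM.Fubini_integral[OF iw] by simp
  define H where "H = (\<lambda>(z, \<omega>). w (fst z) \<omega> * w (snd z) \<omega>)"
  have wf: "(\<lambda>x. w (fst (fst x)) (snd x)) \<in> borel_measurable ((N \<Otimes>\<^sub>M N) \<Otimes>\<^sub>M M)"
    "(\<lambda>x. w (snd (fst x)) (snd x)) \<in> borel_measurable ((N \<Otimes>\<^sub>M N) \<Otimes>\<^sub>M M)"
    using measurable_compose[of "\<lambda>x. (fst (fst x), snd x)" "(N \<Otimes>\<^sub>M N) \<Otimes>\<^sub>M M" "N \<Otimes>\<^sub>M M", OF _ wm]
      measurable_compose[of "\<lambda>x. (snd (fst x), snd x)" "(N \<Otimes>\<^sub>M N) \<Otimes>\<^sub>M M" "N \<Otimes>\<^sub>M M", OF _ wm] by simp_all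
  then have Hm: "H \<in> borel_measurable ((N \<Otimes>\<^sub>M N) \<Otimes>\<^sub>M M)"
    unfolding H_def split_beta' by simp
  have Hb: "\<bar>H x\<bar> \<le> K * K" for x
    unfolding H_def split_beta' abs_mult using K0 by (intro mult_mono wb) auto
  have iH: "integrable ((N \<Otimes>\<^sub>M N) \<Otimes>\<^sub>M M) H"
    by (rule finite_measure.integrable_const_bound[OF finM(2), where B="K * K"]) (use Hb Hm in auto)
  have "(\<integral>z. expectation (\<lambda>\<omega>. w (fst z) \<omega> * w (snd z) \<omega>) \<partial>(N \<Otimes>\<^sub>M N)) = expectation (\<lambda>\<omega>. \<integral>z. w (fst z) \<omega> * w (snd z) \<omega> \<partial>(N \<Otimes>\<^sub>M N))"
    using NNM.Fubini_integral[of "\<lambda>z \<omega>. w (fst z) \<omega> * w (snd z) \<omega>"] iH by (simp add: H_def)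
  also have "\<dots> = expectation (\<lambda>\<omega>. (V \<omega>)\<^sup>2)"
  proof (rule Bochner_Integration.integral_cong[OF refl])
    fix \<omega> assume w: "\<omega> \<in> space M"
    have "(\<lambda>z. H (z, \<omega>)) \<in> borel_measurable (N \<Otimes>\<^sub>M N)"
      using measurable_compose[OF measurable_Pair2'[OF w] Hm] by simp
    then have "integrable (N \<Otimes>\<^sub>M N) (\<lambda>z. H (z, \<omega>))"
      by (intro NNf.integrable_const_bound[where B="K * K"]) (auto simp: Hb)
    from NN.integral_fst'[OF this]
    have "(\<integral>z. w (fst z) \<omega> * w (snd z) \<omega> \<partial>(N \<Otimes>\<^sub>M N)) = (\<integral>x. (\<integral>y. w x \<omega> * w y \<omega> \<partial>N) \<partial>N)"
      by (simp add: H_def)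
    also have "\<dots> = (V \<omega>)\<^sup>2" by (simp add: V_def power2_eq_square)
    finally show "(\<integral>z. w (fst z) \<omega> * w (snd z) \<omega> \<partial>(N \<Otimes>\<^sub>M N)) = (V \<omega>)\<^sup>2" .
  qed
  finally have A: "expectation (\<lambda>\<omega>. (V \<omega>)\<^sup>2) = (\<integral>z. expectation (\<lambda>\<omega>. w (fst z) \<omega> * w (snd z) \<omega>) \<partial>(N \<Otimes>\<^sub>M N))" by simp
  have i1: "integrable (N \<Otimes>\<^sub>M N) (\<lambda>z. expectation (\<lambda>\<omega>. w (fst z) \<omega> * w (snd z) \<omega>))"
    using NNM.integrable_fst'[OF iH] by (simp add: H_def)
  have ie: "integrable N (\<lambda>p. expectation (w p))"
    using NM.integrable_fst'[OF iw] by simp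
  have eb: "\<bar>expectation (w p)\<bar> \<le> K" for p
  proof (cases "integrable M (w p)")
    case True
    have "\<bar>expectation (w p)\<bar> \<le> expectation (\<lambda>\<omega>. \<bar>w p \<omega>\<bar>)" by (rule integral_abs_bound)
    also have "\<dots> \<le> expectation (\<lambda>\<omega>. K)" using True wb by (intro integral_mono) auto
    finally show ?thesis by (simp add: prob_space)
  qed (use K0 in \<open>simp add: not_integrable_integral_eq\<close>)
  have i2: "integrable (N \<Otimes>\<^sub>M N) (\<lambda>z. expectation (w (fst z)) * expectation (w (snd z)))"
  proof (rule NNf.integrable_const_bound[where B="K * K"])
    have [measurable]: "(\<lambda>p. expectation (w p)) \<in> borel_measurable N" using ie by auto
    show "(\<lambda>z. expectation (w (fst z)) * expectation (w (snd z))) \<in> borel_measurable (N \<Otimes>\<^sub>M N)" by measurable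
    show "AE z in N \<Otimes>\<^sub>M N. norm (expectation (w (fst z)) * expectation (w (snd z))) \<le> K * K"
      unfolding real_norm_def abs_mult using K0 by (intro AE_I2 mult_mono eb) auto
  qed
  have B: "(expectation V)\<^sup>2 = (\<integral>z. expectation (w (fst z)) * expectation (w (snd z)) \<partial>(N \<Otimes>\<^sub>M N))"
    unfolding EV using NN.integral_fst'[OF i2] by (simp add: power2_eq_square)
  have iV: "integrable M V"
    by (rule integrable_const_bound[where B="K * measure N (space N)"]) (auto simp: Vb)
  have iV2: "integrable M (\<lambda>\<omega>. (V \<omega>)\<^sup>2)"
    unfolding power2_eq_square by (rule integrable_bounded_mult[OF _ _ Vb Vb]) auto
  have *: "expectation (\<lambda>\<omega>. (V \<omega> - expectation V)\<^sup>2)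
     = (\<integral>z. expectation (\<lambda>\<omega>. w (fst z) \<omega> * w (snd z) \<omega>) - expectation (w (fst z)) * expectation (w (snd z)) \<partial>(N \<Otimes>\<^sub>M N))"
    unfolding variance_eq[OF iV iV2] A B by (rule Bochner_Integration.integral_diff[OF i1 i2, symmetric])
  show "expectation (\<lambda>\<omega>. (V \<omega> - expectation V)\<^sup>2)
      = (\<integral>p. (\<integral>p'. expectation (\<lambda>\<omega>. w p \<omega> * w p' \<omega>) - expectation (w p) * expectation (w p') \<partial>N) \<partial>N)"
    using NN.integral_fst'[OF Bochner_Integration.integrable_diff[OF i1 i2]] unfolding * by simp
  have "ennreal (expectation (\<lambda>\<omega>. (V \<omega> - expectation V)\<^sup>2))
     \<le> ennreal (norm (\<integral>z. expectation (\<lambda>\<omega>. w (fst z) \<omega> * w (snd z) \<omega>) - expectation (w (fst z)) * expectation (w (snd z)) \<partial>(N \<Otimes>\<^sub>M N)))"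
    using * by (simp add: ennreal_leI)
  also have "\<dots> \<le> (\<integral>\<^sup>+z. norm (expectation (\<lambda>\<omega>. w (fst z) \<omega> * w (snd z) \<omega>) - expectation (w (fst z)) * expectation (w (snd z))) \<partial>(N \<Otimes>\<^sub>M N))"
    by (intro integral_norm_bound_ennreal Bochner_Integration.integrable_diff i1 i2)
  also have "\<dots> \<le> (\<integral>\<^sup>+z. ennreal (c (fst z) (snd z)) \<partial>(N \<Otimes>\<^sub>M N))"
    by (intro nn_integral_mono ennreal_leI) (auto simp: space_pair_measure cov)
  also have "\<dots> = (\<integral>\<^sup>+p. \<integral>\<^sup>+p'. ennreal (c p p') \<partial>N \<partial>N)"
    using cm by (subst N.nn_integral_fst[symmetric]) (simp_all add: split_beta')
  finally show "ennreal (expectation (\<lambda>\<omega>. (V \<omega> - expectation V)\<^sup>2)) \<le> (\<integral>\<^sup>+p. \<integral>\<^sup>+p'. ennreal (c p p') \<partial>N \<partial>N)" .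
qed

section \<open>Laws and covariances of the stationary field\<close>

locale stationary_gaussian_field = prob_space M for M :: "'a measure" +
  fixes X :: "'t::euclidean_space \<Rightarrow> 'a \<Rightarrow> real" and \<rho> :: "'t \<Rightarrow> real"
  assumes meas: "(\<lambda>(t, \<omega>). X t \<omega>) \<in> borel_measurable (lborel \<Otimes>\<^sub>M M)"
    and gauss: "gaussian_field M X"
    and centered: "\<And>t. expectation (X t) = 0"
    and cov: "\<And>s t. expectation (\<lambda>\<omega>. X (s + t) \<omega> * X s \<omega>) = \<rho> t"
    and unit_var: "\<rho> 0 = 1"
    and rho_int: "integrable lborel \<rho>"
begin

lemma X_gaussian_rv:
  assumes "finite I"
  shows "gaussian_rv M (\<lambda>\<omega>. \<Sum>i\<in>I. c i * X (ts i) \<omega>)"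
proof -
  obtain xs where xs: "set xs = I" "distinct xs" using finite_distinct_list[OF assms] by blast
  have "gaussian_rv M (\<lambda>\<omega>. \<Sum>i<length (map ts xs). map c xs ! i * X (map ts xs ! i) \<omega>)"
    using gauss[unfolded gaussian_field_def, rule_format, of "map c xs" "map ts xs"] by (simp only: length_map)
  moreover have "(\<Sum>i<length (map ts xs). map c xs ! i * X (map ts xs ! i) \<omega>) = (\<Sum>i\<in>I. c i * X (ts i) \<omega>)" for \<omega>
  proof -
    have "(\<Sum>i<length (map ts xs). map c xs ! i * X (map ts xs ! i) \<omega>) = (\<Sum>i<length xs. c (xs ! i) * X (ts (xs ! i)) \<omega>)"
      by (intro sum.cong) auto
    also have "\<dots> = sum_list (map (\<lambda>i. c i * X (ts i) \<omega>) xs)"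
      by (simp add: sum_list_sum_nth atLeast0LessThan)
    also have "\<dots> = (\<Sum>i\<in>I. c i * X (ts i) \<omega>)"
      using xs by (simp add: sum_list_distinct_conv_sum_set)
    finally show ?thesis .
  qed
  ultimately show ?thesis by simp
qed

lemma X_rv: "gaussian_rv M (X t)"
  using X_gaussian_rv[of "{()}" "\<lambda>_. 1" "\<lambda>_. t"] by simp

lemma X_measurable [measurable]: "X t \<in> borel_measurable M"
  using X_rv[of t] by (simp add: gaussian_rv_def)

lemma X_square: "integrable M (\<lambda>\<omega>. (X t \<omega>)\<^sup>2)"
  using gaussian_rv_char(1)[OF X_rv centered] .

lemma X_integrable: "integrable M (X t)"
  using expectation_abs_le_sqrt(1)[OF X_measurable X_square] .

lemma X_family:
  assumes I: "finite I"
  shows "gaussian_family M I (\<lambda>i. X (ts i))"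
  unfolding gaussian_family_def
proof (intro conjI ballI allI I X_measurable X_square)
  fix c
  have "expectation (\<lambda>\<omega>. \<Sum>i\<in>I. c i * X (ts i) \<omega>) = 0"
    by (subst Bochner_Integration.integral_sum) (auto simp: X_integrable centered)
  from gaussian_rv_char(2)[OF X_gaussian_rv[OF I] this]
  show "expectation (\<lambda>\<omega>. iexp (\<Sum>i\<in>I. c i * X (ts i) \<omega>))
    = of_real (exp (- expectation (\<lambda>\<omega>. (\<Sum>i\<in>I. c i * X (ts i) \<omega>)\<^sup>2) / 2))" .
qed

lemma X_cov: "expectation (\<lambda>\<omega>. X s \<omega> * X t \<omega>) = \<rho> (t - s)"
  using cov[of s "t - s"] by (simp add: mult.commute)

lemma rho_sym: "\<rho> (- t) = \<rho> t"
  using X_cov[of t 0] X_cov[of 0 t] by (simp add: mult.commute)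

lemma X_var: "expectation (\<lambda>\<omega>. (X t \<omega>)\<^sup>2) = 1"
  using X_cov[of t t] by (simp add: power2_eq_square unit_var)

lemma rho_le_1: "\<bar>\<rho> t\<bar> \<le> 1"
  using integral_Cauchy_Schwarz[OF X_measurable X_measurable X_square X_square, of 0 t]
  by (simp add: X_cov X_var)

lemma rho_measurable [measurable]: "\<rho> \<in> borel_measurable borel"
  using rho_int by auto

lemma X_law: "distr M borel (X t) = gam"
  using gaussian_family_std_normal[OF X_family[of "{()}" "\<lambda>_. t"], of "()"] by (simp add: X_var)

lemma X_integral:
  fixes f :: "real \<Rightarrow> 'b::{banach, second_countable_topology}"
  assumes "f \<in> borel_measurable borel"
  shows "expectation (\<lambda>\<omega>. f (X t \<omega>)) = (\<integral>x. f x \<partial>gam)"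
  unfolding X_law[of t, symmetric] using assms by (subst integral_distr) auto

lemma X_char: "expectation (\<lambda>\<omega>. iexp (a * X s \<omega> + b * X t \<omega>)) = of_real (exp (- (a\<^sup>2 + 2 * \<rho> (t - s) * a * b + b\<^sup>2) / 2))"
proof -
  have "gaussian_family M UNIV (\<lambda>i. X (if i then s else t))"
    by (rule X_family) simp
  from gaussian_family_char[OF this, of "\<lambda>i. if i then a else b"]
  have "expectation (\<lambda>\<omega>. iexp (a * X s \<omega> + b * X t \<omega>)) = of_real (exp (- expectation (\<lambda>\<omega>. (a * X s \<omega> + b * X t \<omega>)\<^sup>2) / 2))"
    by (simp add: UNIV_bool add.commute)
  moreover have "expectation (\<lambda>\<omega>. (a * X s \<omega> + b * X t \<omega>)\<^sup>2)
     = expectation (\<lambda>\<omega>. a\<^sup>2 * (X s \<omega>)\<^sup>2 + 2 * a * b * (X s \<omega> * X t \<omega>) + b\<^sup>2 * (X t \<omega>)\<^sup>2)"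
    by (intro Bochner_Integration.integral_cong) (auto simp: power2_eq_square algebra_simps)
  moreover have "\<dots> = a\<^sup>2 + 2 * \<rho> (t - s) * a * b + b\<^sup>2"
    using X_square integrable_mult_square[OF X_measurable X_measurable X_square X_square]
    by (simp add: X_cov X_var)
  ultimately show ?thesis by simp
qed

lemma X_gebelein:
  assumes "h \<in> borel_measurable borel" "\<And>x. \<bar>h x\<bar> \<le> K"
  shows "\<bar>expectation (\<lambda>\<omega>. h (X s \<omega>) * h (X t \<omega>)) - (\<integral>x. h x \<partial>gam)\<^sup>2\<bar> \<le> \<bar>\<rho> (t - s)\<bar> * (\<integral>x. (h x)\<^sup>2 \<partial>gam)"
  by (rule gebelein[OF X_measurable X_measurable X_law X_law X_char rho_le_1 assms])

text \<open>One function A at two pairs of points, with L both as bound and as Lipschitz constant;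
  unit variance and the bound on correlations are the side conditions of
  \<open>gaussian_cov_pairs\<close>.\<close>

lemma X_cov_pairs:
  assumes Am: "(\<lambda>p. A (fst p) (snd p)) \<in> borel_measurable (borel \<Otimes>\<^sub>M borel)"
    and AL: "\<And>y z y' z'. \<bar>A y z - A y' z'\<bar> \<le> L * (\<bar>y - y'\<bar> + \<bar>z - z'\<bar>)"
    and Ab: "\<And>y z. \<bar>A y z\<bar> \<le> L"
  shows "\<bar>expectation (\<lambda>\<omega>. A (X s \<omega>) (X t \<omega>) * A (X s' \<omega>) (X t' \<omega>))
        - expectation (\<lambda>\<omega>. A (X s \<omega>) (X t \<omega>)) * expectation (\<lambda>\<omega>. A (X s' \<omega>) (X t' \<omega>))\<bar>
    \<le> 4 * L\<^sup>2 * (\<bar>\<rho> (s' - s)\<bar> + \<bar>\<rho> (t' - s)\<bar> + \<bar>\<rho> (s' - t)\<bar> + \<bar>\<rho> (t' - t)\<bar>)"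
proof -
  define W where "W i = X (if i = 0 then s else if i = 2 then t else if i = 3 then s' else t')" for i :: nat
  have W: "gaussian_family M {0,2,3,4} W"
    unfolding W_def by (rule X_family) simp
  have Ws: "W 0 = X s" "W 2 = X t" "W 3 = X s'" "W 4 = X t'" by (auto simp: W_def)
  have v: "expectation (\<lambda>\<omega>. (W 0 \<omega>)\<^sup>2) = 1"
    unfolding Ws by (rule X_var)
  have r: "\<bar>expectation (\<lambda>\<omega>. W 0 \<omega> * W 2 \<omega>)\<bar> \<le> 1"
    unfolding Ws X_cov by (rule rho_le_1)
  have AL': "\<bar>A x y - A x y'\<bar> \<le> L * \<bar>y - y'\<bar>" for x y y'
    using AL[of x y x y'] by simp
  have c: "2 * (L + L) * L = 4 * L\<^sup>2"
    by (simp add: power2_eq_square)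
  show ?thesis
    using gaussian_cov_pairs[OF W v r Am AL' Ab Am AL Ab] unfolding Ws X_cov c .
qed

end

section \<open>Integrals of the field over an observation window\<close>

text \<open>The cube enters the central limit estimate only through its mass m and the domination by
  Lebesgue measure, which bounds window integrals of a translate of \<bar>\<rho>\<bar> by its
  integral over the whole space. The measure N lives on the full Borel \<sigma>-algebra, so
  measurability statements about the field carry over.\<close>

locale sampling_window = stationary_gaussian_field M X \<rho>
  for M :: "'a measure" and X :: "'t::euclidean_space \<Rightarrow> 'a \<Rightarrow> real" and \<rho> :: "'t \<Rightarrow> real" +
  fixes N :: "'t measure" and m :: real
  assumes finite_N: "finite_measure N" and sets_N: "sets N = sets borel"
    and measure_N: "measure N (space N) = m" and m_pos: "m > 0"
    and N_le: "\<And>f. f \<in> borel_measurable borel \<Longrightarrow> (\<integral>\<^sup>+t. f t \<partial>N) \<le> (\<integral>\<^sup>+t. f t \<partial>lborel)"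
begin

sublocale N: finite_measure N by (rule finite_N)
sublocale NM: pair_sigma_finite N M ..
sublocale NN: pair_sigma_finite N N ..

lemma space_N [simp]: "space N = UNIV"
  using sets_eq_imp_space_eq[OF sets_N] by simp

lemma borel_measurable_N [measurable_cong]: "sets N = sets borel"
  by (rule sets_N)

lemma finite_measure_NM: "finite_measure (N \<Otimes>\<^sub>M M)"
  by (intro finite_measure_pair_measure finite_N finite_measure_axioms)

lemma X_joint [measurable]: "(\<lambda>(t, \<omega>). X t \<omega>) \<in> borel_measurable (N \<Otimes>\<^sub>M M)"
proof -
  have "sets (N \<Otimes>\<^sub>M M) = sets (lborel \<Otimes>\<^sub>M M)"
    by (intro sets_pair_measure_cong) (simp_all add: sets_N)
  then show ?thesis using meas measurable_cong_sets by blast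
qed

lemma X_path [measurable]: "\<omega> \<in> space M \<Longrightarrow> (\<lambda>t. X t \<omega>) \<in> borel_measurable N"
  using measurable_compose[OF measurable_Pair2' X_joint] by simp

lemma X_joint_compose:
  assumes [measurable]: "(\<lambda>(t, x). h t x) \<in> borel_measurable (borel \<Otimes>\<^sub>M borel)"
  shows "(\<lambda>(t, \<omega>). h t (X t \<omega>) :: real) \<in> borel_measurable (N \<Otimes>\<^sub>M M)"
proof -
  have "(\<lambda>z. (fst z, X (fst z) (snd z))) \<in> measurable (N \<Otimes>\<^sub>M M) (borel \<Otimes>\<^sub>M borel)"
    using X_joint by (intro measurable_Pair) (auto simp: split_beta' cong: measurable_cong_sets)
  from measurable_compose[OF this assms] show ?thesis by (simp add: split_beta')
qed

lemma integral_N_measurable: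
  assumes "(\<lambda>(t, \<omega>). w t \<omega> :: real) \<in> borel_measurable (N \<Otimes>\<^sub>M M)"
  shows "(\<lambda>\<omega>. \<integral>t. w t \<omega> \<partial>N) \<in> borel_measurable M"
proof -
  have "(\<lambda>(\<omega>, t). w t \<omega>) \<in> borel_measurable (M \<Otimes>\<^sub>M N)"
    using measurable_compose[OF measurable_pair_swap' assms] by (simp add: split_beta')
  from N.borel_measurable_lebesgue_integral[OF this] show ?thesis .
qed

lemma abs_integral_N_le:
  assumes "\<And>t. \<bar>f t :: real\<bar> \<le> K"
  shows "\<bar>\<integral>t. f t \<partial>N\<bar> \<le> m * K"
proof (cases "integrable N f")
  case True
  have "\<bar>\<integral>t. f t \<partial>N\<bar> \<le> (\<integral>t. \<bar>f t\<bar> \<partial>N)" by (rule integral_abs_bound)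
  also have "\<dots> \<le> (\<integral>t. K \<partial>N)" using True assms by (intro integral_mono) auto
  finally show ?thesis using measure_N by simp
next
  case False
  then show ?thesis using m_pos order_trans[OF abs_ge_zero assms] by (simp add: not_integrable_integral_eq)
qed

text \<open>The finite formula is applied to n sampled points, with c m / n in place of c. The
  sampling errors of both window integrals are of order sqrt n before scaling and 1 / sqrt n after
  it, and neither side depends on n. All scaled sums and integrals stay in [-B, B], so f and f' need
  to be controlled there only.\<close>

lemma X_ibp:
  assumes dq: "\<And>x. (q has_real_derivative q' x) (at x)" and cq: "\<And>x. isCont q' x"
    and dg: "\<And>x. (g has_real_derivative g' x) (at x)" and cg: "\<And>x. isCont g' x"
    and df: "\<And>x. (f has_real_derivative f' x) (at x)" and cf: "\<And>x. isCont f' x"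
    and Q: "\<And>x. \<bar>q x\<bar> \<le> Q" and R: "\<And>x. \<bar>x * q x - q' x\<bar> \<le> R"
    and G: "\<And>x. \<bar>g x\<bar> \<le> G" "\<And>x. \<bar>g' x\<bar> \<le> G"
    and B: "\<bar>c\<bar> * (m * G) \<le> B"
    and F: "\<And>y. \<bar>y\<bar> \<le> B \<Longrightarrow> \<bar>f y\<bar> \<le> F" "\<And>y. \<bar>y\<bar> \<le> B \<Longrightarrow> \<bar>f' y\<bar> \<le> F"
    and L: "\<And>y z. \<bar>y\<bar> \<le> B \<Longrightarrow> \<bar>z\<bar> \<le> B \<Longrightarrow> \<bar>f y - f z\<bar> \<le> L * \<bar>y - z\<bar>"
      "\<And>y z. \<bar>y\<bar> \<le> B \<Longrightarrow> \<bar>z\<bar> \<le> B \<Longrightarrow> \<bar>f' y - f' z\<bar> \<le> L * \<bar>y - z\<bar>" and L0: "L \<ge> 0"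
  shows "expectation (\<lambda>\<omega>. (X s \<omega> * q (X s \<omega>) - q' (X s \<omega>)) * f (c * (\<integral>t. g (X t \<omega>) \<partial>N)))
    = expectation (\<lambda>\<omega>. q (X s \<omega>) * (f' (c * (\<integral>t. g (X t \<omega>) \<partial>N)) * (c * (\<integral>t. \<rho> (t - s) * g' (X t \<omega>) \<partial>N))))"
    (is "?l = ?r")
proof -
  have bm: "h \<in> borel_measurable borel" if "\<And>x. isCont h x" for h :: "real \<Rightarrow> real"
    using that by (intro borel_measurable_continuous_onI continuous_at_imp_continuous_on) auto
  have Cq: "isCont q x" and Cg: "isCont g x" and Cf: "isCont f x" for x
    using dq dg df DERIV_isCont by blast+
  have [measurable]: "q \<in> borel_measurable borel" "q' \<in> borel_measurable borel" "g \<in> borel_measurable borel"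
    "g' \<in> borel_measurable borel" "f \<in> borel_measurable borel" "f' \<in> borel_measurable borel"
    by (intro bm cq cg cf Cq Cg Cf)+
  have G0: "G \<ge> 0" and Q0: "Q \<ge> 0" and R0: "R \<ge> 0"
    using order_trans[OF abs_ge_zero G(1)] order_trans[OF abs_ge_zero Q] order_trans[OF abs_ge_zero R] .
  have B0: "B \<ge> 0" using B G0 m_pos by (smt (verit) mult_nonneg_nonneg)
  have F0: "F \<ge> 0" using order_trans[OF abs_ge_zero F(1)[of 0]] B0 by simp
  define \<Phi> where "\<Phi> \<omega> = (\<integral>t. g (X t \<omega>) \<partial>N)" for \<omega>
  define \<Delta> where "\<Delta> \<omega> = (\<integral>t. \<rho> (t - s) * g' (X t \<omega>) \<partial>N)" for \<omega>
  have am: "(\<lambda>(t, \<omega>). g (X t \<omega>)) \<in> borel_measurable (N \<Otimes>\<^sub>M M)"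
    by (rule X_joint_compose) simp
  have bmm: "(\<lambda>(t, \<omega>). \<rho> (t - s) * g' (X t \<omega>)) \<in> borel_measurable (N \<Otimes>\<^sub>M M)"
    by (rule X_joint_compose) (simp add: split_beta')
  have gb: "\<bar>\<rho> t * g' x\<bar> \<le> G" for t x
    unfolding abs_mult using mult_mono[OF rho_le_1[of t] G(2)[of x]] by simp
  have \<Phi>m [measurable]: "\<Phi> \<in> borel_measurable M" and \<Delta>m [measurable]: "\<Delta> \<in> borel_measurable M"
    unfolding \<Phi>_def [abs_def] \<Delta>_def [abs_def] by (intro integral_N_measurable am bmm)+
  have \<Phi>b: "\<bar>c * \<Phi> \<omega>\<bar> \<le> B" and \<Delta>b: "\<bar>c * \<Delta> \<omega>\<bar> \<le> B" for \<omega>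
    unfolding abs_mult \<Phi>_def \<Delta>_def
    by (intro order_trans[OF mult_left_mono[OF abs_integral_N_le] B] G gb; simp)+
  define C where "C = (R * L + Q * F + Q * L * B) * (\<bar>c\<bar> * m * (sqrt 8 * G))"
  have main: "\<bar>?l - ?r\<bar> \<le> C / sqrt n" if n: "n > 0" for n :: nat
  proof -
    \<comment> \<open>The points must be good for the functional and for its derivative in direction
      X s at the same time, which is why sampling was formulated for two functions.\<close>
    obtain ts where "expectation (\<lambda>\<omega>. (\<Sum>i<n. g (X (ts i) \<omega>) - \<Phi> \<omega> / m)\<^sup>2)
       + expectation (\<lambda>\<omega>. (\<Sum>i<n. \<rho> (ts i - s) * g' (X (ts i) \<omega>) - \<Delta> \<omega> / m)\<^sup>2) \<le> n * (8 * G\<^sup>2)"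
      using greedy_sampling[OF prob_space_axioms finite_N measure_N m_pos am bmm G(1) gb, of n]
      unfolding \<Phi>_def \<Delta>_def by blast
    define An where "An \<omega> = (\<Sum>i<n. g (X (ts i) \<omega>) - \<Phi> \<omega> / m)" for \<omega>
    define Bn where "Bn \<omega> = (\<Sum>i<n. \<rho> (ts i - s) * g' (X (ts i) \<omega>) - \<Delta> \<omega> / m)" for \<omega>
    note samp = \<open>expectation _ + expectation _ \<le> _\<close>[folded An_def Bn_def]
    have ABm [measurable]: "An \<in> borel_measurable M" "Bn \<in> borel_measurable M"
      unfolding An_def [abs_def] Bn_def [abs_def] by measurable
    define \<Phi>n where "\<Phi>n \<omega> = (\<Sum>i<n. g (X (ts i) \<omega>))" for \<omega>
    define \<Delta>n where "\<Delta>n \<omega> = (\<Sum>i<n. \<rho> (ts i - s) * g' (X (ts i) \<omega>))" for \<omega>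
    define cn where "cn = c * (m / n)"
    have [measurable]: "\<Phi>n \<in> borel_measurable M" "\<Delta>n \<in> borel_measurable M"
      unfolding \<Phi>n_def [abs_def] \<Delta>n_def [abs_def] by measurable
    have e1: "cn * \<Phi>n \<omega> - c * \<Phi> \<omega> = cn * An \<omega>" and e2: "cn * \<Delta>n \<omega> - c * \<Delta> \<omega> = cn * Bn \<omega>" for \<omega>
    proof -
      have *: "(\<Sum>i<n. h i - y / m) = (\<Sum>i<n. h i) - n * (y / m)" for h :: "nat \<Rightarrow> real" and y
        by (simp add: sum_subtractf)
      show "cn * \<Phi>n \<omega> - c * \<Phi> \<omega> = cn * An \<omega>" "cn * \<Delta>n \<omega> - c * \<Delta> \<omega> = cn * Bn \<omega>"
        using n m_pos unfolding An_def Bn_def * \<Phi>n_def[symmetric] \<Delta>n_def[symmetric] cn_def by (simp_all add: field_simps)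
    qed
    have cn: "\<bar>cn\<bar> * (n * G) \<le> B"
      using B n m_pos by (simp add: cn_def abs_mult)
    have sb: "\<bar>cn * (\<Sum>i<n. y i)\<bar> \<le> B" if "\<And>i. \<bar>y i\<bar> \<le> G" for y
    proof -
      have "\<bar>\<Sum>i<n. y i\<bar> \<le> n * G"
        using sum_bounded_above[of "{..<n}" "\<lambda>i. \<bar>y i\<bar>" G] that by (intro order_trans[OF sum_abs]) simp
      then have "\<bar>cn\<bar> * \<bar>\<Sum>i<n. y i\<bar> \<le> \<bar>cn\<bar> * (n * G)" by (intro mult_left_mono) auto
      then show ?thesis using cn by (simp add: abs_mult)
    qed
    have \<Phi>nb: "\<bar>cn * \<Phi>n \<omega>\<bar> \<le> B" and \<Delta>nb: "\<bar>cn * \<Delta>n \<omega>\<bar> \<le> B" for \<omega>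
      unfolding \<Phi>n_def \<Delta>n_def by (intro sb G gb)+
    have AB: "\<bar>An \<omega>\<bar> \<le> 2 * n * G" "\<bar>Bn \<omega>\<bar> \<le> 2 * n * G" for \<omega>
    proof -
      have "\<bar>\<Phi> \<omega> / m\<bar> \<le> G" "\<bar>\<Delta> \<omega> / m\<bar> \<le> G"
        using abs_integral_N_le[of "\<lambda>t. g (X t \<omega>)", OF G(1)] abs_integral_N_le[of "\<lambda>t. \<rho> (t - s) * g' (X t \<omega>)", OF gb] m_pos
        by (simp_all add: \<Phi>_def \<Delta>_def abs_div divide_le_eq mult.commute)
      then have "\<bar>g (X t \<omega>) - \<Phi> \<omega> / m\<bar> \<le> 2 * G" "\<bar>\<rho> (t - s) * g' (X t \<omega>) - \<Delta> \<omega> / m\<bar> \<le> 2 * G" for t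
        using G(1)[of "X t \<omega>"] gb[of "t - s" "X t \<omega>"] by linarith+
      then show "\<bar>An \<omega>\<bar> \<le> 2 * n * G" "\<bar>Bn \<omega>\<bar> \<le> 2 * n * G"
        unfolding An_def Bn_def
        by (intro order_trans[OF sum_abs] order_trans[OF sum_bounded_above[where K="2 * G"]]; simp)+
    qed
    have iA: "integrable M (\<lambda>\<omega>. (An \<omega>)\<^sup>2)" "integrable M (\<lambda>\<omega>. (Bn \<omega>)\<^sup>2)"
      unfolding power2_eq_square by (rule integrable_bounded_mult[OF _ _ AB(1) AB(1)] integrable_bounded_mult[OF _ _ AB(2) AB(2)], simp, simp)+
    have sq: "sqrt (n * (8 * G\<^sup>2)) = sqrt n * (sqrt 8 * G)"
      using G0 by (simp add: real_sqrt_mult)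
    have EA: "expectation (\<lambda>\<omega>. \<bar>An \<omega>\<bar>) \<le> sqrt n * (sqrt 8 * G)"
    proof -
      have "expectation (\<lambda>\<omega>. (An \<omega>)\<^sup>2) \<le> n * (8 * G\<^sup>2)"
      proof -
        have "0 \<le> expectation (\<lambda>\<omega>. (Bn \<omega>)\<^sup>2)" by simp
        then show ?thesis using samp by linarith
      qed
      from order_trans[OF expectation_abs_le_sqrt(2)[OF ABm(1) iA(1)] real_sqrt_le_mono[OF this]]
      show ?thesis unfolding sq .
    qed
    have EB: "expectation (\<lambda>\<omega>. \<bar>Bn \<omega>\<bar>) \<le> sqrt n * (sqrt 8 * G)"
    proof -
      have "expectation (\<lambda>\<omega>. (Bn \<omega>)\<^sup>2) \<le> n * (8 * G\<^sup>2)"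
      proof -
        have "0 \<le> expectation (\<lambda>\<omega>. (An \<omega>)\<^sup>2)" by simp
        then show ?thesis using samp by linarith
      qed
      from order_trans[OF expectation_abs_le_sqrt(2)[OF ABm(2) iA(2)] real_sqrt_le_mono[OF this]]
      show ?thesis unfolding sq .
    qed
    have iAB: "integrable M (\<lambda>\<omega>. \<bar>An \<omega>\<bar>)" "integrable M (\<lambda>\<omega>. \<bar>Bn \<omega>\<bar>)"
      using expectation_abs_le_sqrt(1)[OF ABm(1) iA(1)] expectation_abs_le_sqrt(1)[OF ABm(2) iA(2)] by auto
    have ibp: "expectation (\<lambda>\<omega>. (X s \<omega> * q (X s \<omega>) - q' (X s \<omega>)) * f (cn * \<Phi>n \<omega>))
       = expectation (\<lambda>\<omega>. q (X s \<omega>) * (f' (cn * \<Phi>n \<omega>) * (cn * \<Delta>n \<omega>)))"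
    proof -
      \<comment> \<open>The index n carries the pivot s, the indices below n the sampled
        points.\<close>
      define W where "W j = X (if j = n then s else ts j)" for j
      have W: "gaussian_family M (insert n {..<n}) W" unfolding W_def by (rule X_family) simp
      have Wn: "W n = X s" by (simp add: W_def)
      have Wj: "(\<Sum>j<n. h j (W j \<omega>)) = (\<Sum>j<n. h j (X (ts j) \<omega>))" for h :: "nat \<Rightarrow> real \<Rightarrow> real" and \<omega>
        by (intro sum.cong) (auto simp: W_def)
      have cj: "(\<Sum>j<n. expectation (\<lambda>\<omega>. X s \<omega> * W j \<omega>) * g' (W j \<omega>)) = \<Delta>n \<omega>" for \<omega>
        unfolding \<Delta>n_def by (intro sum.cong) (auto simp: W_def X_cov)
      have "expectation (\<lambda>\<omega>. (W n \<omega> * q (W n \<omega>) - q' (W n \<omega>)) * f (cn * (\<Sum>j<n. g (W j \<omega>))))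
        = expectation (\<lambda>\<omega>. q (W n \<omega>) * (f' (cn * (\<Sum>j<n. g (W j \<omega>)))
        * (cn * (\<Sum>j<n. expectation (\<lambda>\<omega>. W n \<omega> * W j \<omega>) * g' (W j \<omega>)))))"
        by (rule gauss_ibp_finite[OF W _ _ dq cq dg cg df cf Q R G(2)])
           (auto simp: Wn X_var intro!: F sb G)
      then show ?thesis unfolding Wn cj Wj[of "\<lambda>_. g"] \<Phi>n_def .
    qed
    define k where "k \<omega> = X s \<omega> * q (X s \<omega>) - q' (X s \<omega>)" for \<omega>
    have [measurable]: "k \<in> borel_measurable M" unfolding k_def [abs_def] by measurable
    have kb: "\<bar>k \<omega>\<bar> \<le> R" for \<omega> unfolding k_def by (rule R)
    have i1: "integrable M (\<lambda>\<omega>. k \<omega> * f (cn * \<Phi>n \<omega>))" "integrable M (\<lambda>\<omega>. k \<omega> * f (c * \<Phi> \<omega>))"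
      by (rule integrable_bounded_mult[where a=R and b=F]; simp add: kb F \<Phi>nb \<Phi>b)+
    have b2: "\<bar>f' y * z\<bar> \<le> F * B" if "\<bar>y\<bar> \<le> B" "\<bar>z\<bar> \<le> B" for y z
      unfolding abs_mult using F0 that by (intro mult_mono F) auto
    have i2: "integrable M (\<lambda>\<omega>. q (X s \<omega>) * (f' (cn * \<Phi>n \<omega>) * (cn * \<Delta>n \<omega>)))"
      "integrable M (\<lambda>\<omega>. q (X s \<omega>) * (f' (c * \<Phi> \<omega>) * (c * \<Delta> \<omega>)))"
      by (rule integrable_bounded_mult[where a=Q and b="F * B"]; simp add: Q b2 \<Phi>nb \<Phi>b \<Delta>nb \<Delta>b)+
    have d1: "\<bar>expectation (\<lambda>\<omega>. k \<omega> * f (cn * \<Phi>n \<omega>)) - expectation (\<lambda>\<omega>. k \<omega> * f (c * \<Phi> \<omega>))\<bar>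
       \<le> R * L * \<bar>cn\<bar> * (sqrt n * (sqrt 8 * G))"
    proof -
      have "\<bar>expectation (\<lambda>\<omega>. k \<omega> * f (cn * \<Phi>n \<omega>)) - expectation (\<lambda>\<omega>. k \<omega> * f (c * \<Phi> \<omega>))\<bar>
         = \<bar>expectation (\<lambda>\<omega>. k \<omega> * f (cn * \<Phi>n \<omega>) - k \<omega> * f (c * \<Phi> \<omega>))\<bar>"
        using i1 by simp
      also have "\<dots> \<le> expectation (\<lambda>\<omega>. \<bar>k \<omega> * f (cn * \<Phi>n \<omega>) - k \<omega> * f (c * \<Phi> \<omega>)\<bar>)"
        by (rule integral_abs_bound)
      also have "\<dots> \<le> expectation (\<lambda>\<omega>. (R * L * \<bar>cn\<bar>) * \<bar>An \<omega>\<bar>)"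
      proof (rule integral_mono)
        fix \<omega>
        have "\<bar>k \<omega> * f (cn * \<Phi>n \<omega>) - k \<omega> * f (c * \<Phi> \<omega>)\<bar> = \<bar>k \<omega>\<bar> * \<bar>f (cn * \<Phi>n \<omega>) - f (c * \<Phi> \<omega>)\<bar>"
          by (simp add: abs_mult[symmetric] right_diff_distrib)
        also have "\<dots> \<le> R * (L * \<bar>cn * \<Phi>n \<omega> - c * \<Phi> \<omega>\<bar>)"
          using R0 by (intro mult_mono kb L \<Phi>nb \<Phi>b) auto
        finally show "\<bar>k \<omega> * f (cn * \<Phi>n \<omega>) - k \<omega> * f (c * \<Phi> \<omega>)\<bar> \<le> (R * L * \<bar>cn\<bar>) * \<bar>An \<omega>\<bar>"
          by (simp add: e1 abs_mult mult_ac)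
      qed (use i1 iAB in auto)
      also have "\<dots> \<le> R * L * \<bar>cn\<bar> * (sqrt n * (sqrt 8 * G))"
        using EA R0 L0 by (simp add: mult_left_mono)
      finally show ?thesis .
    qed
    have d2: "\<bar>expectation (\<lambda>\<omega>. q (X s \<omega>) * (f' (cn * \<Phi>n \<omega>) * (cn * \<Delta>n \<omega>))) - expectation (\<lambda>\<omega>. q (X s \<omega>) * (f' (c * \<Phi> \<omega>) * (c * \<Delta> \<omega>)))\<bar>
       \<le> Q * (F * \<bar>cn\<bar> + L * \<bar>cn\<bar> * B) * (sqrt n * (sqrt 8 * G))"
    proof -
      have "\<bar>expectation (\<lambda>\<omega>. q (X s \<omega>) * (f' (cn * \<Phi>n \<omega>) * (cn * \<Delta>n \<omega>))) - expectation (\<lambda>\<omega>. q (X s \<omega>) * (f' (c * \<Phi> \<omega>) * (c * \<Delta> \<omega>)))\<bar>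
         = \<bar>expectation (\<lambda>\<omega>. q (X s \<omega>) * (f' (cn * \<Phi>n \<omega>) * (cn * \<Delta>n \<omega>)) - q (X s \<omega>) * (f' (c * \<Phi> \<omega>) * (c * \<Delta> \<omega>)))\<bar>"
        using i2 by simp
      also have "\<dots> \<le> expectation (\<lambda>\<omega>. \<bar>q (X s \<omega>) * (f' (cn * \<Phi>n \<omega>) * (cn * \<Delta>n \<omega>)) - q (X s \<omega>) * (f' (c * \<Phi> \<omega>) * (c * \<Delta> \<omega>))\<bar>)"
        by (rule integral_abs_bound)
      also have "\<dots> \<le> expectation (\<lambda>\<omega>. Q * (F * \<bar>cn\<bar>) * \<bar>Bn \<omega>\<bar> + Q * (L * \<bar>cn\<bar> * B) * \<bar>An \<omega>\<bar>)"
      proof (rule integral_mono)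
        fix \<omega>
        let ?y = "cn * \<Phi>n \<omega>" and ?z = "c * \<Phi> \<omega>" and ?u = "cn * \<Delta>n \<omega>" and ?v = "c * \<Delta> \<omega>"
        have "q (X s \<omega>) * (f' ?y * ?u) - q (X s \<omega>) * (f' ?z * ?v) = q (X s \<omega>) * (f' ?y * (?u - ?v) + (f' ?y - f' ?z) * ?v)"
          by (simp add: algebra_simps)
        also have "\<bar>\<dots>\<bar> = \<bar>q (X s \<omega>)\<bar> * \<bar>f' ?y * (?u - ?v) + (f' ?y - f' ?z) * ?v\<bar>" by (rule abs_mult)
        also have "\<dots> \<le> Q * (F * \<bar>?u - ?v\<bar> + (L * \<bar>?y - ?z\<bar>) * B)"
        proof (intro mult_mono Q order_trans[OF abs_triangle_ineq] add_mono)
          show "\<bar>f' ?y * (?u - ?v)\<bar> \<le> F * \<bar>?u - ?v\<bar>"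
            unfolding abs_mult by (intro mult_right_mono F \<Phi>nb) auto
          show "\<bar>(f' ?y - f' ?z) * ?v\<bar> \<le> (L * \<bar>?y - ?z\<bar>) * B"
            unfolding abs_mult[of "f' ?y - f' ?z"] using L0 by (intro mult_mono L \<Phi>nb \<Phi>b \<Delta>b) auto
        qed (use Q0 in auto)
        also have "\<dots> = Q * (F * \<bar>cn\<bar>) * \<bar>Bn \<omega>\<bar> + Q * (L * \<bar>cn\<bar> * B) * \<bar>An \<omega>\<bar>"
          unfolding e1 e2 abs_mult by (simp add: algebra_simps)
        finally show "\<bar>q (X s \<omega>) * (f' ?y * ?u) - q (X s \<omega>) * (f' ?z * ?v)\<bar> \<le> Q * (F * \<bar>cn\<bar>) * \<bar>Bn \<omega>\<bar> + Q * (L * \<bar>cn\<bar> * B) * \<bar>An \<omega>\<bar>" .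
      qed (use i2 iAB in auto)
      also have "\<dots> = Q * (F * \<bar>cn\<bar>) * expectation (\<lambda>\<omega>. \<bar>Bn \<omega>\<bar>) + Q * (L * \<bar>cn\<bar> * B) * expectation (\<lambda>\<omega>. \<bar>An \<omega>\<bar>)"
        using iAB by simp
      also have "\<dots> \<le> Q * (F * \<bar>cn\<bar>) * (sqrt n * (sqrt 8 * G)) + Q * (L * \<bar>cn\<bar> * B) * (sqrt n * (sqrt 8 * G))"
        using Q0 F0 L0 B0 by (intro add_mono mult_left_mono EA EB) auto
      finally show ?thesis by (simp add: algebra_simps)
    qed
    have ncn: "\<bar>cn\<bar> * sqrt n = \<bar>c\<bar> * m / sqrt n"
    proof -
      have "sqrt n * sqrt n = n" by simp
      then show ?thesis using n m_pos by (simp add: cn_def abs_mult field_simps)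
    qed
    have "\<bar>?l - ?r\<bar> \<le> R * L * \<bar>cn\<bar> * (sqrt n * (sqrt 8 * G)) + Q * (F * \<bar>cn\<bar> + L * \<bar>cn\<bar> * B) * (sqrt n * (sqrt 8 * G))"
      using d1 d2 ibp unfolding k_def \<Phi>_def[symmetric] \<Delta>_def[symmetric] by linarith
    also have "\<dots> = (R * L + Q * F + Q * L * B) * (sqrt 8 * G) * (\<bar>cn\<bar> * sqrt n)"
      by (simp add: algebra_simps)
    also have "\<dots> = C / sqrt n"
      unfolding ncn C_def by simp
    finally show ?thesis .
  qed
  \<comment> \<open>The bound C / sqrt n holds for every n > 0, while the left-hand side is
    fixed.\<close>
  have "?l - ?r = 0"
  proof (rule ccontr)
    assume "?l - ?r \<noteq> 0"
    then have x: "\<bar>?l - ?r\<bar> > 0" by simp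
    obtain n :: nat where n: "(C / \<bar>?l - ?r\<bar>)\<^sup>2 < n" using reals_Archimedean2 by blast
    then have n0: "n > 0" using zero_le_power2[of "C / \<bar>?l - ?r\<bar>"] by (cases n) auto
    have "C / \<bar>?l - ?r\<bar> < sqrt n" using n by (rule real_less_rsqrt)
    then have "C / sqrt n < \<bar>?l - ?r\<bar>" using x n0 by (simp add: field_simps)
    with main[OF n0] show False by simp
  qed
  then show ?thesis by simp
qed

end

section \<open>Variance bounds for linear and quadratic functionals\<close>

context sampling_window
begin

definition rho_norm :: real where "rho_norm = (\<integral>t. \<bar>\<rho> t\<bar> \<partial>lborel)"

lemma rho_norm_nonneg: "rho_norm \<ge> 0"
  by (simp add: rho_norm_def)

lemma rho_window:
  "(\<integral>\<^sup>+t. ennreal \<bar>\<rho> (t - s)\<bar> \<partial>N) \<le> ennreal rho_norm"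
  "(\<integral>\<^sup>+t. ennreal \<bar>\<rho> (s - t)\<bar> \<partial>N) \<le> ennreal rho_norm"
proof -
  have "(\<integral>\<^sup>+t. ennreal \<bar>\<rho> (t - s)\<bar> \<partial>N) \<le> (\<integral>\<^sup>+t. ennreal \<bar>\<rho> (t - s)\<bar> \<partial>lborel)"
    by (rule N_le) simp
  also have "\<dots> = (\<integral>\<^sup>+t. ennreal \<bar>\<rho> (t - s)\<bar> \<partial>distr lborel borel ((+) s))"
    by (simp add: lborel_distr_plus)
  also have "\<dots> = (\<integral>\<^sup>+t. ennreal \<bar>\<rho> t\<bar> \<partial>lborel)"
    by (subst nn_integral_distr) auto
  also have "\<dots> = ennreal rho_norm"
    unfolding rho_norm_def using rho_int by (intro nn_integral_eq_integral) auto
  finally show 1: "(\<integral>\<^sup>+t. ennreal \<bar>\<rho> (t - s)\<bar> \<partial>N) \<le> ennreal rho_norm" .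
  have "\<rho> (s - t) = \<rho> (t - s)" for t
    using rho_sym[of "t - s"] by simp
  with 1 show "(\<integral>\<^sup>+t. ennreal \<bar>\<rho> (s - t)\<bar> \<partial>N) \<le> ennreal rho_norm" by simp
qed

lemma emeasure_N: "emeasure N UNIV = ennreal m"
  using N.emeasure_eq_measure[of UNIV] measure_N by simp

text \<open>A Schur-type estimate: the coordinate that \<phi> does not see is integrated first, at
  the cost of one factor \<open>rho_norm\<close>.\<close>

lemma rho_marginal:
  assumes [measurable]: "\<phi> \<in> borel_measurable borel"
  shows "(\<integral>\<^sup>+p. ennreal \<bar>\<rho> (snd p - fst p)\<bar> * \<phi> (fst p) \<partial>(N \<Otimes>\<^sub>M N)) \<le> ennreal rho_norm * (\<integral>\<^sup>+t. \<phi> t \<partial>N)"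
    and "(\<integral>\<^sup>+p. ennreal \<bar>\<rho> (snd p - fst p)\<bar> * \<phi> (snd p) \<partial>(N \<Otimes>\<^sub>M N)) \<le> ennreal rho_norm * (\<integral>\<^sup>+t. \<phi> t \<partial>N)"
proof -
  have "(\<integral>\<^sup>+p. ennreal \<bar>\<rho> (snd p - fst p)\<bar> * \<phi> (fst p) \<partial>(N \<Otimes>\<^sub>M N))
     = (\<integral>\<^sup>+x. \<integral>\<^sup>+y. ennreal \<bar>\<rho> (y - x)\<bar> * \<phi> x \<partial>N \<partial>N)"
    by (subst N.nn_integral_fst[symmetric]) simp_all
  also have "\<dots> = (\<integral>\<^sup>+x. (\<integral>\<^sup>+y. ennreal \<bar>\<rho> (y - x)\<bar> \<partial>N) * \<phi> x \<partial>N)"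
    by (simp add: nn_integral_multc)
  also have "\<dots> \<le> (\<integral>\<^sup>+x. ennreal rho_norm * \<phi> x \<partial>N)"
    by (intro nn_integral_mono mult_right_mono rho_window) auto
  also have "\<dots> = ennreal rho_norm * (\<integral>\<^sup>+x. \<phi> x \<partial>N)"
    by (rule nn_integral_cmult) simp
  finally show "(\<integral>\<^sup>+p. ennreal \<bar>\<rho> (snd p - fst p)\<bar> * \<phi> (fst p) \<partial>(N \<Otimes>\<^sub>M N)) \<le> ennreal rho_norm * (\<integral>\<^sup>+t. \<phi> t \<partial>N)" .
  have "(\<integral>\<^sup>+p. ennreal \<bar>\<rho> (snd p - fst p)\<bar> * \<phi> (snd p) \<partial>(N \<Otimes>\<^sub>M N))
     = (\<integral>\<^sup>+y. \<integral>\<^sup>+x. ennreal \<bar>\<rho> (y - x)\<bar> * \<phi> y \<partial>N \<partial>N)"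
    by (subst NN.nn_integral_snd[symmetric]) (simp_all add: split_beta')
  also have "\<dots> = (\<integral>\<^sup>+y. (\<integral>\<^sup>+x. ennreal \<bar>\<rho> (y - x)\<bar> \<partial>N) * \<phi> y \<partial>N)"
    by (simp add: nn_integral_multc)
  also have "\<dots> \<le> (\<integral>\<^sup>+y. ennreal rho_norm * \<phi> y \<partial>N)"
    by (intro nn_integral_mono mult_right_mono rho_window) auto
  also have "\<dots> = ennreal rho_norm * (\<integral>\<^sup>+y. \<phi> y \<partial>N)"
    by (rule nn_integral_cmult) simp
  finally show "(\<integral>\<^sup>+p. ennreal \<bar>\<rho> (snd p - fst p)\<bar> * \<phi> (snd p) \<partial>(N \<Otimes>\<^sub>M N)) \<le> ennreal rho_norm * (\<integral>\<^sup>+t. \<phi> t \<partial>N)" .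
qed

text \<open>Gebelein's inequality makes the variance proportional to m rather than m^2, and to the
  squared L^2 norm of h, whatever the regularity of h. It is applied to the indicator, to its
  smoothing and to the difference of the two.\<close>

lemma additive_functional_variance:
  assumes h [measurable]: "h \<in> borel_measurable borel" and K: "\<And>x. \<bar>h x :: real\<bar> \<le> K"
  defines "V \<equiv> \<lambda>\<omega>. \<integral>t. h (X t \<omega>) \<partial>N"
  shows "V \<in> borel_measurable M" "\<And>\<omega>. \<bar>V \<omega>\<bar> \<le> K * m" "expectation V = m * (\<integral>x. h x \<partial>gam)"
    "expectation (\<lambda>\<omega>. (V \<omega> - expectation V)\<^sup>2) \<le> m * rho_norm * (\<integral>x. (h x)\<^sup>2 \<partial>gam)"
proof -
  define H where "H = (\<integral>x. (h x)\<^sup>2 \<partial>gam)"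
  have H0: "H \<ge> 0" by (simp add: H_def)
  have wm: "(\<lambda>(p, \<omega>). h (X p \<omega>)) \<in> borel_measurable (N \<Otimes>\<^sub>M M)"
    by (rule X_joint_compose) simp
  have cov: "\<bar>expectation (\<lambda>\<omega>. h (X p \<omega>) * h (X p' \<omega>)) - expectation (\<lambda>\<omega>. h (X p \<omega>)) * expectation (\<lambda>\<omega>. h (X p' \<omega>))\<bar>
     \<le> \<bar>\<rho> (p' - p)\<bar> * H" for p p'
    using X_gebelein[OF h K, of p p'] by (simp add: X_integral H_def power2_eq_square)
  have cm: "(\<lambda>(p, p'). \<bar>\<rho> (p' - p)\<bar> * H) \<in> borel_measurable (N \<Otimes>\<^sub>M N)" by (simp add: split_beta')
  note v = variance_integral_le[OF finite_N wm K cov cm]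
  show "V \<in> borel_measurable M" "\<And>\<omega>. \<bar>V \<omega>\<bar> \<le> K * m" "expectation V = m * (\<integral>x. h x \<partial>gam)"
    unfolding V_def using v(1-3) measure_N by (simp_all add: X_integral)
  have "ennreal (expectation (\<lambda>\<omega>. (V \<omega> - expectation V)\<^sup>2)) \<le> (\<integral>\<^sup>+p. \<integral>\<^sup>+p'. ennreal (\<bar>\<rho> (p' - p)\<bar> * H) \<partial>N \<partial>N)"
    unfolding V_def by (rule v(4))
  also have "\<dots> = (\<integral>\<^sup>+p. (\<integral>\<^sup>+p'. ennreal \<bar>\<rho> (p' - p)\<bar> \<partial>N) * ennreal H \<partial>N)"
    using H0 by (simp add: ennreal_mult nn_integral_multc)
  also have "\<dots> \<le> (\<integral>\<^sup>+p. ennreal rho_norm * ennreal H \<partial>N)"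
    by (intro nn_integral_mono mult_right_mono rho_window) auto
  also have "\<dots> = ennreal (m * rho_norm * H)"
    using m_pos H0 rho_norm_nonneg by (simp add: emeasure_N ennreal_mult mult_ac)
  finally show "expectation (\<lambda>\<omega>. (V \<omega> - expectation V)\<^sup>2) \<le> m * rho_norm * (\<integral>x. (h x)\<^sup>2 \<partial>gam)"
    using m_pos H0 rho_norm_nonneg by (simp add: H_def)
qed

lemma quadratic_functional_measurable:
  assumes [measurable]: "q \<in> borel_measurable borel" "g' \<in> borel_measurable borel"
  shows "(\<lambda>(p, \<omega>). \<rho> (snd p - fst p) * (q (X (fst p) \<omega>) * g' (X (snd p) \<omega>)) :: real) \<in> borel_measurable ((N \<Otimes>\<^sub>M N) \<Otimes>\<^sub>M M)"
proof -
  have [measurable]: "(\<lambda>x. X (fst (fst x)) (snd x)) \<in> borel_measurable ((N \<Otimes>\<^sub>M N) \<Otimes>\<^sub>M M)"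
    "(\<lambda>x. X (snd (fst x)) (snd x)) \<in> borel_measurable ((N \<Otimes>\<^sub>M N) \<Otimes>\<^sub>M M)"
    using measurable_compose[of "\<lambda>x. (fst (fst x), snd x)" "(N \<Otimes>\<^sub>M N) \<Otimes>\<^sub>M M" "N \<Otimes>\<^sub>M M", OF _ X_joint]
      measurable_compose[of "\<lambda>x. (snd (fst x), snd x)" "(N \<Otimes>\<^sub>M N) \<Otimes>\<^sub>M M" "N \<Otimes>\<^sub>M M", OF _ X_joint] by simp_all
  have [measurable]: "(\<lambda>x. \<rho> (snd (fst x) - fst (fst x))) \<in> borel_measurable ((N \<Otimes>\<^sub>M N) \<Otimes>\<^sub>M M)"
    by measurable
  show ?thesis unfolding split_beta' by measurable
qed

text \<open>The covariance of the integrands at two pairs of points carries the factor \<rho> of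
  either pair and a sum of four cross covariances. In each of the four terms, three factors
  \<bar>\<rho>\<bar> link the four points to a tree, so integrating along it gives
  \<open>rho_norm ^ 3\<close> times the mass m of the one free point; 16 is 4 terms times the
  constant 4 of \<open>X_cov_pairs\<close>.\<close>

lemma quadratic_functional_variance:
  assumes qm [measurable]: "q \<in> borel_measurable borel" "g' \<in> borel_measurable borel"
    and Lip: "\<And>y z y' z'. \<bar>q y * g' z - q y' * g' z'\<bar> \<le> L * (\<bar>y - y'\<bar> + \<bar>z - z'\<bar>)"
    and bd: "\<And>y z. \<bar>q y * g' z :: real\<bar> \<le> L"
  defines "V \<equiv> \<lambda>\<omega>. \<integral>p. \<rho> (snd p - fst p) * (q (X (fst p) \<omega>) * g' (X (snd p) \<omega>)) \<partial>(N \<Otimes>\<^sub>M N)"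
  shows "V \<in> borel_measurable M" "\<And>\<omega>. \<bar>V \<omega>\<bar> \<le> L * measure (N \<Otimes>\<^sub>M N) (space (N \<Otimes>\<^sub>M N))"
    "expectation (\<lambda>\<omega>. (V \<omega> - expectation V)\<^sup>2) \<le> 16 * L\<^sup>2 * m * rho_norm ^ 3"
proof -
  define w where "w p \<omega> = \<rho> (snd p - fst p) * (q (X (fst p) \<omega>) * g' (X (snd p) \<omega>))" for p \<omega>
  have finNN: "finite_measure (N \<Otimes>\<^sub>M N)"
    by (intro finite_measure_pair_measure finite_N)
  have wm: "(\<lambda>(p, \<omega>). w p \<omega>) \<in> borel_measurable ((N \<Otimes>\<^sub>M N) \<Otimes>\<^sub>M M)"
    unfolding w_def using quadratic_functional_measurable[OF qm] .
  have wb: "\<bar>w p \<omega>\<bar> \<le> L" for p \<omega>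
    unfolding w_def abs_mult[of "\<rho> _"] using mult_mono[OF rho_le_1 bd] by simp
  define c where "c p p' = \<bar>\<rho> (snd p - fst p)\<bar> * (4 * L\<^sup>2) * (\<bar>\<rho> (snd p' - fst p')\<bar> *
      (\<bar>\<rho> (fst p' - fst p)\<bar> + \<bar>\<rho> (snd p' - fst p)\<bar> + \<bar>\<rho> (fst p' - snd p)\<bar> + \<bar>\<rho> (snd p' - snd p)\<bar>))" for p p'
  have cov: "\<bar>expectation (\<lambda>\<omega>. w p \<omega> * w p' \<omega>) - expectation (w p) * expectation (w p')\<bar> \<le> c p p'" for p p'
  proof -
    let ?r = "\<rho> (snd p - fst p)" and ?r' = "\<rho> (snd p' - fst p')"
    let ?A = "\<lambda>p \<omega>. q (X (fst p) \<omega>) * g' (X (snd p) \<omega>)"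
    have "(\<lambda>\<omega>. w p \<omega> * w p' \<omega>) = (\<lambda>\<omega>. (?r * ?r') * (?A p \<omega> * ?A p' \<omega>))"
      by (auto simp: w_def mult_ac)
    then have e1: "expectation (\<lambda>\<omega>. w p \<omega> * w p' \<omega>) = (?r * ?r') * expectation (\<lambda>\<omega>. ?A p \<omega> * ?A p' \<omega>)"
      by (simp only: integral_mult_right_zero)
    have e2: "expectation (w p) = \<rho> (snd p - fst p) * expectation (?A p)" for p
      unfolding w_def [abs_def] by (rule integral_mult_right_zero)
    have "expectation (\<lambda>\<omega>. w p \<omega> * w p' \<omega>) - expectation (w p) * expectation (w p')
      = (?r * ?r') * (expectation (\<lambda>\<omega>. ?A p \<omega> * ?A p' \<omega>) - expectation (?A p) * expectation (?A p'))"
      unfolding e1 e2 by (simp only: right_diff_distrib mult_ac)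
    also have "\<bar>\<dots>\<bar> \<le> (\<bar>?r\<bar> * \<bar>?r'\<bar>) * (4 * L\<^sup>2 * (\<bar>\<rho> (fst p' - fst p)\<bar> + \<bar>\<rho> (snd p' - fst p)\<bar> + \<bar>\<rho> (fst p' - snd p)\<bar> + \<bar>\<rho> (snd p' - snd p)\<bar>))"
      unfolding abs_mult[of "?r * ?r'"] abs_mult[of ?r]
      by (intro mult_left_mono X_cov_pairs[of "\<lambda>y z. q y * g' z"] Lip bd) auto
    finally show ?thesis by (simp add: c_def mult_ac)
  qed
  have cm: "(\<lambda>(p, p'). c p p') \<in> borel_measurable ((N \<Otimes>\<^sub>M N) \<Otimes>\<^sub>M (N \<Otimes>\<^sub>M N))"
    unfolding c_def split_beta' by measurable
  note v = variance_integral_le[OF finNN wm wb cov cm]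
  show "V \<in> borel_measurable M" "\<And>\<omega>. \<bar>V \<omega>\<bar> \<le> L * measure (N \<Otimes>\<^sub>M N) (space (N \<Otimes>\<^sub>M N))"
    unfolding V_def w_def[symmetric] by (rule v(1), rule v(2))
  have R0: "rho_norm \<ge> 0" by (rule rho_norm_nonneg)
  \<comment> \<open>Two edges of the tree: the pair p' is attached to a point x by its first or by
    its second end.\<close>
  have i1: "(\<integral>\<^sup>+p'. ennreal \<bar>\<rho> (snd p' - fst p')\<bar> * ennreal \<bar>\<rho> (fst p' - x)\<bar> \<partial>(N \<Otimes>\<^sub>M N)) \<le> ennreal (rho_norm\<^sup>2)"
    and i2: "(\<integral>\<^sup>+p'. ennreal \<bar>\<rho> (snd p' - fst p')\<bar> * ennreal \<bar>\<rho> (snd p' - x)\<bar> \<partial>(N \<Otimes>\<^sub>M N)) \<le> ennreal (rho_norm\<^sup>2)" for x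
  proof -
    have e: "ennreal rho_norm * (\<integral>\<^sup>+t. ennreal \<bar>\<rho> (t - x)\<bar> \<partial>N) \<le> ennreal (rho_norm\<^sup>2)"
      using mult_left_mono[OF rho_window(1)[of x], of "ennreal rho_norm"] R0 by (simp add: power2_eq_square ennreal_mult)
    show "(\<integral>\<^sup>+p'. ennreal \<bar>\<rho> (snd p' - fst p')\<bar> * ennreal \<bar>\<rho> (fst p' - x)\<bar> \<partial>(N \<Otimes>\<^sub>M N)) \<le> ennreal (rho_norm\<^sup>2)"
      "(\<integral>\<^sup>+p'. ennreal \<bar>\<rho> (snd p' - fst p')\<bar> * ennreal \<bar>\<rho> (snd p' - x)\<bar> \<partial>(N \<Otimes>\<^sub>M N)) \<le> ennreal (rho_norm\<^sup>2)"
      by (rule order_trans[OF rho_marginal(1)[of "\<lambda>t. ennreal \<bar>\<rho> (t - x)\<bar>"] e] order_trans[OF rho_marginal(2)[of "\<lambda>t. ennreal \<bar>\<rho> (t - x)\<bar>"] e]; simp)+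
  qed
  have inner: "(\<integral>\<^sup>+p'. ennreal (c p p') \<partial>(N \<Otimes>\<^sub>M N)) \<le> ennreal \<bar>\<rho> (snd p - fst p)\<bar> * ennreal (16 * L\<^sup>2 * rho_norm\<^sup>2)" for p
  proof -
    let ?k = "ennreal (\<bar>\<rho> (snd p - fst p)\<bar> * (4 * L\<^sup>2))"
    let ?e = "\<lambda>p'. ennreal \<bar>\<rho> (snd p' - fst p')\<bar>"
    have "(\<integral>\<^sup>+p'. ennreal (c p p') \<partial>(N \<Otimes>\<^sub>M N)) = (\<integral>\<^sup>+p'. ?k * (?e p' * ennreal \<bar>\<rho> (fst p' - fst p)\<bar> + ?e p' * ennreal \<bar>\<rho> (snd p' - fst p)\<bar>
         + ?e p' * ennreal \<bar>\<rho> (fst p' - snd p)\<bar> + ?e p' * ennreal \<bar>\<rho> (snd p' - snd p)\<bar>) \<partial>(N \<Otimes>\<^sub>M N))"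
      unfolding c_def by (intro nn_integral_cong) (simp add: ennreal_mult ennreal_plus distrib_left del: ennreal_plus[symmetric])
    also have "\<dots> = ?k * ((\<integral>\<^sup>+p'. ?e p' * ennreal \<bar>\<rho> (fst p' - fst p)\<bar> \<partial>(N \<Otimes>\<^sub>M N)) + (\<integral>\<^sup>+p'. ?e p' * ennreal \<bar>\<rho> (snd p' - fst p)\<bar> \<partial>(N \<Otimes>\<^sub>M N))
         + (\<integral>\<^sup>+p'. ?e p' * ennreal \<bar>\<rho> (fst p' - snd p)\<bar> \<partial>(N \<Otimes>\<^sub>M N)) + (\<integral>\<^sup>+p'. ?e p' * ennreal \<bar>\<rho> (snd p' - snd p)\<bar> \<partial>(N \<Otimes>\<^sub>M N)))"
      by (simp add: nn_integral_cmult nn_integral_add)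
    also have "\<dots> \<le> ?k * (ennreal (rho_norm\<^sup>2) + ennreal (rho_norm\<^sup>2) + ennreal (rho_norm\<^sup>2) + ennreal (rho_norm\<^sup>2))"
      by (intro mult_left_mono add_mono i1 i2) auto
    also have "\<dots> = ennreal (\<bar>\<rho> (snd p - fst p)\<bar> * (4 * L\<^sup>2) * (4 * rho_norm\<^sup>2))"
      by (simp add: ennreal_plus[symmetric] ennreal_mult[symmetric] del: ennreal_plus)
    also have "\<dots> = ennreal \<bar>\<rho> (snd p - fst p)\<bar> * ennreal (16 * L\<^sup>2 * rho_norm\<^sup>2)"
      by (subst ennreal_mult[symmetric]) (auto intro!: arg_cong[where f=ennreal])
    finally show ?thesis .
  qed
  \<comment> \<open>After the inner integral only the edge inside p is left; it gives the third
    factor \<open>rho_norm\<close>, and its free end the mass m.\<close>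
  have "ennreal (expectation (\<lambda>\<omega>. (V \<omega> - expectation V)\<^sup>2)) \<le> (\<integral>\<^sup>+p. \<integral>\<^sup>+p'. ennreal (c p p') \<partial>(N \<Otimes>\<^sub>M N) \<partial>(N \<Otimes>\<^sub>M N))"
    unfolding V_def w_def[symmetric] by (rule v(4))
  also have "\<dots> \<le> (\<integral>\<^sup>+p. ennreal \<bar>\<rho> (snd p - fst p)\<bar> * ennreal (16 * L\<^sup>2 * rho_norm\<^sup>2) \<partial>(N \<Otimes>\<^sub>M N))"
    by (intro nn_integral_mono inner)
  also have "\<dots> \<le> ennreal rho_norm * (\<integral>\<^sup>+t. ennreal (16 * L\<^sup>2 * rho_norm\<^sup>2) \<partial>N)"
    by (rule rho_marginal(1)) simp
  also have "\<dots> = ennreal rho_norm * (ennreal (16 * L\<^sup>2 * rho_norm\<^sup>2) * ennreal m)"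
    by (simp add: emeasure_N)
  also have "\<dots> = ennreal (16 * L\<^sup>2 * m * rho_norm ^ 3)"
  proof -
    have k: "0 \<le> 16 * L\<^sup>2 * rho_norm\<^sup>2" by simp
    have "ennreal rho_norm * (ennreal (16 * L\<^sup>2 * rho_norm\<^sup>2) * ennreal m) = ennreal (rho_norm * (16 * L\<^sup>2 * rho_norm\<^sup>2 * m))"
      using R0 less_imp_le[OF m_pos] k by (simp only: ennreal_mult mult_nonneg_nonneg)
    also have "rho_norm * (16 * L\<^sup>2 * rho_norm\<^sup>2 * m) = 16 * L\<^sup>2 * m * rho_norm ^ 3"
      by (simp add: power2_eq_square power3_eq_cube)
    finally show ?thesis .
  qed
  finally show "expectation (\<lambda>\<omega>. (V \<omega> - expectation V)\<^sup>2) \<le> 16 * L\<^sup>2 * m * rho_norm ^ 3"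
    using R0 m_pos by simp
qed

text \<open>The weight \<open>V\<close> takes the place of the Malliavin inner product \<open>\<langle>D\<Phi>, -D L\<^sup>-\<^sup>1 \<Phi>\<rangle>\<close>: as \<open>g\<close> is
  the Stein operator applied to \<open>q\<close>, Gaussian integration by parts in each \<open>X s\<close> removes the factor \<open>\<Phi>\<close>.\<close>

lemma stein_functional:
  assumes dq: "\<And>x. (q has_real_derivative q' x) (at x)" and cq: "\<And>x. isCont q' x"
    and dg: "\<And>x. (g has_real_derivative g' x) (at x)" and cg: "\<And>x. isCont g' x"
    and df: "\<And>x. (f has_real_derivative f' x) (at x)" and cf: "\<And>x. isCont f' x"
    and Q: "\<And>x. \<bar>q x\<bar> \<le> Q" and qg: "\<And>x. x * q x - q' x = g x"
    and G: "\<And>x. \<bar>g x\<bar> \<le> G" "\<And>x. \<bar>g' x\<bar> \<le> G"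
    and B: "\<bar>c\<bar> * (m * G) \<le> B"
    and F: "\<And>y. \<bar>y\<bar> \<le> B \<Longrightarrow> \<bar>f y\<bar> \<le> F" "\<And>y. \<bar>y\<bar> \<le> B \<Longrightarrow> \<bar>f' y\<bar> \<le> F"
    and L: "\<And>y z. \<bar>y\<bar> \<le> B \<Longrightarrow> \<bar>z\<bar> \<le> B \<Longrightarrow> \<bar>f y - f z\<bar> \<le> L * \<bar>y - z\<bar>"
      "\<And>y z. \<bar>y\<bar> \<le> B \<Longrightarrow> \<bar>z\<bar> \<le> B \<Longrightarrow> \<bar>f' y - f' z\<bar> \<le> L * \<bar>y - z\<bar>" and L0: "L \<ge> 0"
  defines "\<Phi> \<equiv> \<lambda>\<omega>. c * (\<integral>t. g (X t \<omega>) \<partial>N)"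
    and "V \<equiv> \<lambda>\<omega>. c\<^sup>2 * (\<integral>p. \<rho> (snd p - fst p) * (q (X (fst p) \<omega>) * g' (X (snd p) \<omega>)) \<partial>(N \<Otimes>\<^sub>M N))"
  shows "expectation (\<lambda>\<omega>. \<Phi> \<omega> * f (\<Phi> \<omega>)) = expectation (\<lambda>\<omega>. f' (\<Phi> \<omega>) * V \<omega>)"
proof -
  have bm: "h \<in> borel_measurable borel" if "\<And>x. isCont h x" for h :: "real \<Rightarrow> real"
    using that by (intro borel_measurable_continuous_onI continuous_at_imp_continuous_on) auto
  have Cq: "isCont q x" and Cg: "isCont g x" and Cf: "isCont f x" for x
    using dq dg df DERIV_isCont by blast+
  have qm: "q \<in> borel_measurable borel" and gm: "g' \<in> borel_measurable borel" by (intro bm Cq cg)+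
  have [measurable]: "q \<in> borel_measurable borel" "q' \<in> borel_measurable borel" "g \<in> borel_measurable borel"
    "g' \<in> borel_measurable borel" "f \<in> borel_measurable borel" "f' \<in> borel_measurable borel"
    by (intro bm cq cg cf Cq Cg Cf)+
  have G0: "G \<ge> 0" and Q0: "Q \<ge> 0"
    using order_trans[OF abs_ge_zero G(1)] order_trans[OF abs_ge_zero Q] .
  have B0: "B \<ge> 0" using B G0 m_pos by (smt (verit) mult_nonneg_nonneg)
  have F0: "F \<ge> 0" using order_trans[OF abs_ge_zero F(1)[of 0]] B0 by simp
  have gX: "(\<lambda>(t, \<omega>). g (X t \<omega>)) \<in> borel_measurable (N \<Otimes>\<^sub>M M)" and qX: "(\<lambda>(t, \<omega>). q (X t \<omega>)) \<in> borel_measurable (N \<Otimes>\<^sub>M M)"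
    by (rule X_joint_compose, simp)+
  have [measurable]: "\<Phi> \<in> borel_measurable M"
    unfolding \<Phi>_def using integral_N_measurable[OF gX] by simp
  have \<Phi>b: "\<bar>\<Phi> \<omega>\<bar> \<le> B" for \<omega>
    unfolding \<Phi>_def abs_mult by (intro order_trans[OF mult_left_mono[OF abs_integral_N_le] B] G) auto
  have gb: "\<bar>\<rho> t * g' x\<bar> \<le> G" for t x
    unfolding abs_mult using mult_mono[OF rho_le_1[of t] G(2)[of x]] by simp
  define \<Delta> where "\<Delta> s \<omega> = (\<integral>t. \<rho> (t - s) * g' (X t \<omega>) \<partial>N)" for s \<omega>
  have \<Delta>m [measurable]: "(\<lambda>(s, \<omega>). \<Delta> s \<omega>) \<in> borel_measurable (N \<Otimes>\<^sub>M M)"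
  proof -
    have [measurable]: "(\<lambda>x. X (snd x) (snd (fst x))) \<in> borel_measurable ((N \<Otimes>\<^sub>M M) \<Otimes>\<^sub>M N)"
      using measurable_compose[of "\<lambda>x. (snd x, snd (fst x))" "(N \<Otimes>\<^sub>M M) \<Otimes>\<^sub>M N" "N \<Otimes>\<^sub>M M", OF _ X_joint] by simp
    have "(\<lambda>(z, t). \<rho> (t - fst z) * g' (X t (snd z))) \<in> borel_measurable ((N \<Otimes>\<^sub>M M) \<Otimes>\<^sub>M N)"
      unfolding split_beta' by measurable
    from N.borel_measurable_lebesgue_integral[OF this] show ?thesis by (simp add: \<Delta>_def split_beta')
  qed
  have \<Delta>b: "\<bar>\<Delta> s \<omega>\<bar> \<le> m * G" for s \<omega>
    unfolding \<Delta>_def by (intro abs_integral_N_le gb)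
  interpret NMf: finite_measure "N \<Otimes>\<^sub>M M" by (rule finite_measure_NM)
  have i1: "integrable (N \<Otimes>\<^sub>M M) (\<lambda>(s, \<omega>). g (X s \<omega>) * f (\<Phi> \<omega>))"
  proof (rule NMf.integrable_const_bound[where B="G * F"])
    show "AE x in N \<Otimes>\<^sub>M M. norm (case x of (s, \<omega>) \<Rightarrow> g (X s \<omega>) * f (\<Phi> \<omega>)) \<le> G * F"
      unfolding split_beta' real_norm_def abs_mult using G0 by (intro AE_I2 mult_mono G F \<Phi>b) auto
    show "(\<lambda>(s, \<omega>). g (X s \<omega>) * f (\<Phi> \<omega>)) \<in> borel_measurable (N \<Otimes>\<^sub>M M)"
      using gX unfolding split_beta' by simp
  qed
  have i2: "integrable (N \<Otimes>\<^sub>M M) (\<lambda>(s, \<omega>). q (X s \<omega>) * (f' (\<Phi> \<omega>) * (c * \<Delta> s \<omega>)))"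
  proof (rule NMf.integrable_const_bound[where B="Q * (F * (\<bar>c\<bar> * (m * G)))"])
    show "AE x in N \<Otimes>\<^sub>M M. norm (case x of (s, \<omega>) \<Rightarrow> q (X s \<omega>) * (f' (\<Phi> \<omega>) * (c * \<Delta> s \<omega>))) \<le> Q * (F * (\<bar>c\<bar> * (m * G)))"
      unfolding split_beta' real_norm_def abs_mult using Q0 F0 by (intro AE_I2 mult_mono Q F \<Phi>b \<Delta>b) auto
    show "(\<lambda>(s, \<omega>). q (X s \<omega>) * (f' (\<Phi> \<omega>) * (c * \<Delta> s \<omega>))) \<in> borel_measurable (N \<Otimes>\<^sub>M M)"
      using qX \<Delta>m unfolding split_beta' by simp
  qed
  have "expectation (\<lambda>\<omega>. \<Phi> \<omega> * f (\<Phi> \<omega>)) = c * expectation (\<lambda>\<omega>. \<integral>s. g (X s \<omega>) * f (\<Phi> \<omega>) \<partial>N)"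
    unfolding integral_mult_left_zero by (simp add: \<Phi>_def mult.assoc)
  also have "expectation (\<lambda>\<omega>. \<integral>s. g (X s \<omega>) * f (\<Phi> \<omega>) \<partial>N) = (\<integral>s. expectation (\<lambda>\<omega>. g (X s \<omega>) * f (\<Phi> \<omega>)) \<partial>N)"
    by (rule NM.Fubini_integral[OF i1])
  \<comment> \<open>Integration by parts at each s. By the Stein equation \<open>qg\<close> the
    quantity x q - q' is g itself, so its bound is G.\<close>
  also have "\<dots> = (\<integral>s. expectation (\<lambda>\<omega>. q (X s \<omega>) * (f' (\<Phi> \<omega>) * (c * \<Delta> s \<omega>))) \<partial>N)"
    using X_ibp[OF dq cq dg cg df cf Q _ G B F L L0, of G] G(1) by (simp add: qg \<Phi>_def \<Delta>_def)
  also have "\<dots> = expectation (\<lambda>\<omega>. \<integral>s. q (X s \<omega>) * (f' (\<Phi> \<omega>) * (c * \<Delta> s \<omega>)) \<partial>N)"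
    by (rule NM.Fubini_integral[OF i2, symmetric])
  also have "c * \<dots> = expectation (\<lambda>\<omega>. c * (\<integral>s. q (X s \<omega>) * (f' (\<Phi> \<omega>) * (c * \<Delta> s \<omega>)) \<partial>N))" by simp
  also have "\<dots> = expectation (\<lambda>\<omega>. f' (\<Phi> \<omega>) * V \<omega>)"
  \<comment> \<open>For a fixed outcome the iterated integral over s and t is collected into one
    over N x N. One factor c stems from the outer \<Phi>, the other from differentiating the inner
    one.\<close>
  proof (rule Bochner_Integration.integral_cong[OF refl])
    fix \<omega> assume w: "\<omega> \<in> space M"
    define h where "h = (\<lambda>p. \<rho> (snd p - fst p) * (q (X (fst p) \<omega>) * g' (X (snd p) \<omega>)))"
    have "h \<in> borel_measurable (N \<Otimes>\<^sub>M N)"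
      using measurable_compose[OF measurable_Pair2'[OF w] quadratic_functional_measurable[OF qm gm]] by (simp add: h_def)
    moreover have "\<bar>h p\<bar> \<le> 1 * (Q * G)" for p
      unfolding h_def abs_mult using Q0 by (intro mult_mono rho_le_1 Q G) auto
    moreover have "finite_measure (N \<Otimes>\<^sub>M N)" by (intro finite_measure_pair_measure finite_N)
    ultimately have "integrable (N \<Otimes>\<^sub>M N) h"
      by (intro finite_measure.integrable_const_bound[where B="1 * (Q * G)"]) auto
    from NN.integral_fst'[OF this]
    have "(\<integral>s. q (X s \<omega>) * \<Delta> s \<omega> \<partial>N) = (\<integral>p. h p \<partial>(N \<Otimes>\<^sub>M N))"
    proof -
      have "(\<integral>t. h (s, t) \<partial>N) = q (X s \<omega>) * \<Delta> s \<omega>" for s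
        unfolding \<Delta>_def h_def fst_conv snd_conv mult.left_commute[of "\<rho> _"] by (rule integral_mult_right_zero)
      then show ?thesis
        using \<open>(\<integral>x. \<integral>y. h (x, y) \<partial>N \<partial>N) = (\<integral>p. h p \<partial>(N \<Otimes>\<^sub>M N))\<close> by simp
    qed
    moreover have "(\<integral>s. q (X s \<omega>) * (f' (\<Phi> \<omega>) * (c * \<Delta> s \<omega>)) \<partial>N) = (f' (\<Phi> \<omega>) * c) * (\<integral>s. q (X s \<omega>) * \<Delta> s \<omega> \<partial>N)"
      by (subst integral_mult_right_zero[symmetric]) (simp add: mult_ac)
    ultimately show "c * (\<integral>s. q (X s \<omega>) * (f' (\<Phi> \<omega>) * (c * \<Delta> s \<omega>)) \<partial>N) = f' (\<Phi> \<omega>) * V \<omega>"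
      by (simp add: V_def h_def power2_eq_square mult_ac)
  qed
  finally show ?thesis .
qed

end

subsection \<open>Stein's method for additive functionals\<close>

lemma normal_law_integral:
  fixes h :: "real \<Rightarrow> real"
  assumes s: "\<sigma> > 0" and [measurable]: "h \<in> borel_measurable borel"
  shows "(\<integral>x. h x \<partial>normal_law (\<sigma>\<^sup>2)) = (\<integral>x. h (\<sigma> * x) \<partial>gam)"
proof -
  have "(\<integral>x. h x \<partial>normal_law (\<sigma>\<^sup>2)) = (\<integral>x. normal_density 0 \<sigma> x * h x \<partial>lborel)"
    using s unfolding normal_law_def by (simp add: integral_real_density)
  also have "\<dots> = \<bar>\<sigma>\<bar> *\<^sub>R (\<integral>x. normal_density 0 \<sigma> (0 + \<sigma> * x) * h (0 + \<sigma> * x) \<partial>lborel)"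
    using s by (intro lborel_integral_real_affine) auto
  also have "\<dots> = (\<integral>x. std_normal_density x * h (\<sigma> * x) \<partial>lborel)"
  proof -
    have "\<sigma> * normal_density 0 \<sigma> (\<sigma> * x) = std_normal_density x" for x
      using s by (simp add: normal_density_def power_mult_distrib real_sqrt_mult)
    then show ?thesis
      using s by (simp add: integral_mult_right_zero[symmetric] mult.assoc[symmetric] del: integral_mult_right_zero)
  qed
  also have "\<dots> = (\<integral>x. h (\<sigma> * x) \<partial>gam)"
    by (subst gam_integral) auto
  finally show ?thesis .
qed

text \<open>A Stein solution with merely linearly growing derivative is enough here, since the second
  moment of the functional is bounded.\<close>

lemma stein_solution_lipschitz:
  assumes h: "lipschitz_on 1 UNIV (h :: real \<Rightarrow> real)" and s: "\<sigma> > 0"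
  obtains q q' where "\<And>x. (q has_real_derivative q' x) (at x)" "\<And>x. isCont q' x"
    "\<And>x. \<sigma> * (x * q x - q' x) = h (\<sigma> * x) - (\<integral>x. h (\<sigma> * x) \<partial>gam)"
    "\<And>x. \<bar>q x\<bar> \<le> 7" "\<And>x. \<bar>q' x\<bar> \<le> 8 * \<bar>x\<bar> + 1"
    "\<And>B x y. \<bar>x\<bar> \<le> B \<Longrightarrow> \<bar>y\<bar> \<le> B \<Longrightarrow> \<bar>q x - q y\<bar> \<le> (8 * B + 1) * \<bar>x - y\<bar>"
    "\<And>B x y. \<bar>x\<bar> \<le> B \<Longrightarrow> \<bar>y\<bar> \<le> B \<Longrightarrow> \<bar>q' x - q' y\<bar> \<le> (8 + B * (8 * B + 1)) * \<bar>x - y\<bar>"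
proof -
  have hL: "\<bar>h x - h y\<bar> \<le> \<bar>x - y\<bar>" for x y
    using lipschitz_onD[OF h, of x y] by (simp add: dist_real_def)
  have hc: "continuous_on UNIV h" using h by (rule lipschitz_on_continuous_on)
  have [measurable]: "h \<in> borel_measurable borel"
    using hc by (rule borel_measurable_continuous_onI)
  define a where "a = (\<integral>x. h (\<sigma> * x) \<partial>gam)"
  \<comment> \<open>Rescaled so as to be again 1-Lipschitz and centred under the standard normal
    law; the constants below are thereby independent of h and \<sigma>.\<close>
  define k where "k x = (h (\<sigma> * x) - a) / \<sigma>" for x
  have kL: "\<bar>k x - k y\<bar> \<le> \<bar>x - y\<bar>" for x y
  proof -
    have "\<bar>k x - k y\<bar> = \<bar>h (\<sigma> * x) - h (\<sigma> * y)\<bar> / \<sigma>"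
      using s by (simp add: k_def diff_divide_distrib[symmetric])
    also have "\<dots> \<le> \<bar>\<sigma> * x - \<sigma> * y\<bar> / \<sigma>"
      using s hL by (intro divide_right_mono) auto
    also have "\<dots> = \<bar>x - y\<bar>"
      using s by (simp add: right_diff_distrib[symmetric] abs_mult)
    finally show ?thesis .
  qed
  have kc: "continuous_on UNIV k"
    unfolding k_def by (intro continuous_intros continuous_on_compose2[OF hc]) (use s in auto)
  have [measurable]: "k \<in> borel_measurable borel"
    using kc by (rule borel_measurable_continuous_onI)
  have k0: "\<bar>k x\<bar> \<le> \<bar>k 0\<bar> + \<bar>x\<bar>" for x using kL[of x 0] by simp
  have ih: "integrable gam k"
  proof (rule Bochner_Integration.integrable_bound)
    show "integrable gam (\<lambda>x. \<bar>k 0\<bar> + \<bar>x\<bar>)" using gam_integrable_linear by auto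
    show "AE x in gam. norm (k x) \<le> norm (\<bar>k 0\<bar> + \<bar>x\<bar>)" using k0 by auto
  qed simp
  have ka: "h (\<sigma> * x) = \<sigma> * k x + a" for x using s by (simp add: k_def)
  have one: "(\<integral>x. c \<partial>gam) = c" for c :: real using gam.prob_space by simp
  have mean: "(\<integral>x. k x \<partial>gam) = 0"
  proof -
    have "a = (\<integral>x. h (\<sigma> * x) \<partial>gam)" by (rule a_def)
    also have "\<dots> = (\<integral>x. \<sigma> * k x + a \<partial>gam)" by (simp only: ka)
    also have "\<dots> = \<sigma> * (\<integral>x. k x \<partial>gam) + a" using ih one by (subst Bochner_Integration.integral_add) auto
    finally show ?thesis using s by simp
  qed
  have ab: "(\<integral>y. \<bar>y\<bar> \<partial>gam) \<le> 1"
  proof -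
    have "poly (hp (Suc 0)) = (\<lambda>y. y)" by auto
    with hp_integral_abs[of "Suc 0"] show ?thesis by (simp only: fact_Suc_0 real_sqrt_one)
  qed
  \<comment> \<open>As k has mean zero, k x is the Gaussian average of k x - k y, and the mean
    modulus of a standard normal variable is at most 1. This gives a = b = 1 in
    \<open>stein_equation_solution\<close>, hence the bound 6 + 1 = 7.\<close>
  have kb: "\<bar>k x\<bar> \<le> 1 + 1 * \<bar>x\<bar>" for x
  proof -
    have "\<bar>k x\<bar> = \<bar>\<integral>y. k x - k y \<partial>gam\<bar>"
      unfolding Bochner_Integration.integral_diff[OF gam.integrable_const ih] one mean by simp
    also have "\<dots> \<le> (\<integral>y. \<bar>k x - k y\<bar> \<partial>gam)" by (rule integral_abs_bound)
    also have "\<dots> \<le> (\<integral>y. \<bar>x\<bar> + \<bar>y\<bar> \<partial>gam)"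
    proof (rule integral_mono)
      show "\<bar>k x - k y\<bar> \<le> \<bar>x\<bar> + \<bar>y\<bar>" for y using kL[of x y] by linarith
    qed (use ih gam_integrable_linear in auto)
    also have "\<dots> = \<bar>x\<bar> + (\<integral>y. \<bar>y\<bar> \<partial>gam)"
      using gam_integrable_linear one by (subst Bochner_Integration.integral_add) auto
    finally show ?thesis using ab by simp
  qed
  obtain q where dq: "\<And>x. (q has_real_derivative x * q x - k x) (at x)" and qb: "\<And>x. \<bar>q x\<bar> \<le> 6 * 1 + 1"
    using stein_equation_solution[OF kc kb mean] by auto
  define q' where "q' x = x * q x - k x" for x
  have q'b: "\<bar>q' x\<bar> \<le> 8 * \<bar>x\<bar> + 1" for x
  proof -
    have "\<bar>x * q x\<bar> \<le> \<bar>x\<bar> * 7" unfolding abs_mult using qb by (intro mult_left_mono) auto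
    then show ?thesis using kb[of x] unfolding q'_def by linarith
  qed
  have qL: "\<bar>q x - q y\<bar> \<le> (8 * B + 1) * \<bar>x - y\<bar>" if "\<bar>x\<bar> \<le> B" "\<bar>y\<bar> \<le> B" for B x y
  proof -
    have "norm (q x - q y) \<le> (8 * B + 1) * norm (x - y)"
    proof (rule field_differentiable_bound[of "{-B..B}"])
      show "(q has_field_derivative q' z) (at z within {-B..B})" for z
        using dq[of z] unfolding q'_def by (rule has_field_derivative_at_within)
      show "norm (q' z) \<le> 8 * B + 1" if "z \<in> {-B..B}" for z
        using q'b[of z] that by simp linarith
    qed (use that in auto)
    then show ?thesis by simp
  qed
  \<comment> \<open>The equation q' = x q - k transfers the Lipschitz bounds of q and k to q', on
    bounded intervals only because of the factor x. The 8 is 7 from q plus 1 from k.\<close>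
  have q'L: "\<bar>q' x - q' y\<bar> \<le> (8 + B * (8 * B + 1)) * \<bar>x - y\<bar>" if x: "\<bar>x\<bar> \<le> B" and y: "\<bar>y\<bar> \<le> B" for B x y
  proof -
    have "q' x - q' y = (x - y) * q x + y * (q x - q y) - (k x - k y)"
      by (simp add: q'_def algebra_simps)
    moreover have "\<bar>(x - y) * q x\<bar> \<le> \<bar>x - y\<bar> * 7" unfolding abs_mult using qb by (intro mult_left_mono) auto
    moreover have "\<bar>y * (q x - q y)\<bar> \<le> B * ((8 * B + 1) * \<bar>x - y\<bar>)"
      unfolding abs_mult using y by (intro mult_mono qL x y) auto
    ultimately have "\<bar>q' x - q' y\<bar> \<le> \<bar>x - y\<bar> * 7 + B * ((8 * B + 1) * \<bar>x - y\<bar>) + \<bar>x - y\<bar>"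
      using kL[of x y] by linarith
    also have "\<dots> = (8 + B * (8 * B + 1)) * \<bar>x - y\<bar>" by (simp add: algebra_simps)
    finally show ?thesis .
  qed
  have qk: "\<sigma> * (x * q x - q' x) = h (\<sigma> * x) - (\<integral>x. h (\<sigma> * x) \<partial>gam)" for x
    using s by (simp add: q'_def k_def a_def)
  have "isCont q' x" for x
    unfolding q'_def using DERIV_isCont[OF dq] kc by (intro continuous_intros) (auto simp: continuous_on_eq_continuous_at)
  then show thesis
    using that[of q q'] dq qb q'b qL q'L qk unfolding q'_def by auto
qed

context sampling_window
begin

text \<open>The Stein equation at \<Phi> / \<sigma> expresses the difference of expectations as
  E(\<Phi> f(\<Phi>)) - \<sigma> E u, and \<open>stein_functional\<close> turns this into E(u (V -
  \<sigma>^2)) / \<sigma>. Since the derivative of the Stein solution is not bounded uniformly, u is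
  measured in L^2 and Cauchy-Schwarz is used. The bound K serves for integrability only and does not
  enter the estimate.\<close>

lemma stein_bound:
  assumes dq: "\<And>x. (q has_real_derivative q' x) (at x)" and cq: "\<And>x. isCont q' x"
    and dg: "\<And>x. (g has_real_derivative g' x) (at x)" and cg: "\<And>x. isCont g' x"
    and Q: "\<And>x. \<bar>q x\<bar> \<le> Q" and qg: "\<And>x. x * q x - q' x = g x"
    and G: "\<And>x. \<bar>g x\<bar> \<le> G" "\<And>x. \<bar>g' x\<bar> \<le> G"
    and s: "\<sigma> > 0" and h: "lipschitz_on 1 UNIV h"
    and Vb: "\<And>\<omega>. \<bar>c\<^sup>2 * (\<integral>p. \<rho> (snd p - fst p) * (q (X (fst p) \<omega>) * g' (X (snd p) \<omega>)) \<partial>(N \<Otimes>\<^sub>M N))\<bar> \<le> K"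
  defines "\<Phi> \<equiv> \<lambda>\<omega>. c * (\<integral>t. g (X t \<omega>) \<partial>N)"
    and "V \<equiv> \<lambda>\<omega>. c\<^sup>2 * (\<integral>p. \<rho> (snd p - fst p) * (q (X (fst p) \<omega>) * g' (X (snd p) \<omega>)) \<partial>(N \<Otimes>\<^sub>M N))"
  shows "\<bar>expectation (\<lambda>\<omega>. h (\<Phi> \<omega>)) - (\<integral>x. h x \<partial>normal_law (\<sigma>\<^sup>2))\<bar>
    \<le> sqrt (128 * expectation (\<lambda>\<omega>. (\<Phi> \<omega>)\<^sup>2) / \<sigma>\<^sup>2 + 2) * (sqrt (expectation (\<lambda>\<omega>. (V \<omega> - \<sigma>\<^sup>2)\<^sup>2)) / \<sigma>)"
proof -
  obtain r r' where dr: "\<And>x. (r has_real_derivative r' x) (at x)" and cr: "\<And>x. isCont r' x"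
    and rh: "\<And>x. \<sigma> * (x * r x - r' x) = h (\<sigma> * x) - (\<integral>x. h (\<sigma> * x) \<partial>gam)"
    and rb: "\<And>x. \<bar>r x\<bar> \<le> 7" "\<And>x. \<bar>r' x\<bar> \<le> 8 * \<bar>x\<bar> + 1"
    and rL: "\<And>B x y. \<bar>x\<bar> \<le> B \<Longrightarrow> \<bar>y\<bar> \<le> B \<Longrightarrow> \<bar>r x - r y\<bar> \<le> (8 * B + 1) * \<bar>x - y\<bar>"
    "\<And>B x y. \<bar>x\<bar> \<le> B \<Longrightarrow> \<bar>y\<bar> \<le> B \<Longrightarrow> \<bar>r' x - r' y\<bar> \<le> (8 + B * (8 * B + 1)) * \<bar>x - y\<bar>"
    by (rule stein_solution_lipschitz[OF h s]) (rule that)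
  have bm: "f \<in> borel_measurable borel" if "\<And>x. isCont f x" for f :: "real \<Rightarrow> real"
    using that by (intro borel_measurable_continuous_onI continuous_at_imp_continuous_on) auto
  have hm [measurable]: "h \<in> borel_measurable borel"
    using lipschitz_on_continuous_on[OF h] by (rule borel_measurable_continuous_onI)
  have Cq: "isCont q x" and Cg: "isCont g x" and Cr: "isCont r x" for x
    using dq dg dr DERIV_isCont by blast+
  have qm: "q \<in> borel_measurable borel" and gm': "g' \<in> borel_measurable borel"
    and [measurable]: "g \<in> borel_measurable borel" "r \<in> borel_measurable borel" "r' \<in> borel_measurable borel"
    by (intro bm Cq cg Cg Cr cr)+
  have G0: "G \<ge> 0" using order_trans[OF abs_ge_zero G(1)] .
  \<comment> \<open>A deterministic bound of \<Phi>. It is huge for large windows but affects only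
    the regularity constants P and P', which are absent from the final inequality.\<close>
  define B where "B = \<bar>c\<bar> * (m * G)"
  have B0: "B \<ge> 0" using G0 m_pos by (simp add: B_def)
  define f where "f x = r (x / \<sigma>)" for x
  define f' where "f' x = r' (x / \<sigma>) / \<sigma>" for x
  define P where "P = 8 * (B / \<sigma>) + 1"
  define P' where "P' = 8 + (B / \<sigma>) * P"
  have P0: "P \<ge> 1" "P' \<ge> 0" using B0 s by (simp_all add: P_def P'_def)
  have le: "\<bar>y / \<sigma>\<bar> \<le> B / \<sigma>" if "\<bar>y\<bar> \<le> B" for y
    using that s by (simp add: abs_div divide_right_mono)
  have d\<sigma>: "\<bar>y / \<sigma> - z / \<sigma>\<bar> = \<bar>y - z\<bar> / \<sigma>" for y z
    using s by (simp add: diff_divide_distrib[symmetric])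
  have stein: "expectation (\<lambda>\<omega>. \<Phi> \<omega> * f (\<Phi> \<omega>)) = expectation (\<lambda>\<omega>. f' (\<Phi> \<omega>) * V \<omega>)"
    unfolding \<Phi>_def V_def
  proof (rule stein_functional[OF dq cq dg cg _ _ Q qg G, where B=B and F="7 + P / \<sigma>" and L="P / \<sigma> + P' / \<sigma> / \<sigma>"])
    show "(f has_real_derivative f' x) (at x)" for x
      unfolding f_def f'_def using s
      by (auto intro!: DERIV_cong[OF DERIV_chain2[OF dr]] derivative_eq_intros)
    show "isCont f' x" for x
      unfolding f'_def using s by (intro continuous_intros isCont_o2[OF _ cr]) auto
    show "\<bar>c\<bar> * (m * G) \<le> B" by (simp add: B_def)
    show "\<bar>f y\<bar> \<le> 7 + P / \<sigma>" for y
      using rb(1)[of "y / \<sigma>"] P0 s unfolding f_def by (simp add: add_increasing2)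
    show "\<bar>f' y\<bar> \<le> 7 + P / \<sigma>" if "\<bar>y\<bar> \<le> B" for y
    proof -
      have "\<bar>r' (y / \<sigma>)\<bar> \<le> P" using rb(2)[of "y / \<sigma>"] le[OF that] unfolding P_def by linarith
      then show ?thesis using s unfolding f'_def by (simp add: abs_div divide_right_mono add_increasing)
    qed
    show "\<bar>f y - f z\<bar> \<le> (P / \<sigma> + P' / \<sigma> / \<sigma>) * \<bar>y - z\<bar>" if "\<bar>y\<bar> \<le> B" "\<bar>z\<bar> \<le> B" for y z
    proof -
      have "\<bar>f y - f z\<bar> \<le> P * (\<bar>y - z\<bar> / \<sigma>)"
        unfolding f_def P_def d\<sigma>[symmetric] by (intro rL le that)
      also have "\<dots> = (P / \<sigma> + 0) * \<bar>y - z\<bar>" by simp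
      also have "\<dots> \<le> (P / \<sigma> + P' / \<sigma> / \<sigma>) * \<bar>y - z\<bar>"
        using P0 s by (intro mult_right_mono add_left_mono) auto
      finally show ?thesis .
    qed
    show "\<bar>f' y - f' z\<bar> \<le> (P / \<sigma> + P' / \<sigma> / \<sigma>) * \<bar>y - z\<bar>" if "\<bar>y\<bar> \<le> B" "\<bar>z\<bar> \<le> B" for y z
    proof -
      have rP: "\<bar>r' (y / \<sigma>) - r' (z / \<sigma>)\<bar> \<le> P' * \<bar>y / \<sigma> - z / \<sigma>\<bar>"
        unfolding P'_def P_def by (intro rL le that)
      have "\<bar>f' y - f' z\<bar> = \<bar>r' (y / \<sigma>) - r' (z / \<sigma>)\<bar> / \<sigma>"
        using s by (simp add: f'_def diff_divide_distrib[symmetric])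
      also have "\<dots> \<le> (P' * (\<bar>y - z\<bar> / \<sigma>)) / \<sigma>"
        using s rP by (intro divide_right_mono) (simp_all only: d\<sigma> less_imp_le)
      also have "\<dots> = (0 + P' / \<sigma> / \<sigma>) * \<bar>y - z\<bar>" by simp
      also have "\<dots> \<le> (P / \<sigma> + P' / \<sigma> / \<sigma>) * \<bar>y - z\<bar>"
        using P0 s by (intro mult_right_mono add_right_mono) auto
      finally show ?thesis .
    qed
    show "P / \<sigma> + P' / \<sigma> / \<sigma> \<ge> 0" using P0 s by simp
  qed
  have gX: "(\<lambda>(t, \<omega>). g (X t \<omega>)) \<in> borel_measurable (N \<Otimes>\<^sub>M M)"
    by (rule X_joint_compose) simp
  have \<Phi>m [measurable]: "\<Phi> \<in> borel_measurable M"
    unfolding \<Phi>_def using integral_N_measurable[OF gX] by simp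
  have \<Phi>b: "\<bar>\<Phi> \<omega>\<bar> \<le> B" for \<omega>
    unfolding \<Phi>_def abs_mult B_def by (intro mult_left_mono abs_integral_N_le G) auto
  have Vm [measurable]: "V \<in> borel_measurable M"
  proof -
    have finNN: "finite_measure (N \<Otimes>\<^sub>M N)" by (intro finite_measure_pair_measure finite_N)
    have "(\<lambda>(\<omega>, p). \<rho> (snd p - fst p) * (q (X (fst p) \<omega>) * g' (X (snd p) \<omega>))) \<in> borel_measurable (M \<Otimes>\<^sub>M (N \<Otimes>\<^sub>M N))"
      using measurable_compose[OF measurable_pair_swap' quadratic_functional_measurable[OF qm gm']] by (simp add: split_beta')
    from sigma_finite_measure.borel_measurable_lebesgue_integral[OF finite_measure.axioms(1)[OF finNN] this] show ?thesis by (simp add: V_def)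
  qed
  have Vb': "\<bar>V \<omega>\<bar> \<le> K" for \<omega> unfolding V_def by (rule Vb)
  define u where "u \<omega> = r' (\<Phi> \<omega> / \<sigma>)" for \<omega>
  have [measurable]: "u \<in> borel_measurable M" unfolding u_def [abs_def] by measurable
  have ub: "\<bar>u \<omega>\<bar> \<le> P" for \<omega>
    using rb(2)[of "\<Phi> \<omega> / \<sigma>"] le[OF \<Phi>b, of \<omega>] unfolding u_def P_def by linarith
  have iu: "integrable M u" by (rule integrable_const_bound[where B=P]) (auto simp: ub)
  have iuV: "integrable M (\<lambda>\<omega>. u \<omega> * V \<omega>)" by (rule integrable_bounded_mult[OF _ _ ub Vb']) simp_all
  have i\<Phi>f: "integrable M (\<lambda>\<omega>. \<Phi> \<omega> * f (\<Phi> \<omega>))"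
    unfolding f_def by (rule integrable_bounded_mult[OF _ _ \<Phi>b rb(1)]) simp_all
  have i\<Phi>2: "integrable M (\<lambda>\<omega>. (\<Phi> \<omega>)\<^sup>2)"
    unfolding power2_eq_square by (rule integrable_bounded_mult[OF _ _ \<Phi>b \<Phi>b]) simp_all
  have iu2: "integrable M (\<lambda>\<omega>. (u \<omega>)\<^sup>2)"
    unfolding power2_eq_square by (rule integrable_bounded_mult[OF _ _ ub ub]) simp_all
  have iV2: "integrable M (\<lambda>\<omega>. (V \<omega> - \<sigma>\<^sup>2)\<^sup>2)"
  proof -
    have "\<bar>V \<omega> - \<sigma>\<^sup>2\<bar> \<le> K + \<sigma>\<^sup>2" for \<omega>
      using Vb'[of \<omega>] abs_triangle_ineq4[of "V \<omega>" "\<sigma>\<^sup>2"] by simp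
    then show ?thesis
      unfolding power2_eq_square[of "V _ - _"] by (intro integrable_bounded_mult) simp_all
  qed
  have hf: "h (\<Phi> \<omega>) = \<Phi> \<omega> * f (\<Phi> \<omega>) - \<sigma> * u \<omega> + (\<integral>x. h (\<sigma> * x) \<partial>gam)" for \<omega>
    using rh[of "\<Phi> \<omega> / \<sigma>"] s by (simp add: f_def u_def right_diff_distrib)
  have "expectation (\<lambda>\<omega>. h (\<Phi> \<omega>)) - (\<integral>x. h (\<sigma> * x) \<partial>gam) = expectation (\<lambda>\<omega>. \<Phi> \<omega> * f (\<Phi> \<omega>)) - \<sigma> * expectation u"
    unfolding hf using i\<Phi>f iu by (simp add: prob_space)
  also have "\<dots> = expectation (\<lambda>\<omega>. u \<omega> * V \<omega>) / \<sigma> - \<sigma> * expectation u"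
    unfolding stein by (simp add: f'_def u_def)
  also have "\<dots> = expectation (\<lambda>\<omega>. u \<omega> * V \<omega> - \<sigma>\<^sup>2 * u \<omega>) / \<sigma>"
    using iuV iu s by (simp add: field_simps power2_eq_square)
  also have "expectation (\<lambda>\<omega>. u \<omega> * V \<omega> - \<sigma>\<^sup>2 * u \<omega>) = expectation (\<lambda>\<omega>. u \<omega> * (V \<omega> - \<sigma>\<^sup>2))"
    by (simp add: algebra_simps)
  finally have 1: "\<bar>expectation (\<lambda>\<omega>. h (\<Phi> \<omega>)) - (\<integral>x. h (\<sigma> * x) \<partial>gam)\<bar> = \<bar>expectation (\<lambda>\<omega>. u \<omega> * (V \<omega> - \<sigma>\<^sup>2))\<bar> / \<sigma>"
    using s by simp
  have 2: "\<bar>expectation (\<lambda>\<omega>. u \<omega> * (V \<omega> - \<sigma>\<^sup>2))\<bar> \<le> sqrt (expectation (\<lambda>\<omega>. (u \<omega>)\<^sup>2)) * sqrt (expectation (\<lambda>\<omega>. (V \<omega> - \<sigma>\<^sup>2)\<^sup>2))"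
    by (rule integral_Cauchy_Schwarz[OF _ _ iu2 iV2]) simp_all
  have 3: "expectation (\<lambda>\<omega>. (u \<omega>)\<^sup>2) \<le> 128 * expectation (\<lambda>\<omega>. (\<Phi> \<omega>)\<^sup>2) / \<sigma>\<^sup>2 + 2"
  proof -
    have "expectation (\<lambda>\<omega>. (u \<omega>)\<^sup>2) \<le> expectation (\<lambda>\<omega>. 128 / \<sigma>\<^sup>2 * (\<Phi> \<omega>)\<^sup>2 + 2)"
    proof (rule integral_mono)
      fix \<omega>
      define y where "y = \<bar>\<Phi> \<omega> / \<sigma>\<bar>"
      have "\<bar>u \<omega>\<bar> \<le> 8 * y + 1" using rb(2)[of "\<Phi> \<omega> / \<sigma>"] by (simp add: u_def y_def)
      then have "(u \<omega>)\<^sup>2 \<le> (8 * y + 1)\<^sup>2" using power_mono[of "\<bar>u \<omega>\<bar>" "8 * y + 1" 2] by simp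
      \<comment> \<open>The difference of the two sides is (8 y - 1)^2; this explains 128 = 2 * 8^2
        and 2.\<close>
      also have "\<dots> \<le> 128 * y\<^sup>2 + 2" using zero_le_power2[of "8 * y - 1"] by (simp add: power2_eq_square algebra_simps)
      also have "y\<^sup>2 = (\<Phi> \<omega>)\<^sup>2 / \<sigma>\<^sup>2" by (simp add: y_def power_divide)
      finally show "(u \<omega>)\<^sup>2 \<le> 128 / \<sigma>\<^sup>2 * (\<Phi> \<omega>)\<^sup>2 + 2" by simp
    qed (use iu2 i\<Phi>2 in auto)
    also have "\<dots> = 128 / \<sigma>\<^sup>2 * expectation (\<lambda>\<omega>. (\<Phi> \<omega>)\<^sup>2) + 2"
      using i\<Phi>2 by (simp add: prob_space)
    finally show ?thesis by simp
  qed
  have "\<bar>expectation (\<lambda>\<omega>. u \<omega> * (V \<omega> - \<sigma>\<^sup>2))\<bar> / \<sigma>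
     \<le> (sqrt (128 * expectation (\<lambda>\<omega>. (\<Phi> \<omega>)\<^sup>2) / \<sigma>\<^sup>2 + 2) * sqrt (expectation (\<lambda>\<omega>. (V \<omega> - \<sigma>\<^sup>2)\<^sup>2))) / \<sigma>"
    using s 2 real_sqrt_le_mono[OF 3] by (intro divide_right_mono order_trans[OF 2] mult_right_mono) auto
  then show ?thesis
    unfolding normal_law_integral[OF s hm] 1 by simp
qed

end

subsection \<open>Smoothing the indicator\<close>

lemma gam_interval_le:
  assumes "d \<ge> 0"
  shows "(\<integral>x. indicator {u - d..u + d} x \<partial>gam) \<le> 2 * d"
proof -
  have p: "std_normal_density x \<le> 1" for x
  proof -
    have "1 \<le> sqrt (2 * pi)" using pi_gt3 by (intro real_le_rsqrt) simp
    then have "1 / sqrt (2 * pi) \<le> 1" by simp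
    moreover have "exp (- x\<^sup>2 / 2) \<le> 1" by simp
    ultimately show ?thesis unfolding std_normal_density_def by (intro mult_le_one) auto
  qed
  have i: "integrable lborel (indicator {u - d..u + d} :: real \<Rightarrow> real)"
    by (rule integrable_real_indicator) (auto simp: emeasure_lborel_Icc_eq)
  have "(\<integral>x. indicator {u - d..u + d} x \<partial>gam) = (\<integral>x. std_normal_density x * indicator {u - d..u + d} x \<partial>lborel)"
    by (subst gam_integral) auto
  also have "\<dots> \<le> (\<integral>x. indicator {u - d..u + d} x \<partial>lborel)"
    by (rule integral_mono'[OF i]) (auto simp: indicator_def p)
  also have "\<dots> = 2 * d" using assms by simp
  finally show ?thesis .
qed

lemma inverse_one_plus_square_lipschitz:
  "\<bar>1 / (1 + y\<^sup>2) - 1 / (1 + z\<^sup>2)\<bar> \<le> \<bar>y - z\<bar>" for y z :: real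
proof -
  have p: "1 + y\<^sup>2 > 0" "1 + z\<^sup>2 > 0" by (auto intro: add_pos_nonneg)
  have 1: "1 / (1 + y\<^sup>2) - 1 / (1 + z\<^sup>2) = (z - y) * ((z + y) / ((1 + y\<^sup>2) * (1 + z\<^sup>2)))"
    using p by (simp add: field_simps power2_eq_square)
  have 2: "\<bar>(z + y) / ((1 + y\<^sup>2) * (1 + z\<^sup>2))\<bar> \<le> 1"
  proof -
    have "2 * \<bar>y\<bar> \<le> 1 + y\<^sup>2" "2 * \<bar>z\<bar> \<le> 1 + z\<^sup>2"
      using zero_le_power2[of "\<bar>y\<bar> - 1"] zero_le_power2[of "\<bar>z\<bar> - 1"] by (simp_all add: power2_eq_square algebra_simps)
    then have "\<bar>z + y\<bar> \<le> 1 + y\<^sup>2 + z\<^sup>2"  by (smt (verit) abs_triangle_ineq zero_le_power2)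
    also have "\<dots> \<le> (1 + y\<^sup>2) * (1 + z\<^sup>2)" by (simp add: algebra_simps)
    finally show ?thesis using p by (simp add: abs_div divide_le_eq_1)
  qed
  show ?thesis
    unfolding 1 abs_mult using mult_left_mono[OF 2 abs_ge_zero[of "z - y"]]
    by (simp only: mult_1_right abs_minus_commute[of y z])
qed

text \<open>An arctan ramp at u of width e, i.e. a Cauchy distribution function, has explicit bounds
  for g' and its Lipschitz constant. Beyond distance sqrt e from u it misses the indicator by at
  most sqrt e; the remaining interval has Gaussian mass at most 2 sqrt e. The squared error is thus
  at most 2 sqrt e + e, which is where 3 sqrt e comes from.\<close>

lemma smoothed_indicator:
  assumes e: "0 < e" "e \<le> 1"
  obtains g g' where "\<And>x. (g has_real_derivative g' x) (at x)" "\<And>x. isCont g' x"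
    "\<And>x. 0 \<le> g x" "\<And>x. g x \<le> 1" "\<And>x. \<bar>g' x\<bar> \<le> 1 / e"
    "\<And>x y. \<bar>g' x - g' y\<bar> \<le> 1 / e\<^sup>2 * \<bar>x - y\<bar>"
    "(\<integral>x. (indicator {u..} x - g x)\<^sup>2 \<partial>gam) \<le> 3 * sqrt e"
proof -
  define g where "g x = 1 / 2 + arctan ((x - u) / e) / pi" for x
  define g' where "g' x = 1 / (1 + ((x - u) / e)\<^sup>2) * (1 / (e * pi))" for x
  have p: "1 + y\<^sup>2 > 0" for y :: real by (auto intro: add_pos_nonneg)
  have dg: "(g has_real_derivative g' x) (at x)" for x
  proof -
    have "((\<lambda>x. (x - u) / e) has_real_derivative 1 / e) (at x)"
      using e by (auto intro!: derivative_eq_intros)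
    from DERIV_add[OF DERIV_const[of "1 / 2"] DERIV_cdivide[OF DERIV_chain2[OF DERIV_arctan this], of pi]]
    show ?thesis
      unfolding g_def [abs_def] by (rule DERIV_cong) (simp add: g'_def divide_inverse)
  qed
  have cg: "isCont g' x" for x
    unfolding g'_def using e p[of "(x - u) / e"] by (intro continuous_intros) auto
  have ab: "- (pi / 2) < arctan y" "arctan y < pi / 2" for y
    using arctan_bounded[of y] by auto
  have pg: "arctan y / pi < 1 / 2" "arctan y / pi > - (1 / 2)" for y
    using ab[of y] pi_gt_zero by (simp_all add: field_simps)
  have g0: "0 \<le> g x" and g1: "g x \<le> 1" for x
    using pg[of "(x - u) / e"] unfolding g_def by linarith+
  have ep: "1 / (e * pi) \<le> 1 / e" "1 / (e * pi) > 0"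
    using e pi_gt3 by (auto simp: field_simps)
  have g'b: "\<bar>g' x\<bar> \<le> 1 / e" for x
  proof -
    have "\<bar>g' x\<bar> \<le> 1 * (1 / (e * pi))"
      unfolding g'_def abs_mult using ep p[of "(x - u) / e"] by (intro mult_mono) (auto simp: divide_le_eq_1)
    then show ?thesis using ep by linarith
  qed
  have g'L: "\<bar>g' x - g' y\<bar> \<le> 1 / e\<^sup>2 * \<bar>x - y\<bar>" for x y
  proof -
    have "\<bar>g' x - g' y\<bar> = \<bar>1 / (1 + ((x - u) / e)\<^sup>2) - 1 / (1 + ((y - u) / e)\<^sup>2)\<bar> * (1 / (e * pi))"
      unfolding g'_def left_diff_distrib[symmetric] abs_mult using ep by simp
    also have "\<dots> \<le> \<bar>(x - u) / e - (y - u) / e\<bar> * (1 / e)"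
      using ep by (intro mult_mono inverse_one_plus_square_lipschitz) auto
    also have "(x - u) / e - (y - u) / e = (x - y) / e" by (simp add: diff_divide_distrib)
    finally show ?thesis using e by (simp add: abs_div power2_eq_square)
  qed
  \<comment> \<open>With y = |x - u| / e > 1 / sqrt e one has pi/2 - arctan y = arctan (1/y) <= 1/y
    < sqrt e. By symmetry the same quantity is the error on both sides of u.\<close>
  have dist: "\<bar>indicator {u..} x - g x\<bar> \<le> sqrt e" if "\<bar>x - u\<bar> > sqrt e" for x
  proof -
    define y where "y = \<bar>x - u\<bar> / e"
    have xp: "\<bar>x - u\<bar> > 0" using that real_sqrt_gt_zero[OF e(1)] by linarith
    then have yp: "y > 0" using e(1) unfolding y_def by (rule divide_pos_pos)
    have iy: "1 / y \<le> sqrt e"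
    proof -
      have "sqrt e * sqrt e = e" using e by simp
      moreover have "sqrt e * sqrt e \<le> sqrt e * \<bar>x - u\<bar>" using that e by (intro mult_left_mono) auto
      ultimately show ?thesis using xp by (simp add: y_def divide_le_eq)
    qed
    have "arctan y = pi / 2 - arctan (1 / y)"
      using arctan_inverse[of "1 / y"] yp by simp
    moreover have "arctan (1 / y) \<le> 1 / y"
      using yp by (intro arctan_le_self) auto
    ultimately have a: "pi / 2 - arctan y \<le> sqrt e" "pi / 2 - arctan y > 0"
      using iy ab(2)[of y] by linarith+
    have "(pi / 2 - arctan y) / pi \<le> sqrt e / 1"
      using a e pi_gt3 by (intro frac_le) auto
    then have 1: "1 / 2 - arctan y / pi \<le> sqrt e" "1 / 2 - arctan y / pi \<ge> 0"
      using pg(1)[of y] by (simp_all add: diff_divide_distrib)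
    show ?thesis
    proof (cases "x \<ge> u")
      case True
      then have "(x - u) / e = y" using e by (simp add: y_def)
      then show ?thesis using 1 True by (simp add: g_def)
    next
      case False
      then have "(x - u) / e = - y" using e by (simp add: y_def divide_minus_left[symmetric])
      then show ?thesis using 1 False by (simp add: g_def arctan_minus)
    qed
  qed
  have gc: "continuous_on UNIV g"
    using dg by (intro continuous_at_imp_continuous_on) (auto intro: DERIV_isCont)
  have [measurable]: "g \<in> borel_measurable borel"
    using gc by (rule borel_measurable_continuous_onI)
  have w1: "\<bar>indicator {u..} x - g x\<bar> \<le> 1" for x
    using g0[of x] g1[of x] by (auto simp: indicator_def)
  have i1: "integrable gam (indicator {u - sqrt e..u + sqrt e} :: real \<Rightarrow> real)"
    by (rule gam.integrable_const_bound[where B=1]) (auto simp: indicator_def)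
  have "(\<integral>x. (indicator {u..} x - g x)\<^sup>2 \<partial>gam) \<le> (\<integral>x. indicator {u - sqrt e..u + sqrt e} x + e \<partial>gam)"
  proof (rule integral_mono)
    have w2: "(indicator {u..} x - g x)\<^sup>2 \<le> 1" for x
      using w1[of x] by (simp add: abs_square_le_1)
    show "integrable gam (\<lambda>x. (indicator {u..} x - g x)\<^sup>2)"
      by (rule gam.integrable_const_bound[where B=1]) (use w2 in auto)
    show "integrable gam (\<lambda>x. indicator {u - sqrt e..u + sqrt e} x + e)" using i1 by simp
    show "(indicator {u..} x - g x)\<^sup>2 \<le> indicator {u - sqrt e..u + sqrt e} x + e" for x
    proof (cases "\<bar>x - u\<bar> > sqrt e")
      case True
      have "(indicator {u..} x - g x)\<^sup>2 \<le> (sqrt e)\<^sup>2"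
        using power_mono[OF dist[OF True], of 2] by simp
      then show ?thesis using e by (simp add: indicator_def)
    next
      case False
      then have "x \<in> {u - sqrt e..u + sqrt e}" by auto
      then show ?thesis using w2[of x] e by simp
    qed
  qed
  also have "\<dots> = (\<integral>x. indicator {u - sqrt e..u + sqrt e} x \<partial>gam) + e"
  proof -
    have "(\<integral>x. e \<partial>gam) = e" using gam.prob_space by simp
    then show ?thesis using i1 by (subst Bochner_Integration.integral_add) auto
  qed
  also have "\<dots> \<le> 2 * sqrt e + e" using e by (intro add_right_mono gam_interval_le) simp
  also have "\<dots> \<le> 3 * sqrt e"
    using e mult_left_mono[of "sqrt e" 1 "sqrt e"] by simp
  finally have "(\<integral>x. (indicator {u..} x - g x)\<^sup>2 \<partial>gam) \<le> 3 * sqrt e" .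
  then show thesis using that[of g g'] dg cg g0 g1 g'b g'L by blast
qed

context sampling_window
begin

text \<open>The estimate for one window and one scale e. The first term is the L^2 error of
  smoothing; the bracket bounds the L^2 distance of V from \<sigma>^2 by the standard deviation of
  V, the change of the second moment under smoothing, and the gap \<tau> between the second moment
  of F and \<sigma>^2. Nothing depends on h, so the bound passes to the supremum.\<close>

lemma lipschitz_functional_clt:
  fixes u e \<sigma> \<tau> :: real
  assumes e: "0 < e" "e \<le> 1" and s: "\<sigma> > 0" and h: "lipschitz_on 1 UNIV h"
  defines "S \<equiv> \<lambda>\<omega>. \<integral>t. indicator {u..} (X t \<omega>) \<partial>N"
  defines "F \<equiv> \<lambda>\<omega>. (S \<omega> - expectation S) / sqrt m"
  assumes \<tau>: "\<bar>expectation (\<lambda>\<omega>. (F \<omega>)\<^sup>2) - \<sigma>\<^sup>2\<bar> \<le> \<tau>"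
  shows "\<bar>expectation (\<lambda>\<omega>. h (F \<omega>)) - (\<integral>x. h x \<partial>normal_law (\<sigma>\<^sup>2))\<bar>
    \<le> sqrt (3 * rho_norm * sqrt e) + sqrt (128 * rho_norm / \<sigma>\<^sup>2 + 2) / \<sigma> *
        (sqrt (576 * rho_norm ^ 3 / (e ^ 4 * m)) + sqrt (3 * rho_norm * sqrt e) * (2 * sqrt rho_norm) + \<tau>)"
proof -
  define R where "R = rho_norm"
  have R0: "R \<ge> 0" unfolding R_def by (rule rho_norm_nonneg)
  obtain g1 g' where dg1: "\<And>x. (g1 has_real_derivative g' x) (at x)" and cg: "\<And>x. isCont g' x"
    and g1b: "\<And>x. 0 \<le> g1 x" "\<And>x. g1 x \<le> 1" and g'b: "\<And>x. \<bar>g' x\<bar> \<le> 1 / e"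
    and g'L: "\<And>x y. \<bar>g' x - g' y\<bar> \<le> 1 / e\<^sup>2 * \<bar>x - y\<bar>"
    and g1i: "(\<integral>x. (indicator {u..} x - g1 x)\<^sup>2 \<partial>gam) \<le> 3 * sqrt e"
    by (rule smoothed_indicator[OF e, where u=u]) (rule that)
  have g1c: "continuous_on UNIV g1"
    using dg1 by (intro continuous_at_imp_continuous_on) (auto intro: DERIV_isCont)
  have [measurable]: "g1 \<in> borel_measurable borel"
    using g1c by (rule borel_measurable_continuous_onI)
  \<comment> \<open>Centring, as solvability of the Stein equation with a bounded solution
    requires.\<close>
  define a where "a = (\<integral>x. g1 x \<partial>gam)"
  have ig1: "integrable gam g1"
    by (rule gam.integrable_const_bound[where B=1]) (use g1b in \<open>auto simp: abs_le_iff intro: order_trans[of _ 0]\<close>)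
  have one: "(\<integral>x. c \<partial>gam) = c" for c :: real using gam.prob_space by simp
  have a01: "0 \<le> a" "a \<le> 1"
  proof -
    show "0 \<le> a" unfolding a_def using g1b by (intro integral_nonneg_AE) auto
    have "a \<le> (\<integral>x. 1 \<partial>gam)" unfolding a_def using g1b ig1 by (intro integral_mono) auto
    then show "a \<le> 1" unfolding one .
  qed
  define g where "g x = g1 x - a" for x
  have dg: "(g has_real_derivative g' x) (at x)" for x
    unfolding g_def using DERIV_diff[OF dg1[of x] DERIV_const[of a]] by simp
  have gc: "continuous_on UNIV g" unfolding g_def by (intro continuous_intros g1c)
  have gm [measurable]: "g \<in> borel_measurable borel" using gc by (rule borel_measurable_continuous_onI)
  have g1': "\<bar>g x\<bar> \<le> 1" for x
    using g1b[of x] a01 unfolding g_def by auto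
  have gmean: "(\<integral>x. g x \<partial>gam) = 0"
    unfolding g_def using ig1 one[of a] by (subst Bochner_Integration.integral_diff) (auto simp: a_def)
  \<comment> \<open>For bounded g, the case b = 0, x q is bounded too; so q' is bounded and q
    globally Lipschitz, uniformly in e.\<close>
  obtain q where dq: "\<And>x. (q has_real_derivative x * q x - g x) (at x)" and qb: "\<And>x. \<bar>q x\<bar> \<le> 6 * 1 + 0" and xq: "\<And>x. \<bar>x * q x\<bar> \<le> 1"
    using stein_equation_solution[OF gc, of 1 0] g1' gmean by auto
  define q' where "q' x = x * q x - g x" for x
  have dq': "(q has_real_derivative q' x) (at x)" for x using dq by (simp add: q'_def)
  have cq: "isCont q' x" for x
    unfolding q'_def using DERIV_isCont[OF dq] gc by (intro continuous_intros) (auto simp: continuous_on_eq_continuous_at)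
  have q'b: "\<bar>q' x\<bar> \<le> 2" for x
    using xq[of x] g1'[of x] unfolding q'_def by linarith
  have qg: "x * q x - q' x = g x" for x by (simp add: q'_def)
  have qL: "\<bar>q x - q y\<bar> \<le> 2 * \<bar>x - y\<bar>" for x y
  proof -
    have "norm (q x - q y) \<le> 2 * norm (x - y)"
      by (rule field_differentiable_bound[of UNIV q q']) (use dq' q'b in auto)
    then show ?thesis by simp
  qed
  have bm: "f \<in> borel_measurable borel" if "\<And>x. isCont f x" for f :: "real \<Rightarrow> real"
    using that by (intro borel_measurable_continuous_onI continuous_at_imp_continuous_on) auto
  have qm: "q \<in> borel_measurable borel" and gm': "g' \<in> borel_measurable borel"
    using DERIV_isCont[OF dq] cg by (auto intro: bm)
  \<comment> \<open>A common bound and Lipschitz constant for q(y) g'(z): q is at most 6, while g'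
    is at most 1/e with Lipschitz constant 1/e^2. Then 16 L^2 is the 576 / e^4 of the claim.\<close>
  define L where "L = 6 / e\<^sup>2"
  have ee: "1 / e \<le> 1 / e\<^sup>2" "1 \<le> 1 / e"
    using e by (auto simp: field_simps power2_eq_square mult_le_one)
  have Ab: "\<bar>q y * g' z\<bar> \<le> L" for y z
  proof -
    have "\<bar>q y * g' z\<bar> \<le> 6 * (1 / e)"
      unfolding abs_mult using qb[of y] g'b[of z] by (intro mult_mono) auto
    also have "\<dots> \<le> 6 * (1 / e\<^sup>2)" using ee(1) by (intro mult_left_mono) auto
    finally show ?thesis by (simp add: L_def)
  qed
  have AL: "\<bar>q y * g' z - q y' * g' z'\<bar> \<le> L * (\<bar>y - y'\<bar> + \<bar>z - z'\<bar>)" for y z y' z'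
  proof -
    have "q y * g' z - q y' * g' z' = (q y - q y') * g' z + q y' * (g' z - g' z')"
      by (simp add: algebra_simps)
    also have "\<bar>\<dots>\<bar> \<le> \<bar>q y - q y'\<bar> * \<bar>g' z\<bar> + \<bar>q y'\<bar> * \<bar>g' z - g' z'\<bar>"
      unfolding abs_mult[symmetric] by (rule abs_triangle_ineq)
    also have "\<dots> \<le> (2 * \<bar>y - y'\<bar>) * (1 / e\<^sup>2) + 6 * (1 / e\<^sup>2 * \<bar>z - z'\<bar>)"
      using qb[of y'] ee order_trans[OF g'b ee(1)] by (intro add_mono mult_mono qL g'L) auto
    also have "\<dots> \<le> L * (\<bar>y - y'\<bar> + \<bar>z - z'\<bar>)"
      using e by (simp add: L_def field_simps)
    finally show ?thesis .
  qed
  define c where "c = 1 / sqrt m"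
  have c2: "c\<^sup>2 = 1 / m" using m_pos by (simp add: c_def power_divide)
  define \<Phi> where "\<Phi> \<omega> = c * (\<integral>t. g (X t \<omega>) \<partial>N)" for \<omega>
  define Q where "Q \<omega> = (\<integral>p. \<rho> (snd p - fst p) * (q (X (fst p) \<omega>) * g' (X (snd p) \<omega>)) \<partial>(N \<Otimes>\<^sub>M N))" for \<omega>
  define V where "V \<omega> = c\<^sup>2 * Q \<omega>" for \<omega>
  note quad = quadratic_functional_variance[OF qm gm' AL Ab, folded Q_def]
  have Qm [measurable]: "Q \<in> borel_measurable M" using quad(1) by (simp add: Q_def [abs_def])
  have Vm [measurable]: "V \<in> borel_measurable M" unfolding V_def [abs_def] by simp
  define K where "K = c\<^sup>2 * (L * measure (N \<Otimes>\<^sub>M N) (space (N \<Otimes>\<^sub>M N)))"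
  have Vb: "\<bar>V \<omega>\<bar> \<le> K" for \<omega>
    unfolding V_def K_def abs_mult by (intro mult_mono quad(2)) auto
  have iV: "integrable M V" by (rule integrable_const_bound[where B=K]) (auto simp: Vb)
  have varV: "expectation (\<lambda>\<omega>. (V \<omega> - expectation V)\<^sup>2) \<le> 576 * R ^ 3 / (e ^ 4 * m)"
  proof -
    have "expectation V = c\<^sup>2 * expectation Q" by (simp add: V_def [abs_def])
    then have "(\<lambda>\<omega>. (V \<omega> - expectation V)\<^sup>2) = (\<lambda>\<omega>. (c\<^sup>2)\<^sup>2 * (Q \<omega> - expectation Q)\<^sup>2)"
      by (simp add: V_def right_diff_distrib[symmetric] power_mult_distrib)
    then have "expectation (\<lambda>\<omega>. (V \<omega> - expectation V)\<^sup>2) = (c\<^sup>2)\<^sup>2 * expectation (\<lambda>\<omega>. (Q \<omega> - expectation Q)\<^sup>2)"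
      by simp
    also have "\<dots> \<le> (c\<^sup>2)\<^sup>2 * (16 * L\<^sup>2 * m * R ^ 3)"
      using quad(3) by (intro mult_left_mono) (auto simp: Q_def [abs_def] R_def)
    also have "\<dots> = 576 * R ^ 3 / (e ^ 4 * m)"
      using m_pos e unfolding c2 L_def by (simp add: field_simps power2_eq_square power4_eq_xxxx)
    finally show ?thesis .
  qed
  have G: "\<bar>g x\<bar> \<le> 1 / e" for x using g1'[of x] ee(2) by linarith
  note add_g = additive_functional_variance[OF gm g1']
  have \<Phi>m [measurable]: "\<Phi> \<in> borel_measurable M" unfolding \<Phi>_def [abs_def] using add_g(1) by simp
  have \<Phi>b: "\<bar>\<Phi> \<omega>\<bar> \<le> \<bar>c\<bar> * m" for \<omega>
    unfolding \<Phi>_def abs_mult using add_g(2)[of \<omega>] by (intro mult_left_mono) auto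
  have i\<Phi>2: "integrable M (\<lambda>\<omega>. (\<Phi> \<omega>)\<^sup>2)"
    unfolding power2_eq_square by (rule integrable_bounded_mult[OF _ _ \<Phi>b \<Phi>b]) simp_all
  have sq1: "(\<integral>x. (f x)\<^sup>2 \<partial>gam) \<le> 1" if "f \<in> borel_measurable borel" "\<And>x. \<bar>f x\<bar> \<le> 1" for f :: "real \<Rightarrow> real"
  proof -
    have "\<bar>(f x)\<^sup>2\<bar> \<le> 1" for x using that(2)[of x] by (simp add: abs_square_le_1)
    then have "\<bar>\<integral>x. (f x)\<^sup>2 \<partial>gam\<bar> \<le> 1" by (rule gam.abs_expectation_le)
    then show ?thesis by linarith
  qed
  have cm: "c\<^sup>2 * (m * R * x) = R * x" for x using m_pos unfolding c2 by simp
  have E\<Phi>2: "expectation (\<lambda>\<omega>. (\<Phi> \<omega>)\<^sup>2) \<le> R"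
  proof -
    have "expectation (\<lambda>\<omega>. (\<Phi> \<omega>)\<^sup>2) = c\<^sup>2 * expectation (\<lambda>\<omega>. ((\<integral>t. g (X t \<omega>) \<partial>N) - expectation (\<lambda>\<omega>. \<integral>t. g (X t \<omega>) \<partial>N))\<^sup>2)"
      unfolding add_g(3) gmean by (simp add: \<Phi>_def power_mult_distrib)
    also have "\<dots> \<le> c\<^sup>2 * (m * R * (\<integral>x. (g x)\<^sup>2 \<partial>gam))"
      using add_g(4) by (intro mult_left_mono) (auto simp: R_def)
    also have "\<dots> \<le> R" unfolding cm using R0 sq1[OF gm g1'] by (simp add: mult_left_le)
    finally show ?thesis .
  qed
  \<comment> \<open>\<open>stein_functional\<close> for f = identity: the mean of the weight is
    automatically the variance of the functional, so that only its fluctuation and a variance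
    comparison remain.\<close>
  have EV: "expectation V = expectation (\<lambda>\<omega>. (\<Phi> \<omega>)\<^sup>2)"
  proof -
    let ?B = "\<bar>c\<bar> * (m * (1 / e))"
    have B0: "?B \<ge> 0" using m_pos e by simp
    have "expectation (\<lambda>\<omega>. \<Phi> \<omega> * \<Phi> \<omega>) = expectation (\<lambda>\<omega>. 1 * V \<omega>)"
      unfolding \<Phi>_def V_def Q_def
      by (rule stein_functional[OF dq' cq dg cg _ _ _ qg G g'b, where f="\<lambda>x. x" and f'="\<lambda>_. 1" and B="?B" and F="?B + 1" and L=1 and Q=6])
         (use qb B0 in auto)
    then show ?thesis by (simp add: power2_eq_square)
  qed
  define k :: "real \<Rightarrow> real" where "k x = indicator {u..} x" for x
  have km [measurable]: "k \<in> borel_measurable borel" unfolding k_def [abs_def] by simp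
  have kb: "\<bar>k x\<bar> \<le> 1" for x by (simp add: k_def indicator_def)
  note add_k = additive_functional_variance[OF km kb]
  have S: "S = (\<lambda>\<omega>. \<integral>t. k (X t \<omega>) \<partial>N)" by (simp add: S_def k_def)
  have Sm [measurable]: "S \<in> borel_measurable M" unfolding S by (rule add_k(1))
  have ES: "expectation S = m * (\<integral>x. k x \<partial>gam)" unfolding S by (rule add_k(3))
  have Fm [measurable]: "F \<in> borel_measurable M" unfolding F_def by simp
  have F: "F \<omega> = c * (S \<omega> - expectation S)" for \<omega> by (simp add: F_def c_def)
  have Fb: "\<bar>F \<omega>\<bar> \<le> \<bar>c\<bar> * (m + \<bar>expectation S\<bar>)" for \<omega>
    unfolding F abs_mult using add_k(2)[of \<omega>] by (intro mult_left_mono) (auto simp: S)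
  have iF2: "integrable M (\<lambda>\<omega>. (F \<omega>)\<^sup>2)"
    unfolding power2_eq_square by (rule integrable_bounded_mult[OF _ _ Fb Fb]) simp_all
  have EF2: "expectation (\<lambda>\<omega>. (F \<omega>)\<^sup>2) \<le> R"
  proof -
    have "expectation (\<lambda>\<omega>. (F \<omega>)\<^sup>2) = c\<^sup>2 * expectation (\<lambda>\<omega>. (S \<omega> - expectation S)\<^sup>2)"
      by (simp add: F power_mult_distrib)
    also have "\<dots> \<le> c\<^sup>2 * (m * R * (\<integral>x. (k x)\<^sup>2 \<partial>gam))"
      using add_k(4) by (intro mult_left_mono) (auto simp: R_def S)
    also have "\<dots> \<le> R" unfolding cm using R0 sq1[OF km kb] by (simp add: mult_left_le)
    finally show ?thesis .
  qed
  \<comment> \<open>The difference F - \<Phi> is again a centred additive functional, that of w;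
    hence its L^2 norm is governed by the Gaussian L^2 norm of w, although w is as discontinuous as
    the indicator.\<close>
  define w where "w x = k x - g1 x" for x
  have wm: "w \<in> borel_measurable borel" unfolding w_def [abs_def] by simp
  have wb: "\<bar>w x\<bar> \<le> 1" for x using g1b[of x] by (auto simp: w_def k_def indicator_def)
  note add_w = additive_functional_variance[OF wm wb]
  have FG: "F \<omega> - \<Phi> \<omega> = c * ((\<integral>t. w (X t \<omega>) \<partial>N) - expectation (\<lambda>\<omega>. \<integral>t. w (X t \<omega>) \<partial>N))" if "\<omega> \<in> space M" for \<omega>
  proof -
    have Xm [measurable]: "(\<lambda>t. X t \<omega>) \<in> borel_measurable N" using that by (rule X_path)
    have i1: "integrable N (\<lambda>t. k (X t \<omega>))" by (rule N.integrable_const_bound[where B=1]) (auto simp: kb)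
    have i2: "integrable N (\<lambda>t. g1 (X t \<omega>))"
      by (rule N.integrable_const_bound[where B=1]) (use g1b in \<open>auto simp: abs_le_iff intro: order_trans[of _ 0]\<close>)
    have 1: "(\<integral>t. w (X t \<omega>) \<partial>N) = (\<integral>t. k (X t \<omega>) \<partial>N) - (\<integral>t. g1 (X t \<omega>) \<partial>N)"
      unfolding w_def using i1 i2 by simp
    have 2: "(\<integral>t. g (X t \<omega>) \<partial>N) = (\<integral>t. g1 (X t \<omega>) \<partial>N) - m * a"
      unfolding g_def using i2 measure_N by simp
    have ik: "integrable gam k" by (rule gam.integrable_const_bound[where B=1]) (auto simp: kb)
    have 3: "(\<integral>x. w x \<partial>gam) = (\<integral>x. k x \<partial>gam) - a"
      unfolding w_def using ik ig1 by (simp add: a_def)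
    show ?thesis
      unfolding F \<Phi>_def add_w(3) 1 2 3 ES by (simp add: S algebra_simps)
  qed
  have d2: "expectation (\<lambda>\<omega>. (F \<omega> - \<Phi> \<omega>)\<^sup>2) \<le> 3 * R * sqrt e"
  proof -
    have "expectation (\<lambda>\<omega>. (F \<omega> - \<Phi> \<omega>)\<^sup>2) = expectation (\<lambda>\<omega>. c\<^sup>2 * ((\<integral>t. w (X t \<omega>) \<partial>N) - expectation (\<lambda>\<omega>. \<integral>t. w (X t \<omega>) \<partial>N))\<^sup>2)"
      by (intro Bochner_Integration.integral_cong refl) (simp add: FG power_mult_distrib)
    also have "\<dots> = c\<^sup>2 * expectation (\<lambda>\<omega>. ((\<integral>t. w (X t \<omega>) \<partial>N) - expectation (\<lambda>\<omega>. \<integral>t. w (X t \<omega>) \<partial>N))\<^sup>2)"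
      by (rule integral_mult_right_zero)
    also have "\<dots> \<le> c\<^sup>2 * (m * R * (\<integral>x. (w x)\<^sup>2 \<partial>gam))"
      using add_w(4) by (intro mult_left_mono) (auto simp: R_def)
    also have "\<dots> \<le> R * (3 * sqrt e)"
      unfolding cm using g1i R0 by (intro mult_left_mono) (auto simp: w_def k_def)
    finally show ?thesis by (simp add: mult_ac)
  qed
  define D where "D = sqrt (3 * R * sqrt e)"
  have iFb: "\<bar>F \<omega> - \<Phi> \<omega>\<bar> \<le> \<bar>c\<bar> * (m + \<bar>expectation S\<bar>) + \<bar>c\<bar> * m"
    and iFb': "\<bar>F \<omega> + \<Phi> \<omega>\<bar> \<le> \<bar>c\<bar> * (m + \<bar>expectation S\<bar>) + \<bar>c\<bar> * m" for \<omega>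
    using Fb[of \<omega>] \<Phi>b[of \<omega>] by linarith+
  have id2: "integrable M (\<lambda>\<omega>. (F \<omega> - \<Phi> \<omega>)\<^sup>2)" "integrable M (\<lambda>\<omega>. (F \<omega> + \<Phi> \<omega>)\<^sup>2)"
    unfolding power2_eq_square by (rule integrable_bounded_mult[OF _ _ iFb iFb] integrable_bounded_mult[OF _ _ iFb' iFb'], simp, simp)+
  have Ed: "expectation (\<lambda>\<omega>. \<bar>F \<omega> - \<Phi> \<omega>\<bar>) \<le> D"
    using order_trans[OF expectation_abs_le_sqrt(2)[OF _ id2(1)] real_sqrt_le_mono[OF d2]] by (simp add: D_def)
  have hL: "\<bar>h x - h y\<bar> \<le> \<bar>x - y\<bar>" for x y
    using lipschitz_onD[OF h, of x y] by (simp add: dist_real_def)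
  have hm [measurable]: "h \<in> borel_measurable borel"
    using lipschitz_on_continuous_on[OF h] by (rule borel_measurable_continuous_onI)
  have hint: "integrable M (\<lambda>\<omega>. h (f \<omega>))" if [measurable]: "f \<in> borel_measurable M" and fb: "\<And>\<omega>. \<bar>f \<omega>\<bar> \<le> C" for f C
  proof (rule integrable_const_bound[where B="\<bar>h 0\<bar> + C"])
    have "\<bar>h (f \<omega>)\<bar> \<le> \<bar>h 0\<bar> + C" for \<omega> using hL[of "f \<omega>" 0] fb[of \<omega>] by simp
    then show "AE \<omega> in M. norm (h (f \<omega>)) \<le> \<bar>h 0\<bar> + C" by simp
  qed simp
  have ihF: "integrable M (\<lambda>\<omega>. h (F \<omega>))" and ih\<Phi>: "integrable M (\<lambda>\<omega>. h (\<Phi> \<omega>))"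
    by (rule hint[OF _ Fb] hint[OF _ \<Phi>b], simp)+
  have hd: "\<bar>expectation (\<lambda>\<omega>. h (F \<omega>)) - expectation (\<lambda>\<omega>. h (\<Phi> \<omega>))\<bar> \<le> D"
  proof -
    have "\<bar>expectation (\<lambda>\<omega>. h (F \<omega>)) - expectation (\<lambda>\<omega>. h (\<Phi> \<omega>))\<bar> = \<bar>expectation (\<lambda>\<omega>. h (F \<omega>) - h (\<Phi> \<omega>))\<bar>"
      using ihF ih\<Phi> by simp
    also have "\<dots> \<le> expectation (\<lambda>\<omega>. \<bar>h (F \<omega>) - h (\<Phi> \<omega>)\<bar>)" by (rule integral_abs_bound)
    also have "\<dots> \<le> expectation (\<lambda>\<omega>. \<bar>F \<omega> - \<Phi> \<omega>\<bar>)"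
      using ihF ih\<Phi> expectation_abs_le_sqrt(1)[OF _ id2(1)] by (intro integral_mono integrable_abs) (auto simp: hL)
    finally show ?thesis using Ed by linarith
  qed
  \<comment> \<open>A difference of squares, (F - \<Phi>) (F + \<Phi>): the first factor has L^2
    norm at most D, the second at most sqrt (4 R).\<close>
  have ev: "\<bar>expectation V - expectation (\<lambda>\<omega>. (F \<omega>)\<^sup>2)\<bar> \<le> D * (2 * sqrt R)"
  proof -
    have "expectation (\<lambda>\<omega>. (F \<omega>)\<^sup>2) - expectation V = expectation (\<lambda>\<omega>. (F \<omega> - \<Phi> \<omega>) * (F \<omega> + \<Phi> \<omega>))"
      unfolding EV using iF2 i\<Phi>2 by (subst Bochner_Integration.integral_diff[symmetric]) (auto simp: power2_eq_square algebra_simps)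
    also have "\<bar>\<dots>\<bar> \<le> sqrt (expectation (\<lambda>\<omega>. (F \<omega> - \<Phi> \<omega>)\<^sup>2)) * sqrt (expectation (\<lambda>\<omega>. (F \<omega> + \<Phi> \<omega>)\<^sup>2))"
      by (rule integral_Cauchy_Schwarz[OF _ _ id2]) simp_all
    also have "\<dots> \<le> D * sqrt (4 * R)"
    proof (intro mult_mono real_sqrt_le_mono)
      show "sqrt (expectation (\<lambda>\<omega>. (F \<omega> - \<Phi> \<omega>)\<^sup>2)) \<le> D" unfolding D_def by (rule real_sqrt_le_mono[OF d2])
      have "expectation (\<lambda>\<omega>. (F \<omega> + \<Phi> \<omega>)\<^sup>2) \<le> expectation (\<lambda>\<omega>. 2 * (F \<omega>)\<^sup>2 + 2 * (\<Phi> \<omega>)\<^sup>2)"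
      proof (rule integral_mono)
        show "(F \<omega> + \<Phi> \<omega>)\<^sup>2 \<le> 2 * (F \<omega>)\<^sup>2 + 2 * (\<Phi> \<omega>)\<^sup>2" for \<omega>
          using zero_le_power2[of "F \<omega> - \<Phi> \<omega>"] by (simp add: power2_eq_square algebra_simps)
      qed (use id2 iF2 i\<Phi>2 in auto)
      also have "\<dots> = 2 * expectation (\<lambda>\<omega>. (F \<omega>)\<^sup>2) + 2 * expectation (\<lambda>\<omega>. (\<Phi> \<omega>)\<^sup>2)"
        using iF2 i\<Phi>2 by simp
      finally show "expectation (\<lambda>\<omega>. (F \<omega> + \<Phi> \<omega>)\<^sup>2) \<le> 4 * R" using EF2 E\<Phi>2 by linarith
    qed (use R0 e in \<open>auto simp: D_def\<close>)
    finally show ?thesis by (simp add: real_sqrt_mult abs_minus_commute)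
  qed
  have sV: "sqrt (expectation (\<lambda>\<omega>. (V \<omega> - \<sigma>\<^sup>2)\<^sup>2)) \<le> sqrt (576 * R ^ 3 / (e ^ 4 * m)) + (D * (2 * sqrt R) + \<tau>)"
  proof -
    \<comment> \<open>The bias in the decomposition of the second moment of V - \<sigma>^2 into
      variance and squared bias.\<close>
    define b where "b = expectation V - \<sigma>\<^sup>2"
    have bb: "\<bar>b\<bar> \<le> D * (2 * sqrt R) + \<tau>" using ev \<tau> unfolding b_def by linarith
    have iVv: "integrable M (\<lambda>\<omega>. (V \<omega> - expectation V)\<^sup>2)"
    proof -
      have "\<bar>V \<omega> - expectation V\<bar> \<le> K + \<bar>expectation V\<bar>" for \<omega> using Vb[of \<omega>] by linarith
      then show ?thesis unfolding power2_eq_square by (intro integrable_bounded_mult) simp_all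
    qed
    have "(\<lambda>\<omega>. (V \<omega> - \<sigma>\<^sup>2)\<^sup>2) = (\<lambda>\<omega>. (V \<omega> - expectation V)\<^sup>2 + 2 * b * (V \<omega> - expectation V) + b\<^sup>2)"
      by (auto simp: b_def power2_eq_square algebra_simps)
    then have "expectation (\<lambda>\<omega>. (V \<omega> - \<sigma>\<^sup>2)\<^sup>2) = expectation (\<lambda>\<omega>. (V \<omega> - expectation V)\<^sup>2) + b\<^sup>2"
      using iV iVv by (simp add: prob_space)
    also have "\<dots> \<le> 576 * R ^ 3 / (e ^ 4 * m) + b\<^sup>2" using varV by simp
    finally have "sqrt (expectation (\<lambda>\<omega>. (V \<omega> - \<sigma>\<^sup>2)\<^sup>2)) \<le> sqrt (576 * R ^ 3 / (e ^ 4 * m) + b\<^sup>2)"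
      by (rule real_sqrt_le_mono)
    also have "\<dots> \<le> sqrt (576 * R ^ 3 / (e ^ 4 * m)) + sqrt (b\<^sup>2)"
      using R0 e m_pos by (intro sqrt_add_le_add_sqrt) auto
    finally show ?thesis using bb by simp
  qed
  have "\<bar>expectation (\<lambda>\<omega>. h (\<Phi> \<omega>)) - (\<integral>x. h x \<partial>normal_law (\<sigma>\<^sup>2))\<bar>
     \<le> sqrt (128 * expectation (\<lambda>\<omega>. (\<Phi> \<omega>)\<^sup>2) / \<sigma>\<^sup>2 + 2) * (sqrt (expectation (\<lambda>\<omega>. (V \<omega> - \<sigma>\<^sup>2)\<^sup>2)) / \<sigma>)"
    unfolding \<Phi>_def V_def Q_def
    by (rule stein_bound[OF dq' cq dg cg _ qg G g'b s h, where Q=6 and K=K]) (use qb Vb in \<open>auto simp: V_def Q_def\<close>)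
  also have "\<dots> \<le> sqrt (128 * R / \<sigma>\<^sup>2 + 2) * ((sqrt (576 * R ^ 3 / (e ^ 4 * m)) + (D * (2 * sqrt R) + \<tau>)) / \<sigma>)"
    using s R0 E\<Phi>2 sV by (intro mult_mono real_sqrt_le_mono divide_right_mono add_right_mono mult_left_mono) auto
  finally show ?thesis
    using hd unfolding R_def[symmetric] D_def[symmetric] by (simp add: add.assoc)
qed

end

subsection \<open>The asymptotic variance\<close>

lemma lborel_shift:
  fixes f :: "'t::euclidean_space \<Rightarrow> real"
  assumes [measurable]: "f \<in> borel_measurable borel"
  shows "(\<integral>t. f (t - s) \<partial>lborel) = (\<integral>t. f t \<partial>lborel)"
    and "integrable lborel f \<Longrightarrow> integrable lborel (\<lambda>t. f (t - s))"
proof -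
  have "(\<integral>t. f (t - s) \<partial>distr lborel borel ((+) s)) = (\<integral>t. f t \<partial>lborel)"
    by (subst integral_distr) auto
  then show "(\<integral>t. f (t - s) \<partial>lborel) = (\<integral>t. f t \<partial>lborel)" by (simp add: lborel_distr_plus)
  assume "integrable lborel f"
  then have "integrable (distr lborel borel ((+) s)) (\<lambda>t. f (t - s))"
    by (subst integrable_distr_eq) auto
  then show "integrable lborel (\<lambda>t. f (t - s))" by (simp add: lborel_distr_plus)
qed

text \<open>The coefficient of order n + 1 in the series for \<sigma>^2: the order is shifted by one
  so that the sum starts at 0.\<close>

definition threshold_coeff :: "real \<Rightarrow> nat \<Rightarrow> real" where
  "threshold_coeff u n = (std_normal_density u)\<^sup>2 * (hermite n u)\<^sup>2 / fact (n + 1)"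

text \<open>For x of modulus below 1 this is the covariance of the indicators of two standard normal
  variables with correlation x exceeding u, i.e. Mehler's series without its term of order
  0.\<close>

definition threshold_cov :: "real \<Rightarrow> real \<Rightarrow> real" where
  "threshold_cov u x = (\<Sum>n. threshold_coeff u n * x ^ (n + 1))"

lemma threshold_coeff_eq: "threshold_coeff u n = (hermite_coeff (indicator {u..}) (Suc n))\<^sup>2 / fact (Suc n)"
  unfolding hermite_coeff_def hp_tail_integral threshold_coeff_def hermite_eq_hp power_mult_distrib by simp

lemma threshold_coeff_nonneg: "threshold_coeff u n \<ge> 0"
  by (simp add: threshold_coeff_eq)

lemma threshold_coeff_summable: "summable (threshold_coeff u)" "(\<Sum>n. threshold_coeff u n) \<le> 1"
proof -
  define k :: "real \<Rightarrow> real" where "k = indicator {u..}"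
  define b where "b n = (hermite_coeff k n)\<^sup>2 / fact n" for n
  have "k \<in> borel_measurable borel" "\<bar>k x\<bar> \<le> 1" for x by (auto simp: k_def indicator_def)
  from hp_bessel[OF this]
  have b: "summable b" "(\<Sum>n. b n) \<le> (\<integral>x. (k x)\<^sup>2 \<partial>gam)"
    unfolding b_def [abs_def] hermite_coeff_def by auto
  have eq: "threshold_coeff u = (\<lambda>n. b (Suc n))"
    by (auto simp: threshold_coeff_eq b_def k_def)
  show "summable (threshold_coeff u)"
    unfolding eq using b(1) by (simp add: summable_Suc_iff)
  have "\<bar>(k x)\<^sup>2\<bar> \<le> 1" for x by (simp add: k_def indicator_def)
  then have "\<bar>\<integral>x. (k x)\<^sup>2 \<partial>gam\<bar> \<le> 1" by (rule gam.abs_expectation_le)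
  moreover have "(\<Sum>n. b (Suc n)) \<le> (\<Sum>n. b n)"
  proof -
    have "b 0 \<ge> 0" by (simp add: b_def)
    then show ?thesis using suminf_split_head[OF b(1)] by linarith
  qed
  ultimately show "(\<Sum>n. threshold_coeff u n) \<le> 1" unfolding eq using b(2) by linarith
qed

text \<open>The series has no constant term, so one factor of modulus |x| splits off and the
  coefficients sum to at most 1. This makes the covariance function of the indicators integrable
  along with \<rho>.\<close>

lemma threshold_cov_bound:
  assumes "\<bar>x\<bar> \<le> 1"
  shows "\<bar>threshold_cov u x\<bar> \<le> \<bar>x\<bar>"
proof -
  have le: "norm (threshold_coeff u n * x ^ (n + 1)) \<le> threshold_coeff u n * \<bar>x\<bar>" for n
    using power_decreasing[of 1 "n + 1" "\<bar>x\<bar>"] assms threshold_coeff_nonneg[of u n]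
    unfolding real_norm_def abs_mult power_abs by (simp add: mult_left_mono)
  have "\<bar>threshold_cov u x\<bar> \<le> (\<Sum>n. threshold_coeff u n * \<bar>x\<bar>)"
    unfolding threshold_cov_def using norm_suminf_le[OF le summable_mult2[OF threshold_coeff_summable(1)]] by simp
  also have "\<dots> = (\<Sum>n. threshold_coeff u n) * \<bar>x\<bar>"
    by (rule suminf_mult2[symmetric, OF threshold_coeff_summable(1)])
  also have "\<dots> \<le> 1 * \<bar>x\<bar>"
    by (intro mult_right_mono threshold_coeff_summable) auto
  finally show ?thesis by simp
qed

lemma threshold_cov_measurable [measurable]: "threshold_cov u \<in> borel_measurable borel"
  unfolding threshold_cov_def [abs_def] by measurable

context stationary_gaussian_field
begin

lemma X_threshold_cov:
  assumes "\<bar>\<rho> (t - s)\<bar> < 1"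
  shows "expectation (\<lambda>\<omega>. indicator {u..} (X s \<omega>) * indicator {u..} (X t \<omega>)) - (\<integral>x. indicator {u..} x \<partial>gam)\<^sup>2
    = threshold_cov u (\<rho> (t - s))"
proof -
  define k :: "real \<Rightarrow> real" where "k = indicator {u..}"
  have k: "k \<in> borel_measurable borel" "\<bar>k x\<bar> \<le> 1" for x by (auto simp: k_def indicator_def)
  let ?r = "\<rho> (t - s)"
  have "(\<lambda>n. ?r ^ n / fact n * hermite_coeff k n * hermite_coeff k n) sums expectation (\<lambda>\<omega>. k (X s \<omega>) * k (X t \<omega>))"
    by (rule mehler[OF X_measurable X_measurable X_law X_law X_char assms k(1) k(1) k(2) k(2)])
  moreover have "hermite_coeff k 0 = (\<integral>x. k x \<partial>gam)" by (simp add: hermite_coeff_def)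
  ultimately have "(\<lambda>n. ?r ^ Suc n / fact (Suc n) * hermite_coeff k (Suc n) * hermite_coeff k (Suc n))
      sums (expectation (\<lambda>\<omega>. k (X s \<omega>) * k (X t \<omega>)) - (\<integral>x. k x \<partial>gam)\<^sup>2)"
    by (subst sums_Suc_iff) (simp add: power2_eq_square)
  moreover have "(\<lambda>n. ?r ^ Suc n / fact (Suc n) * hermite_coeff k (Suc n) * hermite_coeff k (Suc n))
     = (\<lambda>n. threshold_coeff u n * ?r ^ (n + 1))"
    by (auto simp: threshold_coeff_eq k_def power2_eq_square)
  ultimately show ?thesis
    unfolding threshold_cov_def k_def by (simp add: sums_iff)
qed

text \<open>If \<rho> t is 1 or -1, then X (s + t) and \<rho> t * X s are at L^2 distance zero;
  taking covariances with X 0 gives \<rho> (s + t) = \<rho> t * \<rho> s.\<close>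

lemma rho_shift:
  assumes "\<bar>\<rho> t\<bar> = 1"
  shows "\<bar>\<rho> (s + t)\<bar> = \<bar>\<rho> s\<bar>"
proof -
  have r2: "\<rho> t * \<rho> t = 1" using assms by (metis abs_mult_self_eq mult_1_right)
  have iXX: "integrable M (\<lambda>\<omega>. X a \<omega> * X b \<omega>)" for a b
    by (rule integrable_mult_square[OF X_measurable X_measurable X_square X_square])
  define D where "D \<omega> = X (s + t) \<omega> - \<rho> t * X s \<omega>" for \<omega>
  have [measurable]: "D \<in> borel_measurable M" unfolding D_def [abs_def] by simp
  have D2: "(\<lambda>\<omega>. (D \<omega>)\<^sup>2) = (\<lambda>\<omega>. (X (s + t) \<omega>)\<^sup>2 - 2 * \<rho> t * (X s \<omega> * X (s + t) \<omega>) + (\<rho> t * \<rho> t) * (X s \<omega>)\<^sup>2)"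
    by (auto simp: D_def power2_eq_square algebra_simps)
  have iD2: "integrable M (\<lambda>\<omega>. (D \<omega>)\<^sup>2)" unfolding D2 using iXX X_square by simp
  have "expectation (\<lambda>\<omega>. (D \<omega>)\<^sup>2) = 0"
    unfolding D2 using iXX X_square r2 by (simp add: X_var X_cov)
  then have "\<bar>expectation (\<lambda>\<omega>. D \<omega> * X 0 \<omega>)\<bar> \<le> 0"
    using integral_Cauchy_Schwarz[OF _ X_measurable iD2 X_square, of 0] by simp
  moreover have "expectation (\<lambda>\<omega>. D \<omega> * X 0 \<omega>) = expectation (\<lambda>\<omega>. X 0 \<omega> * X (s + t) \<omega> - \<rho> t * (X 0 \<omega> * X s \<omega>))"
    by (intro Bochner_Integration.integral_cong) (auto simp: D_def algebra_simps)
  moreover have "\<dots> = \<rho> (s + t) - \<rho> t * \<rho> s"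
    using iXX by (simp add: X_cov)
  ultimately have "\<rho> (s + t) = \<rho> t * \<rho> s" by simp
  then show ?thesis using assms by (simp add: abs_mult)
qed

text \<open>If \<open>\<bar>\<rho>\<bar>\<close> equals one at some \<open>t \<noteq> 0\<close>, then \<open>\<bar>\<rho>\<bar>\<close> has period \<open>t\<close>, and all the slabs
  orthogonal to \<open>t\<close> carry the same mass of the set where it equals one.\<close>

lemma rho_less_1_AE: "AE t in lborel. \<bar>\<rho> t\<bar> < 1"
proof -
  define G where "G = {t. \<bar>\<rho> t\<bar> = 1}"
  have G [measurable]: "G \<in> sets borel" unfolding G_def by measurable
  \<comment> \<open>On G the integrable function \<bar>\<rho>\<bar> equals one.\<close>
  have fin: "emeasure lborel G < \<infinity>"
  proof -
    have "emeasure lborel G = (\<integral>\<^sup>+t. indicator G t \<partial>lborel)" by simp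
    also have "\<dots> \<le> (\<integral>\<^sup>+t. ennreal \<bar>\<rho> t\<bar> \<partial>lborel)"
      by (intro nn_integral_mono) (auto simp: G_def indicator_def)
    also have "\<dots> < \<infinity>" using rho_int unfolding integrable_iff_bounded by simp
    finally show ?thesis .
  qed
  have "emeasure lborel G = 0"
  proof (cases "G \<subseteq> {0}")
    case True
    then show ?thesis using emeasure_mono[of G "{0}" lborel] by simp
  next
    case False
    then obtain t where t: "t \<in> G" "t \<noteq> 0" by blast
    have inv: "x + t \<in> G \<longleftrightarrow> x \<in> G" for x
      using rho_shift[of t x] t by (simp add: G_def)
    have tt: "t \<bullet> t > 0" using t by simp
    \<comment> \<open>Slabs of thickness |t|, half-open so that they tile G. Translation by t adds
      \<open>t \<bullet> t\<close> to \<open>x \<bullet> t\<close>, hence carries each slab onto the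
      next.\<close>
    define E where "E k = {x \<in> G. real_of_int k * (t \<bullet> t) \<le> x \<bullet> t \<and> x \<bullet> t < (real_of_int k + 1) * (t \<bullet> t)}" for k :: int
    have [measurable]: "E k \<in> sets borel" for k unfolding E_def by measurable
    have step: "emeasure lborel (E (k + 1)) = emeasure lborel (E k)" for k
    proof -
      have "emeasure lborel (E (k + 1)) = emeasure (distr lborel borel ((+) t)) (E (k + 1))"
        by (simp add: lborel_distr_plus)
      also have "\<dots> = emeasure lborel ((+) t -` E (k + 1) \<inter> space lborel)"
        by (subst emeasure_distr) auto
      also have "(+) t -` E (k + 1) \<inter> space lborel = E k"
        using inv by (auto simp: E_def add.commute[of t] inner_add_left algebra_simps)
      finally show ?thesis .
    qed
    have all: "emeasure lborel (E k) = emeasure lborel (E 0)" for k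
    proof (induction k rule: int_induct[where k=0])
      case (step1 i) then show ?case using step[of i] by simp
    next
      case (step2 i) then show ?case using step[of "i - 1"] by simp
    qed simp
    have disj: "disjoint_family (\<lambda>n. E (int n))"
    proof -
      have "k = l" if "x \<in> E k" "x \<in> E l" for k l x
      proof -
        have "real_of_int k * (t \<bullet> t) < (real_of_int l + 1) * (t \<bullet> t)" "real_of_int l * (t \<bullet> t) < (real_of_int k + 1) * (t \<bullet> t)"
          using that unfolding E_def by auto
        then have "real_of_int k < real_of_int l + 1" "real_of_int l < real_of_int k + 1"
          using tt by (simp_all only: mult_less_cancel_right_pos)
        then show ?thesis by linarith
      qed
      then show ?thesis unfolding disjoint_family_on_def by (metis disjoint_iff of_nat_eq_iff)
    qed
    \<comment> \<open>Any number of disjoint slabs of equal measure fit into a set of finite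
      measure, so each has measure zero.\<close>
    have le: "of_nat n * emeasure lborel (E 0) \<le> emeasure lborel G" for n :: nat
    proof -
      have "of_nat n * emeasure lborel (E 0) = (\<Sum>i<n. emeasure lborel (E (int i)))"
        unfolding all[of "int i" for i] by simp
      also have "\<dots> \<le> (\<Sum>i. emeasure lborel (E (int i)))"
        by (rule sum_le_suminf) auto
      also have "\<dots> = emeasure lborel (\<Union>i. E (int i))"
        using disj by (intro suminf_emeasure) auto
      also have "\<dots> \<le> emeasure lborel G"
        by (rule emeasure_mono) (auto simp: E_def)
      finally show ?thesis .
    qed
    have E0: "emeasure lborel (E 0) = 0"
    proof (rule ccontr)
      assume ne: "emeasure lborel (E 0) \<noteq> 0"
      have "emeasure lborel (E 0) \<le> emeasure lborel G" using le[of 1] by simp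
      then have f0: "emeasure lborel (E 0) < \<infinity>" using fin by simp
      define c g where "c = enn2real (emeasure lborel (E 0))" and "g = enn2real (emeasure lborel G)"
      have c: "emeasure lborel (E 0) = ennreal c" and g: "emeasure lborel G = ennreal g"
        using f0 fin by (simp_all add: c_def g_def)
      have cp: "c > 0" "g \<ge> 0" using ne f0 unfolding c_def g_def by (auto simp: enn2real_positive_iff zero_less_iff_neq_zero)
      obtain n :: nat where "g < n * c" using reals_Archimedean3[OF cp(1)] by blast
      moreover have "ennreal (n * c) \<le> ennreal g"
        using le[of n] cp unfolding c g by (simp add: ennreal_of_nat_eq_real_of_nat ennreal_mult)
      ultimately show False using cp by simp
    qed
    have "G \<subseteq> (\<Union>k. E k)"
    proof
      fix x assume x: "x \<in> G"
      define k where "k = \<lfloor>(x \<bullet> t) / (t \<bullet> t)\<rfloor>"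
      have "real_of_int k \<le> (x \<bullet> t) / (t \<bullet> t)" "(x \<bullet> t) / (t \<bullet> t) < real_of_int k + 1"
        unfolding k_def by linarith+
      then have "x \<in> E k" using x tt by (simp add: E_def pos_le_divide_eq pos_divide_less_eq)
      then show "x \<in> (\<Union>k. E k)" by blast
    qed
    moreover have "emeasure lborel (\<Union>k. E k) = 0"
    proof -
      have "E k \<in> null_sets lborel" for k
        unfolding null_sets_def using all[of k] E0 by simp
      then show ?thesis using null_sets_UN[of E lborel] by (simp add: null_sets_def)
    qed
    ultimately show ?thesis
      using emeasure_mono[of G "\<Union>k. E k" lborel] by auto
  qed
  then have "G \<in> null_sets lborel" by (simp add: null_sets_def)
  then have "AE t in lborel. t \<notin> G" by (rule AE_not_in)
  then show ?thesis
    by eventually_elim (use rho_le_1 in \<open>auto simp: G_def less_le\<close>)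
qed

text \<open>Identifies the series \<sigma>^2 as the integrated covariance of the indicators.
  Summation and integration may be exchanged since the n-th term has L^1 norm at most
  \<open>threshold_coeff u n\<close> times that of \<rho>.\<close>

lemma threshold_cov_integral:
  "integrable lborel (\<lambda>t. threshold_cov u (\<rho> t))"
  "(\<integral>t. threshold_cov u (\<rho> t) \<partial>lborel) = (\<Sum>n. threshold_coeff u n * (\<integral>t. \<rho> t ^ (n + 1) \<partial>lborel))"
proof -
  have pw: "\<bar>\<rho> t ^ (n + 1)\<bar> \<le> \<bar>\<rho> t\<bar>" for t n
    using power_decreasing[of 1 "n + 1" "\<bar>\<rho> t\<bar>"] rho_le_1[of t] by (simp add: abs_mult power_abs)
  have i: "integrable lborel (\<lambda>t. \<rho> t ^ (n + 1))" for n
    by (rule Bochner_Integration.integrable_bound[OF rho_int]) (use pw in auto)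
  show "integrable lborel (\<lambda>t. threshold_cov u (\<rho> t))"
    by (rule Bochner_Integration.integrable_bound[OF rho_int]) (use threshold_cov_bound[OF rho_le_1] in auto)
  have "(\<lambda>n. \<integral>t. threshold_coeff u n * \<rho> t ^ (n + 1) \<partial>lborel) sums (\<integral>t. (\<Sum>n. threshold_coeff u n * \<rho> t ^ (n + 1)) \<partial>lborel)"
  proof (rule sums_integral)
    show "integrable lborel (\<lambda>t. threshold_coeff u n * \<rho> t ^ (n + 1))" for n
      by (intro integrable_mult_right i)
    have le: "norm (threshold_coeff u n * \<rho> t ^ (n + 1)) \<le> threshold_coeff u n * \<bar>\<rho> t\<bar>" for n t
      unfolding real_norm_def abs_mult using threshold_coeff_nonneg pw by (simp add: mult_left_mono)
    show "AE t in lborel. summable (\<lambda>n. norm (threshold_coeff u n * \<rho> t ^ (n + 1)))"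
      using le by (intro AE_I2 summable_comparison_test'[OF summable_mult2[OF threshold_coeff_summable(1)]]) auto
    show "summable (\<lambda>n. \<integral>t. norm (threshold_coeff u n * \<rho> t ^ (n + 1)) \<partial>lborel)"
    proof (rule summable_comparison_test'[OF summable_mult2[OF threshold_coeff_summable(1)]])
      fix n :: nat
      have "(\<integral>t. norm (threshold_coeff u n * \<rho> t ^ (n + 1)) \<partial>lborel) \<le> (\<integral>t. threshold_coeff u n * \<bar>\<rho> t\<bar> \<partial>lborel)"
        using le i rho_int by (intro integral_mono integrable_norm integrable_mult_right) auto
      then show "norm (\<integral>t. norm (threshold_coeff u n * \<rho> t ^ (n + 1)) \<partial>lborel) \<le> threshold_coeff u n * (\<integral>t. \<bar>\<rho> t\<bar> \<partial>lborel)"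
        by simp
    qed
  qed
  then show "(\<integral>t. threshold_cov u (\<rho> t) \<partial>lborel) = (\<Sum>n. threshold_coeff u n * (\<integral>t. \<rho> t ^ (n + 1) \<partial>lborel))"
    by (simp add: sums_iff threshold_cov_def)
qed

end

section \<open>Cubes as windows and the variance of the sojourn time\<close>

text \<open>Lebesgue measure on [0, T]^d, written as a density rather than as a restricted space so
  that its \<sigma>-algebra stays the Borel one, as \<open>sampling_window\<close> demands.\<close>

definition box_measure :: "real \<Rightarrow> 't::euclidean_space measure" where
  "box_measure T = density lborel (\<lambda>t. ennreal (indicator (cbox 0 (T *\<^sub>R One)) t))"

lemma sets_box_measure [simp, measurable_cong]: "sets (box_measure T) = sets borel"
  by (simp add: box_measure_def)

lemma emeasure_cube:
  fixes l u :: real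
  assumes "l \<le> u"
  shows "emeasure lborel (cbox (l *\<^sub>R One) (u *\<^sub>R One) :: 't::euclidean_space set) = ennreal ((u - l) ^ DIM('t))"
proof -
  have "emeasure lborel (cbox (l *\<^sub>R One) (u *\<^sub>R One) :: 't set) = ennreal (\<Prod>b\<in>Basis. (u *\<^sub>R One - l *\<^sub>R One) \<bullet> (b :: 't))"
    using assms by (intro emeasure_lborel_cbox) simp
  also have "(\<Prod>b\<in>Basis. (u *\<^sub>R One - l *\<^sub>R One) \<bullet> (b :: 't)) = (\<Prod>b\<in>(Basis :: 't set). u - l)"
    by (rule prod.cong) (simp_all add: inner_diff_left)
  finally show ?thesis by simp
qed

lemma box_measure_emeasure:
  assumes "A \<in> sets borel"
  shows "emeasure (box_measure T) A = emeasure lborel (cbox 0 (T *\<^sub>R One) \<inter> A)"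
proof -
  have "emeasure (box_measure T) A = (\<integral>\<^sup>+t. ennreal (indicator (cbox 0 (T *\<^sub>R One)) t) * indicator A t \<partial>lborel)"
    unfolding box_measure_def using assms by (intro emeasure_density) auto
  also have "\<dots> = (\<integral>\<^sup>+t. indicator (cbox 0 (T *\<^sub>R One) \<inter> A) t \<partial>lborel)"
    by (intro nn_integral_cong) (auto split: split_indicator)
  also have "\<dots> = emeasure lborel (cbox 0 (T *\<^sub>R One) \<inter> A)"
    using assms by (intro nn_integral_indicator) auto
  finally show ?thesis .
qed

lemma box_measure_integral:
  fixes f :: "'t::euclidean_space \<Rightarrow> real"
  assumes "f \<in> borel_measurable borel"
  shows "(\<integral>t. f t \<partial>box_measure T) = (\<integral>t. indicator (cbox 0 (T *\<^sub>R One)) t * f t \<partial>lborel)"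
  using assms unfolding box_measure_def by (subst integral_density) auto

context stationary_gaussian_field
begin

lemma box_window:
  assumes T: "T > 0"
  shows "sampling_window M X \<rho> (box_measure T) (T ^ DIM('t))"
proof (intro sampling_window.intro sampling_window_axioms.intro)
  show "stationary_gaussian_field M X \<rho>" ..
  have e: "emeasure (box_measure T :: 't measure) UNIV = ennreal (T ^ DIM('t))"
    using emeasure_cube[of 0 T, where 't='t] T by (simp add: box_measure_emeasure)
  have sp: "space (box_measure T :: 't measure) = UNIV" by (simp add: box_measure_def)
  show "finite_measure (box_measure T :: 't measure)"
    by (rule finite_measureI) (simp add: sp e)
  show "measure (box_measure T :: 't measure) (space (box_measure T)) = T ^ DIM('t)"
    using T by (simp add: sp measure_def e)
  show "(\<integral>\<^sup>+t. f t \<partial>box_measure T) \<le> (\<integral>\<^sup>+t. f t \<partial>lborel)" if "f \<in> borel_measurable borel" for f :: "'t \<Rightarrow> ennreal"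
    unfolding box_measure_def using that
    by (subst nn_integral_density) (auto intro!: nn_integral_mono split: split_indicator)
  show "sets (box_measure T :: 't measure) = sets borel" by simp
  show "T ^ DIM('t) > 0" using T by simp
qed

text \<open>The normalised variance is the average over s in the cube of \<open>w s\<close>, the
  covariance integrated over the cube as seen from s. For s at distance at least a from the
  boundary, the missing part lies outside [-a, a]^d and costs at most \<kappa>; the boundary layer
  has relative volume at most 2 a d / T and costs at most the integral of \<bar>\<rho>\<bar> per
  point.\<close>

lemma box_variance:
  fixes T a \<kappa> u :: real
  assumes T: "T > 0" and a: "a \<ge> 0" "2 * a \<le> T"
    and \<kappa>: "(\<integral>t. indicator (- cbox (- (a *\<^sub>R One)) (a *\<^sub>R One)) t * \<bar>\<rho> t\<bar> \<partial>lborel) \<le> \<kappa>"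
  defines "S \<equiv> \<lambda>\<omega>. \<integral>t. indicator {u..} (X t \<omega>) \<partial>box_measure T"
  defines "F \<equiv> \<lambda>\<omega>. (S \<omega> - expectation S) / sqrt (T ^ DIM('t))"
  shows "\<bar>expectation (\<lambda>\<omega>. (F \<omega>)\<^sup>2) - (\<integral>t. threshold_cov u (\<rho> t) \<partial>lborel)\<bar>
    \<le> \<kappa> + (\<integral>t. \<bar>\<rho> t\<bar> \<partial>lborel) * (2 * a * DIM('t) / T)"
proof -
  interpret W: sampling_window M X \<rho> "box_measure T" "T ^ DIM('t)" by (rule box_window[OF T])
  define N where "N = (box_measure T :: 't measure)"
  define m where "m = T ^ DIM('t)"
  have m: "m > 0" using T by (simp add: m_def)
  define R where "R = (\<integral>t. \<bar>\<rho> t\<bar> \<partial>lborel)"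
  have R0: "R \<ge> 0" by (simp add: R_def)
  define v where "v = (\<integral>t. threshold_cov u (\<rho> t) \<partial>lborel)"
  define k :: "real \<Rightarrow> real" where "k = indicator {u..}"
  have km: "k \<in> borel_measurable borel" and kb: "\<bar>k x\<bar> \<le> 1" for x by (auto simp: k_def indicator_def)
  have S: "S = (\<lambda>\<omega>. \<integral>t. k (X t \<omega>) \<partial>N)" by (simp add: S_def k_def N_def)
  have wm: "(\<lambda>(p, \<omega>). k (X p \<omega>)) \<in> borel_measurable (N \<Otimes>\<^sub>M M)"
    unfolding N_def by (rule W.X_joint_compose) (use km in \<open>simp add: split_beta'\<close>)
  have cov: "\<bar>expectation (\<lambda>\<omega>. k (X p \<omega>) * k (X p' \<omega>)) - expectation (\<lambda>\<omega>. k (X p \<omega>)) * expectation (\<lambda>\<omega>. k (X p' \<omega>))\<bar>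
     \<le> \<bar>\<rho> (p' - p)\<bar> * (\<integral>x. (k x)\<^sup>2 \<partial>gam)" for p p'
    using X_gebelein[OF km kb, of p p'] by (simp add: X_integral[OF km] power2_eq_square)
  have cm: "(\<lambda>(p, p'). \<bar>\<rho> (p' - p)\<bar> * (\<integral>x. (k x)\<^sup>2 \<partial>gam)) \<in> borel_measurable (N \<Otimes>\<^sub>M N)"
    unfolding N_def by (simp add: split_beta')
  have finN: "finite_measure N" unfolding N_def by (rule W.finite_N)
  interpret N: finite_measure N by (rule finN)
  have mN: "measure N UNIV = m" using W.measure_N by (simp add: N_def m_def)
  define w where "w s = (\<integral>t. threshold_cov u (\<rho> (t - s)) \<partial>N)" for s
  have "expectation (\<lambda>\<omega>. (S \<omega> - expectation S)\<^sup>2)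
      = (\<integral>s. (\<integral>t. expectation (\<lambda>\<omega>. k (X s \<omega>) * k (X t \<omega>)) - expectation (\<lambda>\<omega>. k (X s \<omega>)) * expectation (\<lambda>\<omega>. k (X t \<omega>)) \<partial>N) \<partial>N)"
    unfolding S by (rule variance_integral_le(5)[OF finN wm kb cov cm])
  also have "\<dots> = (\<integral>s. w s \<partial>N)"
  proof (rule Bochner_Integration.integral_cong[OF refl])
    fix s
    \<comment> \<open>Mehler's series gives the covariance for correlations of modulus below one,
      hence for almost every t.\<close>
    have ae: "AE t in lborel. \<bar>\<rho> (t - s)\<bar> < 1"
    proof -
      have "AE t in distr lborel borel ((+) s). \<bar>\<rho> (t - s)\<bar> < 1"
        using rho_less_1_AE by (subst AE_distr_iff) auto
      then show ?thesis unfolding lborel_distr_plus .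
    qed
    have aeN: "AE t in N. \<bar>\<rho> (t - s)\<bar> < 1"
      unfolding N_def box_measure_def by (subst AE_density) (use ae in auto)
    define Cv where "Cv t = expectation (\<lambda>\<omega>. k (X s \<omega>) * k (X t \<omega>)) - expectation (\<lambda>\<omega>. k (X s \<omega>)) * expectation (\<lambda>\<omega>. k (X t \<omega>))" for t
    have eq: "Cv t = threshold_cov u (\<rho> (t - s))" if "\<bar>\<rho> (t - s)\<bar> < 1" for t
      using X_threshold_cov[OF that, of u] unfolding Cv_def X_integral[OF km] by (simp add: k_def power2_eq_square)
    have "(\<lambda>(t, \<omega>). k (X s \<omega>) * k (X t \<omega>)) \<in> borel_measurable (N \<Otimes>\<^sub>M M)"
      using wm km unfolding split_beta' by simp
    then have "(\<lambda>t. expectation (\<lambda>\<omega>. k (X s \<omega>) * k (X t \<omega>))) \<in> borel_measurable N"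
      by (rule borel_measurable_lebesgue_integral)
    then have m1: "Cv \<in> borel_measurable N"
      unfolding Cv_def [abs_def] X_integral[OF km] by simp
    have m2: "(\<lambda>t. threshold_cov u (\<rho> (t - s))) \<in> borel_measurable N"
      unfolding N_def by measurable
    have "(\<integral>t. Cv t \<partial>N) = w s"
      unfolding w_def proof (rule integral_cong_AE[OF m1 m2])
        show "AE t in N. Cv t = threshold_cov u (\<rho> (t - s))" using aeN by eventually_elim (rule eq)
      qed
    then show "(\<integral>t. expectation (\<lambda>\<omega>. k (X s \<omega>) * k (X t \<omega>)) - expectation (\<lambda>\<omega>. k (X s \<omega>)) * expectation (\<lambda>\<omega>. k (X t \<omega>)) \<partial>N) = w s"
      by (simp add: Cv_def)
  qed
  finally have var: "expectation (\<lambda>\<omega>. (S \<omega> - expectation S)\<^sup>2) = (\<integral>s. w s \<partial>N)" .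
  let ?B = "cbox 0 (T *\<^sub>R One) :: 't set"
  let ?I = "cbox (a *\<^sub>R One) ((T - a) *\<^sub>R One) :: 't set"
  have ith: "integrable lborel (\<lambda>t. threshold_cov u (\<rho> (t - s)))" and vs: "v = (\<integral>t. threshold_cov u (\<rho> (t - s)) \<partial>lborel)" for s
    using lborel_shift[of "\<lambda>t. threshold_cov u (\<rho> t)" s] threshold_cov_integral(1)[of u] by (simp_all add: v_def)
  have irho: "integrable lborel (\<lambda>t. \<bar>\<rho> t\<bar>)" using rho_int by simp
  have irs: "integrable lborel (\<lambda>t. \<bar>\<rho> (t - s)\<bar>)" for s
    using lborel_shift(2)[of "\<lambda>t. \<bar>\<rho> t\<bar>" s] irho by simp
  \<comment> \<open>By translation invariance v is the same integral over all t; the two differ only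
    in the region outside the cube.\<close>
  have diff: "\<bar>w s - v\<bar> \<le> (\<integral>t. indicator (- ?B) (t + s) * \<bar>\<rho> t\<bar> \<partial>lborel)" for s
  proof -
    have i1: "integrable lborel (\<lambda>t. indicator ?B t * threshold_cov u (\<rho> (t - s)))"
      using integrable_mult_indicator[OF _ ith, of ?B s] by simp
    have "w s - v = (\<integral>t. indicator ?B t * threshold_cov u (\<rho> (t - s)) \<partial>lborel) - (\<integral>t. threshold_cov u (\<rho> (t - s)) \<partial>lborel)"
      unfolding w_def vs[of s] N_def by (subst box_measure_integral) auto
    also have "\<dots> = (\<integral>t. indicator ?B t * threshold_cov u (\<rho> (t - s)) - threshold_cov u (\<rho> (t - s)) \<partial>lborel)"
      using i1 ith by simp
    also have "\<bar>\<dots>\<bar> \<le> (\<integral>t. \<bar>indicator ?B t * threshold_cov u (\<rho> (t - s)) - threshold_cov u (\<rho> (t - s))\<bar> \<partial>lborel)"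
      by (rule integral_abs_bound)
    also have "\<dots> \<le> (\<integral>t. indicator (- ?B) t * \<bar>\<rho> (t - s)\<bar> \<partial>lborel)"
    proof (rule integral_mono)
      show "integrable lborel (\<lambda>t. indicator (- ?B) t * \<bar>\<rho> (t - s)\<bar>)"
        using integrable_mult_indicator[OF _ irs, of "- ?B" s] by simp
      show "\<bar>indicator ?B t * threshold_cov u (\<rho> (t - s)) - threshold_cov u (\<rho> (t - s))\<bar> \<le> indicator (- ?B) t * \<bar>\<rho> (t - s)\<bar>" for t
        using threshold_cov_bound[OF rho_le_1, of u "t - s"] by (auto simp: indicator_def)
    qed (use i1 ith in auto)
    also have "\<dots> = (\<integral>t. indicator (- ?B) (t + s) * \<bar>\<rho> t\<bar> \<partial>lborel)"
      using lborel_shift(1)[of "\<lambda>t. indicator (- ?B) (t + s) * \<bar>\<rho> t\<bar>" s] by simp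
    finally show ?thesis .
  qed
  have ii: "integrable lborel (\<lambda>t. indicator A (t + s) * \<bar>\<rho> t\<bar>)" if "A \<in> sets borel" for A s
  proof (rule Bochner_Integration.integrable_bound[OF irho])
    have [measurable]: "A \<in> sets borel" by fact
    show "(\<lambda>t. indicator A (t + s) * \<bar>\<rho> t\<bar>) \<in> borel_measurable lborel" by measurable
  qed (auto simp: indicator_def)
  have d1: "\<bar>w s - v\<bar> \<le> R" for s
  proof -
    have "(\<integral>t. indicator (- ?B) (t + s) * \<bar>\<rho> t\<bar> \<partial>lborel) \<le> R"
      unfolding R_def using ii[of "- ?B" s] irho by (intro integral_mono) (auto simp: indicator_def)
    then show ?thesis using diff[of s] by linarith
  qed
  have d2: "\<bar>w s - v\<bar> \<le> \<kappa>" if s: "s \<in> ?I" for s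
  proof -
    have "indicator (- ?B) (t + s) * \<bar>\<rho> t\<bar> \<le> indicator (- cbox (- (a *\<^sub>R One)) (a *\<^sub>R One)) t * \<bar>\<rho> t\<bar>" for t
    proof -
      have "t + s \<in> ?B" if t: "t \<in> cbox (- (a *\<^sub>R One)) (a *\<^sub>R One)"
      proof -
        have "0 \<le> (t + s) \<bullet> i \<and> (t + s) \<bullet> i \<le> T" if i: "i \<in> Basis" for i
        proof -
          have "- a \<le> t \<bullet> i" "t \<bullet> i \<le> a" "a \<le> s \<bullet> i" "s \<bullet> i \<le> T - a"
            using s t i by (auto simp: mem_box)
          then show ?thesis by (simp add: inner_add_left)
        qed
        then show ?thesis by (simp add: mem_box)
      qed
      then show ?thesis by (auto simp: indicator_def)
    qed
    moreover have "integrable lborel (\<lambda>t. indicator (- cbox (- (a *\<^sub>R One)) (a *\<^sub>R One)) t * \<bar>\<rho> t\<bar>)"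
      using ii[of "- cbox (- (a *\<^sub>R One)) (a *\<^sub>R One)" 0] by simp
    ultimately have "(\<integral>t. indicator (- ?B) (t + s) * \<bar>\<rho> t\<bar> \<partial>lborel) \<le> (\<integral>t. indicator (- cbox (- (a *\<^sub>R One)) (a *\<^sub>R One)) t * \<bar>\<rho> t\<bar> \<partial>lborel)"
      using ii[of "- ?B" s] by (intro integral_mono) auto
    then show ?thesis using diff[of s] \<kappa> by linarith
  qed
  have \<kappa>0: "\<kappa> \<ge> 0"
  proof -
    have "0 \<le> (\<integral>t. indicator (- cbox (- (a *\<^sub>R One)) (a *\<^sub>R One)) t * \<bar>\<rho> t\<bar> \<partial>lborel)" by (rule integral_nonneg_AE) simp
    then show ?thesis using \<kappa> by linarith
  qed
  have wmeas: "w \<in> borel_measurable N"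
  proof -
    have "(\<lambda>(s, t). threshold_cov u (\<rho> (t - s))) \<in> borel_measurable (N \<Otimes>\<^sub>M N)"
      unfolding N_def split_beta' by measurable
    from N.borel_measurable_lebesgue_integral[OF this] show ?thesis by (simp add: w_def [abs_def])
  qed
  have iw: "integrable N w"
  proof (rule N.integrable_const_bound[where B="R + \<bar>v\<bar>"])
    show "AE s in N. norm (w s) \<le> R + \<bar>v\<bar>" using d1 by (intro AE_I2) (smt (verit) real_norm_def)
  qed (rule wmeas)
  have mI: "measure N ?I = (T - 2 * a) ^ DIM('t)"
  proof -
    have "?B \<inter> ?I = ?I" using a by (fastforce simp: mem_box)
    then have "emeasure N ?I = emeasure lborel ?I"
      unfolding N_def by (subst box_measure_emeasure) auto
    also have "\<dots> = ennreal ((T - 2 * a) ^ DIM('t))"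
      using emeasure_cube[of a "T - a", where 't='t] a by (simp add: algebra_simps)
    finally show ?thesis using a by (simp add: measure_def)
  qed
  have iI: "integrable N (indicator ?I :: 't \<Rightarrow> real)"
    by (rule N.integrable_const_bound[where B=1]) (auto simp: N_def indicator_def)
  have spN: "space N = UNIV" by (simp add: N_def)
  have "\<bar>(\<integral>s. w s \<partial>N) - m * v\<bar> = \<bar>\<integral>s. w s - v \<partial>N\<bar>"
    using iw mN spN by simp
  also have "\<dots> \<le> (\<integral>s. \<bar>w s - v\<bar> \<partial>N)" by (rule integral_abs_bound)
  also have "\<dots> \<le> (\<integral>s. (\<kappa> + R) - R * indicator ?I s \<partial>N)"
  proof (rule integral_mono)
    \<comment> \<open>Equal to \<kappa> on the inner cube and to \<kappa> + R on the boundary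
      layer.\<close>
    show "\<bar>w s - v\<bar> \<le> (\<kappa> + R) - R * indicator ?I s" for s
      using d1[of s] d2[of s] \<kappa>0 by (auto simp: indicator_def)
  qed (use iw iI in auto)
  also have "\<dots> = m * (\<kappa> + R) - R * (T - 2 * a) ^ DIM('t)"
  proof -
    have "(\<integral>s. indicator ?I s \<partial>N) = (T - 2 * a) ^ DIM('t)"
      using mI spN by simp
    then show ?thesis using iI mN spN by (subst Bochner_Integration.integral_diff) auto
  qed
  finally have main: "\<bar>(\<integral>s. w s \<partial>N) - m * v\<bar> \<le> m * (\<kappa> + R) - R * (T - 2 * a) ^ DIM('t)" .
  \<comment> \<open>Bernoulli's inequality for (1 - 2 a / T)^d; its hypothesis holds as 2 a <=
    T.\<close>
  have bern: "1 - 2 * a * DIM('t) / T \<le> (T - 2 * a) ^ DIM('t) / m"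
  proof -
    have "1 + real DIM('t) * (- (2 * a / T)) \<le> (1 + (- (2 * a / T))) ^ DIM('t)"
      using a T by (intro Bernoulli_inequality) (simp add: divide_le_eq)
    moreover have "1 + (- (2 * a / T)) = (T - 2 * a) / T" using T by (simp add: diff_divide_distrib)
    ultimately show ?thesis by (simp add: power_divide m_def mult_ac)
  qed
  have "expectation (\<lambda>\<omega>. (F \<omega>)\<^sup>2) = (\<integral>s. w s \<partial>N) / m"
    unfolding var[symmetric] using m by (simp add: F_def power_divide m_def)
  then have "expectation (\<lambda>\<omega>. (F \<omega>)\<^sup>2) - v = ((\<integral>s. w s \<partial>N) - m * v) / m"
    using m by (simp add: diff_divide_distrib)
  then have "\<bar>expectation (\<lambda>\<omega>. (F \<omega>)\<^sup>2) - v\<bar> = \<bar>(\<integral>s. w s \<partial>N) - m * v\<bar> / m"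
    using m by simp
  also have "\<dots> \<le> (m * (\<kappa> + R) - R * (T - 2 * a) ^ DIM('t)) / m"
    using main m by (intro divide_right_mono) auto
  also have "\<dots> = \<kappa> + R * (1 - (T - 2 * a) ^ DIM('t) / m)"
    using m by (simp add: field_simps)
  also have "\<dots> \<le> \<kappa> + R * (2 * a * DIM('t) / T)"
    using bern R0 by (intro add_left_mono mult_left_mono) auto
  finally show ?thesis by (simp add: v_def R_def)
qed

end

subsection \<open>The rate of convergence\<close>

lemma exp_minus_le_inverse: "(y::real) > 0 \<Longrightarrow> exp (- y) \<le> 1 / y"
  unfolding exp_minus divide_inverse mult_1_left
  using exp_ge_add_one_self[of y] by (intro le_imp_inverse_le) linarith

text \<open>In terms of T = exp L the scale is e = T^(-1/8). The first error is a multiple of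
  e^(1/4) = T^(-1/32); in the second, e^4 m is at least T^(1/2), whose root gives T^(-1/4). Both
  powers are weakened to 1 / L by exp (-y) <= 1 / y.\<close>

lemma smoothing_error_decay:
  fixes L R e m :: real
  assumes L: "L > 0" and R0: "R \<ge> 0" and e: "e = exp (- (L / 8))"
  shows "sqrt (3 * R * sqrt e) \<le> sqrt (3 * R) * 32 / L"
    and "exp L \<le> m \<Longrightarrow> sqrt (576 * R ^ 3 / (e ^ 4 * m)) \<le> sqrt (576 * R ^ 3) * 4 / L"
proof -
  have sq: "sqrt (exp (2 * x)) = exp x" for x :: real
    by (rule real_sqrt_unique) (simp_all only: exp_double exp_ge_zero)
  have "sqrt (sqrt e) = exp (- (L / 32))"
    using sq[of "- (L / 16)"] sq[of "- (L / 32)"] unfolding e by simp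
  then have "sqrt (3 * R * sqrt e) = sqrt (3 * R) * exp (- (L / 32))"
    by (simp only: real_sqrt_mult[of "3 * R"])
  also have "\<dots> \<le> sqrt (3 * R) * (32 / L)"
    using exp_minus_le_inverse[of "L / 32"] L R0 by (intro mult_left_mono) auto
  finally show "sqrt (3 * R * sqrt e) \<le> sqrt (3 * R) * 32 / L" by simp
  assume m: "exp L \<le> m"
  have e4: "e ^ 4 = exp (- (L / 2))"
    using exp_of_nat_mult[of 4 "- (L / 8)"] unfolding e by simp
  have "exp (L / 2) = exp (- (L / 2)) * exp L" by (simp only: mult_exp_exp) simp
  also have "\<dots> \<le> e ^ 4 * m" unfolding e4 using m by (intro mult_left_mono) auto
  finally have ge: "exp (L / 2) \<le> e ^ 4 * m" .
  have "sqrt (576 * R ^ 3 / (e ^ 4 * m)) \<le> sqrt (576 * R ^ 3 / exp (L / 2))"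
  proof (rule real_sqrt_le_mono, rule divide_left_mono[OF ge])
    show "0 \<le> 576 * R ^ 3" using R0 by simp
    show "0 < (e ^ 4 * m) * exp (L / 2)"
      by (intro mult_pos_pos less_le_trans[OF exp_gt_zero ge]) simp
  qed
  also have "\<dots> = sqrt (576 * R ^ 3) * exp (- (L / 4))"
  proof -
    have sL: "sqrt (exp (L / 2)) = exp (L / 4)" using sq[of "L / 4"] by simp
    show ?thesis unfolding real_sqrt_divide sL exp_minus by (rule divide_inverse)
  qed
  also have "\<dots> \<le> sqrt (576 * R ^ 3) * (4 / L)"
    using exp_minus_le_inverse[of "L / 4"] L R0 by (intro mult_left_mono) auto
  finally show "sqrt (576 * R ^ 3 / (e ^ 4 * m)) \<le> sqrt (576 * R ^ 3) * 4 / L" by simp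
qed

context stationary_gaussian_field
begin

definition sojourn :: "real \<Rightarrow> real \<Rightarrow> 'a \<Rightarrow> real" where
  "sojourn u T \<omega> = (\<integral>t. indicator {u..} (X t \<omega>) \<partial>box_measure T)"

definition normalized_sojourn :: "real \<Rightarrow> real \<Rightarrow> 'a \<Rightarrow> real" where
  "normalized_sojourn u T \<omega> = (sojourn u T \<omega> - expectation (sojourn u T)) / sqrt (T ^ DIM('t))"

lemma sojourn_measurable:
  assumes "T > 0"
  shows "sojourn u T \<in> borel_measurable M"
proof -
  interpret W: sampling_window M X \<rho> "box_measure T" "T ^ DIM('t)" by (rule box_window[OF assms])
  have "(\<lambda>(t, \<omega>). indicator {u..} (X t \<omega>) :: real) \<in> borel_measurable (box_measure T \<Otimes>\<^sub>M M)"
    by (rule W.X_joint_compose) simp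
  then show ?thesis unfolding sojourn_def by (rule W.integral_N_measurable)
qed

lemma abs_sojourn_le:
  assumes "T > 0"
  shows "\<bar>sojourn u T \<omega>\<bar> \<le> T ^ DIM('t)"
proof -
  interpret W: sampling_window M X \<rho> "box_measure T" "T ^ DIM('t)" by (rule box_window[OF assms])
  have "\<bar>sojourn u T \<omega>\<bar> \<le> T ^ DIM('t) * 1"
    unfolding sojourn_def by (rule W.abs_integral_N_le) (simp add: indicator_def)
  then show ?thesis by simp
qed

lemma normalized_sojourn_measurable:
  assumes "T > 0"
  shows "normalized_sojourn u T \<in> borel_measurable M"
  unfolding normalized_sojourn_def using sojourn_measurable[OF assms] by simp

lemma normalized_sojourn_integrable:
  assumes "T > 0"
  shows "integrable M (normalized_sojourn u T)" "integrable M (\<lambda>\<omega>. (normalized_sojourn u T \<omega>)\<^sup>2)"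
proof -
  note [measurable] = normalized_sojourn_measurable[OF assms]
  define B where "B = 2 * T ^ DIM('t) / sqrt (T ^ DIM('t))"
  have E: "\<bar>expectation (sojourn u T)\<bar> \<le> T ^ DIM('t)"
    by (rule abs_expectation_le[OF abs_sojourn_le[OF assms]])
  have b: "\<bar>normalized_sojourn u T \<omega>\<bar> \<le> B" for \<omega>
  proof -
    have "\<bar>sojourn u T \<omega> - expectation (sojourn u T)\<bar> \<le> 2 * T ^ DIM('t)"
      using abs_sojourn_le[OF assms, of u \<omega>] E by linarith
    then show ?thesis using assms unfolding normalized_sojourn_def B_def abs_divide
      by (simp add: divide_right_mono)
  qed
  show "integrable M (normalized_sojourn u T)"
    by (rule integrable_const_bound[where B=B]) (use b in auto)
  have "(normalized_sojourn u T \<omega>)\<^sup>2 \<le> B\<^sup>2" for \<omega>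
    using power_mono[OF b abs_ge_zero, of \<omega> 2] by simp
  then show "integrable M (\<lambda>\<omega>. (normalized_sojourn u T \<omega>)\<^sup>2)"
    by (intro integrable_const_bound[where B="B\<^sup>2"]) auto
qed

text \<open>With a = sqrt T in \<open>box_variance\<close> the tail contributes c / ln (sqrt T) = 2
  c / ln T, and the boundary layer 2 d / sqrt T <= 4 d / ln T.\<close>

lemma sojourn_variance_rate:
  fixes u :: real
  assumes c: "c > 0"
    and tail: "\<forall>\<^sub>F a in at_top. (\<integral>t. indicator (- cbox (- (a *\<^sub>R One)) (a *\<^sub>R One)) t * \<bar>\<rho> t\<bar> \<partial>lborel) \<le> c / ln a"
  shows "\<exists>C>0. \<forall>\<^sub>F T in at_top.
    \<bar>expectation (\<lambda>\<omega>. (normalized_sojourn u T \<omega>)\<^sup>2) - (\<integral>t. threshold_cov u (\<rho> t) \<partial>lborel)\<bar> \<le> C / ln T"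
proof (intro exI conjI)
  define R where "R = (\<integral>t. \<bar>\<rho> t\<bar> \<partial>lborel)"
  have R0: "R \<ge> 0" by (simp add: R_def)
  let ?C = "2 * c + R * (4 * DIM('t))"
  show "?C > 0" using c R0 by (simp add: add_pos_nonneg)
  have "\<forall>\<^sub>F T in at_top. (\<integral>t. indicator (- cbox (- (sqrt T *\<^sub>R One)) (sqrt T *\<^sub>R One)) t * \<bar>\<rho> t\<bar> \<partial>lborel) \<le> c / ln (sqrt T)"
    using tail sqrt_at_top by (rule eventually_compose_filterlim)
  then show "\<forall>\<^sub>F T in at_top.
    \<bar>expectation (\<lambda>\<omega>. (normalized_sojourn u T \<omega>)\<^sup>2) - (\<integral>t. threshold_cov u (\<rho> t) \<partial>lborel)\<bar> \<le> ?C / ln T"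
    \<comment> \<open>From T = 4 on, 2 sqrt T <= T, as \<open>box_variance\<close> needs for a =
      sqrt T.\<close>
    using eventually_ge_at_top[of 4]
  proof eventually_elim
    case (elim T)
    have T: "T > 0" using elim by simp
    have s2: "sqrt T \<ge> 2" using elim real_le_rsqrt[of 2 T] by auto
    have sT: "sqrt T * sqrt T = T" using T by (intro real_sqrt_mult_self[THEN trans]) auto
    have "2 * sqrt T \<le> sqrt T * sqrt T" using s2 T by (intro mult_right_mono) (auto simp: less_imp_le)
    then have le: "2 * sqrt T \<le> T" using sT by simp
    have lT: "ln T > 0" using elim by simp
    have lnle: "ln T \<le> 2 * sqrt T"
      using ln_le_minus_one[of "sqrt T"] T by (simp add: ln_sqrt)
    have "2 * sqrt T * DIM('t) / T = 2 * DIM('t) / sqrt T"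
    proof -
      have "2 * sqrt T * DIM('t) / T = (2 * DIM('t)) * sqrt T / (sqrt T * sqrt T)" unfolding sT by (simp add: mult_ac)
      also have "\<dots> = 2 * DIM('t) / sqrt T" using T by (simp del: real_sqrt_mult_self)
      finally show ?thesis .
    qed
    also have "\<dots> \<le> 4 * DIM('t) / ln T"
    proof -
      have "2 * DIM('t) * ln T \<le> 2 * DIM('t) * (2 * sqrt T)"
        using lnle by (intro mult_left_mono) auto
      moreover have "sqrt T > 0" using T by simp
      ultimately show ?thesis using lT by (subst frac_le_eq) (auto simp: divide_le_0_iff algebra_simps)
    qed
    finally have 1: "2 * sqrt T * DIM('t) / T \<le> 4 * DIM('t) / ln T" .
    have "\<bar>expectation (\<lambda>\<omega>. (normalized_sojourn u T \<omega>)\<^sup>2) - (\<integral>t. threshold_cov u (\<rho> t) \<partial>lborel)\<bar>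
      \<le> c / ln (sqrt T) + R * (2 * sqrt T * DIM('t) / T)"
      unfolding normalized_sojourn_def sojourn_def R_def using box_variance[OF T _ le elim(1), of u] T by simp
    also have "\<dots> \<le> 2 * c / ln T + R * (4 * DIM('t) / ln T)"
      using 1 R0 T by (intro add_mono mult_left_mono) (auto simp: ln_sqrt mult.commute)
    also have "\<dots> = ?C / ln T" by (simp add: add_divide_distrib)
    finally show ?case .
  qed
qed

text \<open>For the degenerate limit: against the point mass at 0, a Lipschitz test function is
  controlled by the first absolute moment.\<close>

lemma expectation_normalized_sojourn_le:
  assumes "T > 0" and h: "lipschitz_on 1 UNIV h"
  shows "\<bar>expectation (\<lambda>\<omega>. h (normalized_sojourn u T \<omega>)) - h 0\<bar>
    \<le> sqrt (expectation (\<lambda>\<omega>. (normalized_sojourn u T \<omega>)\<^sup>2))"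
proof -
  let ?F = "normalized_sojourn u T"
  note [measurable] = normalized_sojourn_measurable[OF assms(1)]
  have [measurable]: "h \<in> borel_measurable borel"
    using lipschitz_on_continuous_on[OF h] by (rule borel_measurable_continuous_onI)
  note i = normalized_sojourn_integrable[OF assms(1), of u]
  have le: "\<bar>h (?F \<omega>) - h 0\<bar> \<le> \<bar>?F \<omega>\<bar>" for \<omega>
    using lipschitz_onD[OF h, of "?F \<omega>" 0] by (simp add: dist_real_def)
  have id: "integrable M (\<lambda>\<omega>. h (?F \<omega>) - h 0)"
    by (rule Bochner_Integration.integrable_bound[OF i(1)]) (use le in auto)
  then have "integrable M (\<lambda>\<omega>. (h (?F \<omega>) - h 0) + h 0)" by (intro Bochner_Integration.integrable_add) auto
  then have ih: "integrable M (\<lambda>\<omega>. h (?F \<omega>))" by simp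
  have "expectation (\<lambda>\<omega>. h (?F \<omega>)) - h 0 = expectation (\<lambda>\<omega>. h (?F \<omega>) - h 0)"
    using ih by (simp add: prob_space)
  then have "\<bar>expectation (\<lambda>\<omega>. h (?F \<omega>)) - h 0\<bar> \<le> expectation (\<lambda>\<omega>. \<bar>h (?F \<omega>) - h 0\<bar>)"
    using integral_abs_bound[of M "\<lambda>\<omega>. h (?F \<omega>) - h 0"] by simp
  also have "\<dots> \<le> expectation (\<lambda>\<omega>. \<bar>?F \<omega>\<bar>)"
    using id i(1) le by (intro integral_mono) auto
  also have "\<dots> \<le> sqrt (expectation (\<lambda>\<omega>. (?F \<omega>)\<^sup>2))"
    by (rule expectation_abs_le_sqrt) (use i in auto)
  finally show ?thesis .
qed

text \<open>The quantifier over h stands inside the eventuality, so the threshold for T is common to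
  all test functions and the supremum can be taken afterwards.\<close>

theorem sojourn_clt_rate:
  fixes u :: real
  assumes c: "c > 0"
    and tail: "\<forall>\<^sub>F a in at_top. (\<integral>t. indicator (- cbox (- (a *\<^sub>R One)) (a *\<^sub>R One)) t * \<bar>\<rho> t\<bar> \<partial>lborel) \<le> c / ln a"
  defines "v \<equiv> \<integral>t. threshold_cov u (\<rho> t) \<partial>lborel"
  shows "\<exists>C>0. \<forall>\<^sub>F T in at_top. \<forall>h. lipschitz_on 1 UNIV h \<longrightarrow>
    \<bar>expectation (\<lambda>\<omega>. h (normalized_sojourn u T \<omega>)) - (\<integral>x. h x \<partial>normal_law v)\<bar> \<le> C * ln T powr (- 1 / 4)"
proof -
  let ?V = "\<lambda>T. expectation (\<lambda>\<omega>. (normalized_sojourn u T \<omega>)\<^sup>2)"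
  obtain C1 where C1: "C1 > 0" and rate: "\<forall>\<^sub>F T in at_top. \<bar>?V T - v\<bar> \<le> C1 / ln T"
    using sojourn_variance_rate[OF c tail, of u] unfolding v_def by blast
  have ln_large: "\<forall>\<^sub>F T in at_top. ln T > K" for K :: real
    using ln_at_top unfolding filterlim_at_top_dense by blast
  \<comment> \<open>The value v is a limit of second moments; a negative v would contradict the rate
    once ln T exceeds C1 / (- v).\<close>
  have v0: "v \<ge> 0"
  proof (rule ccontr)
    assume v: "\<not> v \<ge> 0"
    have "\<forall>\<^sub>F T::real in at_top. False"
      using rate ln_large[of "C1 / - v"] ln_large[of 0]
    proof eventually_elim
      case (elim T)
      have "?V T \<ge> 0" by (rule integral_nonneg_AE) simp
      then have "- v \<le> C1 / ln T" using elim(1) by linarith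
      moreover have "C1 / ln T < - v" using elim(2,3) v by (simp add: field_simps)
      ultimately show ?case by linarith
    qed
    then show False by simp
  qed
  have large: "\<forall>\<^sub>F T in at_top. (T::real) \<ge> 1 \<and> ln T \<ge> 1"
    using eventually_ge_at_top[of 1] ln_large[of 1] by eventually_elim auto
  show ?thesis
  proof (cases "v = 0")
    \<comment> \<open>Here the rate is (ln T)^(-1/2), the square root of that of the second moment,
      and ln T >= 1 lets it be weakened to the exponent -1/4.\<close>
    case True
    show ?thesis
    proof (intro exI conjI)
      show "sqrt C1 > 0" using C1 by simp
      show "\<forall>\<^sub>F T in at_top. \<forall>h. lipschitz_on 1 UNIV h \<longrightarrow>
        \<bar>expectation (\<lambda>\<omega>. h (normalized_sojourn u T \<omega>)) - (\<integral>x. h x \<partial>normal_law v)\<bar> \<le> sqrt C1 * ln T powr (- 1 / 4)"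
        using rate large
      proof eventually_elim
        case (elim T)
        show ?case
        proof (intro allI impI)
          fix h :: "real \<Rightarrow> real" assume h: "lipschitz_on 1 UNIV h"
          have [measurable]: "h \<in> borel_measurable borel"
            using lipschitz_on_continuous_on[OF h] by (rule borel_measurable_continuous_onI)
          have "(\<integral>x. h x \<partial>normal_law v) = h 0"
            using True by (simp add: normal_law_def integral_return)
          then have "\<bar>expectation (\<lambda>\<omega>. h (normalized_sojourn u T \<omega>)) - (\<integral>x. h x \<partial>normal_law v)\<bar> \<le> sqrt (?V T)"
            using expectation_normalized_sojourn_le[OF _ h, of T u] elim by simp
          also have "\<dots> \<le> sqrt (C1 / ln T)" using elim True by (intro real_sqrt_le_mono) linarith
          also have "\<dots> = sqrt C1 * ln T powr (- (1 / 2))"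
          proof -
            have eq: "ln T powr (1 / 2) = sqrt (ln T)" using elim by (intro powr_half_sqrt) simp
            show ?thesis unfolding real_sqrt_divide powr_minus eq by (rule divide_inverse)
          qed
          also have "\<dots> \<le> sqrt C1 * ln T powr (- 1 / 4)"
            using elim C1 by (intro mult_left_mono powr_mono) auto
          finally show "\<bar>expectation (\<lambda>\<omega>. h (normalized_sojourn u T \<omega>)) - (\<integral>x. h x \<partial>normal_law v)\<bar> \<le> sqrt C1 * ln T powr (- 1 / 4)" .
        qed
      qed
    qed
  next
    case False
    then have vp: "v > 0" using v0 by simp
    define R where "R = (\<integral>t. \<bar>\<rho> t\<bar> \<partial>lborel)"
    have R0: "R \<ge> 0" by (simp add: R_def)
    define A where "A = sqrt (128 * R / v + 2) / sqrt v"
    have A0: "A \<ge> 0" using vp R0 by (simp add: A_def)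
    \<comment> \<open>Collects the coefficients of 1 / L of all error terms. It is only known to be
      nonnegative; K + 1 is taken in the claim so as to be positive.\<close>
    define K where "K = sqrt (3 * R) * 32 + A * (sqrt (576 * R ^ 3) * 4 + (sqrt (3 * R) * 32) * (2 * sqrt R) + C1)"
    show ?thesis
    proof (intro exI conjI)
      have "0 \<le> K" unfolding K_def using A0 R0 C1 by (intro add_nonneg_nonneg mult_nonneg_nonneg) auto
      then show "K + 1 > 0" by simp
      show "\<forall>\<^sub>F T in at_top. \<forall>h. lipschitz_on 1 UNIV h \<longrightarrow>
        \<bar>expectation (\<lambda>\<omega>. h (normalized_sojourn u T \<omega>)) - (\<integral>x. h x \<partial>normal_law v)\<bar> \<le> (K + 1) * ln T powr (- 1 / 4)"
        using rate large
      proof eventually_elim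
        case (elim T)
        have T: "T > 0" "T \<ge> 1" using elim by auto
        interpret W: sampling_window M X \<rho> "box_measure T" "T ^ DIM('t)" by (rule box_window[OF T(1)])
        define L where "L = ln T"
        have L: "L \<ge> 1" "T = exp L" using elim T by (auto simp: L_def)
        define e where "e = exp (- (L / 8))"
        have e: "0 < e" "e \<le> 1" using L(1) by (auto simp: e_def)
        have Rn: "W.rho_norm = R" by (simp add: W.rho_norm_def R_def)
        have "T \<le> T ^ DIM('t)" using T DIM_positive by (intro self_le_power) auto
        then have "exp L \<le> T ^ DIM('t)" unfolding L(2)[symmetric] .
        note b1 = smoothing_error_decay(1)[OF _ R0 e_def]
          and b2 = smoothing_error_decay(2)[OF _ R0 e_def this]
        \<comment> \<open>For \<sigma> > 0 every error is of order 1 / L, which for L >= 1 is below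
          the rate claimed.\<close>
        have L14: "1 / L \<le> L powr (- 1 / 4)"
          using powr_mono[of "-1" "- 1 / 4" L] L(1) by (simp add: powr_neg_one)
        show ?case
        proof (intro allI impI)
          fix h :: "real \<Rightarrow> real" assume h: "lipschitz_on 1 UNIV h"
          have sv: "sqrt v > 0" "(sqrt v)\<^sup>2 = v" using vp by auto
          have "\<bar>?V T - (sqrt v)\<^sup>2\<bar> \<le> C1 / L" using elim sv(2) by (simp add: L_def)
          from W.lipschitz_functional_clt[OF e sv(1) h this[unfolded normalized_sojourn_def sojourn_def]]
          have "\<bar>expectation (\<lambda>\<omega>. h (normalized_sojourn u T \<omega>)) - (\<integral>x. h x \<partial>normal_law v)\<bar>
            \<le> sqrt (3 * R * sqrt e) + A * (sqrt (576 * R ^ 3 / (e ^ 4 * T ^ DIM('t))) + sqrt (3 * R * sqrt e) * (2 * sqrt R) + C1 / L)"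
            unfolding Rn sv(2) A_def normalized_sojourn_def sojourn_def .
          also have "\<dots> \<le> sqrt (3 * R) * 32 / L + A * (sqrt (576 * R ^ 3) * 4 / L + sqrt (3 * R) * 32 / L * (2 * sqrt R) + C1 / L)"
            by (intro add_mono mult_left_mono mult_right_mono b1 b2 order_refl A0) (use R0 L(1) in simp_all)
          also have "\<dots> = K * (1 / L)" unfolding K_def by (simp add: algebra_simps add_divide_distrib)
          also have "\<dots> \<le> (K + 1) * L powr (- 1 / 4)"
            using L14 \<open>0 \<le> K\<close> L(1) by (intro mult_mono) auto
          finally show "\<bar>expectation (\<lambda>\<omega>. h (normalized_sojourn u T \<omega>)) - (\<integral>x. h x \<partial>normal_law v)\<bar> \<le> (K + 1) * ln T powr (- 1 / 4)"
            by (simp add: L_def)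
        qed
      qed
    qed
  qed
qed

end

section \<open>The Wasserstein bound for the sojourn time\<close>

theorem theorem2:
  fixes M :: "'a measure"
    and X :: "real ^ 'd \<Rightarrow> 'a \<Rightarrow> real"
    and \<rho> :: "real ^ 'd \<Rightarrow> real"
    and u :: real
  assumes "prob_space M"
    and meas: "(\<lambda>(t, \<omega>). X t \<omega>) \<in> borel_measurable (lborel \<Otimes>\<^sub>M M)"
    and gauss: "gaussian_field M X"
    and centered: "\<And>t. prob_space.expectation M (X t) = 0"
    and cov: "\<And>s t. prob_space.expectation M (\<lambda>\<omega>. X (s + t) \<omega> * X s \<omega>) = \<rho> t"
    and unit_var: "\<rho> 0 = 1"
    and rho_int: "integrable lborel \<rho>"
    and tail: "\<exists>c>0. \<forall>\<^sub>F a in at_top.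
               (LINT t : - cbox (- (a *\<^sub>R One)) (a *\<^sub>R One) | lborel. \<bar>\<rho> t\<bar>) \<le> c / ln a"
  defines "S \<equiv> \<lambda>T \<omega>. LINT t : cbox 0 (T *\<^sub>R One) | lborel. (if X t \<omega> \<ge> u then 1 else 0 :: real)"
    and "\<sigma>2 \<equiv> (\<Sum>n. (std_normal_density u)\<^sup>2 * (hermite n u)\<^sup>2 / fact (n + 1)
                 * (LINT t | lborel. \<rho> t ^ (n + 1)))"
  shows "\<exists>C>0. \<exists>T0>1. \<forall>T\<ge>T0.
           wasserstein
             (distr M borel (\<lambda>\<omega>. (S T \<omega> - prob_space.expectation M (S T)) / sqrt (T ^ CARD('d))))
             (normal_law \<sigma>2)
           \<le> ereal (C * ln T powr (- 1 / 4))"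
proof -
  interpret stationary_gaussian_field M X \<rho>
    by (intro stationary_gaussian_field.intro stationary_gaussian_field_axioms.intro) fact+
  obtain c where c: "c > 0"
    and tl: "\<forall>\<^sub>F a in at_top. (\<integral>t. indicator (- cbox (- (a *\<^sub>R One)) (a *\<^sub>R One)) t * \<bar>\<rho> t\<bar> \<partial>lborel) \<le> c / ln a"
    using tail by (auto simp: set_lebesgue_integral_def)
  have \<sigma>2: "\<sigma>2 = (\<integral>t. threshold_cov u (\<rho> t) \<partial>lborel)"
    unfolding \<sigma>2_def threshold_cov_integral(2) threshold_coeff_def ..
  obtain C where C: "C > 0" and ev: "\<forall>\<^sub>F T in at_top. \<forall>h. lipschitz_on 1 UNIV h \<longrightarrow>
    \<bar>expectation (\<lambda>\<omega>. h (normalized_sojourn u T \<omega>)) - (\<integral>x. h x \<partial>normal_law \<sigma>2)\<bar> \<le> C * ln T powr (- 1 / 4)"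
    using sojourn_clt_rate[OF c tl, of u] unfolding \<sigma>2 by blast
  obtain T1 where T1: "\<And>T h. T \<ge> T1 \<Longrightarrow> lipschitz_on 1 UNIV h \<Longrightarrow>
    \<bar>expectation (\<lambda>\<omega>. h (normalized_sojourn u T \<omega>)) - (\<integral>x. h x \<partial>normal_law \<sigma>2)\<bar> \<le> C * ln T powr (- 1 / 4)"
    using ev unfolding eventually_at_top_linorder by blast
  have "wasserstein
             (distr M borel (\<lambda>\<omega>. (S T \<omega> - expectation (S T)) / sqrt (T ^ CARD('d))))
             (normal_law \<sigma>2)
           \<le> ereal (C * ln T powr (- 1 / 4))" if T: "T \<ge> max 2 T1" for T
  proof -
    have T0: "T > 0" "T \<ge> T1" using T by auto
    interpret W: sampling_window M X \<rho> "box_measure T" "T ^ DIM(real ^ 'd)" by (rule box_window[OF T0(1)])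
    \<comment> \<open>Rewriting the integral over the box measure as a Lebesgue integral needs a
      measurable path, which joint measurability provides for outcomes in the space of M; equality
      there suffices for expectations and image measures.\<close>
    have S: "S T \<omega> = sojourn u T \<omega>" if "\<omega> \<in> space M" for \<omega>
    proof -
      have [measurable]: "(\<lambda>t. X t \<omega>) \<in> borel_measurable borel"
        using W.X_path[OF that] by (simp cong: measurable_cong_sets)
      have "sojourn u T \<omega> = (\<integral>t. indicator (cbox 0 (T *\<^sub>R One)) t * indicator {u..} (X t \<omega>) \<partial>lborel)"
        unfolding sojourn_def by (rule box_measure_integral) measurable
      also have "\<dots> = S T \<omega>"
        unfolding S_def set_lebesgue_integral_def
        by (rule Bochner_Integration.integral_cong) (auto simp: indicator_def)
      finally show ?thesis ..
    qed
    have ES: "expectation (S T) = expectation (sojourn u T)"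
      by (rule Bochner_Integration.integral_cong) (simp_all add: S)
    have D: "distr M borel (\<lambda>\<omega>. (S T \<omega> - expectation (S T)) / sqrt (T ^ CARD('d))) = distr M borel (normalized_sojourn u T)"
      by (rule distr_cong) (simp_all add: S ES normalized_sojourn_def)
    show ?thesis
      unfolding D wasserstein_def
    \<comment> \<open>The bound from \<open>T1\<close> is the same for every admissible h, hence
      bounds the supremum.\<close>
    proof (rule SUP_least)
      fix h :: "real \<Rightarrow> real" assume "h \<in> {h. lipschitz_on 1 UNIV h}"
      then have h: "lipschitz_on 1 UNIV h" by simp
      have [measurable]: "h \<in> borel_measurable borel"
        using lipschitz_on_continuous_on[OF h] by (rule borel_measurable_continuous_onI)
      have "(\<integral>x. h x \<partial>distr M borel (normalized_sojourn u T)) = expectation (\<lambda>\<omega>. h (normalized_sojourn u T \<omega>))"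
        using normalized_sojourn_measurable[OF T0(1)] by (intro integral_distr) auto
      then show "ereal \<bar>(\<integral>x. h x \<partial>distr M borel (normalized_sojourn u T)) - (\<integral>x. h x \<partial>normal_law \<sigma>2)\<bar>
          \<le> ereal (C * ln T powr (- 1 / 4))"
        using T1[OF T0(2) h] by simp
    qed
  qed
  \<comment> \<open>The maximum with 2 ensures a threshold above 1.\<close>
  then show ?thesis using C by (intro exI[of _ C] conjI exI[of _ "max 2 T1"]) auto
qed

end
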